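(* For any augmented chain map $\phi:C_\ast(\mathcal{F}at)\to\mathcal{G}_\ast^{\mathbb{Z}}$ carried by the forest carrier $F_\ast$, the composition $$\mathcal{G}_\ast\otimes\mathbb{Q}\xrightarrow{\ \psi\ }C_\ast(\mathcal{F}in;\mathbb{Q})\hookrightarrow C_\ast(\mathcal{F}at;\mathbb{Q})\xrightarrow{\ \phi\ }\mathcal{G}_\ast\otimes\mathbb{Q}$$ (where $\phi$ also denotes $\phi\otimes\mathbb{Q}$) is the identity map on $\mathcal{G}_\ast\otimes\mathbb{Q}=\mathcal{G}_\ast^{\mathbb{Z}}\otimes\mathbb{Q}$.
   Context: **Ribbon graphs.** Fix an infinite set $\Omega$ disjoint from its power set. A graph is a finite subset of $\Omega$ (the half-edges) with a partition into pairs (edges) and a partition into subsets of cardinality $\ge 3$ (vertices); the cardinality of a vertex is its valence and its elements are the half-edges incident to it. An edge is a loop if both its halves lie in the same vertex. A ribbon graph is a connected graph with a cyclic ordering of the half-edges at each vertex. The codimension of a vertex is its valence minus $3$; the codimension of a graph is the sum of the codimensions of its vertices. If $e=\{e^-,e^+\}$ is not a loop, with endpoints $v_1=(e^-,h_1,\dots,h_p)$ and $v_2=(e^+,k_1,\dots,k_q)$, then $\Gamma/e$ is obtained by deleting $e^\pm$ and merging $v_1,v_2$ into one vertex $(h_1,\dots,h_p,k_1,\dots,k_q)$. For a spanning forest $F$ of $\Gamma$, $\Gamma/F$ is obtained by collapsing all edges of $F$. A morphism $\Gamma_0\to\Gamma_1$ is an isomorphism of ribbon graphs $\Gamma_0/F\cong\Gamma_1$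 for some spanning forest $F$ of $\Gamma_0$. This gives the category $\mathcal{F}at$; $\mathrm{Aut}(\Gamma)$ is the group of ribbon graph automorphisms. $C_n(\mathcal{F}at)$ is the free abelian group on the $n$-simplices $\Gamma_\ast=(\Gamma_0\to\cdots\to\Gamma_n)$ of the nerve, with the usual alternating-sum boundary and augmentation sending each $0$-simplex to $1$. **Orientations.** An orientation of a graph is an orientation of the real vector space spanned by its vertices and half-edges (equivalently given by ordering the vertices and orienting the edges). If the orientation of $\Gamma$ is $v_1v_2\,e^-e^+\cdots$ where $e=\{e^-,e^+\}$ goes from $v_1$ to $v_2$, the induced orientation of $\Gamma/e$ is $v_\ast\cdots$ with $v_\ast$ the merged vertex and the rest unchanged. A morphism induces an orientation by collapsing edges successively. A ribbon graph with all valences odd has a natural orientation: $v_1$, then its half-edges in cyclic order, then $v_2$, then its half-edges in cyclic order, etc. For oriented such $\Gamma$, $o(\Gamma)=\pm1$ according to whether the orientation is the natural one. **Graph cohomology.** $\mathcal{G}^n$ is the abelian group generated by isomorphism classes $[\Gamma]$ of oriented ribbon graphs of codimension $n$ modulo $[-\Gamma]=-[\Gamma]$, with $\partial[\Gamma]=\sum_e[\Gamma/e]$ over non-loop edges. $\mathcal{G}_n$ is the group of finitely supported homomorphisms $\mathcal{G}^n\to\mathbb{Z}$, generated by the duals $[\Gamma]^\ast$ ($[\Gamma]^*=0$ if $\Gamma$ has an orientation-reversing automorphism), with $d:\mathcal{G}_n\to\mathcal{G}_{n-1}$ dual to $\partial$. $\mathcal{G}_\ast^{\mathbb{Z}}\subset\mathcal{G}_\ast$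 is the subcomplex generated by the elements $\langle\Gamma\rangle=|\mathrm{Aut}(\Gamma)|[\Gamma]^\ast$, augmented by $\varepsilon\langle\Gamma\rangle=o(\Gamma)$ for $\Gamma$ trivalent. **Forest carrier.** For a ribbon graph $\Gamma_0$, $F_k(\Gamma_0)$ is the free abelian group generated by isomorphism classes (over $\Gamma_0$, orientation preserving) of morphisms $f:\Gamma\to\Gamma_0$ in $\mathcal{F}at$ with $\Gamma$ oriented of codimension $k$, modulo reversal of orientation $=$ change of sign. The boundary is $d[f:\Gamma\to\Gamma_0]=\sum[f\circ g_i:\Gamma_i\to\Gamma_0]$ over all right equivalence classes (isomorphism classes over $\Gamma$) of morphisms $g_i:\Gamma_i\to\Gamma$ collapsing exactly one edge, $\Gamma_i$ having the orientation inducing that of $\Gamma$; the augmentation is $\varepsilon[\Gamma\to\Gamma_0]=o(\Gamma)$ on $F_0$. $F_\ast$ is a covariant functor on $\mathcal{F}at$ by composition, and $p:F_\ast(\Gamma_0)\to\mathcal{G}_\ast^{\mathbb{Z}}$, $p[f:\Gamma\to\Gamma_0]=\langle\Gamma\rangle$, is a natural augmented chain map. Each augmented complex $F_\ast(\Gamma_0)$ is acyclic. An augmented chain map $\phi:C_\ast(\mathcal{F}at)\to\mathcal{G}_\ast^{\mathbb{Z}}$ is carried by $F_\ast$ if there are augmented chain maps $\Phi_\Gamma:C_\ast(\mathcal{F}at/\Gamma)\to F_\ast(\Gamma)$, natural in $\Gamma\in\mathcal{F}at$, such that $p\circ\Phi_\Gamma$ equals the composition of the forgetful map $C_\ast(\mathcal{F}at/\Gamma)\to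 C_\ast(\mathcal{F}at)$ with $\phi$. **The chain map $\psi$.** Let $\mathcal{F}in\subset\mathcal{F}at$ be a full subcategory containing exactly one object of each isomorphism class. For $\Gamma$ oriented of codimension $n$ let $$\overline{D}(\Gamma)=\sum\frac{o(\Gamma_\ast)}{|\mathrm{Aut}(\Gamma_0)|\cdots|\mathrm{Aut}(\Gamma_n)|}(\Gamma_0\to\cdots\to\Gamma_n)\in C_n(\mathcal{F}in;\mathbb{Q}),$$ summed over all sequences $\Gamma_0\to\cdots\to\Gamma_n\xrightarrow{\approx}\Gamma$ with $\Gamma_i\in\mathcal{F}in$ of codimension $i$, where $o(\Gamma_\ast)=\pm1$ is positive iff the given orientation of $\Gamma$ is the one induced from the natural orientation of the trivalent graph $\Gamma_0$. The chain map $\psi:\mathcal{G}_\ast^{\mathbb{Z}}\otimes\mathbb{Q}\to C_\ast(\mathcal{F}in;\mathbb{Q})$ is given by $\psi\langle\Gamma\rangle=(-1)^{\binom{n+1}{2}}\overline{D}(\Gamma)$. *)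

theory Defs
  imports
    "HOL-Algebra.Free_Abelian_Groups"
    "HOL-Combinatorics.Orbits"
    "HOL-Library.Disjoint_Sets"
    "HOL-Library.Function_Algebras"
    "HOL-Library.Infinite_Typeclass"
begin

section \<open>Ribbon graphs\<close>

text \<open>
  The ambient infinite set of half-edges is a type \<open>'h\<close>.  The cyclic orderings at the vertices
  are recorded by one permutation \<open>nxt\<close>, sending a half-edge to its successor; it is required to be
  the identity off the set of half-edges, so that equality of records is equality of ribbon graphs.
\<close>

record 'h rgraph =
  halfs :: "'h set"
  edges :: "'h set set"
  verts :: "'h set set"
  nxt :: "'h \<Rightarrow> 'h"

definition is_graph :: "'h rgraph \<Rightarrow> bool" where
  "is_graph G \<longleftrightarrow> finite (halfs G) \<and>
     partition_on (halfs G) (edges G) \<and> (\<forall>e\<in>edges G. card e = 2) \<and>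
     partition_on (halfs G) (verts G) \<and> (\<forall>v\<in>verts G. card v \<ge> 3)"

definition adjacent :: "'h rgraph \<Rightarrow> ('h set \<times> 'h set) set" where
  "adjacent G = {(v, w). v \<in> verts G \<and> w \<in> verts G \<and>
     (\<exists>e\<in>edges G. e \<inter> v \<noteq> {} \<and> e \<inter> w \<noteq> {})}"

text \<open>Connected graphs are nonempty.\<close>

definition connected_graph :: "'h rgraph \<Rightarrow> bool" where
  "connected_graph G \<longleftrightarrow> verts G \<noteq> {} \<and> (\<forall>v\<in>verts G. \<forall>w\<in>verts G. (v, w) \<in> (adjacent G)\<^sup>*)"

definition ribbon_graph :: "'h rgraph \<Rightarrow> bool" where
  "ribbon_graph G \<longleftrightarrow> is_graph G \<and> connected_graph G \<and>
     nxt G permutes halfs G \<and> (\<forall>v\<in>verts G. cyclic_on (nxt G) v)"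

definition codim :: "'h rgraph \<Rightarrow> nat" where
  "codim G = (\<Sum>v\<in>verts G. card v - 3)"

definition vert_of :: "'h rgraph \<Rightarrow> 'h \<Rightarrow> 'h set" where
  "vert_of G h = (THE v. v \<in> verts G \<and> h \<in> v)"

definition edge_of :: "'h rgraph \<Rightarrow> 'h \<Rightarrow> 'h set" where
  "edge_of G h = (THE e. e \<in> edges G \<and> h \<in> e)"

definition other_half :: "'h rgraph \<Rightarrow> 'h \<Rightarrow> 'h" where
  "other_half G h = (THE k. k \<noteq> h \<and> {h, k} \<in> edges G)"

definition is_loop :: "'h rgraph \<Rightarrow> 'h set \<Rightarrow> bool" where
  "is_loop G e \<longleftrightarrow> (\<exists>v\<in>verts G. e \<subseteq> v)"

definition merged_vertex :: "'h rgraph \<Rightarrow> 'h set \<Rightarrow> 'h set" where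
  "merged_vertex G e = (\<Union>h\<in>e. vert_of G h) - e"

text \<open>
  If \<open>(e\<^sup>-, h\<^sub>1, \<dots>, h\<^sub>p)\<close> and \<open>(e\<^sup>+, k\<^sub>1, \<dots>, k\<^sub>q)\<close> are merged to
  \<open>(h\<^sub>1, \<dots>, h\<^sub>p, k\<^sub>1, \<dots>, k\<^sub>q)\<close>, the successor of \<open>h\<^sub>p\<close> changes from \<open>e\<^sup>-\<close> to the
  successor \<open>k\<^sub>1\<close> of \<open>e\<^sup>+\<close>, and that of \<open>k\<^sub>q\<close> from \<open>e\<^sup>+\<close> to the successor \<open>h\<^sub>1\<close> of \<open>e\<^sup>-\<close>.
  Only meant for edges \<open>e\<close> that are not loops.
\<close>

definition collapse_edge :: "'h rgraph \<Rightarrow> 'h set \<Rightarrow> 'h rgraph" where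
  "collapse_edge G e =
     \<lparr> halfs = halfs G - e,
       edges = edges G - {e},
       verts = insert (merged_vertex G e) (verts G - vert_of G ` e),
       nxt = (\<lambda>h. if h \<in> e then h
                  else if nxt G h \<in> e then nxt G (other_half G (nxt G h))
                  else nxt G h) \<rparr>"

text \<open>
  A closed trail is traversed by the half-edges \<open>hs ! i\<close> at which its edges are entered.  The
  case of length 1 is that of a loop.
\<close>

definition closed_trail :: "'h rgraph \<Rightarrow> 'h set set \<Rightarrow> 'h list \<Rightarrow> bool" where
  "closed_trail G F hs \<longleftrightarrow> hs \<noteq> [] \<and> set hs \<subseteq> \<Union>F \<and> distinct (map (edge_of G) hs) \<and>
     (\<forall>i<length hs. vert_of G (other_half G (hs ! i)) = vert_of G (hs ! (Suc i mod length hs)))"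

definition spanning_forest :: "'h rgraph \<Rightarrow> 'h set set \<Rightarrow> bool" where
  "spanning_forest G F \<longleftrightarrow> F \<subseteq> edges G \<and> (\<nexists>hs. closed_trail G F hs)"


section \<open>The category of ribbon graphs\<close>

text \<open>
  Isomorphisms and, more generally, morphisms are represented by partial maps on half-edges, the
  half-edges of the collapsed edges being those where the map is undefined.  Composition is
  \<open>\<circ>\<^sub>m\<close>.
\<close>

type_synonym 'h pmap = "'h \<Rightarrow> 'h option"

definition rg_iso :: "'h rgraph \<Rightarrow> 'h rgraph \<Rightarrow> 'h pmap \<Rightarrow> bool" where
  "rg_iso G G' m \<longleftrightarrow> dom m = halfs G \<and> inj_on m (dom m) \<and> ran m = halfs G' \<and>
     (`) (the \<circ> m) ` edges G = edges G' \<and>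
     (`) (the \<circ> m) ` verts G = verts G' \<and>
     (\<forall>h\<in>halfs G. m (nxt G h) = map_option (nxt G') (m h))"

definition Aut :: "'h rgraph \<Rightarrow> 'h pmap set" where
  "Aut G = {m. rg_iso G G m}"

text \<open>
  The list \<open>es\<close> enumerates the forest \<open>F\<close>; the result of collapsing its members one after the
  other does not depend on the enumeration.
\<close>

definition fat_mor :: "'h rgraph \<Rightarrow> 'h rgraph \<Rightarrow> 'h pmap \<Rightarrow> bool" where
  "fat_mor G0 G1 m \<longleftrightarrow> ribbon_graph G0 \<and> ribbon_graph G1 \<and>
     (\<exists>F es. spanning_forest G0 F \<and> distinct es \<and> set es = F \<and>
        rg_iso (foldl collapse_edge G0 es) G1 m)"

definition collapsed :: "'h rgraph \<Rightarrow> 'h pmap \<Rightarrow> 'h set set" where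
  "collapsed G m = {e \<in> edges G. e \<inter> dom m = {}}"

definition is_skeleton :: "'h rgraph set \<Rightarrow> bool" where
  "is_skeleton S \<longleftrightarrow> S \<subseteq> Collect ribbon_graph \<and>
     (\<forall>G. ribbon_graph G \<longrightarrow> (\<exists>!G'. G' \<in> S \<and> (\<exists>m. rg_iso G G' m)))"


section \<open>Orientations\<close>

text \<open>
  An orientation of the real vector space with basis \<open>V \<squnion> H\<close> (vertices and half-edges) is
  represented by the set of those orderings of \<open>V \<squnion> H\<close> that are positively oriented bases: a class
  of orderings modulo even permutations.  (A ribbon graph has at least 4 basis elements, so the two
  orientations of the vector space correspond to two such classes.)
\<close>

type_synonym 'h ordering = "('h set + 'h) list"

definition orderings :: "'h rgraph \<Rightarrow> 'h ordering set" where
  "orderings G = {xs. distinct xs \<and> set xs = Inl ` verts G \<union> Inr ` halfs G}"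

definition or_class :: "'h ordering \<Rightarrow> 'h ordering set" where
  "or_class xs = {permute_list p xs | p. p permutes {..<length xs} \<and> evenperm p}"

definition orientations :: "'h rgraph \<Rightarrow> 'h ordering set set" where
  "orientations G = or_class ` orderings G"

definition rev_or :: "'h rgraph \<Rightarrow> 'h ordering set \<Rightarrow> 'h ordering set" where
  "rev_or G \<omega> = orderings G - \<omega>"

definition collapse_or :: "'h rgraph \<Rightarrow> 'h set \<Rightarrow> 'h ordering set \<Rightarrow> 'h ordering set" where
  "collapse_or G e \<omega> = \<Union> {or_class (Inl (merged_vertex G e) # xs) | xs a b. e = {a, b} \<and> a \<noteq> b \<and>
     Inl (vert_of G a) # Inl (vert_of G b) # Inr a # Inr b # xs \<in> \<omega>}"

definition transport :: "'h pmap \<Rightarrow> 'h ordering set \<Rightarrow> 'h ordering set" where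
  "transport m \<omega> = map (map_sum ((`) (the \<circ> m)) (the \<circ> m)) ` \<omega>"

text \<open>
  Collapsing two edges in the two possible orders results in opposite orientations (this is why
  \<open>\<partial>\<^sup>2 = 0\<close> in graph cohomology).  Hence a morphism by itself induces an orientation only if it
  collapses at most one edge; only such morphisms are used below, and longer collapses
  are given as sequences of such morphisms.
\<close>

definition induced_or :: "'h rgraph \<Rightarrow> 'h pmap \<Rightarrow> 'h ordering set \<Rightarrow> 'h ordering set" where
  "induced_or G m \<omega> = transport m
     (if collapsed G m = {} then \<omega> else collapse_or G (the_elem (collapsed G m)) \<omega>)"

text \<open>For odd valences, all the orderings below belong to the same class.\<close>

definition natural_or :: "'h rgraph \<Rightarrow> 'h ordering set" where
  "natural_or G = \<Union> {or_class
       (concat (map (\<lambda>v. Inl v # map (\<lambda>i. Inr ((nxt G ^^ i) (first v))) [0..<card v]) vs)) | vs first.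
     distinct vs \<and> set vs = verts G \<and> (\<forall>v\<in>verts G. first v \<in> v)}"

type_synonym 'h ograph = "'h rgraph \<times> 'h ordering set"

definition o_sign :: "'h ograph \<Rightarrow> int" where
  "o_sign x = (if snd x = natural_or (fst x) then 1 else - 1)"

definition ographs :: "nat \<Rightarrow> 'h ograph set" where
  "ographs n = {(G, \<omega>). ribbon_graph G \<and> codim G = n \<and> \<omega> \<in> orientations G}"

definition oiso :: "'h ograph \<Rightarrow> 'h ograph \<Rightarrow> 'h pmap \<Rightarrow> bool" where
  "oiso x y m \<longleftrightarrow> rg_iso (fst x) (fst y) m \<and> transport m (snd x) = snd y"

definition rev_graph :: "'h ograph \<Rightarrow> 'h ograph" where
  "rev_graph x = (fst x, rev_or (fst x) (snd x))"


section \<open>Abelian groups and augmented chain complexes\<close>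

definition add_group :: "'a::ab_group_add set \<Rightarrow> 'a monoid" where
  "add_group A = \<lparr> carrier = A, monoid.mult = (+), one = 0 \<rparr>"

text \<open>The abelian group with generators \<open>S\<close> and relators \<open>R\<close>, and the class of a generator.\<close>

definition pres_group :: "'a set \<Rightarrow> ('a \<Rightarrow>\<^sub>0 int) set \<Rightarrow> ('a \<Rightarrow>\<^sub>0 int) set monoid" where
  "pres_group S R = free_Abelian_group S Mod generate (free_Abelian_group S) R"

definition pres_gen :: "'a set \<Rightarrow> ('a \<Rightarrow>\<^sub>0 int) set \<Rightarrow> 'a \<Rightarrow> ('a \<Rightarrow>\<^sub>0 int) set" where
  "pres_gen S R s = generate (free_Abelian_group S) R #>\<^bsub>free_Abelian_group S\<^esub> frag_of s"

text \<open>
  The homomorphism \<open>A \<rightarrow> B\<close> with \<open>gen i \<mapsto> val i\<close> for all \<open>i \<in> I\<close>.  It is used where there is exactly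
  one (values outside the carrier being normalised).
\<close>

definition the_hom ::
    "'a monoid \<Rightarrow> 'b monoid \<Rightarrow> 'i set \<Rightarrow> ('i \<Rightarrow> 'a) \<Rightarrow> ('i \<Rightarrow> 'b) \<Rightarrow> 'a \<Rightarrow> 'b" where
  "the_hom A B I gen val = (THE h. h \<in> hom A B \<and> (\<forall>x. x \<notin> carrier A \<longrightarrow> h x = \<one>\<^bsub>B\<^esub>) \<and>
     (\<forall>i\<in>I. h (gen i) = val i))"

text \<open>\<open>bd C n\<close> is the boundary from degree \<open>n + 1\<close> to degree \<open>n\<close>.\<close>

record 'a aug_complex =
  grp :: "nat \<Rightarrow> 'a monoid"
  bd :: "nat \<Rightarrow> 'a \<Rightarrow> 'a"
  aug :: "'a \<Rightarrow> int"

definition aug_chain_map ::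
    "'a aug_complex \<Rightarrow> 'b aug_complex \<Rightarrow> (nat \<Rightarrow> 'a \<Rightarrow> 'b) \<Rightarrow> bool" where
  "aug_chain_map C D f \<longleftrightarrow> (\<forall>n. f n \<in> hom (grp C n) (grp D n)) \<and>
     (\<forall>n. \<forall>x\<in>carrier (grp C (Suc n)). bd D n (f (Suc n) x) = f n (bd C n x)) \<and>
     (\<forall>x\<in>carrier (grp C 0). aug D (f 0 x) = aug C x)"


section \<open>Nerves\<close>

text \<open>
  The \<open>n\<close>-simplices of the nerve of a category with objects \<open>Ob\<close>, whose arrows are partial maps
  composed by \<open>\<circ>\<^sub>m\<close>: \<open>n + 1\<close> objects and \<open>n\<close> arrows between consecutive ones.
\<close>

definition nerve :: "'o set \<Rightarrow> ('o \<Rightarrow> 'o \<Rightarrow> 'h pmap \<Rightarrow> bool) \<Rightarrow> nat \<Rightarrow> ('o list \<times> 'h pmap list) set" where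
  "nerve Ob Arr n = {(xs, ms). length xs = Suc n \<and> length ms = n \<and> set xs \<subseteq> Ob \<and>
     (\<forall>i<n. Arr (xs ! i) (xs ! Suc i) (ms ! i))}"

definition face :: "nat \<Rightarrow> 'o list \<times> 'h pmap list \<Rightarrow> 'o list \<times> 'h pmap list" where
  "face i s = (let xs = fst s; ms = snd s in
     (take i xs @ drop (Suc i) xs,
      if i = 0 then tl ms
      else if i = length ms then butlast ms
      else take (i - 1) ms @ [ms ! i \<circ>\<^sub>m ms ! (i - 1)] @ drop (Suc i) ms))"

definition nerve_complex ::
    "'o set \<Rightarrow> ('o \<Rightarrow> 'o \<Rightarrow> 'h pmap \<Rightarrow> bool) \<Rightarrow> ('o list \<times> 'h pmap list \<Rightarrow>\<^sub>0 int) aug_complex" where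
  "nerve_complex Ob Arr =
     \<lparr> grp = (\<lambda>n. free_Abelian_group (nerve Ob Arr n)),
       bd = (\<lambda>n. frag_extend (\<lambda>s. \<Sum>i\<le>Suc n. frag_cmul ((-1) ^ i) (frag_of (face i s)))),
       aug = (\<lambda>c. \<Sum>s\<in>Poly_Mapping.keys c. Poly_Mapping.lookup c s) \<rparr>"

type_synonym 'h simplex = "'h rgraph list \<times> 'h pmap list"

definition C_Fat :: "('h simplex \<Rightarrow>\<^sub>0 int) aug_complex" where
  "C_Fat = nerve_complex (Collect ribbon_graph) fat_mor"

text \<open>The slice category over \<open>G\<close>; its objects are pairs of a graph and a morphism to \<open>G\<close>.\<close>

type_synonym 'h over_simplex = "('h rgraph \<times> 'h pmap) list \<times> 'h pmap list"

definition over_obj :: "'h rgraph \<Rightarrow> ('h rgraph \<times> 'h pmap) set" where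
  "over_obj G = {(D, a). fat_mor D G a}"

definition over_arr :: "'h rgraph \<times> 'h pmap \<Rightarrow> 'h rgraph \<times> 'h pmap \<Rightarrow> 'h pmap \<Rightarrow> bool" where
  "over_arr x y m \<longleftrightarrow> fat_mor (fst x) (fst y) m \<and> snd y \<circ>\<^sub>m m = snd x"

definition C_over :: "'h rgraph \<Rightarrow> ('h over_simplex \<Rightarrow>\<^sub>0 int) aug_complex" where
  "C_over G = nerve_complex (over_obj G) over_arr"

definition over_forget :: "('h over_simplex \<Rightarrow>\<^sub>0 int) \<Rightarrow> ('h simplex \<Rightarrow>\<^sub>0 int)" where
  "over_forget = frag_extend (\<lambda>(xs, ms). frag_of (map fst xs, ms))"

definition over_map :: "'h pmap \<Rightarrow> ('h over_simplex \<Rightarrow>\<^sub>0 int) \<Rightarrow> ('h over_simplex \<Rightarrow>\<^sub>0 int)" where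
  "over_map f = frag_extend (\<lambda>(xs, ms). frag_of (map (\<lambda>(D, a). (D, f \<circ>\<^sub>m a)) xs, ms))"


section \<open>Graph cohomology\<close>

definition coh_rels :: "nat \<Rightarrow> ('h ograph \<Rightarrow>\<^sub>0 int) set" where
  "coh_rels n =
     {frag_of x - frag_of y | x y. x \<in> ographs n \<and> y \<in> ographs n \<and> (\<exists>m. oiso x y m)} \<union>
     {frag_of (rev_graph x) + frag_of x | x. x \<in> ographs n}"

text \<open>The groups \<open>\<G>\<^sup>n\<close> and their generators \<open>[\<Gamma>]\<close>.\<close>

definition Gcoh :: "nat \<Rightarrow> ('h ograph \<Rightarrow>\<^sub>0 int) set monoid" where
  "Gcoh n = pres_group (ographs n) (coh_rels n)"

definition Gcls :: "nat \<Rightarrow> 'h ograph \<Rightarrow> ('h ograph \<Rightarrow>\<^sub>0 int) set" where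
  "Gcls n = pres_gen (ographs n) (coh_rels n)"

definition Gcoh_bd :: "nat \<Rightarrow> ('h ograph \<Rightarrow>\<^sub>0 int) set \<Rightarrow> ('h ograph \<Rightarrow>\<^sub>0 int) set" where
  "Gcoh_bd n = the_hom (Gcoh n) (Gcoh (Suc n)) (ographs n) (Gcls n)
     (\<lambda>(G, \<omega>). finprod (Gcoh (Suc n))
        (\<lambda>e. Gcls (Suc n) (collapse_edge G e, collapse_or G e \<omega>)) {e \<in> edges G. \<not> is_loop G e})"

text \<open>
  Finitely supported homomorphisms from \<open>\<G>\<^sup>n\<close> to the additive group of a ring (extended by 0 outside
  the carrier).  For \<open>int\<close> this is \<open>\<G>\<^sub>n\<close>; for \<open>rat\<close> it is \<open>\<G>\<^sub>n \<otimes> \<rat>\<close>, because \<open>\<G>\<^sub>n\<close> is free on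
  the nonzero duals \<open>[\<Gamma>]\<^sup>*\<close> (one for each pair \<open>\<plusminus>[\<Gamma>]\<close>).
\<close>

type_synonym ('h, 'r) gcochain = "('h ograph \<Rightarrow>\<^sub>0 int) set \<Rightarrow> 'r"

definition Ghom :: "nat \<Rightarrow> ('h, 'r::comm_ring_1) gcochain monoid" where
  "Ghom n = add_group {c. c \<in> hom (Gcoh n) (add_group UNIV) \<and>
     (\<forall>X. X \<notin> carrier (Gcoh n) \<longrightarrow> c X = 0) \<and>
     finite {X \<in> Gcls n ` ographs n. c X \<noteq> 0}}"

text \<open>The difference is 0 if \<open>x\<close> has an orientation-reversing automorphism.\<close>

definition Gdual :: "nat \<Rightarrow> 'h ograph \<Rightarrow> ('h, int) gcochain" where
  "Gdual n x = the_hom (Gcoh n) (add_group UNIV) (ographs n) (Gcls n)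
     (\<lambda>y. of_bool (\<exists>m. oiso y x m) - of_bool (\<exists>m. oiso y (rev_graph x) m))"

definition angle :: "nat \<Rightarrow> 'h ograph \<Rightarrow> ('h, int) gcochain" where
  "angle n x = (\<lambda>X. int (card (Aut (fst x))) * Gdual n x X)"

definition GZ_group :: "nat \<Rightarrow> ('h, int) gcochain monoid" where
  "GZ_group n = subgroup_generated (Ghom n) (angle n ` ographs n)"

definition GZ :: "('h, int) gcochain aug_complex" where
  "GZ = \<lparr> grp = GZ_group,
          bd = (\<lambda>n c. c \<circ> Gcoh_bd n),
          aug = the_hom (GZ_group 0) (add_group UNIV) (ographs 0) (angle 0) o_sign \<rparr>"


section \<open>The forest carrier\<close>

type_synonym 'h fgen = "'h ograph \<times> 'h pmap"

definition F_gens :: "nat \<Rightarrow> 'h rgraph \<Rightarrow> 'h fgen set" where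
  "F_gens k G0 = {(x, f). x \<in> ographs k \<and> fat_mor (fst x) G0 f}"

definition F_rels :: "nat \<Rightarrow> 'h rgraph \<Rightarrow> ('h fgen \<Rightarrow>\<^sub>0 int) set" where
  "F_rels k G0 =
     {frag_of (x, f) - frag_of (y, g) | x f y g. (x, f) \<in> F_gens k G0 \<and> (y, g) \<in> F_gens k G0 \<and>
        (\<exists>m. oiso x y m \<and> g \<circ>\<^sub>m m = f)} \<union>
     {frag_of (rev_graph x, f) + frag_of (x, f) | x f. (x, f) \<in> F_gens k G0}"

definition F_group :: "nat \<Rightarrow> 'h rgraph \<Rightarrow> ('h fgen \<Rightarrow>\<^sub>0 int) set monoid" where
  "F_group k G0 = pres_group (F_gens k G0) (F_rels k G0)"

definition F_cls :: "nat \<Rightarrow> 'h rgraph \<Rightarrow> 'h fgen \<Rightarrow> ('h fgen \<Rightarrow>\<^sub>0 int) set" where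
  "F_cls k G0 = pres_gen (F_gens k G0) (F_rels k G0)"

text \<open>Morphisms to \<open>G\<close> collapsing exactly one edge, and isomorphism over \<open>G\<close> between them.\<close>

definition expansions :: "'h rgraph \<Rightarrow> ('h rgraph \<times> 'h pmap) set" where
  "expansions G = {(D, g). fat_mor D G g \<and> card (collapsed D g) = 1}"

definition exp_equiv :: "'h rgraph \<Rightarrow> (('h rgraph \<times> 'h pmap) \<times> ('h rgraph \<times> 'h pmap)) set" where
  "exp_equiv G = {((D, g), (D', g')). (D, g) \<in> expansions G \<and> (D', g') \<in> expansions G \<and>
     (\<exists>m. rg_iso D D' m \<and> g' \<circ>\<^sub>m m = g)}"

definition inducing_or :: "'h rgraph \<Rightarrow> 'h pmap \<Rightarrow> 'h ordering set \<Rightarrow> 'h ordering set" where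
  "inducing_or D g \<omega> = (THE \<omega>'. \<omega>' \<in> orientations D \<and> induced_or D g \<omega>' = \<omega>)"

definition F_bd :: "nat \<Rightarrow> 'h rgraph \<Rightarrow> ('h fgen \<Rightarrow>\<^sub>0 int) set \<Rightarrow> ('h fgen \<Rightarrow>\<^sub>0 int) set" where
  "F_bd k G0 = the_hom (F_group (Suc k) G0) (F_group k G0) (F_gens (Suc k) G0) (F_cls (Suc k) G0)
     (\<lambda>((G, \<omega>), f). finprod (F_group k G0)
        (\<lambda>K. let (D, g) = (SOME z. z \<in> K) in F_cls k G0 ((D, inducing_or D g \<omega>), f \<circ>\<^sub>m g))
        (expansions G // exp_equiv G))"

definition F_complex :: "'h rgraph \<Rightarrow> ('h fgen \<Rightarrow>\<^sub>0 int) set aug_complex" where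
  "F_complex G0 =
     \<lparr> grp = (\<lambda>k. F_group k G0),
       bd = (\<lambda>k. F_bd k G0),
       aug = the_hom (F_group 0 G0) (add_group UNIV) (F_gens 0 G0) (F_cls 0 G0)
               (\<lambda>(x, f). o_sign x) \<rparr>"

definition F_map ::
    "nat \<Rightarrow> 'h rgraph \<Rightarrow> 'h rgraph \<Rightarrow> 'h pmap \<Rightarrow> ('h fgen \<Rightarrow>\<^sub>0 int) set \<Rightarrow> ('h fgen \<Rightarrow>\<^sub>0 int) set" where
  "F_map k G0 G1 h = the_hom (F_group k G0) (F_group k G1) (F_gens k G0) (F_cls k G0)
     (\<lambda>(x, f). F_cls k G1 (x, h \<circ>\<^sub>m f))"

definition F_proj :: "nat \<Rightarrow> 'h rgraph \<Rightarrow> ('h fgen \<Rightarrow>\<^sub>0 int) set \<Rightarrow> ('h, int) gcochain" where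
  "F_proj k G0 = the_hom (F_group k G0) (GZ_group k) (F_gens k G0) (F_cls k G0)
     (\<lambda>(x, f). angle k x)"

definition carried_by_F :: "(nat \<Rightarrow> ('h simplex \<Rightarrow>\<^sub>0 int) \<Rightarrow> ('h, int) gcochain) \<Rightarrow> bool" where
  "carried_by_F \<phi> \<longleftrightarrow>
     (\<exists>\<Phi> :: 'h rgraph \<Rightarrow> nat \<Rightarrow> ('h over_simplex \<Rightarrow>\<^sub>0 int) \<Rightarrow> ('h fgen \<Rightarrow>\<^sub>0 int) set.
        (\<forall>G. ribbon_graph G \<longrightarrow> aug_chain_map (C_over G) (F_complex G) (\<Phi> G)) \<and>
        (\<forall>G G' h n. fat_mor G G' h \<longrightarrow>
           (\<forall>c\<in>carrier (grp (C_over G) n). F_map n G G' h (\<Phi> G n c) = \<Phi> G' n (over_map h c))) \<and>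
        (\<forall>G n. ribbon_graph G \<longrightarrow>
           (\<forall>c\<in>carrier (grp (C_over G) n). F_proj n G (\<Phi> G n c) = \<phi> n (over_forget c))))"


section \<open>The chain map psi\<close>

text \<open>
  The sequences \<open>\<Gamma>\<^sub>0 \<rightarrow> \<dots> \<rightarrow> \<Gamma>\<^sub>n \<approx> \<Gamma>\<close>; \<open>a\<close> is the last isomorphism, and \<open>S\<close> is the set of
  objects of the skeleton.
\<close>

definition D_seqs :: "'h rgraph set \<Rightarrow> nat \<Rightarrow> 'h rgraph \<Rightarrow> ('h simplex \<times> 'h pmap) set" where
  "D_seqs S n G = {((xs, ms), a). (xs, ms) \<in> nerve S fat_mor n \<and> (\<forall>i\<le>n. codim (xs ! i) = i) \<and>
     rg_iso (xs ! n) G a}"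

definition seq_sign :: "'h ordering set \<Rightarrow> 'h simplex \<times> 'h pmap \<Rightarrow> int" where
  "seq_sign \<omega> = (\<lambda>((xs, ms), a).
     if foldl (\<lambda>\<omega>' (G, m). induced_or G m \<omega>') (natural_or (xs ! 0)) (zip xs (ms @ [a])) = \<omega>
     then 1 else - 1)"

definition Dbar :: "'h rgraph set \<Rightarrow> nat \<Rightarrow> 'h ograph \<Rightarrow> 'h simplex \<Rightarrow>\<^sub>0 rat" where
  "Dbar S n x = (\<Sum>t\<in>D_seqs S n (fst x). Poly_Mapping.single (fst t)
     (of_int (seq_sign (snd x) t) / (\<Prod>G\<leftarrow>fst (fst t). of_nat (card (Aut G)))))"

definition CQ_Fin :: "'h rgraph set \<Rightarrow> nat \<Rightarrow> ('h simplex \<Rightarrow>\<^sub>0 rat) monoid" where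
  "CQ_Fin S n = add_group {c. Poly_Mapping.keys c \<subseteq> nerve S fat_mor n}"

text \<open>
  A homomorphism of abelian groups between rational vector spaces is \<open>\<rat>\<close>-linear, so that it is
  determined by its values at the elements \<open>\<langle>\<Gamma>\<rangle> \<otimes> 1\<close>.
\<close>

definition psi :: "'h rgraph set \<Rightarrow> nat \<Rightarrow> ('h, rat) gcochain \<Rightarrow> 'h simplex \<Rightarrow>\<^sub>0 rat" where
  "psi S n = the_hom (Ghom n) (CQ_Fin S n) (ographs n)
     (\<lambda>x X. of_int (angle n x X))
     (\<lambda>x. Poly_Mapping.map ((*) ((-1) ^ (Suc n choose 2))) (Dbar S n x))"

text \<open>
  \<open>\<phi> \<otimes> \<rat>\<close>.  The inclusion of the rational chains of the skeleton is the identity on finitely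
  supported functions.
\<close>

definition tensor_Q ::
    "(nat \<Rightarrow> ('h simplex \<Rightarrow>\<^sub>0 int) \<Rightarrow> ('h, int) gcochain) \<Rightarrow>
     nat \<Rightarrow> ('h simplex \<Rightarrow>\<^sub>0 rat) \<Rightarrow> ('h, rat) gcochain" where
  "tensor_Q \<phi> n c = (\<lambda>X. \<Sum>s\<in>Poly_Mapping.keys c.
     Poly_Mapping.lookup c s * of_int (\<phi> n (frag_of s) X))"

end

theory Submission
  imports Defs
begin

text \<open>
  If \<open>\<Gamma>\<close> has codimension \<open>n\<close>, then \<open>F\<^sub>n(\<Gamma>)\<close> is infinite cyclic, generated by the identity of \<open>\<Gamma>\<close>.
  Lift the sequences \<open>\<Gamma>\<^sub>0 \<rightarrow> \<dots> \<rightarrow> \<Gamma>\<^sub>n \<approx> \<Gamma>\<close> occurring in \<open>D(\<Gamma>)\<close> to the slice over \<open>\<Gamma>\<close> and apply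
  \<open>\<Phi>\<close>: what has to be shown is that the weighted sum of the resulting coefficients is
  \<open>(-1)^(n + 1 choose 2)\<close>.  This goes by induction on \<open>n\<close>.  A coefficient in \<open>F\<^sub>n(\<Gamma>)\<close> can be read off
  from the boundary, as the coefficient at an arbitrary one-edge expansion \<open>\<Gamma>' \<rightarrow> \<Gamma>\<close>.  In the boundary
  of the lifted chain all faces but the last one cancel: a morphism collapsing two edges factors in
  two ways, which induce opposite orientations, and the two expansions of a 4-valent vertex to a
  trivalent graph induce opposite orientations as well.  By naturality the last face contributes
  \<open>(-1)^n\<close> times the sum for \<open>\<Gamma>'\<close>, the terms not factoring through \<open>\<Gamma>'\<close> being zero.
\<close>

section \<open>Orderings up to even permutations\<close>

text \<open>Two difficulties shape the argument. A morphism collapsing several edges has no induced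
  orientation of its own, so every sign is computed along a sequence of one-edge collapses, as the
  parity of exchanges of blocks in orderings of vertices and half-edges. And a skeleton keeps one
  graph of each isomorphism class, so a factorization of a morphism is met once for each choice of
  an isomorphism; the factors 1/|Aut| correct exactly this, since two isomorphic graphs have as many
  isomorphisms as either has automorphisms, and each weighted count of choices becomes 1. One
  coefficient suffices because an expansion has no nontrivial automorphism over \<Gamma>: its
  generator is not its own negative, and it occurs in the boundary of the identity of \<Gamma> with
  coefficient exactly 1. The last faces in degrees 1, ..., n contribute (-1)^1, ..., (-1)^n, whence
  the exponent (n + 1 choose 2). Finally, \<open>psi\<close> and the operators on F are given by
  descriptions, so the homomorphisms in question have to be shown to exist and to be unique.\<close>

definition adj_swap :: "('a list \<times> 'a list) set" where
  "adj_swap = {(u @ x # y # v, u @ y # x # v) | u x y v. True}"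

lemma adj_swapI: "(u @ x # y # v, u @ y # x # v) \<in> adj_swap"
  unfolding adj_swap_def by blast

lemma adj_swap_append:
  assumes "(xs, ys) \<in> adj_swap" shows "(u @ xs @ v, u @ ys @ v) \<in> adj_swap"
proof -
  obtain u' x y v' where "xs = u' @ x # y # v'" "ys = u' @ y # x # v'"
    using assms unfolding adj_swap_def by blast
  thus ?thesis using adj_swapI[of "u @ u'" x y "v' @ v"] by simp
qed

lemma adj_swaps_append:
  "(xs, ys) \<in> adj_swap ^^ k \<Longrightarrow> (u @ xs @ v, u @ ys @ v) \<in> adj_swap ^^ k"
proof (induction k arbitrary: ys)
  case (Suc k)
  then obtain zs where "(xs, zs) \<in> adj_swap ^^ k" "(zs, ys) \<in> adj_swap" by auto
  thus ?case using Suc.IH adj_swap_append by (metis relpow_Suc_I)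
qed simp

lemma adj_swaps_prefix: "(xs, ys) \<in> adj_swap ^^ k \<Longrightarrow> (u @ xs, u @ ys) \<in> adj_swap ^^ k"
  using adj_swaps_append[of xs ys k u "[]"] by simp

lemma adj_swaps_trans:
  "(xs, ys) \<in> adj_swap ^^ j \<Longrightarrow> (ys, zs) \<in> adj_swap ^^ k \<Longrightarrow> (xs, zs) \<in> adj_swap ^^ (j + k)"
  by (auto simp: relpow_add)

lemma adj_swap_mset: "(xs, ys) \<in> adj_swap \<Longrightarrow> mset ys = mset xs"
  unfolding adj_swap_def by auto

lemma adj_swaps_mset: "(xs, ys) \<in> adj_swap ^^ k \<Longrightarrow> mset ys = mset xs"
  by (induction k arbitrary: ys) (auto dest: adj_swap_mset)

text \<open>Bubbling \<open>y\<close> to the front costs one exchange for each entry of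
  \<open>u\<close>.\<close>

lemma adj_swaps_move: "(u @ y # v, y # u @ v) \<in> adj_swap ^^ length u"
proof (induction u)
  case (Cons x u)
  have "(x # u @ y # v, x # y # u @ v) \<in> adj_swap ^^ length u"
    using adj_swaps_prefix[OF Cons.IH, of "[x]"] by simp
  moreover have "(x # y # u @ v, y # x # u @ v) \<in> adj_swap"
    using adj_swapI[of "[]"] by simp
  ultimately show ?case by auto
qed simp

text \<open>Each entry of \<open>v\<close> moves past all of \<open>u\<close>. So the parity of the
  product of the two lengths is the sign of every block exchange used later.\<close>

lemma adj_swaps_block: "(u @ v @ w, v @ u @ w) \<in> adj_swap ^^ (length u * length v)"
proof (induction v)
  case (Cons y v)
  have "(u @ y # v @ w, y # u @ v @ w) \<in> adj_swap ^^ length u"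
    by (rule adj_swaps_move)
  moreover have "(y # u @ v @ w, y # v @ u @ w) \<in> adj_swap ^^ (length u * length v)"
    using adj_swaps_prefix[OF Cons.IH, of "[y]"] by simp
  ultimately show ?case using adj_swaps_trans by fastforce
qed simp

lemma adj_swaps_block': 
  "(a @ u @ v @ w, a @ v @ u @ w) \<in> adj_swap ^^ (length u * length v)"
  by (rule adj_swaps_prefix[OF adj_swaps_block])

text \<open>Sorting by insertion: the first entry of the target is bubbled to the front, and the
  tail follows by induction.\<close>

lemma adj_swaps_exist:
  "mset xs = mset ys \<Longrightarrow> \<exists>k. (xs, ys) \<in> adj_swap ^^ k"
proof (induction ys arbitrary: xs)
  case Nil thus ?case by (auto intro: exI[of _ 0])
next
  case (Cons y ys)
  then have "y \<in> set xs" by (metis list.set_intros(1) set_mset_mset)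
  then obtain u v where xs: "xs = u @ y # v" by (meson split_list)
  with Cons.prems have "mset (u @ v) = mset ys" by simp
  then obtain k where "(u @ v, ys) \<in> adj_swap ^^ k" using Cons.IH by blast
  from adj_swaps_prefix[OF this, of "[y]"] adj_swaps_move[of u y v] xs
  show ?case using adj_swaps_trans by fastforce
qed

text \<open>Without repeated entries the permutation relating two orderings is unique; this makes
  its parity an invariant of the two lists.\<close>

lemma permute_list_inject:
  assumes "distinct xs" "p permutes {..<length xs}" "q permutes {..<length xs}"
    and "permute_list p xs = permute_list q xs"
  shows "p = q"
proof
  fix i
  show "p i = q i"
  proof (cases "i < length xs")
    case True
    have "xs ! p i = xs ! q i"
      using assms(4) permute_list_nth[OF assms(2) True] permute_list_nth[OF assms(3) True] by simp
    moreover have "p i < length xs" "q i < length xs"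
      using True permutes_in_image[OF assms(2)] permutes_in_image[OF assms(3)] by auto
    ultimately show ?thesis using assms(1) by (simp add: nth_eq_iff_index_eq)
  next
    case False
    thus ?thesis using assms(2,3) by (simp add: permutes_not_in)
  qed
qed

lemma adj_swap_permute:
  assumes "(xs, ys) \<in> adj_swap"
  shows "\<exists>p. p permutes {..<length xs} \<and> \<not> evenperm p \<and> ys = permute_list p xs"
proof -
  obtain u x y v where xs: "xs = u @ x # y # v" and ys: "ys = u @ y # x # v"
    using assms unfolding adj_swap_def by blast
  let ?p = "transpose (length u) (Suc (length u))"
  have p: "?p permutes {..<length xs}" by (rule permutes_swap_id) (auto simp: xs)
  have "ys = permute_list ?p xs"
  proof (rule nth_equalityI)
    fix i assume "i < length ys"
    hence "i < length xs" using xs ys by simp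
    then have "permute_list ?p xs ! i = xs ! ?p i" by (rule permute_list_nth[OF p])
    thus "ys ! i = permute_list ?p xs ! i"
      by (auto simp: xs ys nth_append transpose_def nth_Cons split: nat.splits)
  qed (simp add: xs ys)
  with p show ?thesis by (intro exI[of _ ?p]) (auto simp: evenperm_swap)
qed

text \<open>Every adjacent exchange composes with one transposition, so the count and the
  permutation have the same parity. This links counting of exchanges to the definition of
  \<open>or_class\<close> by \<open>evenperm\<close>.\<close>

lemma adj_swaps_permute:
  "(xs, ys) \<in> adj_swap ^^ k \<Longrightarrow>
     \<exists>p. p permutes {..<length xs} \<and> (evenperm p \<longleftrightarrow> even k) \<and> ys = permute_list p xs"
proof (induction k arbitrary: ys)
  case 0
  thus ?case by (intro exI[of _ id] conjI permutes_id) auto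
next
  case (Suc k)
  then obtain zs where zs: "(xs, zs) \<in> adj_swap ^^ k" "(zs, ys) \<in> adj_swap" by auto
  from Suc.IH[OF zs(1)] obtain p where p: "p permutes {..<length xs}" "evenperm p \<longleftrightarrow> even k"
    "zs = permute_list p xs" by blast
  from adj_swap_permute[OF zs(2)] obtain q where q: "q permutes {..<length zs}" "\<not> evenperm q"
    "ys = permute_list q zs" by blast
  have len: "length zs = length xs" using p(3) by simp
  have perm: "permutation p" "permutation q"
    using p(1) q(1) by (auto simp: permutation_permutes)
  have "ys = permute_list (p \<circ> q) xs"
    using p q len by (simp add: permute_list_compose)
  moreover have "p \<circ> q permutes {..<length xs}"
    using p(1) q(1) len by (simp add: permutes_compose)
  moreover have "evenperm (p \<circ> q) \<longleftrightarrow> even (Suc k)"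
    using evenperm_comp[OF perm] p(2) q(2) by simp
  ultimately show ?case by blast
qed

text \<open>The permutation behind a chain of exchanges is unique on a list without repetitions, so
  any chain between two lists decides membership.\<close>

lemma or_class_iff_adj_swaps:
  assumes "distinct xs" "(xs, ys) \<in> adj_swap ^^ k"
  shows "ys \<in> or_class xs \<longleftrightarrow> even k"
proof -
  obtain p where p: "p permutes {..<length xs}" "evenperm p \<longleftrightarrow> even k" "ys = permute_list p xs"
    using adj_swaps_permute[OF assms(2)] by blast
  show ?thesis unfolding or_class_def
    using p permute_list_inject[OF assms(1) p(1)] by auto
qed

lemma or_class_adj_swaps:
  assumes that: "distinct xs"
  shows "or_class xs = {ys. \<exists>k. even k \<and> (xs, ys) \<in> adj_swap ^^ k}"
proof (intro Set.set_eqI iffI)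
  fix ys assume ys: "ys \<in> or_class xs"
  hence "mset xs = mset ys" unfolding or_class_def by auto
  with adj_swaps_exist obtain k where "(xs, ys) \<in> adj_swap ^^ k" by blast
  with ys that or_class_iff_adj_swaps show "ys \<in> {ys. \<exists>k. even k \<and> (xs, ys) \<in> adj_swap ^^ k}"
    by blast
qed (use that or_class_iff_adj_swaps in blast)

section \<open>The two orientations spanned by a finite set of basis elements\<close>

definition orders :: "'a set \<Rightarrow> 'a list set" where
  "orders B = {xs. distinct xs \<and> set xs = B}"

lemma orders_adj_swaps:
  assumes "xs \<in> orders B" "(xs, ys) \<in> adj_swap ^^ k" shows "ys \<in> orders B"
  using assms adj_swaps_mset[OF assms(2)] unfolding orders_def
  by (metis (mono_tags, lifting) mem_Collect_eq mset_eq_imp_distinct_iff mset_eq_setD)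

lemma orders_adj_swaps_exist:
  assumes "xs \<in> orders B" "ys \<in> orders B" obtains k where "(xs, ys) \<in> adj_swap ^^ k"
proof -
  have "mset xs = mset ys" using assms unfolding orders_def
    by (simp add: set_eq_iff_mset_eq_distinct[symmetric])
  thus thesis using adj_swaps_exist that by blast
qed

lemma or_class_subset: "xs \<in> orders B \<Longrightarrow> or_class xs \<subseteq> orders B"
  unfolding or_class_def orders_def by auto

lemma or_class_self: "xs \<in> or_class xs"
  unfolding or_class_def by (auto intro!: exI[of _ id] simp: permutes_id)

lemma mem_or_class_iff:
  assumes "xs \<in> orders B" "ys \<in> or_class xs" "(ys, zs) \<in> adj_swap ^^ k"
  shows "zs \<in> or_class xs \<longleftrightarrow> even k"
proof -
  have d: "distinct xs" using assms(1) by (simp add: orders_def)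
  obtain j where j: "even j" "(xs, ys) \<in> adj_swap ^^ j"
    using assms(2) or_class_adj_swaps[OF d] by blast
  have "(xs, zs) \<in> adj_swap ^^ (j + k)" using adj_swaps_trans[OF j(2) assms(3)] .
  from or_class_iff_adj_swaps[OF d this] j(1) show ?thesis by simp
qed

text \<open>Membership alternates with the parity of exchanges, whichever ordering the orientation
  was given by. All later sign computations go through this rule.\<close>

lemma or_class_adj_swaps_iff:
  assumes "\<omega> \<in> or_class ` orders B" "ys \<in> orders B" "(ys, zs) \<in> adj_swap ^^ k"
  shows "zs \<in> \<omega> \<longleftrightarrow> (ys \<in> \<omega> \<longleftrightarrow> even k)"
proof -
  obtain xs where xs: "xs \<in> orders B" "\<omega> = or_class xs" using assms(1) by blast
  obtain j where j: "(xs, ys) \<in> adj_swap ^^ j" by (rule orders_adj_swaps_exist[OF xs(1) assms(2)])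
  have "ys \<in> \<omega> \<longleftrightarrow> even j"
    using mem_or_class_iff[OF xs(1) or_class_self j] xs(2) by simp
  moreover have "zs \<in> \<omega> \<longleftrightarrow> even (j + k)"
    using mem_or_class_iff[OF xs(1) or_class_self adj_swaps_trans[OF j assms(3)]] xs(2) by simp
  ultimately show ?thesis by auto
qed

lemma or_class_eqI:
  assumes "xs \<in> orders B" "ys \<in> orders B" "zs \<in> or_class xs" "zs \<in> or_class ys"
  shows "or_class xs = or_class ys"
proof -
  have z: "zs \<in> orders B" using assms or_class_subset by blast
  have "us \<in> or_class xs \<longleftrightarrow> us \<in> or_class ys" if "us \<in> orders B" for us
  proof -
    obtain k where "(zs, us) \<in> adj_swap ^^ k" by (rule orders_adj_swaps_exist[OF z \<open>us \<in> orders B\<close>])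
    thus ?thesis using mem_or_class_iff[OF assms(1,3)] mem_or_class_iff[OF assms(2,4)] by simp
  qed
  thus ?thesis using or_class_subset assms(1,2) by blast
qed

lemma orient_subset: "\<omega> \<in> or_class ` orders B \<Longrightarrow> \<omega> \<subseteq> orders B"
  using or_class_subset by blast

lemma orient_eqI:
  assumes "\<omega> \<in> or_class ` orders B" "\<omega>' \<in> or_class ` orders B" "xs \<in> \<omega>" "xs \<in> \<omega>'"
  shows "\<omega> = \<omega>'"
  using assms or_class_eqI by blast

lemma orient_nonempty: "\<omega> \<in> or_class ` orders B \<Longrightarrow> \<exists>xs. xs \<in> \<omega>"
  using or_class_self by blast

lemma orient_eq_or_class:
  "\<omega> \<in> or_class ` orders B \<Longrightarrow> xs \<in> \<omega> \<Longrightarrow> \<omega> = or_class xs"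
  using or_class_eqI or_class_self or_class_subset by blast

text \<open>Exchanging the first two entries of a representative shifts every exchange count by one,
  so the complement is again a class. Two basis elements must exist for this.\<close>

lemma orient_reverse:
  assumes "\<omega> \<in> or_class ` orders B" "card B \<ge> 2"
  shows "orders B - \<omega> \<in> or_class ` orders B"
proof -
  obtain xs where xs: "xs \<in> orders B" "\<omega> = or_class xs" using assms by blast
  have "length xs = card B" using xs(1) distinct_card unfolding orders_def by fastforce
  then obtain x y v where v: "xs = x # y # v" using assms(2)
    by (metis Suc_le_length_iff numeral_2_eq_2)
  have "(xs, y # x # v) \<in> adj_swap" using adj_swapI[of "[]"] v by simp
  hence sw: "(xs, y # x # v) \<in> adj_swap ^^ 1" by simp
  have y: "y # x # v \<in> orders B" using orders_adj_swaps[OF xs(1) sw] .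
  have "or_class (y # x # v) = orders B - \<omega>"
  proof (intro Set.set_eqI)
    fix us
    show "us \<in> or_class (y # x # v) \<longleftrightarrow> us \<in> orders B - \<omega>"
    proof (cases "us \<in> orders B")
      case True
      obtain k where k: "(y # x # v, us) \<in> adj_swap ^^ k" by (rule orders_adj_swaps_exist[OF y True])
      have "us \<in> or_class (y # x # v) \<longleftrightarrow> even k"
        using mem_or_class_iff[OF y or_class_self k] .
      moreover have "us \<in> \<omega> \<longleftrightarrow> even (1 + k)"
        using mem_or_class_iff[OF xs(1) or_class_self adj_swaps_trans[OF sw k]] xs(2) by simp
      ultimately show ?thesis using True by simp
    next
      case False thus ?thesis using or_class_subset[OF y] by blast
    qed
  qed
  thus ?thesis using y by blast
qed

lemma orient_cases:
  assumes "\<omega> \<in> or_class ` orders B" "\<omega>' \<in> or_class ` orders B" "card B \<ge> 2"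
  shows "\<omega>' = \<omega> \<or> \<omega>' = orders B - \<omega>"
proof -
  obtain xs where "xs \<in> \<omega>'" using assms orient_nonempty by blast
  thus ?thesis using orient_eqI[OF assms(2,1)] orient_eqI[OF assms(2) orient_reverse[OF assms(1,3)]]
      orient_subset[OF assms(2)] by blast
qed

lemma orient_ne_reverse: "\<omega> \<in> or_class ` orders B \<Longrightarrow> \<omega> \<noteq> orders B - \<omega>"
  using orient_nonempty by blast

text \<open>Parity only sees the exchanges inside the common tail, so the prefix can be replaced.
  This is what collapsing an edge does: four leading basis elements give way to one.\<close>

lemma or_class_prefix_iff:
  assumes "distinct (p @ xs)" "mset ys = mset xs" "distinct (q @ xs)"
  shows "p @ ys \<in> or_class (p @ xs) \<longleftrightarrow> q @ ys \<in> or_class (q @ xs)"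
proof -
  obtain k where k: "(xs, ys) \<in> adj_swap ^^ k" using adj_swaps_exist assms(2) by metis
  show ?thesis
    using or_class_iff_adj_swaps[OF assms(1) adj_swaps_prefix[OF k]]
      or_class_iff_adj_swaps[OF assms(3) adj_swaps_prefix[OF k]] by simp
qed

lemma or_class_map: "map f ` or_class xs = or_class (map f xs)"
proof -
  have "map f (permute_list p xs) = permute_list p (map f xs)" if "p permutes {..<length xs}" for p
    using permute_list_map[OF that, of f] by simp
  thus ?thesis unfolding or_class_def by (auto simp: image_def)
qed

section \<open>Collapsing an edge\<close>

text \<open>Connectedness is left out because collapsing treats it by a separate argument, whereas
  the remaining conditions can be checked vertex by vertex and edge by edge.\<close>

definition rib :: "'h rgraph \<Rightarrow> bool" where
  "rib G \<longleftrightarrow> is_graph G \<and> nxt G permutes halfs G \<and> (\<forall>v\<in>verts G. cyclic_on (nxt G) v)"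

lemma ribbon_graph_iff: "ribbon_graph G \<longleftrightarrow> rib G \<and> connected_graph G"
  unfolding ribbon_graph_def rib_def by blast

text \<open>A nonempty closed subset contains an orbit, and one orbit is everything. Arguments about
  cyclic orders are run through such closed subsets, without writing down cycles.\<close>

lemma cyclic_on_invariant:
  assumes "cyclic_on f V" "U \<subseteq> V" "U \<noteq> {}" "\<And>x. x \<in> U \<Longrightarrow> f x \<in> U"
  shows "U = V"
proof -
  obtain x where x: "x \<in> U" using assms(3) by blast
  have "orbit f x \<subseteq> U"
  proof
    fix y assume "y \<in> orbit f x" thus "y \<in> U" by induction (use x assms(4) in auto)
  qed
  moreover have "orbit f x = V" using assms(1,2) x by (metis cyclic_on_alldef subsetD)
  ultimately show ?thesis using assms(2) by blast
qed

text \<open>Converse criterion: the orbit of any point is itself a nonempty closed subset.\<close>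

lemma cyclic_onI_invariant:
  assumes "V \<noteq> {}" "\<And>x. x \<in> V \<Longrightarrow> f x \<in> V"
    and "\<And>U. U \<subseteq> V \<Longrightarrow> U \<noteq> {} \<Longrightarrow> (\<And>x. x \<in> U \<Longrightarrow> f x \<in> U) \<Longrightarrow> U = V"
  shows "cyclic_on f V"
proof -
  obtain x where x: "x \<in> V" using assms(1) by blast
  have "orbit f x \<subseteq> V"
  proof
    fix y assume "y \<in> orbit f x" thus "y \<in> V" by induction (use x assms(2) in auto)
  qed
  moreover have "orbit f x \<noteq> {}" by (simp add: orbit_nonempty)
  moreover have "\<And>y. y \<in> orbit f x \<Longrightarrow> f y \<in> orbit f x" by (rule orbit.step)
  ultimately have "orbit f x = V" using assms(3) by blast
  with x show ?thesis unfolding cyclic_on_def by blast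
qed

lemma cyclic_on_closed: "cyclic_on f V \<Longrightarrow> x \<in> V \<Longrightarrow> f x \<in> V"
  unfolding cyclic_on_def by (auto intro: orbit.step)

lemma cyclic_on_surj:
  assumes "cyclic_on f V" shows "f ` V = V"
proof -
  have "f ` V \<subseteq> V" using cyclic_on_closed[OF assms] by blast
  moreover have "V \<noteq> {}" using assms unfolding cyclic_on_def by blast
  ultimately show ?thesis by (intro cyclic_on_invariant[OF assms]) auto
qed

section \<open>Vertices, edges and halves of a graph\<close>

context
  fixes G :: "'h rgraph"
  assumes G: "is_graph G"
begin

lemma finite_halfs: "finite (halfs G)"
  using G unfolding is_graph_def by blast

lemma verts_partition: "partition_on (halfs G) (verts G)"
  and edges_partition: "partition_on (halfs G) (edges G)"
  and card_edge: "e \<in> edges G \<Longrightarrow> card e = 2"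
  and card_vert: "v \<in> verts G \<Longrightarrow> card v \<ge> 3"
  using G unfolding is_graph_def by blast+

lemma vert_subset: "v \<in> verts G \<Longrightarrow> v \<subseteq> halfs G"
  and edge_subset: "e \<in> edges G \<Longrightarrow> e \<subseteq> halfs G"
  and Union_verts: "\<Union>(verts G) = halfs G"
  and Union_edges: "\<Union>(edges G) = halfs G"
  using verts_partition edges_partition unfolding partition_on_def by blast+

lemma finite_vert: "v \<in> verts G \<Longrightarrow> finite v"
  using vert_subset finite_halfs finite_subset by blast

lemma finite_verts: "finite (verts G)" and finite_edges: "finite (edges G)"
  by (rule finite_elements[OF finite_halfs verts_partition], rule finite_elements[OF finite_halfs edges_partition])

lemma vert_unique: "v \<in> verts G \<Longrightarrow> w \<in> verts G \<Longrightarrow> h \<in> v \<Longrightarrow> h \<in> w \<Longrightarrow> v = w"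
  and edge_unique: "e \<in> edges G \<Longrightarrow> e' \<in> edges G \<Longrightarrow> h \<in> e \<Longrightarrow> h \<in> e' \<Longrightarrow> e = e'"
  using disjointD[OF partition_onD2[OF verts_partition], of v w]
    disjointD[OF partition_onD2[OF edges_partition], of e e'] by auto

lemma vert_of_eq:
  assumes "v \<in> verts G" "h \<in> v" shows "vert_of G h = v"
  unfolding vert_of_def
proof (rule the_equality)
  show "w = v" if "w \<in> verts G \<and> h \<in> w" for w using that assms vert_unique[of w v h] by simp
qed (use assms in simp)

lemma edge_of_eq:
  assumes "e \<in> edges G" "h \<in> e" shows "edge_of G h = e"
  unfolding edge_of_def
proof (rule the_equality)
  show "e' = e" if "e' \<in> edges G \<and> h \<in> e'" for e' using that assms edge_unique[of e' e h] by simp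
qed (use assms in simp)

lemma vert_of_in: "h \<in> halfs G \<Longrightarrow> vert_of G h \<in> verts G"
  and in_vert_of: "h \<in> halfs G \<Longrightarrow> h \<in> vert_of G h"
  using Union_verts vert_of_eq by auto

lemma edge_of_in: "h \<in> halfs G \<Longrightarrow> edge_of G h \<in> edges G"
  and in_edge_of: "h \<in> halfs G \<Longrightarrow> h \<in> edge_of G h"
  using Union_edges edge_of_eq by auto

lemma edgeE:
  assumes "e \<in> edges G"
  obtains a b where "e = {a, b}" "a \<noteq> b" "a \<in> halfs G" "b \<in> halfs G"
  using card_edge[OF assms] edge_subset[OF assms] unfolding card_2_iff by blast

lemma other_half_eq:
  assumes "{a, b} \<in> edges G" shows "other_half G a = b"
proof -
  have ab: "a \<noteq> b" using card_edge[OF assms] by auto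
  show ?thesis unfolding other_half_def
  proof (rule the_equality)
    fix k assume k: "k \<noteq> a \<and> {a, k} \<in> edges G"
    hence "{a, k} = {a, b}" using edge_unique[of "{a, k}" "{a, b}" a] assms by blast
    thus "k = b" using k ab by (metis doubleton_eq_iff)
  qed (use ab assms in auto)
qed

lemma other_half:
  assumes "h \<in> halfs G"
  shows "other_half G h \<noteq> h" "{h, other_half G h} \<in> edges G" "other_half G h \<in> halfs G"
    "other_half G (other_half G h) = h" "edge_of G h = {h, other_half G h}"
proof -
  obtain a b where e: "edge_of G h = {a, b}" "a \<noteq> b" using edgeE[OF edge_of_in[OF assms]] by metis
  then obtain k where k: "edge_of G h = {h, k}" "h \<noteq> k" using in_edge_of[OF assms] by fastforce
  hence e: "{h, k} \<in> edges G" "{k, h} \<in> edges G" using edge_of_in[OF assms] by (simp_all add: insert_commute)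
  show "other_half G h \<noteq> h" "{h, other_half G h} \<in> edges G" "other_half G h \<in> halfs G"
    "other_half G (other_half G h) = h" "edge_of G h = {h, other_half G h}"
    using other_half_eq[OF e(1)] other_half_eq[OF e(2)] e edge_subset[OF e(1)] k by auto
qed

lemma not_loop_iff:
  assumes "{a, b} \<in> edges G" shows "\<not> is_loop G {a, b} \<longleftrightarrow> vert_of G a \<noteq> vert_of G b"
proof -
  have "a \<in> halfs G" "b \<in> halfs G" using edge_subset[OF assms] by auto
  thus ?thesis unfolding is_loop_def
    by (metis empty_subsetI in_vert_of insert_subset vert_of_eq vert_of_in)
qed

end

text \<open>A cyclic map is onto on each vertex, hence onto on the finite set of half-edges, hence
  bijective there.\<close>

lemma permutes_if_cyclic:
  assumes "is_graph G" "\<And>h. h \<notin> halfs G \<Longrightarrow> nxt G h = h" "\<And>v. v \<in> verts G \<Longrightarrow> cyclic_on (nxt G) v"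
  shows "nxt G permutes halfs G"
proof (rule bij_imp_permutes)
  have "nxt G ` halfs G = \<Union>((`) (nxt G) ` verts G)"
    using Union_verts[OF assms(1)] by blast
  also have "\<dots> = halfs G"
    using Union_verts[OF assms(1)] cyclic_on_surj[OF assms(3)] by simp
  finally have "nxt G ` halfs G = halfs G" .
  thus "bij_betw (nxt G) (halfs G) (halfs G)"
    using finite_halfs[OF assms(1)] by (simp add: bij_betw_def eq_card_imp_inj_on)
qed (use assms(2) in auto)

lemma ribI:
  assumes "is_graph G" "\<And>h. h \<notin> halfs G \<Longrightarrow> nxt G h = h" "\<And>v. v \<in> verts G \<Longrightarrow> cyclic_on (nxt G) v"
  shows "rib G"
  unfolding rib_def using assms permutes_if_cyclic by blast

section \<open>The successor permutation of a ribbon graph\<close>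

context
  fixes G :: "'h rgraph"
  assumes R: "rib G"
begin

lemma rib_is_graph: "is_graph G" using R unfolding rib_def by blast

lemma nxt_permutes: "nxt G permutes halfs G" using R unfolding rib_def by blast

lemma nxt_off: "h \<notin> halfs G \<Longrightarrow> nxt G h = h"
  using nxt_permutes permutes_not_in by metis

lemma nxt_inject: "nxt G h = nxt G k \<longleftrightarrow> h = k"
  using nxt_permutes permutes_inj inj_eq by metis

lemma cyclic_vert: "v \<in> verts G \<Longrightarrow> cyclic_on (nxt G) v"
  using R unfolding rib_def by blast

lemma nxt_vert: "v \<in> verts G \<Longrightarrow> h \<in> v \<Longrightarrow> nxt G h \<in> v"
  using cyclic_vert cyclic_on_closed by metis

lemma nxt_halfs: "nxt G h \<in> halfs G \<longleftrightarrow> h \<in> halfs G"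
  using nxt_permutes permutes_in_image by metis

lemma vert_of_nxt: "vert_of G (nxt G h) = vert_of G h"
proof (cases "h \<in> halfs G")
  case True
  thus ?thesis using vert_of_eq[OF rib_is_graph] vert_of_in[OF rib_is_graph] in_vert_of[OF rib_is_graph]
      nxt_vert by metis
qed (simp add: nxt_off)

lemma nxt_vert_iff: "v \<in> verts G \<Longrightarrow> nxt G h \<in> v \<longleftrightarrow> h \<in> v"
  using vert_of_nxt vert_of_eq[OF rib_is_graph] in_vert_of[OF rib_is_graph] nxt_halfs
    vert_subset[OF rib_is_graph] by (metis subsetD)

text \<open>A cycle of length at most 2 would be the whole vertex, against valence at least
  3.\<close>

lemma nxt_neq: "h \<in> halfs G \<Longrightarrow> nxt G h \<noteq> h" 
  and nxt_nxt_neq: "h \<in> halfs G \<Longrightarrow> nxt G (nxt G h) \<noteq> h"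
proof -
  assume h: "h \<in> halfs G"
  let ?v = "vert_of G h"
  have v: "?v \<in> verts G" "h \<in> ?v" using h vert_of_in[OF rib_is_graph] in_vert_of[OF rib_is_graph] by auto
  have c: "card ?v \<ge> 3" using card_vert[OF rib_is_graph v(1)] .
  show "nxt G (nxt G h) \<noteq> h"
  proof
    assume *: "nxt G (nxt G h) = h"
    have "{h, nxt G h} = ?v"
      by (rule cyclic_on_invariant[OF cyclic_vert[OF v(1)]]) (use * v nxt_vert[OF v(1)] in auto)
    moreover have "card {h, nxt G h} \<le> 2" by (simp add: card_insert_if)
    ultimately show False using c by simp
  qed
  thus "nxt G h \<noteq> h" by metis
qed

lemma vert_of_subset_closed:
  assumes "h \<in> U" "h \<in> halfs G" "\<And>x. x \<in> U \<Longrightarrow> x \<in> halfs G \<Longrightarrow> nxt G x \<in> U"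
  shows "vert_of G h \<subseteq> U"
proof -
  have v: "vert_of G h \<in> verts G" "h \<in> vert_of G h"
    using assms vert_of_in[OF rib_is_graph] in_vert_of[OF rib_is_graph] by auto
  have "U \<inter> vert_of G h = vert_of G h"
    by (rule cyclic_on_invariant[OF cyclic_vert[OF v(1)]])
      (use assms v nxt_vert[OF v(1)] vert_subset[OF rib_is_graph v(1)] in auto)
  thus ?thesis by blast
qed

end

text \<open>Paths of vertices are hard to follow through a collapse. Sets of half-edges closed under
  \<open>nxt\<close> and \<open>other_half\<close> are easier, because a collapse only removes two
  half-edges and redirects their predecessors.\<close>

lemma connected_graph_iff:
  assumes R: "rib G"
  shows "connected_graph G \<longleftrightarrow> halfs G \<noteq> {} \<and>
    (\<forall>H\<subseteq>halfs G. H \<noteq> {} \<longrightarrow> (\<forall>h\<in>H. nxt G h \<in> H \<and> other_half G h \<in> H) \<longrightarrow> H = halfs G)"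
proof
  note g = rib_is_graph[OF R]
  assume c: "connected_graph G"
  have ne: "halfs G \<noteq> {}"
  proof -
    obtain v where v: "v \<in> verts G" using c unfolding connected_graph_def by blast
    hence "v \<noteq> {}" using card_vert[OF g v] by auto
    thus ?thesis using vert_subset[OF g v] by blast
  qed
  moreover have "H = halfs G" if H: "H \<subseteq> halfs G" "H \<noteq> {}" "\<And>h. h \<in> H \<Longrightarrow> nxt G h \<in> H \<and> other_half G h \<in> H" for H
  proof -
    have sub: "vert_of G h \<subseteq> H" if "h \<in> H" for h
      using vert_of_subset_closed[OF R that] that H by blast
    obtain h0 where h0: "h0 \<in> H" using H by blast
    have step: "w \<subseteq> H" if "(v, w) \<in> adjacent G" "v \<subseteq> H" for v w
    proof -
      from that(1) obtain e where e: "v \<in> verts G" "w \<in> verts G" "e \<in> edges G" "e \<inter> v \<noteq> {}" "e \<inter> w \<noteq> {}"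
        unfolding adjacent_def by blast
      then obtain h k where hk: "h \<in> e" "h \<in> v" "k \<in> e" "k \<in> w" by blast
      have "h \<in> H" using hk that(2) by blast
      have "e = {h, other_half G h}"
        using edge_of_eq[OF g e(3) hk(1)] other_half(5)[OF g] H(1) \<open>h \<in> H\<close> by auto
      hence "k \<in> H" using hk H(3)[OF \<open>h \<in> H\<close>] \<open>h \<in> H\<close> by blast
      thus ?thesis using sub vert_of_eq[OF g e(2) hk(4)] by blast
    qed
    have all: "w \<subseteq> H" if "w \<in> verts G" for w
    proof -
      have "(vert_of G h0, w) \<in> (adjacent G)\<^sup>*"
        using c that vert_of_in[OF g] h0 H(1) unfolding connected_graph_def by blast
      thus ?thesis by (induction) (use sub[OF h0] step in auto)
    qed
    thus ?thesis using H(1) Union_verts[OF g] by blast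
  qed
  ultimately show "halfs G \<noteq> {} \<and>
    (\<forall>H\<subseteq>halfs G. H \<noteq> {} \<longrightarrow> (\<forall>h\<in>H. nxt G h \<in> H \<and> other_half G h \<in> H) \<longrightarrow> H = halfs G)" by blast
next
  note g = rib_is_graph[OF R]
  assume A: "halfs G \<noteq> {} \<and>
    (\<forall>H\<subseteq>halfs G. H \<noteq> {} \<longrightarrow> (\<forall>h\<in>H. nxt G h \<in> H \<and> other_half G h \<in> H) \<longrightarrow> H = halfs G)"
  have "(v, w) \<in> (adjacent G)\<^sup>*" if v: "v \<in> verts G" and w: "w \<in> verts G" for v w
  proof -
    \<comment> \<open>The half-edges at the vertices reachable from \<open>v\<close>; this set is
      closed, hence everything.\<close>
    define H where "H = {h \<in> halfs G. (v, vert_of G h) \<in> (adjacent G)\<^sup>*}"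
    have "v \<noteq> {}" using card_vert[OF g v] by auto
    then obtain h0 where h0: "h0 \<in> v" by blast
    hence "h0 \<in> H" unfolding H_def using vert_of_eq[OF g v h0] vert_subset[OF g v] by auto
    moreover have "nxt G h \<in> H \<and> other_half G h \<in> H" if h: "h \<in> H" for h
    proof
      have hh: "h \<in> halfs G" using h H_def by blast
      show "nxt G h \<in> H" using h unfolding H_def by (simp add: vert_of_nxt[OF R] nxt_halfs[OF R])
      have "(vert_of G h, vert_of G (other_half G h)) \<in> adjacent G"
      proof -
        have "{h, other_half G h} \<inter> vert_of G h \<noteq> {}"
          "{h, other_half G h} \<inter> vert_of G (other_half G h) \<noteq> {}"
          using in_vert_of[OF g hh] in_vert_of[OF g other_half(3)[OF g hh]] by auto
        hence "\<exists>e\<in>edges G. e \<inter> vert_of G h \<noteq> {} \<and> e \<inter> vert_of G (other_half G h) \<noteq> {}"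
          by (intro bexI[OF conjI other_half(2)[OF g hh]])
        thus ?thesis unfolding adjacent_def
          using vert_of_in[OF g hh] vert_of_in[OF g other_half(3)[OF g hh]] by simp
      qed
      thus "other_half G h \<in> H" using h other_half(3)[OF g hh] unfolding H_def by auto
    qed
    moreover have "H \<subseteq> halfs G" unfolding H_def by blast
    moreover have "H \<noteq> {}" using \<open>h0 \<in> H\<close> by blast
    ultimately have Heq: "H = halfs G"
      using A[THEN conjunct2, THEN spec, of H] by (metis (no_types, lifting))
    moreover have "w \<noteq> {}" using card_vert[OF g w] by auto
    then obtain k where k: "k \<in> w" by blast
    ultimately have "(v, vert_of G k) \<in> (adjacent G)\<^sup>*"
      using vert_subset[OF g w] unfolding H_def by blast
    thus ?thesis using vert_of_eq[OF g w k] by simp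
  qed
  moreover have "verts G \<noteq> {}" using A Union_verts[OF g] by blast
  ultimately show "connected_graph G" unfolding connected_graph_def by blast
qed

text \<open>The edge is given with its ends in order, so that the new successor map can be written
  by cases. Distinctness of the end vertices expresses that the edge is not a loop.\<close>

locale edge_collapse =
  fixes G :: "'h rgraph" and a b :: 'h
  assumes R: "rib G" and e: "{a, b} \<in> edges G" and nl: "vert_of G a \<noteq> vert_of G b"
begin

abbreviation "va \<equiv> vert_of G a"
abbreviation "vb \<equiv> vert_of G b"
abbreviation "G' \<equiv> collapse_edge G {a, b}"
abbreviation "vm \<equiv> va \<union> vb - {a, b}"

lemmas g = rib_is_graph[OF R]

lemma ab: "a \<noteq> b" using nl by blast
lemma ha: "a \<in> halfs G" and hb: "b \<in> halfs G" using edge_subset[OF g e] by auto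
lemma va: "va \<in> verts G" "a \<in> va" and vb: "vb \<in> verts G" "b \<in> vb"
  using ha hb vert_of_in[OF g] in_vert_of[OF g] by auto
lemma disj: "va \<inter> vb = {}" using vert_unique[OF g va(1) vb(1)] nl by blast
lemma notin: "a \<notin> vb" "b \<notin> va" using disj va vb by auto

lemma oh: "other_half G a = b" "other_half G b = a"
  using other_half_eq[OF g e] other_half_eq[OF g, of b a] e by (simp_all add: insert_commute)

lemma merged: "merged_vertex G {a, b} = vm"
  unfolding merged_vertex_def by auto

lemma halfs': "halfs G' = halfs G - {a, b}"
  and edges': "edges G' = edges G - {{a, b}}"
  and verts': "verts G' = insert vm (verts G - {va, vb})"
  unfolding collapse_edge_def by (simp_all add: merged)

lemma nxt': "nxt G' h = (if h = a \<or> h = b then h else if nxt G h = a then nxt G b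
    else if nxt G h = b then nxt G a else nxt G h)"
  unfolding collapse_edge_def using oh by auto

lemma nxt_a: "nxt G a \<in> va - {a, b}" and nxt_b: "nxt G b \<in> vb - {a, b}"
  using nxt_vert[OF R va] nxt_vert[OF R vb] nxt_neq[OF R ha] nxt_neq[OF R hb] notin by auto

lemma vm_disj: "v \<in> verts G \<Longrightarrow> v \<noteq> va \<Longrightarrow> v \<noteq> vb \<Longrightarrow> v \<inter> (va \<union> vb) = {}"
  using vert_unique[OF g] va vb by blast

lemma card_vm: "card vm = card va + card vb - 2" "card vm \<ge> 4"
proof -
  have f: "finite va" "finite vb" using finite_vert[OF g] va vb by auto
  have "card (va \<union> vb) = card va + card vb" using f disj by (simp add: card_Un_disjoint)
  moreover have "card vm = card (va \<union> vb) - card {a, b}"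
    by (rule card_Diff_subset) (use va vb in auto)
  ultimately show "card vm = card va + card vb - 2" using ab by simp
  thus "card vm \<ge> 4" using card_vert[OF g va(1)] card_vert[OF g vb(1)] by simp
qed

lemma vm_ne: "vm \<noteq> {}" using card_vm(2) by (metis card.empty not_numeral_le_zero)

lemma is_graph': "is_graph G'"
proof -
  have P: "partition_on (halfs G') (edges G')"
  proof (rule partition_onI)
    have "c \<inter> {a, b} = {}" if "c \<in> edges G" "c \<noteq> {a, b}" for c
      using that edge_unique[OF g that(1) e] by blast
    thus "\<Union>(edges G') = halfs G'" using Union_edges[OF g] unfolding halfs' edges' by blast
    show "disjnt p q" if "p \<in> edges G'" "q \<in> edges G'" "p \<noteq> q" for p q
      using that edge_unique[OF g, of p q] unfolding edges' disjnt_def by blast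
    show "{} \<notin> edges G'" unfolding edges' using card_edge[OF g, of "{}"] by auto
  qed
  have Q: "partition_on (halfs G') (verts G')"
  proof (rule partition_onI)
    show "\<Union>(verts G') = halfs G'"
    proof -
      have "\<Union>(verts G) = va \<union> vb \<union> \<Union>(verts G - {va, vb})" using va vb by blast
      moreover have "\<Union>(verts G - {va, vb}) \<inter> {a, b} = {}" using vm_disj va vb by blast
      ultimately have "\<Union>(verts G) - {a, b} = vm \<union> \<Union>(verts G - {va, vb})" by blast
      thus ?thesis unfolding halfs' verts' Union_verts[OF g] Union_insert by (rule sym)
    qed
    show "disjnt p q" if "p \<in> verts G'" "q \<in> verts G'" "p \<noteq> q" for p q
    proof -
      have pq: "p = vm \<or> p \<in> verts G \<and> p \<inter> (va \<union> vb) = {}" "q = vm \<or> q \<in> verts G \<and> q \<inter> (va \<union> vb) = {}"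
      proof -
        have D: "r = vm \<or> r \<in> verts G \<and> r \<inter> (va \<union> vb) = {}" if "r \<in> verts G'" for r
        proof (cases "r = vm")
          case False
          hence "r \<in> verts G" "r \<noteq> va" "r \<noteq> vb" using that verts' by simp_all
          thus ?thesis using vm_disj by simp
        qed simp
        show "p = vm \<or> p \<in> verts G \<and> p \<inter> (va \<union> vb) = {}" by (rule D[OF that(1)])
        show "q = vm \<or> q \<in> verts G \<and> q \<inter> (va \<union> vb) = {}" by (rule D[OF that(2)])
      qed
      have "p \<inter> q = {}" if "p \<in> verts G" "q \<in> verts G" using vert_unique[OF g that] \<open>p \<noteq> q\<close> by blast
      with pq \<open>p \<noteq> q\<close> show ?thesis unfolding disjnt_def by blast
    qed
    show "{} \<notin> verts G'" unfolding verts' using vm_ne card_vert[OF g, of "{}"] by (metis Diff_iff card.empty insert_iff not_numeral_le_zero)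
  qed
  show ?thesis unfolding is_graph_def
  proof (intro conjI ballI P Q)
    show "finite (halfs G')" using finite_halfs[OF g] halfs' by simp
    show "card e = 2" if "e \<in> edges G'" for e using that card_edge[OF g] edges' by simp
    show "3 \<le> card v" if "v \<in> verts G'" for v using that card_vert[OF g] card_vm(2) verts' by auto
  qed
qed

lemma cyclic_vm: "cyclic_on (nxt G') vm"
proof (rule cyclic_onI_invariant)
  show "vm \<noteq> {}" by (rule vm_ne)
  show "nxt G' x \<in> vm" if "x \<in> vm" for x
    using that nxt_a nxt_b nxt_vert[OF R va(1), of x] nxt_vert[OF R vb(1), of x] by (auto simp: nxt')
next
  fix U assume U: "U \<subseteq> vm" "U \<noteq> {}" "\<And>x. x \<in> U \<Longrightarrow> nxt G' x \<in> U"
  have step: "nxt G x \<in> U" if "x \<in> U" "nxt G x \<noteq> a" "nxt G x \<noteq> b" for x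
  proof -
    have "x \<noteq> a" "x \<noteq> b" using that(1) U(1) by auto
    thus ?thesis using U(3)[OF that(1)] that by (simp add: nxt')
  qed
  \<comment> \<open>Inside \<open>va\<close> the old and the new successor agree until
    \<open>a\<close> is reached, so a closed set containing the successor of \<open>a\<close>
    contains the rest of that vertex.\<close>
  have A: "va - {a} \<subseteq> U" if "nxt G a \<in> U"
  proof -
    have "insert a (U \<inter> va) = va"
      by (rule cyclic_on_invariant[OF cyclic_vert[OF R va(1)]])
        (use va that nxt_a step nxt_vert[OF R va(1)] notin in auto)
    thus ?thesis by blast
  qed
  have B: "vb - {b} \<subseteq> U" if "nxt G b \<in> U"
  proof -
    have "insert b (U \<inter> vb) = vb"
      by (rule cyclic_on_invariant[OF cyclic_vert[OF R vb(1)]])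
        (use vb that nxt_b step nxt_vert[OF R vb(1)] notin in auto)
    thus ?thesis by blast
  qed
  \<comment> \<open>The merged cyclic order jumps to the other vertex at the predecessor of
    \<open>a\<close>: its new successor is that of \<open>b\<close>. Exhausting one side therefore
    enters the other.\<close>
  obtain pa where pa: "nxt G pa = a" "pa \<in> va"
    using cyclic_on_surj[OF cyclic_vert[OF R va(1)]] va(2) by (metis imageE)
  obtain pb where pb: "nxt G pb = b" "pb \<in> vb"
    using cyclic_on_surj[OF cyclic_vert[OF R vb(1)]] vb(2) by (metis imageE)
  have pa': "pa \<notin> {a, b}" using pa nxt_neq[OF R ha] notin by auto
  have pb': "pb \<notin> {a, b}" using pb nxt_neq[OF R hb] notin by auto
  have ab1: "nxt G b \<in> U" if "va - {a} \<subseteq> U"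
    using U(3)[of pa] that pa pa' by (auto simp: nxt')
  have ba1: "nxt G a \<in> U" if "vb - {b} \<subseteq> U"
    using U(3)[of pb] that pb pb' ab by (auto simp: nxt')
  \<comment> \<open>Otherwise \<open>U\<close> would be closed under the old successor and contain a
    whole end vertex, with \<open>a\<close> or \<open>b\<close> in it.\<close>
  have "nxt G a \<in> U \<or> nxt G b \<in> U"
  proof (rule ccontr)
    assume N: "\<not> ?thesis"
    have n: "nxt G x \<notin> {a, b}" if "x \<in> U" for x
      using U(3)[OF that] that U(1) N by (auto simp: nxt' split: if_splits)
    obtain x where x: "x \<in> U" using U(2) by blast
    have xh: "x \<in> halfs G" using x U(1) vert_subset[OF g va(1)] vert_subset[OF g vb(1)] by blast
    have "vert_of G x \<subseteq> U"
      by (rule vert_of_subset_closed[OF R x xh]) (use step n in auto)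
    moreover have "vert_of G x = va \<or> vert_of G x = vb"
      using x U(1) vert_of_eq[OF g va(1)] vert_of_eq[OF g vb(1)] by blast
    ultimately show False using va vb U(1) by auto
  qed
  thus "U = vm" using A B ab1 ba1 U(1) by blast
qed

lemma cyclic_other:
  assumes v: "v \<in> verts G" "v \<noteq> va" "v \<noteq> vb" shows "cyclic_on (nxt G') v"
proof -
  have "nxt G' x = nxt G x" if "x \<in> v" for x
    using vm_disj[OF v] nxt_vert[OF R v(1) that] that va vb by (auto simp: nxt')
  thus ?thesis using cyclic_cong[of v "nxt G" "nxt G'"] cyclic_vert[OF R v(1)] by metis
qed

lemma rib': "rib G'"
proof (rule ribI[OF is_graph'])
  show "nxt G' h = h" if "h \<notin> halfs G'" for h
    using that nxt_off[OF R, of h] ha hb by (auto simp: nxt' halfs')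
  show "cyclic_on (nxt G') v" if "v \<in> verts G'" for v
    using that cyclic_vm cyclic_other unfolding verts' by auto
qed

lemma other_half': "h \<in> halfs G' \<Longrightarrow> other_half G' h = other_half G h"
  using other_half_eq[OF is_graph'] other_half(2)[OF is_graph'] other_half_eq[OF g] edges'
  by (metis DiffD1)

lemma vert_of': "h \<in> halfs G' \<Longrightarrow> vert_of G' h = (if vert_of G h \<in> {va, vb} then vm else vert_of G h)"
proof -
  assume h: "h \<in> halfs G'"
  hence hG: "h \<in> halfs G" "h \<notin> {a, b}" using halfs' by auto
  note v = vert_of_in[OF g hG(1)] in_vert_of[OF g hG(1)]
  show ?thesis
    using vert_of_eq[OF is_graph', of vm h] vert_of_eq[OF is_graph', of "vert_of G h" h] v hG
    unfolding verts' by auto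
qed

text \<open>Valences p and q merge into p + q - 2, and (p + q - 2) - 3 = (p - 3) + (q - 3) +
  1.\<close>

lemma codim': "codim G' = Suc (codim G)"
proof -
  let ?V = "verts G - {va, vb}"
  have fin: "finite ?V" using finite_verts[OF g] by simp
  have vmV: "vm \<notin> ?V" using vm_disj[of vm] vm_ne by blast
  have "codim G' = card vm - 3 + (\<Sum>v\<in>?V. card v - 3)"
    unfolding codim_def verts' using fin vmV by simp
  moreover have "codim G = (card va - 3) + (card vb - 3) + (\<Sum>v\<in>?V. card v - 3)"
    unfolding codim_def using sum.subset_diff[of "{va, vb}" "verts G" "\<lambda>v. card v - 3"]
      finite_verts[OF g] va vb nl by simp
  ultimately show ?thesis using card_vm(1) card_vert[OF g va(1)] card_vert[OF g vb(1)] by simp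
qed

lemma connected': "connected_graph G' \<longleftrightarrow> connected_graph G"
proof -
  have ne: "halfs G \<noteq> {}" "halfs G' \<noteq> {}" using ha vm_ne vert_subset[OF is_graph', of vm] verts' by blast+
  obtain pa where pa: "nxt G pa = a" "pa \<in> va"
    using cyclic_on_surj[OF cyclic_vert[OF R va(1)]] va(2) by (metis imageE)
  obtain pb where pb: "nxt G pb = b" "pb \<in> vb"
    using cyclic_on_surj[OF cyclic_vert[OF R vb(1)]] vb(2) by (metis imageE)
  have pa': "pa \<notin> {a, b}" using pa nxt_neq[OF R ha] notin by auto
  show ?thesis
  proof
    assume c: "connected_graph G'"
    show "connected_graph G" unfolding connected_graph_iff[OF R]
    proof (intro conjI ne allI impI)
      fix H assume H: "H \<subseteq> halfs G" "H \<noteq> {}" "\<forall>h\<in>H. nxt G h \<in> H \<and> other_half G h \<in> H"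
      have "H - {a, b} = halfs G'"
      proof -
        have "H - {a, b} \<subseteq> halfs G'" using H halfs' by blast
        \<comment> \<open>A closed set cannot consist of the halves of the edge alone, since the
          successors of \<open>a\<close> and \<open>b\<close> lie off the edge.\<close>
        moreover have "H - {a, b} \<noteq> {}" 
        proof -
          have "\<exists>x\<in>H. x \<notin> {a, b}"
          proof -
            obtain x where x: "x \<in> H" using H by blast
            have "x \<in> {a, b} \<Longrightarrow> nxt G x \<notin> {a, b}" using nxt_a nxt_b by auto
            thus ?thesis using x H(3) by blast
          qed
          thus ?thesis by blast
        qed
        moreover have "nxt G' h \<in> H - {a, b} \<and> other_half G' h \<in> H - {a, b}" if h: "h \<in> H - {a, b}" for h
        proof
          have h': "h \<in> halfs G'" using h H(1) halfs' by blast
          show "nxt G' h \<in> H - {a, b}"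
          proof (cases "nxt G h \<in> {a, b}")
            case True
            hence "a \<in> H \<and> b \<in> H" using H(3) h oh by (metis DiffD1 insertE singletonD)
            thus ?thesis using True h H(3) nxt_a nxt_b ab by (auto simp: nxt')
          next
            case False thus ?thesis using h H(3) by (auto simp: nxt')
          qed
          show "other_half G' h \<in> H - {a, b}"
            using other_half(3)[OF is_graph' h'] H(3) h other_half'[OF h'] halfs' by auto
        qed
        ultimately show ?thesis using c unfolding connected_graph_iff[OF rib'] by blast
      qed
      moreover have "pa \<in> H" using calculation pa pa' vert_subset[OF g va(1)] halfs' by blast
      ultimately have "a \<in> H" using pa H(3) by metis
      hence "b \<in> H" using H(3) oh by metis
      with \<open>a \<in> H\<close> \<open>H - {a, b} = halfs G'\<close> show "H = halfs G" using halfs' ha hb by blast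
    qed
  next
    assume c: "connected_graph G"
    show "connected_graph G'" unfolding connected_graph_iff[OF rib']
    proof (intro conjI ne allI impI)
      fix H assume H: "H \<subseteq> halfs G'" "H \<noteq> {}" "\<forall>h\<in>H. nxt G' h \<in> H \<and> other_half G' h \<in> H"
      \<comment> \<open>The two halves are added back exactly when \<open>H\<close> meets the merged
        vertex, which it then contains entirely.\<close>
      define H' where "H' = (if H \<inter> vm = {} then H else H \<union> {a, b})"
      have vmH: "vm \<subseteq> H" if "H \<inter> vm \<noteq> {}"
      proof -
        from that obtain x where x: "x \<in> H" "x \<in> vm" by (meson IntE all_not_in_conv)
        have "vert_of G' x \<subseteq> H"
          by (rule vert_of_subset_closed[OF rib']) (use x H in auto)
        thus ?thesis using vert_of_eq[OF is_graph', of vm x] x verts' by auto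
      qed
      have "nxt G h \<in> H' \<and> other_half G h \<in> H'" if h: "h \<in> H'" for h
      proof (cases "h \<in> {a, b}")
        case True
        hence "vm \<subseteq> H" "H' = H \<union> {a, b}" using h vmH H halfs' unfolding H'_def by (auto split: if_splits)
        thus ?thesis using True nxt_a nxt_b oh by auto
      next
        case False
        hence hH: "h \<in> H" using h unfolding H'_def by (auto split: if_splits)
        have "nxt G h \<in> {a, b} \<Longrightarrow> h \<in> vm"
          using False nxt_vert_iff[OF R va(1), of h] nxt_vert_iff[OF R vb(1), of h] va vb by auto
        have HH: "H \<subseteq> H'" unfolding H'_def by auto
        have "nxt G h \<in> H'"
        proof (cases "nxt G h \<in> {a, b}")
          case True
          with \<open>_ \<Longrightarrow> h \<in> vm\<close> hH have "H \<inter> vm \<noteq> {}" by blast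
          thus ?thesis using True unfolding H'_def by auto
        next
          case F: False
          have "nxt G' h = nxt G h" using F False by (simp add: nxt')
          thus ?thesis using H(3) hH HH by auto
        qed
        moreover have "other_half G h \<in> H'" using other_half'[of h] H hH HH by (metis subsetD)
        ultimately show ?thesis ..
      qed
      moreover have "H' \<subseteq> halfs G" "H' \<noteq> {}" using H halfs' ha hb unfolding H'_def by auto
      ultimately have "H' = halfs G" using c unfolding connected_graph_iff[OF R] by blast
      thus "H = halfs G'" using H halfs' ha hb unfolding H'_def by (auto split: if_splits)
    qed
  qed
qed

lemma ribbon_graph': "ribbon_graph G' \<longleftrightarrow> ribbon_graph G"
  using connected' rib' R unfolding ribbon_graph_iff by blast

end

lemma edge_collapseI:
  assumes "rib G" "e \<in> edges G" "\<not> is_loop G e"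
  obtains a b where "e = {a, b}" "edge_collapse G a b"
proof -
  obtain a b where ab: "e = {a, b}" using edgeE[OF rib_is_graph[OF assms(1)] assms(2)] by metis
  have "edge_collapse G a b"
    using assms ab not_loop_iff[OF rib_is_graph[OF assms(1)], of a b] unfolding edge_collapse_def by blast
  thus thesis using that ab by blast
qed

section \<open>Forests\<close>

text \<open>Cycles modulo 2: unlike closed trails, they behave well under collapses.\<close>

definition even_set :: "'h rgraph \<Rightarrow> 'h set set \<Rightarrow> bool" where
  "even_set G E \<longleftrightarrow> E \<subseteq> edges G \<and> E \<noteq> {} \<and> (\<forall>v\<in>verts G. even (card (v \<inter> \<Union>E)))"

lemma map_rotate1_nth:
  assumes "\<And>i. i < length xs \<Longrightarrow> f (xs ! i) = g (xs ! (Suc i mod length xs))"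
  shows "map f xs = rotate1 (map g xs)"
proof (rule nth_equalityI)
  fix i assume "i < length (map f xs)"
  hence i: "i < length xs" "Suc i mod length xs < length xs" by (auto intro: mod_less_divisor)
  thus "map f xs ! i = rotate1 (map g xs) ! i" using assms[OF i(1)] by (simp add: nth_rotate1)
qed simp

text \<open>As many edges of the trail begin at a vertex as end there, because the list of end
  vertices is the list of start vertices moved on by one place.\<close>

lemma closed_trail_even_set:
  assumes g: "is_graph G" and F: "F \<subseteq> edges G" and t: "closed_trail G F hs"
  shows "\<exists>E\<subseteq>F. even_set G E"
proof -
  let ?o = "other_half G"
  have hs: "set hs \<subseteq> \<Union>F" "distinct (map (edge_of G) hs)" "hs \<noteq> []"
    and nx: "\<And>i. i < length hs \<Longrightarrow> vert_of G (?o (hs ! i)) = vert_of G (hs ! (Suc i mod length hs))"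
    using t unfolding closed_trail_def by auto
  have hh: "set hs \<subseteq> halfs G" using hs(1) F Union_edges[OF g] by blast
  let ?E = "edge_of G ` set hs"
  have dist: "distinct hs" and inj: "inj_on (edge_of G) (set hs)"
    using hs(2) by (simp_all add: distinct_map)
  have UE: "\<Union>?E = set hs \<union> ?o ` set hs"
  proof -
    have "\<Union>?E = (\<Union>h\<in>set hs. {h, ?o h})" by (rule SUP_cong) (use other_half(5)[OF g] hh in auto)
    thus ?thesis by auto
  qed
  have EF: "?E \<subseteq> F"
  proof
    fix e assume "e \<in> ?E"
    then obtain h where h: "h \<in> set hs" "e = edge_of G h" by blast
    then obtain f where f: "f \<in> F" "h \<in> f" using hs(1) by blast
    thus "e \<in> F" using edge_of_eq[OF g, of f h] F h by auto
  qed
  have odj: "set hs \<inter> ?o ` set hs = {}"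
  proof -
    have "k \<noteq> ?o h" if "h \<in> set hs" "k \<in> set hs" for h k
    proof
      assume k: "k = ?o h"
      have "edge_of G k = edge_of G h"
        using k that hh other_half[OF g, of h] other_half(5)[OF g, of k] by auto
      hence "h = k" using inj that by (simp add: inj_on_def)
      thus False using k other_half(1)[OF g, of h] that hh by auto
    qed
    thus ?thesis by blast
  qed
  have oinj: "inj_on ?o (set hs)" by (rule inj_on_inverseI[of _ ?o]) (use other_half(4)[OF g] hh in auto)
  have "even (card (v \<inter> \<Union>?E))" if v: "v \<in> verts G" for v
  proof -
    have mem: "h \<in> v \<longleftrightarrow> vert_of G h = v" if "h \<in> halfs G" for h
      using that v vert_of_eq[OF g] in_vert_of[OF g] by blast
    have "v \<inter> \<Union>?E = {h \<in> set hs. vert_of G h = v} \<union> ?o ` {h \<in> set hs. vert_of G (?o h) = v}"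
      unfolding UE using mem hh other_half(3)[OF g] by auto
    also have "card \<dots> = card {h \<in> set hs. vert_of G h = v} + card (?o ` {h \<in> set hs. vert_of G (?o h) = v})"
      by (rule card_Un_disjoint) (use odj in auto)
    also have "card (?o ` {h \<in> set hs. vert_of G (?o h) = v}) = card {h \<in> set hs. vert_of G (?o h) = v}"
      by (rule card_image) (rule inj_on_subset[OF oinj], blast)
    also have "card {h \<in> set hs. vert_of G (?o h) = v} = length (filter (\<lambda>w. w = v) (map (vert_of G \<circ> ?o) hs))"
      using dist by (simp add: filter_map comp_def distinct_card[symmetric])
    also have "map (vert_of G \<circ> ?o) hs = rotate1 (map (vert_of G) hs)"
      by (rule map_rotate1_nth) (use nx in auto)
    also have "length (filter (\<lambda>w. w = v) (rotate1 (map (vert_of G) hs))) = length (filter (\<lambda>w. w = v) (map (vert_of G) hs))"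
      by (cases hs) auto
    also have "\<dots> = card {h \<in> set hs. vert_of G h = v}"
      using dist by (simp add: filter_map comp_def distinct_card[symmetric])
    finally show ?thesis by simp
  qed
  moreover have "?E \<noteq> {}" using hs(3) by simp
  ultimately show ?thesis using EF F unfolding even_set_def by blast
qed

text \<open>Even degree allows a walk to leave every vertex by a half-edge other than the one by
  which it arrived. The walk goes on for ever in a finite set of edges, and its first repeated edge
  closes a trail.\<close>

lemma even_set_closed_trail:
  assumes g: "is_graph G" and F: "F \<subseteq> edges G" and E: "E \<subseteq> F" "even_set G E"
  shows "\<exists>hs. closed_trail G F hs"
proof -
  let ?o = "other_half G"
  have UE: "\<Union>E \<subseteq> halfs G" using E F Union_edges[OF g] by blast
  have oE: "?o h \<in> \<Union>E" if "h \<in> \<Union>E" for h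
  proof -
    obtain e where e: "e \<in> E" "h \<in> e" using \<open>h \<in> \<Union>E\<close> by blast
    hence "e = {h, ?o h}" using edge_of_eq[OF g, of e h] other_half(5)[OF g, of h] E F UE by auto
    thus ?thesis using e by blast
  qed
  have "\<exists>k. k \<in> \<Union>E \<and> k \<noteq> ?o h \<and> vert_of G k = vert_of G (?o h)" if h: "h \<in> \<Union>E" for h
  proof -
    let ?v = "vert_of G (?o h)"
    have oh: "?o h \<in> halfs G" using oE[OF h] UE by blast
    note v = vert_of_in[OF g oh] in_vert_of[OF g oh]
    have "even (card (?v \<inter> \<Union>E))" using E(2) v unfolding even_set_def by blast
    moreover have "?v \<inter> \<Union>E \<noteq> {?o h}" using calculation by fastforce
    moreover have "?o h \<in> ?v \<inter> \<Union>E" using v oE[OF h] by blast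
    ultimately obtain k where "k \<in> ?v \<inter> \<Union>E" "k \<noteq> ?o h" by blast
    thus ?thesis using vert_of_eq[OF g v(1)] by blast
  qed
  then obtain s where s: "\<And>h. h \<in> \<Union>E \<Longrightarrow> s h \<in> \<Union>E \<and> s h \<noteq> ?o h \<and> vert_of G (s h) = vert_of G (?o h)"
    by metis
  obtain e0 where e0: "e0 \<in> E" using E(2) unfolding even_set_def by blast
  have "e0 \<noteq> {}" using card_edge[OF g, of e0] e0 E F by auto
  then obtain h0 where h0: "h0 \<in> \<Union>E" using e0 by blast
  define w where "w i = (s ^^ i) h0" for i
  have wE: "w i \<in> \<Union>E" for i
    by (induction i) (use h0 s in \<open>auto simp: w_def\<close>)
  have wS: "w (Suc i) = s (w i)" for i unfolding w_def by simp
  let ?e = "edge_of G"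
  have "finite (\<Union>E)" using UE finite_halfs[OF g] finite_subset by blast
  hence "finite (range (?e \<circ> w))" using wE by (metis finite_imageI finite_subset image_comp image_subsetI image_mono)
  hence "\<not> inj (?e \<circ> w)" using finite_imageD by blast
  hence "\<exists>j. \<exists>i<j. ?e (w i) = ?e (w j)" unfolding inj_def by (metis comp_apply linorder_neqE_nat)
  \<comment> \<open>With the least such \<open>j\<close>, the edges before it are pairwise
    distinct.\<close>
  then obtain j where j: "\<exists>i<j. ?e (w i) = ?e (w j)" and min: "\<And>j'. j' < j \<Longrightarrow> \<not> (\<exists>i<j'. ?e (w i) = ?e (w j'))"
    using exists_least_iff[of "\<lambda>j. \<exists>i<j. ?e (w i) = ?e (w j)"] by blast
  then obtain i where i: "i < j" "?e (w i) = ?e (w j)" by blast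
  have inj: "inj_on (\<lambda>l. ?e (w l)) {..<j}"
    using min by (auto simp: inj_on_def) (metis linorder_neqE_nat)
  have whG: "w l \<in> halfs G" for l using wE UE by blast
  have "w j \<in> {w i, ?o (w i)}"
    using i(2) in_edge_of[OF g whG[of j]] other_half(5)[OF g whG[of i]] by simp
  moreover have trail: "closed_trail G F (map w [l..<j])" if l: "l < j" "vert_of G (w j) = vert_of G (w l)" for l
    unfolding closed_trail_def
  proof (intro conjI allI impI)
    show "map w [l..<j] \<noteq> []" using l by simp
    show "set (map w [l..<j]) \<subseteq> \<Union>F" using wE E(1) by auto
    show "distinct (map ?e (map w [l..<j]))"
    proof -
      have "inj_on (\<lambda>l. ?e (w l)) {l..<j}" by (rule inj_on_subset[OF inj]) auto
      thus ?thesis by (simp add: distinct_map comp_def)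
    qed
    fix m assume "m < length (map w [l..<j])"
    hence m: "l + m < j" by simp
    have st: "vert_of G (?o (w (l + m))) = vert_of G (w (Suc (l + m)))"
      using s[OF wE] wS by metis
    show "vert_of G (?o (map w [l..<j] ! m)) = vert_of G (map w [l..<j] ! (Suc m mod length (map w [l..<j])))"
    proof (cases "Suc m < j - l")
      case True thus ?thesis using st m by simp
    next
      case False
      hence *: "Suc m = j - l" "Suc (l + m) = j" using m by auto
      thus ?thesis using st m l by simp
    qed
  qed
  \<comment> \<open>The repeated edge may be met backwards. Then \<open>w j\<close> starts where
    \<open>w i\<close> ends, so the trail begins at \<open>Suc i\<close>; it is nonempty because the
    walk never turns back at once.\<close>
  moreover have "\<exists>hs. closed_trail G F hs" if "w j = ?o (w i)"
  proof (rule exI, rule trail)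
    have "w (Suc i) \<noteq> ?o (w i)" using s[OF wE] wS by metis
    hence "Suc i \<noteq> j" using that by metis
    thus "Suc i < j" using i by simp
    show "vert_of G (w j) = vert_of G (w (Suc i))" using that s[OF wE] wS by metis
  qed
  moreover have "\<exists>hs. closed_trail G F hs" if "w j = w i" using trail[OF i(1)] that by auto
  ultimately show ?thesis by blast
qed

lemma spanning_forest_iff:
  assumes "is_graph G"
  shows "spanning_forest G F \<longleftrightarrow> F \<subseteq> edges G \<and> (\<nexists>E. E \<subseteq> F \<and> even_set G E)"
  unfolding spanning_forest_def
  using closed_trail_even_set[OF assms] even_set_closed_trail[OF assms] by blast

text \<open>A single edge has degree 2 at its vertex if it is a loop, and degree 1 at both of its
  ends otherwise.\<close>

lemma even_set_loop:
  assumes g: "is_graph G" and e: "e \<in> edges G"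
  shows "even_set G {e} \<longleftrightarrow> is_loop G e"
proof -
  obtain a b where ab: "e = {a, b}" "a \<noteq> b" "a \<in> halfs G" "b \<in> halfs G" using edgeE[OF g e] by metis
  show ?thesis
  proof
    assume "even_set G {e}"
    hence "even (card (vert_of G a \<inter> {a, b}))"
      using vert_of_in[OF g ab(3)] ab unfolding even_set_def by simp
    moreover have "vert_of G a \<inter> {a, b} = {a}" if "b \<notin> vert_of G a"
      using that in_vert_of[OF g ab(3)] by blast
    ultimately have "b \<in> vert_of G a" by fastforce
    thus "is_loop G e" unfolding is_loop_def using in_vert_of[OF g ab(3)] vert_of_in[OF g ab(3)] ab by blast
  next
    assume "is_loop G e"
    then obtain v where v: "v \<in> verts G" "e \<subseteq> v" unfolding is_loop_def by blast
    have "even (card (w \<inter> e))" if "w \<in> verts G" for w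
    proof (cases "w = v")
      case True
      hence "w \<inter> e = e" using v by blast
      thus ?thesis using card_edge[OF g e] by simp
    next
      case False
      hence "w \<inter> e = {}" using vert_unique[OF g that v(1)] v(2) by blast
      thus ?thesis by simp
    qed
    thus "even_set G {e}" unfolding even_set_def using e by simp
  qed
qed

section \<open>Cycles modulo 2 under the collapse of an edge\<close>

context edge_collapse
begin

lemma vert_Int:
  assumes "E' \<subseteq> edges G'"
  shows "v \<in> verts G \<Longrightarrow> v \<inter> \<Union>(insert {a, b} E') = (v \<inter> \<Union>E') \<union> (v \<inter> {a, b})" "\<Union>E' \<inter> {a, b} = {}"
    "vm \<inter> \<Union>E' = (va \<inter> \<Union>E') \<union> (vb \<inter> \<Union>E')"
    "card (vm \<inter> \<Union>E') = card (va \<inter> \<Union>E') + card (vb \<inter> \<Union>E')"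
    "card (va \<inter> \<Union>(insert {a, b} E')) = Suc (card (va \<inter> \<Union>E'))"
    "card (vb \<inter> \<Union>(insert {a, b} E')) = Suc (card (vb \<inter> \<Union>E'))"
proof -
  show "v \<inter> \<Union>(insert {a, b} E') = (v \<inter> \<Union>E') \<union> (v \<inter> {a, b})" by blast
  have "\<Union>E' \<subseteq> halfs G'" using assms Union_edges[OF is_graph'] by blast
  thus 1: "\<Union>E' \<inter> {a, b} = {}" unfolding halfs' by blast
  thus 2: "vm \<inter> \<Union>E' = (va \<inter> \<Union>E') \<union> (vb \<inter> \<Union>E')" by blast
  have f: "finite va" "finite vb" using finite_vert[OF g] va vb by auto
  show "card (vm \<inter> \<Union>E') = card (va \<inter> \<Union>E') + card (vb \<inter> \<Union>E')"
    unfolding 2 by (rule card_Un_disjoint) (use f disj in auto)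
  have "va \<inter> \<Union>(insert {a, b} E') = insert a (va \<inter> \<Union>E')" "vb \<inter> \<Union>(insert {a, b} E') = insert b (vb \<inter> \<Union>E')"
    using va vb notin by auto
  thus "card (va \<inter> \<Union>(insert {a, b} E')) = Suc (card (va \<inter> \<Union>E'))"
    "card (vb \<inter> \<Union>(insert {a, b} E')) = Suc (card (vb \<inter> \<Union>E'))" using 1 f by auto
qed

lemma vert_Int_other:
  assumes "v \<in> verts G" "v \<noteq> va" "v \<noteq> vb"
  shows "v \<inter> \<Union>(insert {a, b} E') = v \<inter> \<Union>E'"
  using vm_disj[OF assms] va vb by blast

text \<open>The degree at the merged vertex is the sum of the degrees at the two ends, up to the two
  halves of the edge, so parity survives. Something is left because a single edge that is not a loop
  is no cycle.\<close>

lemma even_set_collapse: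
  assumes "even_set G E" shows "even_set G' (E - {{a, b}})"
proof -
  let ?E = "E - {{a, b}}"
  have E: "E \<subseteq> edges G" "E \<noteq> {}" "\<And>v. v \<in> verts G \<Longrightarrow> even (card (v \<inter> \<Union>E))"
    using assms unfolding even_set_def by auto
  have "E \<noteq> {{a, b}}"
    using even_set_loop[OF g e] not_loop_iff[OF g e] nl assms by auto
  hence ne: "?E \<noteq> {}" using E(2) by auto
  have sub: "?E \<subseteq> edges G'" using E(1) edges' by blast
  have cases: "E = ?E \<or> E = insert {a, b} ?E" by blast
  have "even (card (va \<inter> \<Union>E))" "even (card (vb \<inter> \<Union>E))" using E(3) va vb by auto
  hence vmE: "even (card (vm \<inter> \<Union>?E))"
    using cases vert_Int(4-6)[OF sub] by (metis even_Suc odd_even_add even_add)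
  have "even (card (v \<inter> \<Union>?E))" if v: "v \<in> verts G'" for v
  proof (cases "v = vm")
    case False
    hence vv: "v \<in> verts G" "v \<noteq> va" "v \<noteq> vb" using v verts' by auto
    show ?thesis using E(3)[OF vv(1)] vert_Int_other[OF vv] cases by metis
  qed (use vmE in simp)
  thus ?thesis unfolding even_set_def using ne sub by blast
qed

text \<open>The degrees of \<open>E'\<close> at the two ends have the same parity; if it is odd,
  adding the edge repairs both at once.\<close>

lemma even_set_expand:
  assumes "even_set G' E'" shows "even_set G E' \<or> even_set G (insert {a, b} E')"
proof -
  have E: "E' \<subseteq> edges G'" "E' \<noteq> {}" "\<And>v. v \<in> verts G' \<Longrightarrow> even (card (v \<inter> \<Union>E'))"
    using assms unfolding even_set_def by auto
  have sub: "E' \<subseteq> edges G" "insert {a, b} E' \<subseteq> edges G" using E(1) edges' e by auto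
  have "even (card (vm \<inter> \<Union>E'))" using E(3)[of vm] verts' by blast
  hence *: "even (card (va \<inter> \<Union>E')) \<longleftrightarrow> even (card (vb \<inter> \<Union>E'))" using vert_Int(4)[OF E(1)] by simp
  have oth: "even (card (v \<inter> \<Union>E'))" if "v \<in> verts G" "v \<noteq> va" "v \<noteq> vb" for v
    using that E(3)[of v] verts' by simp
  show ?thesis
  proof (cases "even (card (va \<inter> \<Union>E'))")
    case True
    hence "even (card (v \<inter> \<Union>E'))" if "v \<in> verts G" for v using * oth[OF that] by metis
    thus ?thesis unfolding even_set_def using E sub by blast
  next
    case False
    have "even (card (v \<inter> \<Union>(insert {a, b} E')))" if "v \<in> verts G" for v
      using * oth[OF that] vert_Int_other[OF that, of E'] vert_Int(5,6)[OF E(1)] False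
      by (metis even_Suc)
    thus ?thesis unfolding even_set_def using sub by blast
  qed
qed

end

text \<open>Cycles modulo 2 inside \<open>F\<close> and inside \<open>F - {e}\<close> after the
  collapse produce each other, which is why a forest can be collapsed edge by edge. A loop or a
  foreign edge is excluded on both sides.\<close>

lemma spanning_forest_step:
  assumes R: "rib G" and e: "e \<in> F"
  shows "spanning_forest G F \<longleftrightarrow> e \<in> edges G \<and> \<not> is_loop G e \<and> spanning_forest (collapse_edge G e) (F - {e})"
proof (cases "e \<in> edges G \<and> \<not> is_loop G e")
  case True
  then obtain a b where eab: "e = {a, b}" "edge_collapse G a b" using edge_collapseI[OF R] by metis
  interpret edge_collapse G a b by fact
  show ?thesis unfolding spanning_forest_iff[OF g] spanning_forest_iff[OF is_graph', folded eab(1)]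
  proof (safe)
    fix x E assume *: "F \<subseteq> edges G" "\<nexists>E. E \<subseteq> F \<and> even_set G E" "E \<subseteq> F - {e}" "even_set (collapse_edge G e) E"
    have "even_set G E \<or> even_set G (insert e E)" using even_set_expand[of E] *(4) eab(1) by simp
    moreover have "E \<subseteq> F" "insert e E \<subseteq> F" using *(3) assms(2) by auto
    ultimately show False using *(2) by metis
  next
    fix x E assume *: "F - {e} \<subseteq> edges (collapse_edge G e)"
      "\<nexists>E. E \<subseteq> F - {e} \<and> even_set (collapse_edge G e) E" "E \<subseteq> F" "even_set G E"
    have "even_set (collapse_edge G e) (E - {e})" using even_set_collapse[OF *(4)] eab(1) by simp
    moreover have "E - {e} \<subseteq> F - {e}" using *(3) by auto
    ultimately show False using *(2) by metis
  qed (use True eab edges' in auto)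
next
  case False
  have "\<not> spanning_forest G F"
  proof
    assume "spanning_forest G F"
    hence *: "F \<subseteq> edges G" "\<nexists>E. E \<subseteq> F \<and> even_set G E" using spanning_forest_iff[OF rib_is_graph[OF R]] by auto
    hence "even_set G {e}" using e False even_set_loop[OF rib_is_graph[OF R], of e] by blast
    thus False using * e by blast
  qed
  thus ?thesis using False by blast
qed

section \<open>Collapsing a list of edges\<close>

fun collapsible :: "'h rgraph \<Rightarrow> 'h set list \<Rightarrow> bool" where
  "collapsible G [] \<longleftrightarrow> True"
| "collapsible G (e # es) \<longleftrightarrow> e \<in> edges G \<and> \<not> is_loop G e \<and> collapsible (collapse_edge G e) es"

lemma rib_collapse: "rib G \<Longrightarrow> e \<in> edges G \<Longrightarrow> \<not> is_loop G e \<Longrightarrow> rib (collapse_edge G e)"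
  by (metis edge_collapse.rib' edge_collapseI)

lemma collapse_simps:
  "halfs (collapse_edge G e) = halfs G - e" "edges (collapse_edge G e) = edges G - {e}"
  by (simp_all add: collapse_edge_def)

text \<open>Each edge only has to be a non-loop at the moment of its collapse. That the order of the
  list is immaterial can be read off from the right-hand side.\<close>

lemma collapsible_iff:
  "rib G \<Longrightarrow> collapsible G es \<longleftrightarrow> spanning_forest G (set es) \<and> distinct es"
proof (induction es arbitrary: G)
  case Nil
  thus ?case by (auto simp: spanning_forest_def closed_trail_def)
next
  case (Cons e es)
  show ?case
  proof (cases "e \<in> edges G \<and> \<not> is_loop G e")
    case True
    hence IH: "collapsible (collapse_edge G e) es \<longleftrightarrow> spanning_forest (collapse_edge G e) (set es) \<and> distinct es"
      using Cons rib_collapse by blast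
    have "spanning_forest (collapse_edge G e) (set es) \<Longrightarrow> e \<notin> set es"
      unfolding spanning_forest_def collapse_simps by blast
    moreover have "e \<notin> set es \<Longrightarrow> set (e # es) - {e} = set es" by auto
    ultimately show ?thesis using spanning_forest_step[OF Cons.prems, of e "set (e # es)"] IH True
      by (metis collapsible.simps(2) distinct.simps(2) list.set_intros(1))
  next
    case False
    thus ?thesis using spanning_forest_step[OF Cons.prems, of e "set (e # es)"] by auto
  qed
qed

lemma fat_mor_iff:
  "fat_mor G0 G1 m \<longleftrightarrow> ribbon_graph G0 \<and> ribbon_graph G1 \<and>
     (\<exists>es. collapsible G0 es \<and> rg_iso (foldl collapse_edge G0 es) G1 m)"
  unfolding fat_mor_def using collapsible_iff[of G0] ribbon_graph_iff by metis

lemma foldl_collapse: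
  "rib G \<Longrightarrow> collapsible G es \<Longrightarrow>
     rib (foldl collapse_edge G es) \<and> halfs (foldl collapse_edge G es) = halfs G - \<Union>(set es) \<and>
     edges (foldl collapse_edge G es) = edges G - set es \<and> set es \<subseteq> edges G \<and>
     codim (foldl collapse_edge G es) = codim G + length es \<and>
     (ribbon_graph (foldl collapse_edge G es) \<longleftrightarrow> ribbon_graph G)"
proof (induction es arbitrary: G)
  case (Cons e es)
  then have ee: "e \<in> edges G" "\<not> is_loop G e" "collapsible (collapse_edge G e) es" by auto
  obtain a b where eab: "e = {a, b}" "edge_collapse G a b" using edge_collapseI[OF Cons.prems(1) ee(1,2)] by metis
  then interpret edge_collapse G a b by simp
  note IH = Cons.IH[OF rib', folded eab(1), OF ee(3)]
  have 1: "codim (collapse_edge G e) = Suc (codim G)" "ribbon_graph (collapse_edge G e) \<longleftrightarrow> ribbon_graph G"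
    using codim' ribbon_graph' eab(1) by simp_all
  have 2: "foldl collapse_edge G (e # es) = foldl collapse_edge (collapse_edge G e) es" by simp
  show ?case unfolding 2 using IH ee(1) unfolding 1 collapse_simps by (simp add: Diff_eq Int_assoc Compl_Un) blast
qed simp

section \<open>Isomorphisms and morphisms\<close>

lemma nxt_collapse:
  "nxt (collapse_edge G e) h = (if h \<in> e then h
     else if nxt G h \<in> e then nxt G (other_half G (nxt G h)) else nxt G h)"
  by (simp add: collapse_edge_def)

text \<open>The vertices are the orbits of \<open>nxt\<close> on the half-edges, hence they are
  determined by the remaining data.\<close>

lemma rib_eqI:
  assumes R: "rib G" "rib (G' :: 'h rgraph)" and eq: "halfs G = halfs G'" "edges G = edges G'" "nxt G = nxt G'"
  shows "G = G'"
proof -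
  have V: "verts H = (\<lambda>h. orbit (nxt H) h) ` halfs H" if R: "rib H" for H :: "'h rgraph"
  proof -
    note g = rib_is_graph[OF R]
    have "orbit (nxt H) h = vert_of H h" if "h \<in> halfs H" for h
      using cyclic_vert[OF R vert_of_in[OF g that]] in_vert_of[OF g that] by (metis cyclic_on_alldef)
    moreover have "verts H = vert_of H ` halfs H"
    proof (intro Set.set_eqI iffI)
      fix v assume v: "v \<in> verts H"
      hence "v \<noteq> {}" using card_vert[OF g v] by auto
      then obtain h where "h \<in> v" by blast
      thus "v \<in> vert_of H ` halfs H" using vert_of_eq[OF g v] vert_subset[OF g v] by blast
    qed (use vert_of_in[OF g] in auto)
    ultimately show ?thesis by simp
  qed
  have "verts G = verts G'" using V[OF R(1)] V[OF R(2)] eq by simp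
  thus ?thesis using eq by (intro rgraph.equality) auto
qed

text \<open>Half-edges and edges are removed in either order, and the vertices follow from
  \<open>rib_eqI\<close>. Only the successors need an argument, since one of them may be redirected
  twice.\<close>

lemma collapse_commute:
  assumes R: "rib G" and c: "collapsible G [e1, e2]"
  shows "collapsible G [e2, e1]"
    "collapse_edge (collapse_edge G e1) e2 = collapse_edge (collapse_edge G e2) e1"
proof -
  show c': "collapsible G [e2, e1]"
    using c unfolding collapsible_iff[OF R] by (auto simp: insert_commute)
  note g = rib_is_graph[OF R]
  let ?G1 = "collapse_edge G e1" and ?G2 = "collapse_edge G e2"
  from c have e1: "e1 \<in> edges G" "\<not> is_loop G e1" "e2 \<in> edges ?G1" "\<not> is_loop ?G1 e2" by auto
  from c' have e2: "e2 \<in> edges G" "\<not> is_loop G e2" "e1 \<in> edges ?G2" "\<not> is_loop ?G2 e1" by auto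
  have R12: "rib ?G1" "rib ?G2" using rib_collapse R e1 e2 by blast+
  have R12': "rib (collapse_edge ?G1 e2)" "rib (collapse_edge ?G2 e1)" using rib_collapse R12 e1 e2 by blast+
  have dj: "e1 \<inter> e2 = {}" using e1(3) edge_unique[OF g e1(1) e2(1)] by (auto simp: collapse_simps)
  have oh: "other_half (collapse_edge G e) x = other_half G x" "other_half G x \<in> f" "vert_of G x \<noteq> vert_of G (other_half G x)"
    if th: "e \<in> edges G" "\<not> is_loop G e" "f \<in> edges G" "\<not> is_loop G f" "e \<inter> f = {}" "x \<in> f" for e f x
  proof -
    obtain a b where eab: "e = {a, b}" "edge_collapse G a b" using edge_collapseI[OF R th(1,2)] by metis
    then interpret edge_collapse G a b by simp
    have f: "f = {x, other_half G x}" and x: "x \<in> halfs G"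
      using edge_of_eq[OF g th(3,6)] other_half(5)[OF g, of x] edge_subset[OF g th(3)] th(6) by auto
    show "other_half (collapse_edge G e) x = other_half G x"
      using other_half'[of x] x th(5,6) halfs' unfolding eab(1) by auto
    show "other_half G x \<in> f" using f by blast
    show "vert_of G x \<noteq> vert_of G (other_half G x)" using not_loop_iff[OF g] f th(3,4) by metis
  qed
  note o1 = oh[OF e1(1,2) e2(1,2) dj] and o2 = oh[OF e2(1,2) e1(1,2) dj[unfolded Int_commute[of e1]]]
  \<comment> \<open>After two redirections the successor cannot return to \<open>e\<close>:
    injectivity of \<open>nxt\<close> excludes the half where the first redirection took place, and
    the other half would make \<open>f\<close> a loop.\<close>
  have key: "nxt G (other_half G (nxt G (other_half G (nxt G h)))) \<notin> e"
    if e: "e \<in> edges G" "\<not> is_loop G e" and f: "f \<in> edges G" "\<not> is_loop G f" and "e \<inter> f = {}"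
      and h: "nxt G h \<in> e" "nxt G (other_half G (nxt G h)) \<in> f" "h \<notin> f" for e f h
  proof
    let ?a = "nxt G h"
    let ?b = "other_half G ?a" let ?c = "nxt G ?b" let ?d = "other_half G ?c"
    assume "nxt G ?d \<in> e"
    moreover have "e = {?a, ?b}"
      using edge_of_eq[OF g e(1) h(1)] other_half(5)[OF g, of ?a] edge_subset[OF g e(1)] h(1) by auto
    moreover have "nxt G ?d \<noteq> ?a"
      using nxt_inject[OF R, of ?d h] oh(2)[OF e f \<open>e \<inter> f = {}\<close> h(2)] h(3) by auto
    ultimately have "nxt G ?d = ?b" by blast
    hence "vert_of G ?d = vert_of G ?c" by (metis vert_of_nxt[OF R])
    thus False using oh(3)[OF e f \<open>e \<inter> f = {}\<close> h(2)] by simp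
  qed
  have "nxt (collapse_edge ?G1 e2) h = nxt (collapse_edge ?G2 e1) h" for h
  proof -
    consider "h \<in> e1 \<union> e2" | "h \<notin> e1 \<union> e2" "nxt G h \<in> e1" | "h \<notin> e1 \<union> e2" "nxt G h \<in> e2"
      | "h \<notin> e1 \<union> e2" "nxt G h \<notin> e1 \<union> e2" by blast
    thus ?thesis
    proof cases
      case 1
      thus ?thesis using dj by (auto simp: nxt_collapse)
    next
      case 2
      have "nxt G h \<notin> e2" using 2 dj by blast
      moreover have "other_half G (nxt G h) \<in> e1" using o2(2)[OF 2(2)] .
      moreover have "other_half G (nxt G h) \<notin> e2" using calculation dj by blast
      moreover have "other_half G x \<notin> e1" if "x \<in> e2" for x using o1(2)[OF that] dj by blast
      ultimately show ?thesis using 2 o1 o2 key[OF e1(1,2) e2(1,2) dj 2(2)]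
        by (simp add: nxt_collapse)
    next
      case 3
      have "nxt G h \<notin> e1" using 3 dj by blast
      moreover have "other_half G (nxt G h) \<in> e2" using o1(2)[OF 3(2)] .
      moreover have "other_half G (nxt G h) \<notin> e1" using calculation dj by blast
      moreover have "other_half G x \<notin> e2" if "x \<in> e1" for x using o2(2)[OF that] dj by blast
      ultimately show ?thesis using 3 o1 o2 key[OF e2(1,2) e1(1,2) dj[unfolded Int_commute[of e1]] 3(2)]
        by (simp add: nxt_collapse)
    next
      case 4
      thus ?thesis by (simp add: nxt_collapse)
    qed
  qed
  thus "collapse_edge ?G1 e2 = collapse_edge ?G2 e1"
    by (intro rib_eqI[OF R12'] ext) (auto simp: collapse_simps)
qed

section \<open>Criteria for isomorphisms and what they preserve\<close>

lemma rg_isoI: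
  assumes "rib G" "dom m = halfs G" "bij_betw (the \<circ> m) (halfs G) (halfs G')"
    "(`) (the \<circ> m) ` edges G = edges G'" "(`) (the \<circ> m) ` verts G = verts G'"
    "\<And>h. h \<in> halfs G \<Longrightarrow> the (m (nxt G h)) = nxt G' (the (m h))"
  shows "rg_iso G G' m"
proof -
  have S: "m h = Some (the (m h))" if "h \<in> halfs G" for h
    using that assms(2) by (metis domIff option.collapse)
  have "inj_on m (dom m)" using assms(2,3) unfolding bij_betw_def inj_on_def by auto
  moreover have "ran m = halfs G'"
  proof -
    have "ran m = (the \<circ> m) ` dom m" by (force simp: ran_def dom_def image_def)
    thus ?thesis using assms(2,3) by (simp add: bij_betw_def)
  qed
  moreover have "m (nxt G h) = map_option (nxt G') (m h)" if h: "h \<in> halfs G" for h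
    using S[OF h] S[of "nxt G h"] assms(6)[OF h] nxt_halfs[OF assms(1)] h
    by (metis option.simps(9))
  ultimately show ?thesis unfolding rg_iso_def using assms by blast
qed

context
  fixes G G' :: "'h rgraph" and m
  assumes i: "rg_iso G G' m"
begin

lemma rg_iso_dom: "dom m = halfs G" and rg_iso_ran: "ran m = halfs G'"
  and rg_iso_edges: "(`) (the \<circ> m) ` edges G = edges G'"
  and rg_iso_verts: "(`) (the \<circ> m) ` verts G = verts G'"
  using i unfolding rg_iso_def by auto

lemma rg_iso_Some: "h \<in> halfs G \<Longrightarrow> m h = Some (the (m h))"
  and rg_iso_None: "h \<notin> halfs G \<Longrightarrow> m h = None"
  using rg_iso_dom by (metis domIff option.collapse)+

lemma rg_iso_bij: "bij_betw (the \<circ> m) (halfs G) (halfs G')"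
proof -
  have "inj_on (the \<circ> m) (halfs G)"
    using i rg_iso_dom unfolding rg_iso_def inj_on_def by (metis comp_apply domIff option.expand)
  moreover have "(the \<circ> m) ` halfs G = halfs G'"
  proof -
    have "ran m = (the \<circ> m) ` dom m" by (force simp: ran_def dom_def image_def)
    thus ?thesis using rg_iso_dom rg_iso_ran by simp
  qed
  ultimately show ?thesis by (simp add: bij_betw_def)
qed

lemma rg_iso_inj: "h \<in> halfs G \<Longrightarrow> k \<in> halfs G \<Longrightarrow> the (m h) = the (m k) \<longleftrightarrow> h = k"
  using bij_betw_imp_inj_on[OF rg_iso_bij] unfolding inj_on_def by auto

lemma rg_iso_in: "h \<in> halfs G \<Longrightarrow> the (m h) \<in> halfs G'"
  using bij_betwE[OF rg_iso_bij] by auto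

lemma rg_iso_surj: "k \<in> halfs G' \<Longrightarrow> \<exists>h\<in>halfs G. the (m h) = k"
  using bij_betw_imp_surj_on[OF rg_iso_bij] by force

lemma rg_iso_nxt: "h \<in> halfs G \<Longrightarrow> the (m (nxt G h)) = nxt G' (the (m h))"
  using i rg_iso_Some[of h] unfolding rg_iso_def by (metis option.map_sel option.sel option.simps(9))

lemma rg_iso_edge: "e \<in> edges G \<Longrightarrow> (the \<circ> m) ` e \<in> edges G'"
  and rg_iso_vert: "v \<in> verts G \<Longrightarrow> (the \<circ> m) ` v \<in> verts G'"
  using rg_iso_edges rg_iso_verts by blast+

end

context
  fixes G G' :: "'h rgraph" and m
  assumes R: "rib G" and i: "rg_iso G G' m"
begin

lemma rg_iso_codim: "codim G' = codim G"
proof -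
  note g = rib_is_graph[OF R]
  have inj: "inj_on (the \<circ> m) v" if "v \<in> verts G" for v
    using inj_on_subset[OF bij_betw_imp_inj_on[OF rg_iso_bij[OF i]] vert_subset[OF g that]] .
  have "inj_on ((`) (the \<circ> m)) (verts G)"
    by (rule inj_on_subset[OF inj_on_image_Pow[OF bij_betw_imp_inj_on[OF rg_iso_bij[OF i]]]])
      (use vert_subset[OF g] in auto)
  hence "codim G' = (\<Sum>v\<in>verts G. card ((the \<circ> m) ` v) - 3)"
    unfolding codim_def rg_iso_verts[OF i, symmetric] using sum.reindex[of "(`) (the \<circ> m)" "verts G" "\<lambda>v. card v - 3"] by (metis (no_types, lifting) comp_apply sum.cong)
  also have "\<dots> = codim G" unfolding codim_def using card_image[OF inj] by simp
  finally show ?thesis .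
qed

context
  assumes g': "is_graph G'"
begin

lemma rg_iso_vert_of: "h \<in> halfs G \<Longrightarrow> vert_of G' (the (m h)) = (the \<circ> m) ` vert_of G h"
  using vert_of_eq[OF g' rg_iso_vert[OF i]] vert_of_in[OF rib_is_graph[OF R]] in_vert_of[OF rib_is_graph[OF R]] by auto

lemma rg_iso_other_half: "h \<in> halfs G \<Longrightarrow> other_half G' (the (m h)) = the (m (other_half G h))"
  using rg_iso_edge[OF i other_half(2)[OF rib_is_graph[OF R]], of h] other_half_eq[OF g'] by simp

lemma rg_iso_loop: 
  assumes "e \<in> edges G" shows "is_loop G' ((the \<circ> m) ` e) \<longleftrightarrow> is_loop G e"
proof -
  note g = rib_is_graph[OF R]
  obtain a b where ab: "e = {a, b}" "a \<in> halfs G" "b \<in> halfs G" using edgeE[OF g assms] by metis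
  have "inj_on ((`) (the \<circ> m)) (verts G)"
    by (rule inj_on_subset[OF inj_on_image_Pow[OF bij_betw_imp_inj_on[OF rg_iso_bij[OF i]]]])
      (use vert_subset[OF g] in auto)
  hence "(the \<circ> m) ` vert_of G a = (the \<circ> m) ` vert_of G b \<longleftrightarrow> vert_of G a = vert_of G b"
    using vert_of_in[OF g] ab by (simp only: inj_on_eq_iff)
  moreover have "{the (m a), the (m b)} \<in> edges G'" using rg_iso_edge[OF i assms] ab by simp
  ultimately show ?thesis
    using not_loop_iff[OF g, of a b] not_loop_iff[OF g', of "the (m a)" "the (m b)"]
      rg_iso_vert_of ab assms by auto
qed

end

end

text \<open>A bijection commuting with \<open>nxt\<close> carries orbits to orbits, so the condition
  on the vertices is automatic.\<close>

lemma rg_isoI_rib: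
  assumes R: "rib G" "rib G'" and "dom m = halfs G" and b: "bij_betw (the \<circ> m) (halfs G) (halfs G')"
    and "(`) (the \<circ> m) ` edges G = edges G'"
    and n: "\<And>h. h \<in> halfs G \<Longrightarrow> the (m (nxt G h)) = nxt G' (the (m h))"
  shows "rg_iso G G' m"
proof (rule rg_isoI[OF R(1) assms(3-5)])
  note g = rib_is_graph[OF R(1)] and g' = rib_is_graph[OF R(2)]
  let ?j = "the \<circ> m"
  have V: "?j ` vert_of G h = vert_of G' (?j h)" if h: "h \<in> halfs G" for h
  proof
    have jh: "?j h \<in> halfs G'" using bij_betwE[OF b] h by blast
    show "vert_of G' (?j h) \<subseteq> ?j ` vert_of G h"
    proof (rule vert_of_subset_closed[OF R(2) _ jh])
      fix x assume "x \<in> ?j ` vert_of G h"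
      then obtain k where k: "k \<in> vert_of G h" "x = ?j k" by blast
      hence kh: "k \<in> halfs G" using vert_subset[OF g vert_of_in[OF g h]] by blast
      have "nxt G' x = ?j (nxt G k)" using n[OF kh] k by simp
      thus "nxt G' x \<in> ?j ` vert_of G h" using nxt_vert[OF R(1) vert_of_in[OF g h] k(1)] by blast
    qed (use in_vert_of[OF g h] in blast)
    have "vert_of G h \<subseteq> {k \<in> halfs G. ?j k \<in> vert_of G' (?j h)}"
    proof (rule vert_of_subset_closed[OF R(1) _ h])
      show "h \<in> {k \<in> halfs G. ?j k \<in> vert_of G' (?j h)}" using h in_vert_of[OF g' jh] by simp
      show "nxt G x \<in> {k \<in> halfs G. ?j k \<in> vert_of G' (?j h)}" if "x \<in> {k \<in> halfs G. ?j k \<in> vert_of G' (?j h)}" for x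
        using that n[of x] nxt_vert[OF R(2) vert_of_in[OF g' jh]] nxt_halfs[OF R(1)] by auto
    qed
    thus "?j ` vert_of G h \<subseteq> vert_of G' (?j h)" by blast
  qed
  have ve: "verts H = vert_of H ` halfs H" if g: "is_graph H" for H :: "'x rgraph"
  proof (intro Set.set_eqI iffI)
    fix v assume v: "v \<in> verts H"
    hence "v \<noteq> {}" using card_vert[OF g v] by auto
    then obtain h where "h \<in> v" by blast
    thus "v \<in> vert_of H ` halfs H" using vert_of_eq[OF g v] vert_subset[OF g v] by blast
  qed (use vert_of_in[OF g] in auto)
  have "(`) ?j ` verts G = (\<lambda>h. vert_of G' (?j h)) ` halfs G"
    unfolding ve[OF g] image_image using V by (intro image_cong) auto
  also have "\<dots> = vert_of G' ` ?j ` halfs G" by (simp add: image_image)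
  also have "?j ` halfs G = halfs G'" using b by (simp add: bij_betw_def)
  finally show "(`) ?j ` verts G = verts G'" unfolding ve[OF g'] .
qed (use n in auto)

section \<open>Identities, composites and inverses\<close>

abbreviation idm :: "'h rgraph \<Rightarrow> 'h pmap" where "idm G \<equiv> Some |` halfs G"

lemma rg_iso_id: "rib G \<Longrightarrow> rg_iso G G (idm G)"
proof (rule rg_isoI)
  assume R: "rib G"
  note g = rib_is_graph[OF R]
  have *: "(the \<circ> idm G) ` x = x" if "x \<subseteq> halfs G" for x using that by (auto simp: restrict_map_def image_def)
  show "(`) (the \<circ> idm G) ` edges G = edges G" "(`) (the \<circ> idm G) ` verts G = verts G"
    using * edge_subset[OF g] vert_subset[OF g] by simp_all
  show "bij_betw (the \<circ> idm G) (halfs G) (halfs G)"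
    by (rule bij_betw_cong[THEN iffD1, of _ id]) (auto simp: bij_betw_id)
qed (auto simp: nxt_halfs)

lemma map_comp_idm [simp]: "dom m \<subseteq> halfs G \<Longrightarrow> m \<circ>\<^sub>m idm G = m"
proof (rule ext)
  fix x assume "dom m \<subseteq> halfs G"
  thus "(m \<circ>\<^sub>m idm G) x = m x"
    by (cases "x \<in> halfs G"; cases "m x") (auto simp: map_comp_def restrict_map_def domIff subset_iff)
qed

lemma idm_map_comp [simp]: "ran m \<subseteq> halfs G \<Longrightarrow> idm G \<circ>\<^sub>m m = m"
  by (rule ext) (auto simp: map_comp_def restrict_map_def ran_def split: option.splits)

lemma map_comp_assoc: "(f \<circ>\<^sub>m g) \<circ>\<^sub>m h = f \<circ>\<^sub>m (g \<circ>\<^sub>m h)"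
  by (rule ext) (auto simp: map_comp_def split: option.splits)

text \<open>Morphisms are onto the half-edges of their target, so they can be cancelled on the
  right.\<close>

lemma map_comp_cancel:
  assumes "dom g \<subseteq> ran f" "dom g' \<subseteq> ran f" "g \<circ>\<^sub>m f = g' \<circ>\<^sub>m f" shows "g = g'"
proof
  fix y
  show "g y = g' y"
  proof (cases "y \<in> ran f")
    case True
    then obtain x where "f x = Some y" by (auto simp: ran_def)
    thus ?thesis using fun_cong[OF assms(3), of x] by (simp add: map_comp_def)
  next
    case False thus ?thesis using assms(1,2) by (metis domIff in_mono)
  qed
qed

lemma rg_iso_comp:
  assumes R: "rib A" and i: "rg_iso A B m" and k: "rg_iso B C n" and RB: "rib B"
  shows "rg_iso A C (n \<circ>\<^sub>m m)"
proof -
  have S: "(n \<circ>\<^sub>m m) h = Some (the (n (the (m h))))" if "h \<in> halfs A" for h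
  proof -
    note h = that
    obtain y where y: "m h = Some y" using rg_iso_Some[OF i h] by blast
    moreover obtain z where "n y = Some z" using rg_iso_Some[OF k rg_iso_in[OF i h]] y by auto
    ultimately show ?thesis by (simp add: map_comp_def)
  qed
  have T: "(the \<circ> (n \<circ>\<^sub>m m)) ` x = (the \<circ> n) ` (the \<circ> m) ` x" if "x \<subseteq> halfs A" for x
    using that S by (auto simp: image_image intro!: image_cong)
  note g = rib_is_graph[OF R]
  show ?thesis
  proof (rule rg_isoI[OF R])
    show "dom (n \<circ>\<^sub>m m) = halfs A" 
    proof (intro Set.set_eqI iffI)
      fix h assume "h \<in> dom (n \<circ>\<^sub>m m)"
      thus "h \<in> halfs A" using rg_iso_None[OF i, of h] by (cases "h \<in> halfs A") (auto simp: map_comp_def)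
    qed (use S in auto)
    have "bij_betw ((the \<circ> n) \<circ> (the \<circ> m)) (halfs A) (halfs C)"
      using bij_betw_trans rg_iso_bij i k by blast
    thus "bij_betw (the \<circ> (n \<circ>\<^sub>m m)) (halfs A) (halfs C)"
      by (rule bij_betw_cong[THEN iffD1, rotated]) (use S in auto)
    have "(`) (the \<circ> (n \<circ>\<^sub>m m)) ` edges A = (`) (the \<circ> n) ` (`) (the \<circ> m) ` edges A"
      unfolding image_image by (rule image_cong) (use T edge_subset[OF g] in \<open>auto simp: image_image\<close>)
    thus "(`) (the \<circ> (n \<circ>\<^sub>m m)) ` edges A = edges C" using rg_iso_edges[OF i] rg_iso_edges[OF k] by simp
    have "(`) (the \<circ> (n \<circ>\<^sub>m m)) ` verts A = (`) (the \<circ> n) ` (`) (the \<circ> m) ` verts A"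
      unfolding image_image by (rule image_cong) (use T vert_subset[OF g] in \<open>auto simp: image_image\<close>)
    thus "(`) (the \<circ> (n \<circ>\<^sub>m m)) ` verts A = verts C" using rg_iso_verts[OF i] rg_iso_verts[OF k] by simp
    show "the ((n \<circ>\<^sub>m m) (nxt A h)) = nxt C (the ((n \<circ>\<^sub>m m) h))" if h: "h \<in> halfs A" for h
      using S[OF h] S[of "nxt A h"] h nxt_halfs[OF R] rg_iso_nxt[OF i h] rg_iso_nxt[OF k rg_iso_in[OF i h]] by simp
  qed
qed

lemma rg_iso_inverse:
  assumes R: "rib A" "rib B" and i: "rg_iso A B m"
  obtains n where "rg_iso B A n" "n \<circ>\<^sub>m m = idm A" "m \<circ>\<^sub>m n = idm B"
proof -
  let ?j = "the \<circ> m"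
  note b = rg_iso_bij[OF i]
  define k where "k = inv_into (halfs A) ?j"
  define n where "n = (\<lambda>h. if h \<in> halfs B then Some (k h) else None)"
  note g = rib_is_graph[OF R(1)]
  have kj: "k (the (m h)) = h" if "h \<in> halfs A" for h unfolding k_def using that b bij_betw_inv_into_left by fastforce
  have jk: "the (m (k h)) = h" if "h \<in> halfs B" for h unfolding k_def using that b bij_betw_inv_into_right by fastforce
  have kin: "k h \<in> halfs A" if "h \<in> halfs B" for h using that jk kj rg_iso_surj[OF i] by metis
  have im: "(the \<circ> n) ` ?j ` x = x" if "x \<subseteq> halfs A" for x
  proof -
    have "(the \<circ> n) ` ?j ` x = (\<lambda>h. h) ` x"
      unfolding image_image by (rule image_cong) (use that kj rg_iso_in[OF i] in \<open>auto simp: n_def\<close>)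
    thus ?thesis by simp
  qed
  have "rg_iso B A n"
  proof (rule rg_isoI[OF R(2)])
    show "dom n = halfs B" by (auto simp: n_def split: if_splits)
    have "bij_betw k (halfs B) (halfs A)" unfolding k_def using b bij_betw_inv_into by blast
    thus "bij_betw (the \<circ> n) (halfs B) (halfs A)"
      by (rule bij_betw_cong[THEN iffD1, rotated]) (auto simp: n_def)
    have "(`) (the \<circ> n) ` (`) ?j ` edges A = (\<lambda>x. x) ` edges A"
      unfolding image_image[of _ _ "edges A"] by (rule image_cong) (use im edge_subset[OF g] in auto)
    thus "(`) (the \<circ> n) ` edges B = edges A" using rg_iso_edges[OF i] by simp
    have "(`) (the \<circ> n) ` (`) ?j ` verts A = (\<lambda>x. x) ` verts A"
      unfolding image_image[of _ _ "verts A"] by (rule image_cong) (use im vert_subset[OF g] in auto)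
    thus "(`) (the \<circ> n) ` verts B = verts A" using rg_iso_verts[OF i] by simp
    show "the (n (nxt B h)) = nxt A (the (n h))" if h: "h \<in> halfs B" for h
    proof -
      have "nxt B h = the (m (nxt A (k h)))" using rg_iso_nxt[OF i kin[OF h]] jk[OF h] by simp
      moreover have "nxt A (k h) \<in> halfs A" "nxt B h \<in> halfs B"
        using kin[OF h] h nxt_halfs[OF R(1)] nxt_halfs[OF R(2)] by auto
      ultimately show ?thesis using kj[of "nxt A (k h)"] h by (simp add: n_def)
    qed
  qed
  moreover have "n \<circ>\<^sub>m m = idm A"
  proof
    fix h show "(n \<circ>\<^sub>m m) h = idm A h"
    proof (cases "h \<in> halfs A")
      case True
      then obtain y where "m h = Some y" using rg_iso_Some[OF i True] by blast
      thus ?thesis using kj[OF True] rg_iso_in[OF i True] True by (simp add: map_comp_def n_def)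
    qed (use rg_iso_None[OF i] in \<open>simp add: map_comp_def\<close>)
  qed
  moreover have "m \<circ>\<^sub>m n = idm B"
  proof
    fix h show "(m \<circ>\<^sub>m n) h = idm B h"
    proof (cases "h \<in> halfs B")
      case True
      then obtain y where "m (k h) = Some y" using rg_iso_Some[OF i kin] by blast
      thus ?thesis using jk[OF True] True by (simp add: map_comp_def n_def)
    qed (simp add: map_comp_def n_def)
  qed
  ultimately show thesis using that by blast
qed

text \<open>An isomorphism commutes with \<open>nxt\<close> and \<open>other_half\<close>, and the
  redirected successors are made of these.\<close>

lemma rg_iso_collapse:
  assumes R: "rib A" "rib B" and i: "rg_iso A B m" and e: "e \<in> edges A" "\<not> is_loop A e"
  shows "(the \<circ> m) ` e \<in> edges B" "\<not> is_loop B ((the \<circ> m) ` e)"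
    "rg_iso (collapse_edge A e) (collapse_edge B ((the \<circ> m) ` e)) (m |` (halfs A - e))"
proof -
  let ?j = "the \<circ> m"
  note g = rib_is_graph[OF R(1)] and g' = rib_is_graph[OF R(2)]
  show E: "?j ` e \<in> edges B" using rg_iso_edge[OF i e(1)] .
  show L: "\<not> is_loop B (?j ` e)" using rg_iso_loop[OF R(1) i g'] e by simp
  have eh: "e \<subseteq> halfs A" using edge_subset[OF g e(1)] .
  have inj: "inj_on ?j (halfs A)" using rg_iso_bij[OF i] bij_betw_imp_inj_on by blast
  have mem: "the (m h) \<in> ?j ` e \<longleftrightarrow> h \<in> e" if "h \<in> halfs A" for h
    using that rg_iso_inj[OF i] eh by auto
  show "rg_iso (collapse_edge A e) (collapse_edge B (?j ` e)) (m |` (halfs A - e))"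
  proof (rule rg_isoI_rib[OF rib_collapse[OF R(1) e] rib_collapse[OF R(2) E L]])
    show "dom (m |` (halfs A - e)) = halfs (collapse_edge A e)"
      using rg_iso_dom[OF i] by (auto simp: collapse_simps)
    have "?j ` (halfs A - e) = halfs B - ?j ` e"
      using inj_on_image_set_diff[OF inj, of "halfs A" e] eh rg_iso_bij[OF i] by (auto simp: bij_betw_def)
    hence "bij_betw ?j (halfs A - e) (halfs B - ?j ` e)"
      using inj_on_subset[OF inj, of "halfs A - e"] by (auto simp: bij_betw_def)
    thus "bij_betw (the \<circ> m |` (halfs A - e)) (halfs (collapse_edge A e)) (halfs (collapse_edge B (?j ` e)))"
      unfolding collapse_simps by (rule bij_betw_cong[THEN iffD1, rotated]) auto
    have sub: "x \<subseteq> halfs A - e" if "x \<in> edges A - {e}" for x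
      using that edge_subset[OF g] edge_unique[OF g _ e(1)] by blast
    have "(`) (the \<circ> m |` (halfs A - e)) ` (edges A - {e}) = (`) ?j ` (edges A - {e})"
    proof (rule image_cong)
      fix x assume "x \<in> edges A - {e}"
      from sub[OF this] show "(the \<circ> m |` (halfs A - e)) ` x = ?j ` x" by (intro image_cong) auto
    qed simp
    also have "\<dots> = (`) ?j ` edges A - {?j ` e}"
    proof -
      have "inj_on ((`) ?j) (edges A)"
        by (rule inj_on_subset[OF inj_on_image_Pow[OF inj]]) (use edge_subset[OF g] in auto)
      thus ?thesis using inj_on_image_set_diff[of "(`) ?j" "edges A" "edges A" "{e}"] e by auto
    qed
    finally show "(`) (the \<circ> m |` (halfs A - e)) ` edges (collapse_edge A e) = edges (collapse_edge B (?j ` e))"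
      unfolding collapse_simps rg_iso_edges[OF i] .
    show "the ((m |` (halfs A - e)) (nxt (collapse_edge A e) h)) =
        nxt (collapse_edge B (?j ` e)) (the ((m |` (halfs A - e)) h))"
      if h: "h \<in> halfs (collapse_edge A e)" for h
    proof -
      have hA: "h \<in> halfs A" "h \<notin> e" using h by (auto simp: collapse_simps)
      have hn: "nxt (collapse_edge A e) h \<in> halfs A - e"
        using nxt_halfs[OF rib_collapse[OF R(1) e], of h] h unfolding collapse_simps by blast
      have nA: "nxt A h \<in> halfs A" using hA nxt_halfs[OF R(1)] by simp
      have oA: "other_half A (nxt A h) \<in> halfs A" using other_half(3)[OF g nA] .
      show ?thesis using hn hA mem[OF hA(1)] mem[OF nA] rg_iso_nxt[OF i hA(1)] rg_iso_nxt[OF i oA]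
          rg_iso_other_half[OF R(1) i g' nA]
        by (auto simp: nxt_collapse)
    qed
  qed
qed

text \<open>Edges are pulled back one at a time along the restricted isomorphisms. In this way the
  forest of a second morphism becomes one in the graph left over by the first.\<close>

lemma collapsible_pullback:
  assumes "rib A" "rib B" "rg_iso A B m" "collapsible B es" "rg_iso (foldl collapse_edge B es) C n"
  shows "\<exists>es'. length es' = length es \<and> collapsible A es' \<and> rg_iso (foldl collapse_edge A es') C (n \<circ>\<^sub>m m)"
  using assms
proof (induction es arbitrary: A B m)
  case Nil
  thus ?case using rg_iso_comp[of A B m C n] by auto
next
  case (Cons e es)
  note g = rib_is_graph[OF Cons.prems(1)]
  have e: "e \<in> edges B" "\<not> is_loop B e" "collapsible (collapse_edge B e) es" using Cons.prems(4) by auto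
  have "e \<in> (`) (the \<circ> m) ` edges A" using e(1) rg_iso_edges[OF Cons.prems(3)] by metis
  then obtain e' where e': "e' \<in> edges A" "(the \<circ> m) ` e' = e" by (auto simp only: image_iff)
  have nl: "\<not> is_loop A e'"
    using rg_iso_loop[OF Cons.prems(1,3) rib_is_graph[OF Cons.prems(2)] e'(1)] e' e by simp
  note RA = rib_collapse[OF Cons.prems(1) e'(1) nl] and RB = rib_collapse[OF Cons.prems(2) e(1,2)]
  have i: "rg_iso (collapse_edge A e') (collapse_edge B e) (m |` (halfs A - e'))"
    using rg_iso_collapse(3)[OF Cons.prems(1,2,3) e'(1) nl] e' by simp
  obtain es' where es': "length es' = length es" "collapsible (collapse_edge A e') es'"
    "rg_iso (foldl collapse_edge (collapse_edge A e') es') C (n \<circ>\<^sub>m (m |` (halfs A - e')))"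
    using Cons.IH[OF RA RB i e(3)] Cons.prems(5) by auto
  have "dom n \<subseteq> halfs B - e"
    using rg_iso_dom[OF Cons.prems(5)] foldl_collapse[OF RB e(3)] by (auto simp: collapse_simps)
  \<comment> \<open>Restricting \<open>m\<close> changes nothing in the composite, because
    \<open>n\<close> is undefined on the collapsed edge.\<close>
  hence "n \<circ>\<^sub>m (m |` (halfs A - e')) = n \<circ>\<^sub>m m"
  proof (intro ext)
    fix h
    assume *: "dom n \<subseteq> halfs B - e"
    show "(n \<circ>\<^sub>m (m |` (halfs A - e'))) h = (n \<circ>\<^sub>m m) h"
    proof (cases "h \<in> e'")
      case True
      hence "m h = Some (the (m h))" "the (m h) \<in> e"
        using rg_iso_Some[OF Cons.prems(3)] edge_subset[OF g e'(1)] e'(2) by auto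
      hence "(n \<circ>\<^sub>m m) h = None" using * by (metis DiffD2 domIff in_mono map_comp_simps(2))
      thus ?thesis using True by (simp add: map_comp_def)
    next
      case False
      thus ?thesis using rg_iso_None[OF Cons.prems(3), of h] by (cases "h \<in> halfs A") (auto simp: map_comp_def)
    qed
  qed
  thus ?case using es' e' nl by (intro exI[of _ "e' # es'"]) auto
qed

lemma collapsible_append:
  "collapsible G (xs @ ys) \<longleftrightarrow> collapsible G xs \<and> collapsible (foldl collapse_edge G xs) ys"
  by (induction xs arbitrary: G) auto

section \<open>Morphisms: composition and the collapsed edges\<close>

lemma fat_mor_ribbon: assumes "fat_mor A B m" shows "ribbon_graph A" "ribbon_graph B" "rib A" "rib B"
  using assms unfolding fat_mor_def ribbon_graph_iff by auto

text \<open>The forest of the composite is the first forest followed by the pullback of the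
  second.\<close>

lemma fat_mor_comp:
  assumes "fat_mor A B m" "fat_mor B C n" shows "fat_mor A C (n \<circ>\<^sub>m m)"
proof -
  note R = fat_mor_ribbon[OF assms(1)] fat_mor_ribbon[OF assms(2)]
  obtain es es' where es: "collapsible A es" "rg_iso (foldl collapse_edge A es) B m"
    and es': "collapsible B es'" "rg_iso (foldl collapse_edge B es') C n"
    using assms unfolding fat_mor_iff by blast
  have "rib (foldl collapse_edge A es)" using foldl_collapse[OF R(3) es(1)] by blast
  from collapsible_pullback[OF this R(4) es(2) es'] obtain es'' where
    "collapsible (foldl collapse_edge A es) es''"
    "rg_iso (foldl collapse_edge (foldl collapse_edge A es) es'') C (n \<circ>\<^sub>m m)" by blast
  hence "collapsible A (es @ es'') \<and> rg_iso (foldl collapse_edge A (es @ es'')) C (n \<circ>\<^sub>m m)"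
    using es(1) by (simp add: collapsible_append)
  thus ?thesis unfolding fat_mor_iff using R by blast
qed

lemma rg_iso_fat_mor: "ribbon_graph A \<Longrightarrow> ribbon_graph B \<Longrightarrow> rg_iso A B m \<Longrightarrow> fat_mor A B m"
  unfolding fat_mor_iff by (metis collapsible.simps(1) foldl_Nil)

text \<open>The partial map alone remembers the forest: a collapsed edge misses the domain, and an
  edge that misses the domain shares a half with a collapsed one.\<close>

lemma fat_mor_collapsed:
  assumes R: "rib A" and es: "collapsible A es" "rg_iso (foldl collapse_edge A es) B m"
  shows "collapsed A m = set es" "codim B = codim A + length es" "dom m = halfs A - \<Union>(set es)" "distinct es"
proof -
  note g = rib_is_graph[OF R] and F = foldl_collapse[OF R es(1)]
  show d: "dom m = halfs A - \<Union>(set es)" using rg_iso_dom[OF es(2)] F by simp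
  show "codim B = codim A + length es" using rg_iso_codim[OF _ es(2)] F by simp
  show "distinct es" using collapsible_iff[OF R] es(1) by blast
  show "collapsed A m = set es"
  proof (intro Set.set_eqI iffI)
    fix e assume "e \<in> collapsed A m"
    hence e: "e \<in> edges A" "e \<inter> dom m = {}" unfolding collapsed_def by auto
    obtain h where h: "h \<in> e" "h \<in> halfs A" using edgeE[OF g e(1)] by blast
    then obtain e' where e': "e' \<in> set es" "h \<in> e'" using e d by blast
    hence "e' = e" using edge_unique[OF g _ e(1) e'(2) h(1)] F by blast
    thus "e \<in> set es" using e' by simp
  next
    fix e assume e: "e \<in> set es"
    thus "e \<in> collapsed A m" unfolding collapsed_def using d F by blast
  qed
qed

lemma fat_mor_domran:
  assumes "fat_mor A B m" shows "dom m \<subseteq> halfs A" "ran m = halfs B" "codim A \<le> codim B"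
    "card (collapsed A m) = codim B - codim A"
proof -
  note R = fat_mor_ribbon[OF assms]
  obtain es where es: "collapsible A es" "rg_iso (foldl collapse_edge A es) B m"
    using assms unfolding fat_mor_iff by blast
  show "dom m \<subseteq> halfs A" "ran m = halfs B" "codim A \<le> codim B" "card (collapsed A m) = codim B - codim A"
    using fat_mor_collapsed[OF R(3) es] rg_iso_ran[OF es(2)] by (auto simp: distinct_card)
qed

lemma fat_mor_iso:
  assumes "fat_mor A B m" "codim A = codim B" shows "rg_iso A B m"
proof -
  note R = fat_mor_ribbon[OF assms(1)]
  obtain es where es: "collapsible A es" "rg_iso (foldl collapse_edge A es) B m"
    using assms unfolding fat_mor_iff by blast
  hence "es = []" using fat_mor_collapsed(2)[OF R(3) es] assms(2) by simp
  thus ?thesis using es by simp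
qed

section \<open>Morphisms collapsing one or two edges\<close>

definition one_edge :: "'h rgraph \<Rightarrow> 'h set \<Rightarrow> 'h rgraph \<Rightarrow> 'h pmap \<Rightarrow> bool" where
  "one_edge A e B m \<longleftrightarrow> ribbon_graph A \<and> ribbon_graph B \<and> e \<in> edges A \<and> \<not> is_loop A e \<and>
     rg_iso (collapse_edge A e) B m"

lemma one_edgeD:
  assumes "one_edge A e B m"
  shows "rib A" "rib B" "ribbon_graph A" "ribbon_graph B" "e \<in> edges A" "\<not> is_loop A e"
    "rg_iso (collapse_edge A e) B m"
    "fat_mor A B m" "collapsed A m = {e}" "codim B = Suc (codim A)" "rib (collapse_edge A e)"
    "dom m = halfs A - e"
proof -
  show *: "rib A" "rib B" "ribbon_graph A" "ribbon_graph B" "e \<in> edges A" "\<not> is_loop A e"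
    "rg_iso (collapse_edge A e) B m"
    using assms unfolding one_edge_def ribbon_graph_iff by auto
  show "rib (collapse_edge A e)" using rib_collapse * by blast
  have c: "collapsible A [e]" "rg_iso (foldl collapse_edge A [e]) B m" using * by auto
  show "fat_mor A B m" unfolding fat_mor_iff using c * by blast
  show "collapsed A m = {e}" "codim B = Suc (codim A)" "dom m = halfs A - e"
    using fat_mor_collapsed[OF *(1) c] by auto
qed

lemma fat_mor_one_edge:
  assumes "fat_mor A B m" "codim B = Suc (codim A)" obtains e where "one_edge A e B m"
proof -
  note R = fat_mor_ribbon[OF assms(1)]
  obtain es where es: "collapsible A es" "rg_iso (foldl collapse_edge A es) B m"
    using assms unfolding fat_mor_iff by blast
  have "length es = 1" using fat_mor_collapsed(2)[OF R(3) es] assms(2) by simp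
  then obtain e where "es = [e]" by (auto simp: length_Suc_conv)
  thus thesis using that es R unfolding one_edge_def by auto
qed

lemma fat_mor_two_edges:
  assumes "fat_mor A B m" "codim B = Suc (Suc (codim A))"
  obtains e1 e2 where "collapsible A [e1, e2]" "rg_iso (collapse_edge (collapse_edge A e1) e2) B m"
    "e1 \<noteq> e2" "collapsed A m = {e1, e2}"
proof -
  note R = fat_mor_ribbon[OF assms(1)]
  obtain es where es: "collapsible A es" "rg_iso (foldl collapse_edge A es) B m"
    using assms unfolding fat_mor_iff by blast
  note c = fat_mor_collapsed[OF R(3) es]
  have "length es = Suc (Suc 0)" using c(2) assms(2) by simp
  then obtain e1 e2 where "es = [e1, e2]" by (auto simp: length_Suc_conv)
  thus thesis using that[of e1 e2] es c by auto
qed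

section \<open>Orientations\<close>

definition basis :: "'h rgraph \<Rightarrow> ('h set + 'h) set" where
  "basis G = Inl ` verts G \<union> Inr ` halfs G"

lemma orderings_eq: "orderings G = orders (basis G)"
  unfolding orderings_def orders_def basis_def by simp

lemma orientations_eq: "orientations G = or_class ` orders (basis G)"
  unfolding orientations_def orderings_eq ..

lemma orientations_nonempty: "rib G \<Longrightarrow> \<exists>\<omega>. \<omega> \<in> orientations G"
proof -
  assume R: "rib G"
  have "finite (basis G)" unfolding basis_def
    using finite_verts[OF rib_is_graph[OF R]] finite_halfs[OF rib_is_graph[OF R]] by simp
  then obtain xs where "set xs = basis G" "distinct xs" using finite_distinct_list by blast
  thus ?thesis unfolding orientations_eq orders_def by blast
qed

lemma card_basis:
  assumes "rib G" "halfs G \<noteq> {}" shows "card (basis G) \<ge> 2"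
proof -
  note g = rib_is_graph[OF assms(1)]
  obtain h where h: "h \<in> halfs G" using assms(2) by blast
  have "card (vert_of G h) \<ge> 3" "vert_of G h \<subseteq> halfs G"
    using card_vert[OF g] vert_subset[OF g] vert_of_in[OF g h] by auto
  hence "card (halfs G) \<ge> 3" using card_mono[OF finite_halfs[OF g]] by (meson le_trans)
  moreover have "card (Inr ` halfs G :: ('a set + 'a) set) \<le> card (basis G)"
    unfolding basis_def using finite_verts[OF g] finite_halfs[OF g] by (intro card_mono) auto
  moreover have "card (Inr ` halfs G :: ('a set + 'a) set) = card (halfs G)" by (rule card_image) simp
  ultimately show ?thesis by simp
qed

lemma ribbon_card_basis: "ribbon_graph G \<Longrightarrow> card (basis G) \<ge> 2"
  using card_basis connected_graph_iff unfolding ribbon_graph_iff by blast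

lemma collapse_card_basis: "edge_collapse G a b \<Longrightarrow> card (basis (collapse_edge G {a, b})) \<ge> 2"
proof -
  assume "edge_collapse G a b"
  then interpret edge_collapse G a b .
  have "vm \<in> verts G'" using verts' by blast
  hence "halfs G' \<noteq> {}" using vm_ne vert_subset[OF is_graph'] by blast
  thus ?thesis using card_basis[OF rib'] by blast
qed

lemma orient_rev:
  assumes "\<omega> \<in> orientations G" "card (basis G) \<ge> 2"
  shows "rev_or G \<omega> \<in> orientations G" "rev_or G (rev_or G \<omega>) = \<omega>" "rev_or G \<omega> \<noteq> \<omega>"
  using orient_reverse[of \<omega> "basis G"] orient_subset[of \<omega> "basis G"] orient_ne_reverse[of \<omega> "basis G"] assms
  unfolding rev_or_def orientations_eq orderings_eq by auto

lemma orient_or_rev: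
  assumes "\<omega> \<in> orientations G" "\<omega>' \<in> orientations G" "card (basis G) \<ge> 2"
  shows "\<omega>' = \<omega> \<or> \<omega>' = rev_or G \<omega>"
  using orient_cases[of \<omega> "basis G" \<omega>'] assms unfolding rev_or_def orientations_eq orderings_eq by auto

text \<open>There are only two orientations and they are complementary, so a single ordering tells
  them apart. Equalities of orientations are proved in this way from here on.\<close>

lemma orient_eq_iff:
  assumes "\<omega> \<in> orientations G" "\<omega>' \<in> orientations G" "card (basis G) \<ge> 2" "xs \<in> orderings G"
  shows "\<omega>' = \<omega> \<longleftrightarrow> (xs \<in> \<omega>' \<longleftrightarrow> xs \<in> \<omega>)" "\<omega>' = rev_or G \<omega> \<longleftrightarrow> (xs \<in> \<omega>' \<longleftrightarrow> xs \<notin> \<omega>)"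
  using orient_or_rev[OF assms(1-3)] orient_rev(3)[OF assms(1,3)] assms(4) unfolding rev_or_def by auto

lemma orient_block_swap:
  assumes "\<omega> \<in> orientations G" "A @ u @ v @ B \<in> orderings G"
  shows "A @ v @ u @ B \<in> \<omega> \<longleftrightarrow> (A @ u @ v @ B \<in> \<omega> \<longleftrightarrow> even (length u * length v))"
  using or_class_adj_swaps_iff[OF assms(1)[unfolded orientations_eq] assms(2)[unfolded orderings_eq] adj_swaps_block'] .

section \<open>Transport of orientations along isomorphisms\<close>

abbreviation tj :: "'h pmap \<Rightarrow> 'h set + 'h \<Rightarrow> 'h set + 'h" where
  "tj m \<equiv> map_sum ((`) (the \<circ> m)) (the \<circ> m)"

lemma transport_or_class: "transport m (or_class xs) = or_class (map (tj m) xs)"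
  unfolding transport_def by (rule or_class_map)

context
  fixes A B :: "'h rgraph" and m
  assumes R: "rib A" and i: "rg_iso A B m"
begin

lemma tj_bij: "bij_betw (tj m) (basis A) (basis B)"
proof -
  have inj: "inj_on (the \<circ> m) (halfs A)" using rg_iso_bij[OF i] bij_betw_imp_inj_on by blast
  have injV: "inj_on ((`) (the \<circ> m)) (verts A)"
    by (rule inj_on_subset[OF inj_on_image_Pow[OF inj]]) (use vert_subset[OF rib_is_graph[OF R]] in auto)
  have "inj_on (tj m) (basis A)"
  proof (rule inj_onI)
    fix x y assume xy: "x \<in> basis A" "y \<in> basis A" "tj m x = tj m y"
    show "x = y"
    proof (cases x)
      case (Inl u)
      then obtain v where v: "y = Inl v" "(the \<circ> m) ` u = (the \<circ> m) ` v"
        using xy(3) by (cases y) (simp_all only: map_sum.simps sum.inject sum.distinct)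
      have "u \<in> verts A" "v \<in> verts A" using xy Inl v unfolding basis_def by auto
      thus ?thesis using inj_onD[OF injV v(2)] Inl v by simp
    next
      case (Inr u)
      then obtain v where v: "y = Inr v" "(the \<circ> m) u = (the \<circ> m) v"
        using xy(3) by (cases y) (simp_all only: map_sum.simps sum.inject sum.distinct)
      have "u \<in> halfs A" "v \<in> halfs A" using xy Inr v unfolding basis_def by auto
      thus ?thesis using inj_onD[OF inj v(2)] Inr v by simp
    qed
  qed
  moreover have "tj m ` basis A = Inl ` ((`) (the \<circ> m) ` verts A) \<union> Inr ` ((the \<circ> m) ` halfs A)"
    unfolding basis_def image_Un image_image by simp
  moreover have "(the \<circ> m) ` halfs A = halfs B" using rg_iso_bij[OF i] by (simp only: bij_betw_def)
  ultimately show ?thesis unfolding bij_betw_def rg_iso_verts[OF i] basis_def by simp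
qed

lemma tj_ordering: "xs \<in> orderings A \<Longrightarrow> map (tj m) xs \<in> orderings B"
  using tj_bij unfolding orderings_eq orders_def bij_betw_def by (auto simp: distinct_map)

lemma transport_orientation: "\<omega> \<in> orientations A \<Longrightarrow> transport m \<omega> \<in> orientations B"
  unfolding orientations_def using transport_or_class tj_ordering by blast

lemma transport_mem:
  assumes "\<omega> \<in> orientations A" "xs \<in> orderings A"
  shows "map (tj m) xs \<in> transport m \<omega> \<longleftrightarrow> xs \<in> \<omega>"
proof
  assume "map (tj m) xs \<in> transport m \<omega>"
  then obtain ys where ys: "ys \<in> \<omega>" "map (tj m) xs = map (tj m) ys" unfolding transport_def by blast
  hence "ys \<in> orderings A" using assms orient_subset unfolding orderings_eq orientations_eq by blast
  hence "set xs = basis A" "set ys = basis A" using assms unfolding orderings_eq orders_def by auto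
  hence "xs = ys" using ys(2) map_inj_on[of "tj m" xs ys] tj_bij by (simp add: bij_betw_def)
  thus "xs \<in> \<omega>" using ys by simp
qed (simp add: transport_def)

lemma transport_rev:
  assumes "\<omega> \<in> orientations A" "card (basis A) \<ge> 2"
  shows "transport m (rev_or A \<omega>) = rev_or B (transport m \<omega>)"
proof -
  obtain xs where xs: "xs \<in> \<omega>" using assms orient_nonempty unfolding orientations_eq by blast
  hence xs': "xs \<in> orderings A" using assms orient_subset unfolding orderings_eq orientations_eq by blast
  have c: "card (basis B) \<ge> 2" using assms(2) bij_betw_same_card[OF tj_bij] by simp
  show ?thesis
    using orient_eq_iff(2)[OF transport_orientation[OF assms(1)] transport_orientation[OF orient_rev(1)[OF assms]] c
        tj_ordering[OF xs']] transport_mem[OF assms(1) xs'] transport_mem[OF orient_rev(1)[OF assms] xs'] xs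
    by (auto simp: rev_or_def)
qed

end

lemma transport_cong:
  assumes "\<And>h. h \<in> halfs A \<Longrightarrow> m h = n h" "is_graph A" "\<omega> \<subseteq> orderings A"
  shows "transport m \<omega> = transport n \<omega>"
  unfolding transport_def
proof (rule image_cong)
  fix xs assume "xs \<in> \<omega>"
  hence "set xs = basis A" using assms(3) unfolding orderings_eq orders_def by blast
  moreover have "tj m x = tj n x" if "x \<in> basis A" for x
  proof (cases x)
    case (Inl v)
    hence "v \<in> verts A" using that unfolding basis_def by auto
    from vert_subset[OF assms(2) this] have "(the \<circ> m) ` v = (the \<circ> n) ` v"
      by (intro image_cong) (use assms(1) in auto)
    thus ?thesis using Inl by simp
  qed (use that assms in \<open>auto simp: basis_def\<close>)
  ultimately show "map (tj m) xs = map (tj n) xs" by simp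
qed simp

lemma orientation_subset: "\<omega> \<in> orientations A \<Longrightarrow> \<omega> \<subseteq> orderings A"
  using orient_subset unfolding orderings_eq orientations_eq by blast

lemma transport_comp:
  assumes R: "rib A" and i: "rg_iso A B m" "rg_iso B C n" and w: "\<omega> \<in> orientations A"
  shows "transport (n \<circ>\<^sub>m m) \<omega> = transport n (transport m \<omega>)"
proof -
  note g = rib_is_graph[OF R]
  have S: "the ((n \<circ>\<^sub>m m) h) = the (n (the (m h)))" if h: "h \<in> halfs A" for h
  proof -
    obtain y where "m h = Some y" using rg_iso_Some[OF i(1) h] by blast
    thus ?thesis by (simp add: map_comp_def)
  qed
  show ?thesis unfolding transport_def image_image
  proof (rule image_cong)
    fix xs assume "xs \<in> \<omega>"
    hence xs: "set xs = basis A" using orientation_subset[OF w] unfolding orderings_eq orders_def by blast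
    have "tj (n \<circ>\<^sub>m m) x = tj n (tj m x)" if "x \<in> basis A" for x
    proof (cases x)
      case (Inl v)
      hence "v \<subseteq> halfs A" using that vert_subset[OF g] unfolding basis_def by auto
      hence "(the \<circ> (n \<circ>\<^sub>m m)) ` v = (the \<circ> n) ` (the \<circ> m) ` v"
        unfolding image_image by (intro image_cong) (use S in auto)
      thus ?thesis using Inl by simp
    qed (use that S in \<open>auto simp: basis_def\<close>)
    thus "map (tj (n \<circ>\<^sub>m m)) xs = map (tj n) (map (tj m) xs)" using xs by simp
  qed simp
qed

lemma transport_idm:
  assumes "is_graph A" "\<omega> \<in> orientations A" shows "transport (idm A) \<omega> = \<omega>"
proof -
  have "transport (idm A) \<omega> = transport Some \<omega>"
    using transport_cong[of A "idm A" Some] assms orientation_subset by auto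
  also have "(tj Some :: 'a set + 'a \<Rightarrow> _) = id" by (rule ext) (auto simp: map_sum_def split: sum.split)
  hence "transport Some \<omega> = \<omega>" unfolding transport_def by simp
  finally show ?thesis .
qed

section \<open>Orientations under the collapse of one edge\<close>

context edge_collapse
begin

text \<open>Both sides say that \<open>xs\<close> lists, without repetition, the vertices and
  half-edges that the two graphs have in common.\<close>

lemma ordering_iff:
  "Inl va # Inl vb # Inr a # Inr b # xs \<in> orderings G \<longleftrightarrow> Inl vm # xs \<in> orderings G'"
proof -
  let ?C = "Inl ` (verts G - {va, vb}) \<union> Inr ` (halfs G - {a, b})"
  let ?D = "{Inl va, Inl vb, Inr a, Inr b}"
  have B: "basis G = ?D \<union> ?C" unfolding basis_def using va vb ha hb by blast
  have D: "?D \<inter> ?C = {}" by auto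
  have B': "basis G' = insert (Inl vm) ?C" unfolding basis_def verts' halfs' by blast
  have "vm \<notin> verts G - {va, vb}" using vm_disj[of vm] vm_ne by blast
  hence M: "Inl vm \<notin> ?C" by blast
  have "Inl va # Inl vb # Inr a # Inr b # xs \<in> orderings G \<longleftrightarrow> distinct xs \<and> ?D \<inter> set xs = {} \<and> ?D \<union> set xs = ?D \<union> ?C"
    unfolding orderings_eq orders_def B using nl ab by auto
  also have "\<dots> \<longleftrightarrow> distinct xs \<and> set xs = ?C"
  proof -
    have "D \<inter> X = {} \<and> D \<union> X = D \<union> C \<longleftrightarrow> X = C" if "D \<inter> C = {}" for D X C :: "('h set + 'h) set"
      using that by blast
    from this[OF D] show ?thesis by metis
  qed
  also have "\<dots> \<longleftrightarrow> distinct xs \<and> Inl vm \<notin> set xs \<and> insert (Inl vm) (set xs) = insert (Inl vm) ?C"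
  proof -
    have "X = C \<longleftrightarrow> x \<notin> X \<and> insert x X = insert x C" if "x \<notin> C" for x X and C :: "('h set + 'h) set"
      using that insert_ident[of x X C] by blast
    from this[OF M] show ?thesis by metis
  qed
  also have "\<dots> \<longleftrightarrow> Inl vm # xs \<in> orderings G'" unfolding orderings_eq orders_def B' by auto
  finally show ?thesis .
qed

text \<open>The union defining \<open>collapse_or\<close> runs over all orderings with a suitable
  prefix and over both directions of the edge. They all give the same class, so one of them may be
  used.\<close>

lemma collapse_or_or_class:
  assumes w: "\<omega> \<in> orientations G" and xs: "Inl va # Inl vb # Inr a # Inr b # xs \<in> \<omega>"
  shows "collapse_or G {a, b} \<omega> = or_class (Inl vm # xs)"
proof -
  let ?p = "[Inl va, Inl vb, Inr a, Inr b]" and ?q = "[Inl vm]"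
  have o: "?p @ ys \<in> orderings G" if "?p @ ys \<in> \<omega>" for ys using that orientation_subset[OF w] by blast
  have eq: "or_class (?q @ ys) = or_class (?q @ xs)" if ys: "?p @ ys \<in> \<omega>" for ys
  proof -
    have pp: "?p @ xs \<in> \<omega>" using xs by simp
    have "\<omega> = or_class (?p @ xs)" using orient_eq_or_class[of \<omega> _ "?p @ xs"] w pp unfolding orientations_eq by blast
    hence mem: "?p @ ys \<in> or_class (?p @ xs)" using ys by simp
    have "set (?p @ ys) = set (?p @ xs)" "distinct (?p @ ys)" "distinct (?p @ xs)"
      using o[OF ys] o[OF pp] unfolding orderings_eq orders_def by auto
    hence "mset (?p @ ys) = mset (?p @ xs)" using set_eq_iff_mset_eq_distinct by blast
    hence ms: "mset ys = mset xs" by simp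
    have q: "?q @ xs \<in> orders (basis G')" "?q @ ys \<in> orders (basis G')"
      using o[OF ys] o[OF pp] ordering_iff by (simp_all add: orderings_eq)
    have "?q @ ys \<in> or_class (?q @ xs)"
      using or_class_prefix_iff[OF _ ms, of ?p ?q] mem q \<open>distinct (?p @ xs)\<close> unfolding orders_def by blast
    thus ?thesis using or_class_eqI[OF q(2,1) or_class_self] by simp
  qed
  have "or_class (Inl (merged_vertex G {a, b}) # ys) = or_class (?q @ xs)"
    if "{a, b} = {a', b'}" "a' \<noteq> b'"
      "Inl (vert_of G a') # Inl (vert_of G b') # Inr a' # Inr b' # ys \<in> \<omega>" for ys a' b'
  proof (cases "a' = a")
    case True
    hence "b' = b" using that(1,2) by (auto simp: doubleton_eq_iff)
    thus ?thesis using that(3) True eq[of ys] by (simp add: merged)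
  next
    case False
    \<comment> \<open>In the opposite direction the two vertices and the two half-edges are both
      exchanged, which is an even change.\<close>
    hence s: "a' = b" "b' = a" using that by (auto simp: doubleton_eq_iff)
    let ?z = "Inl vb # Inl va # Inr b # Inr a # ys"
    have z: "?z \<in> \<omega>" using that s by simp
    hence zo: "?z \<in> orderings G" using orientation_subset[OF w] by blast
    have 1: "Inl va # Inl vb # Inr b # Inr a # ys \<notin> \<omega>"
      using orient_block_swap[OF w, of "[]" "[Inl vb]" "[Inl va]" "[Inr b, Inr a] @ ys"] z zo by simp
    have "Inl va # Inl vb # Inr b # Inr a # ys \<in> orderings G"
      using zo unfolding orderings_def by auto
    hence "?p @ ys \<in> \<omega>"
      using orient_block_swap[OF w, of "[Inl va, Inl vb]" "[Inr b]" "[Inr a]" ys] 1 by simp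
    thus ?thesis using eq[of ys] by (simp add: merged)
  qed
  hence "collapse_or G {a, b} \<omega> \<subseteq> or_class (Inl vm # xs)" unfolding collapse_or_def by force
  moreover have "or_class (Inl vm # xs) \<subseteq> collapse_or G {a, b} \<omega>"
    unfolding collapse_or_def
    by (rule Union_upper, rule CollectI, rule exI[of _ xs], rule exI[of _ a], rule exI[of _ b])
      (use xs ab merged in auto)
  ultimately show ?thesis by blast
qed

text \<open>An ordering with the prefix certainly exists. If it has the wrong sign, exchanging two
  entries behind the prefix corrects it; there are two, because the merged vertex has valence at
  least 4.\<close>

lemma exists_prefix_mem:
  assumes w: "\<omega> \<in> orientations G"
  shows "\<exists>xs. Inl va # Inl vb # Inr a # Inr b # xs \<in> \<omega>"
proof -
  let ?p = "[Inl va, Inl vb, Inr a, Inr b]"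
  obtain zs where zs: "zs \<in> orderings G'" using orientations_nonempty[OF rib'] orient_nonempty orientation_subset
    unfolding orientations_eq orderings_eq by blast
  have "Inl vm \<in> set zs" using zs unfolding orderings_def verts' by auto
  then obtain u v where uv: "zs = u @ Inl vm # v" by (meson split_list)
  hence q: "Inl vm # u @ v \<in> orderings G'" using zs unfolding orderings_def by auto
  let ?w = "u @ v"
  have "length (Inl vm # ?w) = card (basis G')" using q distinct_card[of "Inl vm # ?w"]
    unfolding orderings_eq orders_def by auto
  moreover have "card (basis G') \<ge> 5"
  proof -
    have f: "finite (basis G')" unfolding basis_def using finite_verts[OF is_graph'] finite_halfs[OF is_graph'] by simp
    have "insert (Inl vm) (Inr ` vm) \<subseteq> basis G'" unfolding basis_def verts' using vert_subset[OF is_graph', of vm] verts' by auto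
    from card_mono[OF f this] have "card (insert (Inl vm) (Inr ` vm) :: ('h set + 'h) set) \<le> card (basis G')" .
    moreover have "card (Inr ` vm :: ('h set + 'h) set) = card vm" by (rule card_image) simp
    moreover have "finite vm" using finite_vert[OF is_graph', of vm] verts' by simp
    ultimately show ?thesis using card_vm(2) by (simp add: card_insert_if image_iff)
  qed
  ultimately have "length ?w \<ge> 2" by simp
  then obtain x y r where w': "?w = x # y # r" by (metis Suc_le_length_iff numeral_2_eq_2)
  have P: "?p @ x # y # r \<in> orderings G" using q ordering_iff w' by simp
  show ?thesis
    using orient_block_swap[OF w, of ?p "[x]" "[y]" r] P by fastforce
qed

lemma collapse_or_mem:
  assumes w: "\<omega> \<in> orientations G" and xs: "Inl vm # xs \<in> orderings G'"
  shows "Inl vm # xs \<in> collapse_or G {a, b} \<omega> \<longleftrightarrow> Inl va # Inl vb # Inr a # Inr b # xs \<in> \<omega>"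
proof -
  let ?p = "[Inl va, Inl vb, Inr a, Inr b]" and ?q = "[Inl vm]"
  obtain ys where ys: "?p @ ys \<in> \<omega>" using exists_prefix_mem[OF w] by auto
  have p: "?p @ xs \<in> orderings G" "?p @ ys \<in> orderings G"
    using xs ordering_iff orientation_subset[OF w] ys by auto
  have c: "collapse_or G {a, b} \<omega> = or_class (?q @ ys)" "\<omega> = or_class (?p @ ys)"
    using collapse_or_or_class[OF w] ys orient_eq_or_class[of \<omega> _ "?p @ ys"] w unfolding orientations_eq by auto
  have d: "set (?p @ xs) = set (?p @ ys)" "distinct (?p @ xs)" "distinct (?p @ ys)"
    using p unfolding orderings_def by auto
  hence "mset (?p @ xs) = mset (?p @ ys)" using set_eq_iff_mset_eq_distinct by blast
  hence ms: "mset xs = mset ys" by simp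
  have "?q @ ys \<in> orderings G'" using ordering_iff[of ys] p(2) by simp
  hence "distinct (?q @ ys)" unfolding orderings_def by blast
  thus ?thesis using or_class_prefix_iff[OF d(3) ms, of ?q] c by simp
qed

lemma collapse_or_orientation: "\<omega> \<in> orientations G \<Longrightarrow> collapse_or G {a, b} \<omega> \<in> orientations G'"
proof -
  assume w: "\<omega> \<in> orientations G"
  obtain xs where xs: "Inl va # Inl vb # Inr a # Inr b # xs \<in> \<omega>" using exists_prefix_mem[OF w] by blast
  hence "Inl vm # xs \<in> orderings G'" using ordering_iff orientation_subset[OF w] by blast
  thus ?thesis using collapse_or_or_class[OF w xs] unfolding orientations_def by blast
qed

lemma exists_ordering': "\<exists>xs. Inl vm # xs \<in> orderings G'"
  using exists_prefix_mem orientations_nonempty[OF R] ordering_iff orientation_subset by blast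

lemma collapse_or_rev:
  assumes w: "\<omega> \<in> orientations G" and c: "card (basis G) \<ge> 2"
  shows "collapse_or G {a, b} (rev_or G \<omega>) = rev_or G' (collapse_or G {a, b} \<omega>)"
proof -
  have c': "card (basis G') \<ge> 2" by (rule collapse_card_basis) unfold_locales
  obtain xs where xs: "Inl vm # xs \<in> orderings G'" using exists_ordering' by blast
  show ?thesis
    using orient_eq_iff(2)[OF collapse_or_orientation[OF w] collapse_or_orientation[OF orient_rev(1)[OF w c]] c' xs]
      collapse_or_mem[OF w xs] collapse_or_mem[OF orient_rev(1)[OF w c] xs] xs ordering_iff[of xs]
    by (auto simp: rev_or_def)
qed

end

lemma collapse_or_facts:
  assumes "rib G" "e \<in> edges G" "\<not> is_loop G e" "\<omega> \<in> orientations G" "card (basis G) \<ge> 2"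
  shows "collapse_or G e \<omega> \<in> orientations (collapse_edge G e)"
    "collapse_or G e (rev_or G \<omega>) = rev_or (collapse_edge G e) (collapse_or G e \<omega>)"
    "card (basis (collapse_edge G e)) \<ge> 2"
proof -
  obtain a b where eab: "e = {a, b}" "edge_collapse G a b" using edge_collapseI[OF assms(1-3)] by metis
  interpret edge_collapse G a b by fact
  show "collapse_or G e \<omega> \<in> orientations (collapse_edge G e)"
    "collapse_or G e (rev_or G \<omega>) = rev_or (collapse_edge G e) (collapse_or G e \<omega>)"
    "card (basis (collapse_edge G e)) \<ge> 2"
    using collapse_or_orientation collapse_or_rev collapse_card_basis[OF eab(2)] assms(4,5) eab(1) by auto
qed

text \<open>Naturality of the orientation of a collapsed graph. By \<open>orient_eq_iff\<close> it
  is enough to test one ordering that begins with the merged vertex.\<close>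

lemma collapse_or_transport:
  assumes R: "rib A" "rib B" and i: "rg_iso A B m" and e: "e \<in> edges A" "\<not> is_loop A e"
    and w: "\<omega> \<in> orientations A" and c: "card (basis A) \<ge> 2"
  shows "collapse_or B ((the \<circ> m) ` e) (transport m \<omega>)
    = transport (m |` (halfs A - e)) (collapse_or A e \<omega>)"
proof -
  let ?j = "the \<circ> m" and ?m = "m |` (halfs A - e)"
  obtain a b where eab: "e = {a, b}" "edge_collapse A a b" using edge_collapseI[OF R(1) e] by metis
  interpret a: edge_collapse A a b by fact
  note ic = rg_iso_collapse[OF R i e]
  have je: "?j ` e = {?j a, ?j b}" using eab by simp
  note vo = rg_iso_vert_of[OF R(1) i rib_is_graph[OF R(2)]]
  have inj: "inj_on ((`) ?j) (verts A)"
    by (rule inj_on_subset[OF inj_on_image_Pow[OF bij_betw_imp_inj_on[OF rg_iso_bij[OF i]]]])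
      (use vert_subset[OF a.g] in auto)
  have V: "vert_of B (?j a) = ?j ` a.va" "vert_of B (?j b) = ?j ` a.vb" using vo a.ha a.hb by auto
  interpret b: edge_collapse B "?j a" "?j b"
  proof
    show "{?j a, ?j b} \<in> edges B" using ic(1) je by simp
    show "vert_of B (?j a) \<noteq> vert_of B (?j b)" unfolding V using inj a.va a.vb a.nl by (simp only: inj_on_eq_iff not_False_eq_True)
  qed (rule R)
  have w': "transport m \<omega> \<in> orientations B" using transport_orientation[OF R(1) i w] .
  have c1: "collapse_or A e \<omega> \<in> orientations a.G'" using a.collapse_or_orientation[OF w] eab by simp
  have i': "rg_iso a.G' b.G' ?m" using ic(3) eab je by simp
  have c2: "collapse_or B (?j ` e) (transport m \<omega>) \<in> orientations b.G'"
    using b.collapse_or_orientation[OF w'] je by simp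
  have c3: "transport ?m (collapse_or A e \<omega>) \<in> orientations b.G'" by (rule transport_orientation[OF a.rib' i' c1])
  obtain xs where xs: "Inl a.vm # xs \<in> orderings a.G'" using a.exists_ordering' by blast
  have c4: "card (basis b.G') \<ge> 2" by (rule collapse_card_basis) unfold_locales
  have ord: "map (tj ?m) (Inl a.vm # xs) \<in> orderings b.G'" by (rule tj_ordering[OF a.rib' i' xs])
  have vmh: "a.vm \<subseteq> halfs A - e" using vert_subset[OF a.is_graph', of a.vm] a.verts' a.halfs' eab by auto
  have "(the \<circ> ?m) ` a.vm = ?j ` a.vm" by (rule image_cong) (use vmh in auto)
  also have "\<dots> = ?j ` (a.va \<union> a.vb) - ?j ` {a, b}"
  proof (rule inj_on_image_set_diff[of ?j "halfs A"])
    show "inj_on ?j (halfs A)" using rg_iso_bij[OF i] bij_betw_imp_inj_on by blast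
  qed (use vert_subset[OF a.g] a.va a.vb a.ha a.hb in auto)
  also have "\<dots> = b.vm" unfolding V by auto
  finally have jv: "(the \<circ> ?m) ` a.vm = b.vm" .
  have "set xs \<subseteq> basis a.G'" using xs unfolding orderings_eq orders_def by auto
  hence "map (tj ?m) xs = map (tj m) xs"
  proof (intro map_cong refl)
    fix x assume "x \<in> set xs" "set xs \<subseteq> basis a.G'"
    hence x: "x \<in> basis a.G'" by blast
    show "tj ?m x = tj m x"
    proof (cases x)
      case (Inl v)
      hence "v \<subseteq> halfs A - e" using x vert_subset[OF a.is_graph', of v] a.halfs' eab unfolding basis_def by auto
      hence "(the \<circ> ?m) ` v = ?j ` v" by (intro image_cong) auto
      thus ?thesis using Inl by simp
    next
      case (Inr k)
      hence "k \<in> halfs A - e" using x eab(1) unfolding basis_def a.halfs' by auto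
      thus ?thesis using Inr by simp
    qed
  qed
  hence L: "map (tj ?m) (Inl a.vm # xs) = Inl b.vm # map (tj m) xs" using jv by simp
  have o: "Inl a.va # Inl a.vb # Inr a # Inr b # xs \<in> orderings A" using xs a.ordering_iff by blast
  have "Inl b.vm # map (tj m) xs \<in> collapse_or B (?j ` e) (transport m \<omega>) \<longleftrightarrow>
      Inl b.va # Inl b.vb # Inr (?j a) # Inr (?j b) # map (tj m) xs \<in> transport m \<omega>"
    unfolding je by (rule b.collapse_or_mem[OF w' ord[unfolded L]])
  also have "\<dots> \<longleftrightarrow> map (tj m) (Inl a.va # Inl a.vb # Inr a # Inr b # xs) \<in> transport m \<omega>"
    using V by simp
  also have "\<dots> \<longleftrightarrow> Inl a.va # Inl a.vb # Inr a # Inr b # xs \<in> \<omega>" by (rule transport_mem[OF R(1) i w o])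
  also have "\<dots> \<longleftrightarrow> Inl a.vm # xs \<in> collapse_or A e \<omega>" using a.collapse_or_mem[OF w xs] eab by simp
  also have "\<dots> \<longleftrightarrow> Inl b.vm # map (tj m) xs \<in> transport ?m (collapse_or A e \<omega>)"
    unfolding L[symmetric] by (rule transport_mem[OF a.rib' i' c1 xs, symmetric])
  finally show ?thesis using orient_eq_iff(1)[OF c3 c2 c4 ord[unfolded L]] by blast
qed

section \<open>The sign of collapsing two edges in either order\<close>

lemma orderings_block_swap: "A @ u @ v @ B \<in> orderings G \<Longrightarrow> A @ v @ u @ B \<in> orderings G"
  using orders_adj_swaps[OF _ adj_swaps_block'] unfolding orderings_eq by blast

text \<open>The two orders of collapse leave the two merged vertices in front in opposite order, and
  exchanging them is the sign. All other exchanges move a block of four entries and are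
  even.\<close>

lemma collapse_or_anticommute_disjoint:
  assumes "edge_collapse G a b" "edge_collapse G c d" "{a, b} \<inter> {c, d} = {}"
    "vert_of G c \<notin> {vert_of G a, vert_of G b}" "vert_of G d \<notin> {vert_of G a, vert_of G b}"
    and w: "\<omega> \<in> orientations G"
  shows "collapse_or (collapse_edge G {a, b}) {c, d} (collapse_or G {a, b} \<omega>) =
    rev_or (collapse_edge (collapse_edge G {a, b}) {c, d})
      (collapse_or (collapse_edge G {c, d}) {a, b} (collapse_or G {c, d} \<omega>))"
proof -
  interpret p: edge_collapse G a b by fact
  interpret q: edge_collapse G c d by fact
  have h1: "c \<in> halfs p.G'" "d \<in> halfs p.G'" "a \<in> halfs q.G'" "b \<in> halfs q.G'"
    using assms(3) p.ha p.hb q.ha q.hb unfolding p.halfs' q.halfs' by auto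
  have v1: "vert_of p.G' c = q.va" "vert_of p.G' d = q.vb" "vert_of q.G' a = p.va" "vert_of q.G' b = p.vb"
    using p.vert_of'[OF h1(1)] p.vert_of'[OF h1(2)] q.vert_of'[OF h1(3)] q.vert_of'[OF h1(4)] assms(4,5) by auto
  have e1: "{c, d} \<in> edges p.G'" "{a, b} \<in> edges q.G'"
    using p.e q.e assms(3) unfolding p.edges' q.edges' by auto
  interpret r: edge_collapse p.G' c d by standard (use p.rib' e1 v1 q.nl in auto)
  interpret s: edge_collapse q.G' a b by standard (use q.rib' e1 v1 p.nl in auto)
  have "collapsible G [{a, b}, {c, d}]"
    using p.e not_loop_iff[OF p.g p.e] p.nl e1 not_loop_iff[OF p.is_graph' e1(1)] r.nl by simp
  hence eq: "r.G' = s.G'" using collapse_commute(2)[OF p.R] by blast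
  let ?V = "Inl p.vm" and ?W = "Inl q.vm"
  have rvm: "r.vm = q.vm" and svm: "s.vm = p.vm" using v1 by simp_all
  have VW: "p.vm \<noteq> q.vm"
  proof -
    have "p.vm \<inter> q.vm = {}"
      using vert_unique[OF p.g] p.va p.vb q.va q.vb assms(4,5) by blast
    thus ?thesis using p.vm_ne by auto
  qed
  have mem: "?V \<in> basis r.G'" "?W \<in> basis r.G'"
  proof -
    have "Inl s.vm \<in> basis s.G'" unfolding basis_def s.verts' by blast
    thus "?V \<in> basis r.G'" unfolding eq svm .
    have "Inl r.vm \<in> basis r.G'" unfolding basis_def r.verts' by blast
    thus "?W \<in> basis r.G'" unfolding rvm .
  qed
  have "finite (basis r.G')" unfolding basis_def
    using finite_verts[OF r.is_graph'] finite_halfs[OF r.is_graph'] by simp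
  then obtain xs where xs: "set xs = basis r.G' - {?V, ?W}" "distinct xs"
    using finite_distinct_list[of "basis r.G' - {?V, ?W}"] by auto
  have o: "?W # ?V # xs \<in> orderings r.G'" "?V # ?W # xs \<in> orderings r.G'"
    unfolding orderings_eq orders_def using xs mem VW by auto
  have wp: "collapse_or G {a, b} \<omega> \<in> orientations p.G'" by (rule p.collapse_or_orientation[OF w])
  have wq: "collapse_or G {c, d} \<omega> \<in> orientations q.G'" by (rule q.collapse_or_orientation[OF w])
  let ?cd = "[Inl q.va, Inl q.vb, Inr c, Inr d]" and ?ab = "[Inl p.va, Inl p.vb, Inr a, Inr b]"
  have o1: "?cd @ [?V] @ xs \<in> orderings p.G'" using r.ordering_iff[of "?V # xs"] o(1) v1 rvm by simp
  have o2: "?ab @ [?W] @ xs \<in> orderings q.G'" using s.ordering_iff[of "?W # xs"] o(2) v1 svm eq by simp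
  have o1': "[?V] @ ?cd @ xs \<in> orderings p.G'" using orderings_block_swap[of "[]" ?cd "[?V]"] o1 by simp
  have o2': "[?W] @ ?ab @ xs \<in> orderings q.G'" using orderings_block_swap[of "[]" ?ab "[?W]"] o2 by simp
  have o3: "?ab @ ?cd @ xs \<in> orderings G" using p.ordering_iff[of "?cd @ xs"] o1' by simp
  let ?L = "collapse_or p.G' {c, d} (collapse_or G {a, b} \<omega>)"
  let ?R = "collapse_or q.G' {a, b} (collapse_or G {c, d} \<omega>)"
  have L: "?L \<in> orientations r.G'" by (rule r.collapse_or_orientation[OF wp])
  have R: "?R \<in> orientations r.G'" unfolding eq by (rule s.collapse_or_orientation[OF wq])
  have "?W # ?V # xs \<in> ?L \<longleftrightarrow> ?cd @ [?V] @ xs \<in> collapse_or G {a, b} \<omega>"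
    using r.collapse_or_mem[OF wp, of "?V # xs"] o(1) v1 rvm by simp
  also have "\<dots> \<longleftrightarrow> [?V] @ ?cd @ xs \<in> collapse_or G {a, b} \<omega>"
    using orient_block_swap[OF wp, of "[]" ?cd "[?V]" xs] o1 by simp
  also have "\<dots> \<longleftrightarrow> ?ab @ ?cd @ xs \<in> \<omega>"
    using p.collapse_or_mem[OF w, of "?cd @ xs"] o1' by simp
  finally have 1: "?W # ?V # xs \<in> ?L \<longleftrightarrow> ?ab @ ?cd @ xs \<in> \<omega>" .
  have "?W # ?V # xs \<in> ?R \<longleftrightarrow> \<not> (?V # ?W # xs \<in> ?R)"
    using orient_block_swap[OF R, of "[]" "[?V]" "[?W]" xs] o(2) by simp
  moreover have "?V # ?W # xs \<in> ?R \<longleftrightarrow> ?ab @ [?W] @ xs \<in> collapse_or G {c, d} \<omega>"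
    using s.collapse_or_mem[OF wq, of "?W # xs"] o(2) v1 svm eq by simp
  moreover have "\<dots> \<longleftrightarrow> [?W] @ ?ab @ xs \<in> collapse_or G {c, d} \<omega>"
    using orient_block_swap[OF wq, of "[]" ?ab "[?W]" xs] o2 by simp
  moreover have "\<dots> \<longleftrightarrow> ?cd @ ?ab @ xs \<in> \<omega>"
    using q.collapse_or_mem[OF w, of "?ab @ xs"] o2' by simp
  moreover have "\<dots> \<longleftrightarrow> ?ab @ ?cd @ xs \<in> \<omega>"
    using orient_block_swap[OF w, of "[]" ?ab ?cd xs] o3 by simp
  ultimately have 2: "?W # ?V # xs \<in> ?R \<longleftrightarrow> \<not> (?ab @ ?cd @ xs \<in> \<omega>)" by blast
  have c: "card (basis r.G') \<ge> 2" by (rule collapse_card_basis) unfold_locales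
  show ?thesis using orient_eq_iff(2)[OF R L c o(1)] 1 2 by blast
qed

text \<open>Both orders end with the same merged vertex. The only odd exchange is that of the vertex
  of \<open>a\<close> with the vertex created by collapsing \<open>{c, d}\<close>; the others
  involve a block of length four.\<close>

lemma collapse_or_anticommute_adjacent:
  assumes "edge_collapse G a b" "edge_collapse G c d" "{a, b} \<inter> {c, d} = {}"
    "vert_of G c = vert_of G b" "vert_of G d \<notin> {vert_of G a, vert_of G b}"
    and w: "\<omega> \<in> orientations G"
  shows "collapse_or (collapse_edge G {a, b}) {c, d} (collapse_or G {a, b} \<omega>) =
    rev_or (collapse_edge (collapse_edge G {a, b}) {c, d})
      (collapse_or (collapse_edge G {c, d}) {a, b} (collapse_or G {c, d} \<omega>))"
proof -
  interpret p: edge_collapse G a b by fact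
  interpret q: edge_collapse G c d by fact
  have h1: "c \<in> halfs p.G'" "d \<in> halfs p.G'" "a \<in> halfs q.G'" "b \<in> halfs q.G'"
    using assms(3) p.ha p.hb q.ha q.hb unfolding p.halfs' q.halfs' by auto
  have v1: "vert_of p.G' c = p.vm" "vert_of p.G' d = q.vb" "vert_of q.G' a = p.va" "vert_of q.G' b = q.vm"
    using p.vert_of'[OF h1(1)] p.vert_of'[OF h1(2)] q.vert_of'[OF h1(3)] q.vert_of'[OF h1(4)] assms(4,5) p.nl by auto
  have e1: "{c, d} \<in> edges p.G'" "{a, b} \<in> edges q.G'"
    using p.e q.e assms(3) unfolding p.edges' q.edges' by auto
  have n1: "p.vm \<noteq> q.vb" using p.vm_disj[OF q.vb(1)] assms(5) p.vm_ne by blast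
  have n2: "p.va \<noteq> q.vm" 
  proof -
    have "p.va \<noteq> q.va" "p.va \<noteq> q.vb" using assms(4,5) p.nl by auto
    from q.vm_disj[OF p.va(1) this] have "p.va \<inter> q.vm = {}" by blast
    thus ?thesis using q.vm_ne by auto
  qed
  interpret r: edge_collapse p.G' c d by standard (use p.rib' e1 v1 n1 in auto)
  interpret s: edge_collapse q.G' a b by standard (use q.rib' e1 v1 n2 in auto)
  have "collapsible G [{a, b}, {c, d}]"
    using p.e not_loop_iff[OF p.g p.e] p.nl e1 not_loop_iff[OF p.is_graph' e1(1)] r.nl by simp
  hence eq: "r.G' = s.G'" using collapse_commute(2)[OF p.R] by blast
  have rvm: "r.vm = s.vm"
  proof -
    have "{a, b} \<inter> q.vb = {}" "{c, d} \<inter> p.va = {}"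
      using vert_unique[OF p.g p.va(1) q.vb(1)] vert_unique[OF p.g p.vb(1) q.vb(1)]
        vert_unique[OF p.g p.va(1) q.va(1)] p.va p.vb q.va q.vb assms(4,5) p.nl by auto
    thus ?thesis unfolding v1 using assms(4) by auto
  qed
  let ?V = "Inl p.vm" and ?W = "Inl q.vm"
  obtain xs where o: "Inl r.vm # xs \<in> orderings r.G'" using r.exists_ordering' by blast
  have wp: "collapse_or G {a, b} \<omega> \<in> orientations p.G'" by (rule p.collapse_or_orientation[OF w])
  have wq: "collapse_or G {c, d} \<omega> \<in> orientations q.G'" by (rule q.collapse_or_orientation[OF w])
  let ?cd = "[Inl q.vb, Inr c, Inr d]" and ?a = "[Inl p.va]" and ?b = "[Inl p.vb]" and ?ab = "[Inr a, Inr b]"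
  have o1: "[?V] @ ?cd @ xs \<in> orderings p.G'" using r.ordering_iff[of xs] o v1 by simp
  have o2: "?a @ [?W] @ ?ab @ xs \<in> orderings q.G'" using s.ordering_iff[of xs] o v1 rvm eq by simp
  have o2': "[?W] @ ?a @ ?ab @ xs \<in> orderings q.G'" using orderings_block_swap[of "[]" ?a "[?W]"] o2 by simp
  have o3: "?a @ ?b @ ?ab @ ?cd @ xs \<in> orderings G" using p.ordering_iff[of "?cd @ xs"] o1 by simp
  have o4: "?cd @ (?a @ ?b @ ?ab) @ xs \<in> orderings G"
    using orderings_block_swap[of "[]" "?a @ ?b @ ?ab" ?cd xs] o3 by simp
  let ?L = "collapse_or p.G' {c, d} (collapse_or G {a, b} \<omega>)"
  let ?R = "collapse_or q.G' {a, b} (collapse_or G {c, d} \<omega>)"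
  have L: "?L \<in> orientations r.G'" by (rule r.collapse_or_orientation[OF wp])
  have R: "?R \<in> orientations r.G'" unfolding eq by (rule s.collapse_or_orientation[OF wq])
  have "Inl r.vm # xs \<in> ?L \<longleftrightarrow> [?V] @ ?cd @ xs \<in> collapse_or G {a, b} \<omega>"
    using r.collapse_or_mem[OF wp, of xs] o v1 by simp
  also have "\<dots> \<longleftrightarrow> (?a @ ?b @ ?ab) @ ?cd @ xs \<in> \<omega>"
    using p.collapse_or_mem[OF w, of "?cd @ xs"] o1 by simp
  also have "\<dots> \<longleftrightarrow> ?cd @ (?a @ ?b @ ?ab) @ xs \<in> \<omega>"
    using orient_block_swap[OF w, of "[]" "?a @ ?b @ ?ab" ?cd xs] o3 by simp
  finally have 1: "Inl r.vm # xs \<in> ?L \<longleftrightarrow> (?cd @ ?a) @ ?b @ ?ab @ xs \<in> \<omega>" by simp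
  have "Inl r.vm # xs \<in> ?R \<longleftrightarrow> ?a @ [?W] @ ?ab @ xs \<in> collapse_or G {c, d} \<omega>"
    using s.collapse_or_mem[OF wq, of xs] o v1 rvm eq by simp
  also have "\<dots> \<longleftrightarrow> \<not> ([?W] @ ?a @ ?ab @ xs \<in> collapse_or G {c, d} \<omega>)"
    using orient_block_swap[OF wq, of "[]" ?a "[?W]" "?ab @ xs"] o2 by simp
  also have "[?W] @ ?a @ ?ab @ xs \<in> collapse_or G {c, d} \<omega> \<longleftrightarrow> ?b @ (?cd @ ?a) @ ?ab @ xs \<in> \<omega>"
    using q.collapse_or_mem[OF w, of "?a @ ?ab @ xs"] o2' assms(4) by simp
  also have "\<dots> \<longleftrightarrow> (?cd @ ?a) @ ?b @ ?ab @ xs \<in> \<omega>"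
    using orient_block_swap[OF w, of "[]" "?cd @ ?a" ?b "?ab @ xs"] o4 by simp
  finally have 2: "Inl r.vm # xs \<in> ?R \<longleftrightarrow> \<not> ((?cd @ ?a) @ ?b @ ?ab @ xs \<in> \<omega>)" .
  have c: "card (basis r.G') \<ge> 2" by (rule collapse_card_basis) unfold_locales
  show ?thesis using orient_eq_iff(2)[OF R L c o] 1 2 by blast
qed

text \<open>This is the sign behind \<open>\<partial>\<^sup>2 = 0\<close> in graph cohomology.\<close>

lemma collapse_or_anticommute:
  assumes R: "rib G" and c: "collapsible G [e1, e2]" and w: "\<omega> \<in> orientations G"
  shows "collapse_or (collapse_edge G e1) e2 (collapse_or G e1 \<omega>) =
    rev_or (collapse_edge (collapse_edge G e1) e2)
      (collapse_or (collapse_edge G e2) e1 (collapse_or G e2 \<omega>))"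
proof -
  note g = rib_is_graph[OF R]
  have c': "collapsible G [e2, e1]" by (rule collapse_commute(1)[OF R c])
  obtain a b where ab: "e1 = {a, b}" "edge_collapse G a b" using edge_collapseI[OF R, of e1] c by auto
  obtain c d where cd: "e2 = {c, d}" "edge_collapse G c d" using edge_collapseI[OF R, of e2] c' by auto
  interpret p: edge_collapse G a b by fact
  interpret q: edge_collapse G c d by fact
  have e2: "{c, d} \<in> edges p.G'" "\<not> is_loop p.G' {c, d}" using c ab cd by auto
  have dj: "{a, b} \<inter> {c, d} = {}"
    using e2(1) edge_unique[OF g p.e q.e] unfolding p.edges' by blast
  have h1: "c \<in> halfs p.G'" "d \<in> halfs p.G'" 
    using dj q.ha q.hb unfolding p.halfs' by auto
  have nl: "vert_of p.G' c \<noteq> vert_of p.G' d" using not_loop_iff[OF p.is_graph' e2(1)] e2(2) by blast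
  \<comment> \<open>Edges sharing both end vertices are excluded: collapsing one would turn the
    other into a loop. Up to the directions of the edges, they are disjoint or share one
    vertex.\<close>
  hence nb: "\<not> (q.va \<in> {p.va, p.vb} \<and> q.vb \<in> {p.va, p.vb})"
    using p.vert_of'[OF h1(1)] p.vert_of'[OF h1(2)] by auto
  have sab: "edge_collapse G b a" and scd: "edge_collapse G d c"
    using p.R p.e p.nl q.e q.nl by (auto simp: edge_collapse_def insert_commute)
  have co: "{b, a} = {a, b}" "{d, c} = {c, d}" by auto
  consider "q.va \<notin> {p.va, p.vb}" "q.vb \<notin> {p.va, p.vb}" | "q.va = p.vb" "q.vb \<notin> {p.va, p.vb}"
    | "q.va = p.va" "q.vb \<notin> {p.va, p.vb}" | "q.vb = p.vb" "q.va \<notin> {p.va, p.vb}"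
    | "q.vb = p.va" "q.va \<notin> {p.va, p.vb}" using nb by blast
  thus ?thesis
  proof cases
    case 1
    from collapse_or_anticommute_disjoint[OF ab(2) cd(2) dj this w] show ?thesis unfolding ab(1) cd(1) .
  next
    case 2
    from collapse_or_anticommute_adjacent[OF ab(2) cd(2) dj this w] show ?thesis unfolding ab(1) cd(1) .
  next
    case 3
    hence "q.vb \<notin> {p.vb, p.va}" by blast
    from collapse_or_anticommute_adjacent[OF sab cd(2) _ 3(1) this w] show ?thesis
      unfolding ab(1) cd(1) using dj unfolding co by blast
  next
    case 4
    from collapse_or_anticommute_adjacent[OF ab(2) scd _ this w] show ?thesis
      unfolding ab(1) cd(1) using dj unfolding co by blast
  next
    case 5
    hence "q.va \<notin> {p.vb, p.va}" by blast
    from collapse_or_anticommute_adjacent[OF sab scd _ 5(1) this w] show ?thesis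
      unfolding ab(1) cd(1) using dj unfolding co by blast
  qed
qed

text \<open>The morphisms collapsing at most one edge, to which the definition of \<open>induced_or\<close> is limited.\<close>

definition step_mor :: "'h rgraph \<Rightarrow> 'h rgraph \<Rightarrow> 'h pmap \<Rightarrow> bool" where
  "step_mor A B f \<longleftrightarrow> fat_mor A B f \<and> codim B \<le> Suc (codim A)"

section \<open>Orientations induced by morphisms collapsing at most one edge\<close>

lemma collapsed_iso: 
  assumes "rib A" "rg_iso A B f" shows "collapsed A f = {}"
proof -
  note g = rib_is_graph[OF assms(1)]
  have "e \<inter> halfs A \<noteq> {}" if "e \<in> edges A" for e
    using edge_subset[OF g that] card_edge[OF g that] by (auto simp: Int_absorb2)
  thus ?thesis unfolding collapsed_def rg_iso_dom[OF assms(2)] by blast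
qed

lemma induced_or_iso: "rib A \<Longrightarrow> rg_iso A B f \<Longrightarrow> induced_or A f \<omega> = transport f \<omega>"
  unfolding induced_or_def by (simp add: collapsed_iso)

lemma induced_or_one_edge: "one_edge A e B f \<Longrightarrow> induced_or A f \<omega> = transport f (collapse_or A e \<omega>)"
  unfolding induced_or_def by (simp add: one_edgeD(9))

lemma step_mor_cases:
  assumes "step_mor A B f"
  obtains "ribbon_graph A" "ribbon_graph B" "rib A" "rib B" "rg_iso A B f"
    | e where "ribbon_graph A" "ribbon_graph B" "rib A" "rib B" "one_edge A e B f"
proof -
  have f: "fat_mor A B f" and c: "codim B \<le> Suc (codim A)" using assms unfolding step_mor_def by auto
  note R = fat_mor_ribbon[OF f]
  have "codim A = codim B \<or> codim B = Suc (codim A)" using fat_mor_domran(3)[OF f] c by linarith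
  thus thesis using fat_mor_iso[OF f] fat_mor_one_edge[OF f] that R by metis
qed

lemma step_mor_iso: "ribbon_graph A \<Longrightarrow> ribbon_graph B \<Longrightarrow> rg_iso A B f \<Longrightarrow> step_mor A B f"
  unfolding step_mor_def using rg_iso_fat_mor rg_iso_codim by (metis ribbon_graph_iff le_SucI order_refl)

lemma step_mor_one_edge: "one_edge A e B f \<Longrightarrow> step_mor A B f"
  unfolding step_mor_def using one_edgeD(8,10) by fastforce

lemma induced_or_facts:
  assumes s: "step_mor A B f" and w: "\<omega> \<in> orientations A"
  shows "induced_or A f \<omega> \<in> orientations B" "induced_or A f (rev_or A \<omega>) = rev_or B (induced_or A f \<omega>)"
proof -
  from s have "induced_or A f \<omega> \<in> orientations B \<and> induced_or A f (rev_or A \<omega>) = rev_or B (induced_or A f \<omega>)"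
  proof (cases rule: step_mor_cases)
    case 1
    show ?thesis unfolding induced_or_iso[OF 1(3,5)]
      using transport_orientation[OF 1(3,5) w] transport_rev[OF 1(3,5) w ribbon_card_basis[OF 1(1)]] by simp
  next
    case (2 e)
    note o = one_edgeD[OF 2(5)]
    note c = collapse_or_facts[OF o(1,5,6) w ribbon_card_basis[OF 2(1)]]
    show ?thesis unfolding induced_or_one_edge[OF 2(5)]
      using transport_orientation[OF o(11,7) c(1)] transport_rev[OF o(11,7) c(1,3)] c(2) by simp
  qed
  thus "induced_or A f \<omega> \<in> orientations B" "induced_or A f (rev_or A \<omega>) = rev_or B (induced_or A f \<omega>)" by auto
qed

lemma step_mor_ribbon: assumes "step_mor A B f" shows "ribbon_graph A" "ribbon_graph B" "rib A" "rib B"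
  using assms fat_mor_ribbon unfolding step_mor_def by blast+

lemma induced_or_inject:
  assumes s: "step_mor A B f" and w: "\<omega> \<in> orientations A" "\<omega>' \<in> orientations A"
  shows "induced_or A f \<omega> = induced_or A f \<omega>' \<longleftrightarrow> \<omega> = \<omega>'"
proof -
  note R = step_mor_ribbon[OF s]
  show ?thesis using orient_or_rev[OF w ribbon_card_basis[OF R(1)]] induced_or_facts[OF s w(1)]
    orient_rev(3)[OF induced_or_facts(1)[OF s w(1)] ribbon_card_basis[OF R(2)]] by metis
qed

lemma induced_or_surj:
  assumes s: "step_mor A B f" and w: "\<eta> \<in> orientations B"
  shows "\<exists>\<omega>\<in>orientations A. induced_or A f \<omega> = \<eta>"
proof -
  note R = step_mor_ribbon[OF s]
  obtain \<omega> where o: "\<omega> \<in> orientations A" using orientations_nonempty[OF R(3)] by blast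
  show ?thesis using orient_or_rev[OF induced_or_facts(1)[OF s o] w ribbon_card_basis[OF R(2)]]
    induced_or_facts(2)[OF s o] orient_rev(1)[OF o ribbon_card_basis[OF R(1)]] o by metis
qed

text \<open>Reversal upstairs gives reversal downstairs, so \<open>induced_or\<close> is a bijection
  between two sets of two elements, and the description in \<open>inducing_or\<close>
  denotes.\<close>

lemma inducing_or:
  assumes s: "step_mor A B f" and w: "\<eta> \<in> orientations B"
  shows "inducing_or A f \<eta> \<in> orientations A" "induced_or A f (inducing_or A f \<eta>) = \<eta>"
proof -
  have "\<exists>!\<omega>. \<omega> \<in> orientations A \<and> induced_or A f \<omega> = \<eta>"
    using induced_or_surj[OF s w] induced_or_inject[OF s] by blast
  from theI'[OF this] show "inducing_or A f \<eta> \<in> orientations A" "induced_or A f (inducing_or A f \<eta>) = \<eta>"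
    unfolding inducing_or_def by blast+
qed

lemma inducing_or_eq: 
  "step_mor A B f \<Longrightarrow> \<omega> \<in> orientations A \<Longrightarrow> inducing_or A f (induced_or A f \<omega>) = \<omega>"
  using inducing_or induced_or_facts(1) induced_or_inject by metis

lemma inducing_or_rev:
  assumes s: "step_mor A B f" and w: "\<eta> \<in> orientations B"
  shows "inducing_or A f (rev_or B \<eta>) = rev_or A (inducing_or A f \<eta>)"
proof -
  note i = inducing_or[OF s w]
  have "rev_or B \<eta> = induced_or A f (rev_or A (inducing_or A f \<eta>))"
    using induced_or_facts(2)[OF s i(1)] i(2) by simp
  thus ?thesis using inducing_or_eq[OF s] orient_rev(1)[OF i(1) ribbon_card_basis[OF step_mor_ribbon(1)[OF s]]] by simp
qed

lemma one_edge_iso_comp: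
  assumes "one_edge A e B f" "rg_iso B C b" "ribbon_graph C"
  shows "one_edge A e C (b \<circ>\<^sub>m f)"
proof -
  note o = one_edgeD[OF assms(1)]
  show ?thesis unfolding one_edge_def using o assms(3) rg_iso_comp[OF o(11,7) assms(2) o(2)] by simp
qed

lemma induced_or_iso_comp:
  assumes s: "step_mor A B f" and b: "rg_iso B C b" "ribbon_graph C" and w: "\<omega> \<in> orientations A"
  shows "induced_or A (b \<circ>\<^sub>m f) \<omega> = transport b (induced_or A f \<omega>)"
  using s
proof (cases rule: step_mor_cases)
  case 1
  show ?thesis
    using induced_or_iso[OF 1(3,5)] induced_or_iso[OF 1(3) rg_iso_comp[OF 1(3,5) b(1) 1(4)]]
      transport_comp[OF 1(3,5) b(1) w] by simp
next
  case (2 e)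
  note o = one_edgeD[OF 2(5)]
  have "collapse_or A e \<omega> \<in> orientations (collapse_edge A e)"
    by (rule collapse_or_facts(1)[OF o(1,5,6) w ribbon_card_basis[OF 2(1)]])
  thus ?thesis
    using induced_or_one_edge[OF 2(5)] induced_or_one_edge[OF one_edge_iso_comp[OF 2(5) b]]
      transport_comp[OF o(11,7) b(1)] by simp
qed

text \<open>The collapsed edge is pulled back along \<open>b\<close>, and
  \<open>collapse_or_transport\<close> compares the orientations.\<close>

lemma one_edge_comp_iso:
  assumes o: "one_edge A e B f" and b: "rg_iso A' A b" "ribbon_graph A'"
    and w: "\<omega> \<in> orientations A'"
  shows "\<exists>e'. one_edge A' e' B (f \<circ>\<^sub>m b) \<and> (the \<circ> b) ` e' = e"
    "induced_or A' (f \<circ>\<^sub>m b) \<omega> = induced_or A f (transport b \<omega>)"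
proof -
  note D = one_edgeD[OF o]
  have R': "rib A'" using b(2) ribbon_graph_iff by blast
  have "e \<in> (`) (the \<circ> b) ` edges A'" using D(5) rg_iso_edges[OF b(1)] by metis
  then obtain e' where e': "e' \<in> edges A'" "(the \<circ> b) ` e' = e" by (auto simp only: image_iff)
  have nl: "\<not> is_loop A' e'" using rg_iso_loop[OF R' b(1) rib_is_graph[OF D(1)] e'(1)] e'(2) D(6) by simp
  let ?b = "b |` (halfs A' - e')"
  have i: "rg_iso (collapse_edge A' e') (collapse_edge A e) ?b"
    using rg_iso_collapse(3)[OF R' D(1) b(1) e'(1) nl] e'(2) by simp
  note Rc = rib_collapse[OF R' e'(1) nl]
  have fb: "f \<circ>\<^sub>m ?b = f \<circ>\<^sub>m b"
  proof
    fix h show "(f \<circ>\<^sub>m ?b) h = (f \<circ>\<^sub>m b) h"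
    proof (cases "h \<in> e'")
      case True
      then obtain y where y: "b h = Some y" "y \<in> e"
        using rg_iso_Some[OF b(1), of h] edge_subset[OF rib_is_graph[OF R'] e'(1)] e'(2) by force
      hence "f y = None" using D(12) by auto
      thus ?thesis using True y by (simp add: map_comp_def)
    next
      case False
      thus ?thesis using rg_iso_None[OF b(1), of h] by (cases "h \<in> halfs A'") (auto simp: map_comp_def)
    qed
  qed
  have "rg_iso (collapse_edge A' e') B (f \<circ>\<^sub>m b)"
    using rg_iso_comp[OF Rc i D(7) D(11)] fb by simp
  hence o': "one_edge A' e' B (f \<circ>\<^sub>m b)" unfolding one_edge_def using b(2) D e' nl by simp
  thus "\<exists>e'. one_edge A' e' B (f \<circ>\<^sub>m b) \<and> (the \<circ> b) ` e' = e" using e' by blast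
  note c = collapse_or_facts[OF R' e'(1) nl w ribbon_card_basis[OF b(2)]]
  have "induced_or A' (f \<circ>\<^sub>m b) \<omega> = transport f (transport ?b (collapse_or A' e' \<omega>))"
    using induced_or_one_edge[OF o'] transport_comp[OF Rc i D(7) c(1)] fb by simp
  also have "transport ?b (collapse_or A' e' \<omega>) = collapse_or A e (transport b \<omega>)"
    using collapse_or_transport[OF R' D(1) b(1) e'(1) nl w ribbon_card_basis[OF b(2)]] e'(2) by simp
  finally show "induced_or A' (f \<circ>\<^sub>m b) \<omega> = induced_or A f (transport b \<omega>)"
    using induced_or_one_edge[OF o] by simp
qed

lemma induced_or_comp_iso:
  assumes s: "step_mor A B f" and b: "rg_iso A' A b" "ribbon_graph A'" and w: "\<omega> \<in> orientations A'"
  shows "induced_or A' (f \<circ>\<^sub>m b) \<omega> = induced_or A f (transport b \<omega>)"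
  using s
proof (cases rule: step_mor_cases)
  case 1
  have R': "rib A'" using b(2) ribbon_graph_iff by blast
  show ?thesis
    using induced_or_iso[OF 1(3,5)] induced_or_iso[OF R' rg_iso_comp[OF R' b(1) 1(5) 1(3)]]
      transport_comp[OF R' b(1) 1(5) w] by simp
next
  case (2 e)
  show ?thesis by (rule one_edge_comp_iso(2)[OF 2(5) b w])
qed

text \<open>The second edge lives in \<open>B\<close>. Pulled back along the isomorphism from the
  collapsed graph \<open>A\<close> it becomes an edge of \<open>A\<close>, and then the composite
  orientation is expressed by \<open>A\<close>, its two edges and the composite morphism
  alone.\<close>

lemma two_steps:
  assumes f: "one_edge A e B f" and g: "one_edge B eB C g" and w: "\<omega> \<in> orientations A"
  obtains e2 where "collapsible A [e, e2]" "e \<noteq> e2" "collapsed A (g \<circ>\<^sub>m f) = {e, e2}"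
    "rg_iso (collapse_edge (collapse_edge A e) e2) C (g \<circ>\<^sub>m f)"
    "induced_or B g (induced_or A f \<omega>) = transport (g \<circ>\<^sub>m f) (collapse_or (collapse_edge A e) e2 (collapse_or A e \<omega>))"
proof -
  note F = one_edgeD[OF f]
  let ?A = "collapse_edge A e"
  have rbA: "ribbon_graph ?A" using foldl_collapse[OF F(1), of "[e]"] F by simp
  note c = collapse_or_facts[OF F(1,5,6) w ribbon_card_basis[OF F(3)]]
  obtain e2 where e2: "one_edge ?A e2 C (g \<circ>\<^sub>m f)"
    using one_edge_comp_iso(1)[OF g F(7) rbA c(1)] by blast
  note D = one_edgeD[OF e2]
  have col: "collapsible A [e, e2]" "rg_iso (foldl collapse_edge A [e, e2]) C (g \<circ>\<^sub>m f)" using F D by auto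
  note fc = fat_mor_collapsed[OF F(1) col]
  have "induced_or B g (induced_or A f \<omega>) = induced_or B g (transport f (collapse_or A e \<omega>))"
    using induced_or_one_edge[OF f] by simp
  also have "\<dots> = induced_or ?A (g \<circ>\<^sub>m f) (collapse_or A e \<omega>)"
    using one_edge_comp_iso(2)[OF g F(7) rbA c(1)] by simp
  also have "\<dots> = transport (g \<circ>\<^sub>m f) (collapse_or ?A e2 (collapse_or A e \<omega>))"
    by (rule induced_or_one_edge[OF e2])
  finally show thesis using that[of e2] fc col by simp
qed

text \<open>The composite determines the pair of collapsed edges, so factorizations that start with
  different edges collapse the same pair in opposite orders.\<close>

lemma two_steps_anticommute:
  assumes f: "one_edge A e B f" "one_edge B eB C g" and f': "one_edge A e' B' f'" "one_edge B' eB' C g'"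
    and eq: "g \<circ>\<^sub>m f = g' \<circ>\<^sub>m f'" and ne: "e \<noteq> e'" and w: "\<omega> \<in> orientations A"
  shows "induced_or B' g' (induced_or A f' \<omega>) = rev_or C (induced_or B g (induced_or A f \<omega>))"
proof -
  note F = one_edgeD[OF f(1)]
  obtain e2 where e2: "collapsible A [e, e2]" "e \<noteq> e2" "collapsed A (g \<circ>\<^sub>m f) = {e, e2}"
    "rg_iso (collapse_edge (collapse_edge A e) e2) C (g \<circ>\<^sub>m f)"
    "induced_or B g (induced_or A f \<omega>) = transport (g \<circ>\<^sub>m f) (collapse_or (collapse_edge A e) e2 (collapse_or A e \<omega>))"
    using two_steps[OF f w] by metis
  obtain e2' where e2': "collapsible A [e', e2']" "e' \<noteq> e2'" "collapsed A (g' \<circ>\<^sub>m f') = {e', e2'}"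
    "rg_iso (collapse_edge (collapse_edge A e') e2') C (g' \<circ>\<^sub>m f')"
    "induced_or B' g' (induced_or A f' \<omega>) = transport (g' \<circ>\<^sub>m f') (collapse_or (collapse_edge A e') e2' (collapse_or A e' \<omega>))"
    using two_steps[OF f' w] by metis
  have s: "e' = e2" "e2' = e" using e2(3) e2'(3) eq ne by (metis doubleton_eq_iff)+
  note co = collapse_commute[OF F(1) e2(1)]
  note c = collapse_or_facts[OF F(1,5,6) w ribbon_card_basis[OF F(3)]]
  note c2 = collapse_or_facts[OF F(11) _ _ c(1,3), of e2]
  have R2: "rib (collapse_edge (collapse_edge A e) e2)" using foldl_collapse[OF F(1) e2(1)] by simp
  have "collapse_or (collapse_edge A e2) e (collapse_or A e2 \<omega>) =
      rev_or (collapse_edge (collapse_edge A e) e2) (collapse_or (collapse_edge A e) e2 (collapse_or A e \<omega>))"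
    using collapse_or_anticommute[OF F(1) co(1) w] co(2) by simp
  thus ?thesis unfolding e2(5) e2'(5) s eq[symmetric] 
    using transport_rev[OF R2 e2(4)] c2 e2(1) by simp
qed

section \<open>Natural orientations\<close>

lemma adj_swaps_block_n:
  "length u * length v = n \<Longrightarrow> (a @ u @ v @ w, a @ v @ u @ w) \<in> adj_swap ^^ n"
  using adj_swaps_block' by blast

text \<open>The contribution of one trivalent vertex to the natural ordering. Its length 4 is even,
  so the order of the vertices will not matter.\<close>

definition blk :: "'h rgraph \<Rightarrow> 'h set \<Rightarrow> 'h \<Rightarrow> 'h ordering" where
  "blk G v h = [Inl v, Inr h, Inr (nxt G h), Inr (nxt G (nxt G h))]"

definition blks :: "'h rgraph \<Rightarrow> 'h set list \<Rightarrow> ('h set \<Rightarrow> 'h) \<Rightarrow> 'h ordering" where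
  "blks G vs first = concat (map (\<lambda>v. blk G v (first v)) vs)"

lemma trivalent_vertex:
  assumes R: "rib G" and v: "v \<in> verts G" "card v = 3" "h \<in> v"
  shows "v = {h, nxt G h, nxt G (nxt G h)}" "nxt G (nxt G (nxt G h)) = h"
    "distinct [h, nxt G h, nxt G (nxt G h)]"
proof -
  note g = rib_is_graph[OF R]
  have hh: "h \<in> halfs G" using v vert_subset[OF g] by blast
  show d: "distinct [h, nxt G h, nxt G (nxt G h)]"
    using nxt_neq[OF R hh] nxt_nxt_neq[OF R hh] nxt_inject[OF R] by auto
  have sub: "{h, nxt G h, nxt G (nxt G h)} \<subseteq> v" using nxt_vert[OF R v(1)] v(3) by auto
  have "card {h, nxt G h, nxt G (nxt G h)} = 3" using d by simp
  thus 1: "v = {h, nxt G h, nxt G (nxt G h)}" using card_subset_eq[OF finite_vert[OF g v(1)] sub] v(2) by simp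
  have "nxt G (nxt G (nxt G h)) \<in> v" using nxt_vert[OF R v(1)] v(3) by simp
  thus "nxt G (nxt G (nxt G h)) = h" using d 1 nxt_inject[OF R] by auto
qed

lemma codim_0_card: 
  assumes "is_graph G" "codim G = 0" "v \<in> verts G" shows "card v = 3"
  using assms card_vert[OF assms(1,3)] finite_verts[OF assms(1)] unfolding codim_def by (auto intro: le_antisym)

lemma blks_ordering_aux:
  assumes R: "rib G"
  shows "distinct vs \<Longrightarrow> set vs \<subseteq> verts G \<Longrightarrow> \<forall>v\<in>set vs. card v = 3 \<and> first v \<in> v \<Longrightarrow>
    distinct (blks G vs first) \<and> set (blks G vs first) = Inl ` set vs \<union> Inr ` \<Union>(set vs)"
proof (induction vs)
  case (Cons v vs)
  note t = trivalent_vertex[OF R, of v "first v"]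
  have v: "v \<in> verts G" "card v = 3" "first v \<in> v" using Cons.prems by auto
  have "v \<inter> w = {}" if "w \<in> set vs" for w
    using that Cons.prems vert_unique[OF rib_is_graph[OF R] v(1), of w] by auto
  hence "v \<inter> \<Union>(set vs) = {}" by blast
  moreover have "v \<notin> set vs" using Cons.prems by simp
  moreover have "set (blk G v (first v)) = insert (Inl v) (Inr ` v)" 
    unfolding blk_def by (subst (3) t(1)[OF v]) auto
  moreover have "distinct (blk G v (first v))" unfolding blk_def using t(3)[OF v] by auto
  ultimately show ?case using Cons unfolding blks_def by auto
qed (simp add: blks_def)

lemma blks_ordering:
  assumes "rib G" "codim G = 0" "distinct vs" "set vs = verts G" "\<forall>v\<in>verts G. first v \<in> v"
  shows "blks G vs first \<in> orderings G"
  using blks_ordering_aux[OF assms(1,3), of first] assms codim_0_card[OF rib_is_graph[OF assms(1)]]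
    Union_verts[OF rib_is_graph[OF assms(1)]] unfolding orderings_def by auto

text \<open>Rotating three half-edges is an even permutation, so the starting half-edge at a
  trivalent vertex is free.\<close>

lemma blks_change_first:
  assumes R: "rib G"
  shows "set vs \<subseteq> verts G \<Longrightarrow> \<forall>v\<in>set vs. card v = 3 \<and> first v \<in> v \<and> first' v \<in> v \<Longrightarrow>
    \<exists>k. even k \<and> (blks G vs first, blks G vs first') \<in> adj_swap ^^ k"
proof (induction vs)
  case (Cons v vs)
  have v: "v \<in> verts G" "card v = 3" "first v \<in> v" "first' v \<in> v" using Cons.prems by auto
  let ?h = "first v"
  note t = trivalent_vertex[OF R v(1-3)]
  obtain k where k: "even k" "(blks G vs first, blks G vs first') \<in> adj_swap ^^ k" using Cons by auto
  have "\<exists>l. even l \<and> (blk G v ?h, blk G v (first' v)) \<in> adj_swap ^^ l"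
  proof -
    consider "first' v = ?h" | "first' v = nxt G ?h" | "first' v = nxt G (nxt G ?h)" using v(4) t(1) by blast
    thus ?thesis
    proof cases
      case 1 thus ?thesis by (intro exI[of _ 0]) simp
    next
      case 2
      have "([Inl v] @ [Inr ?h] @ [Inr (nxt G ?h), Inr (nxt G (nxt G ?h))] @ [],
          [Inl v] @ [Inr (nxt G ?h), Inr (nxt G (nxt G ?h))] @ [Inr ?h] @ []) \<in> adj_swap ^^ 2"
        by (rule adj_swaps_block_n) simp
      thus ?thesis unfolding blk_def 2 t(2) by (intro exI[of _ 2] conjI) simp_all
    next
      case 3
      have "([Inl v] @ [Inr ?h, Inr (nxt G ?h)] @ [Inr (nxt G (nxt G ?h))] @ [],
          [Inl v] @ [Inr (nxt G (nxt G ?h))] @ [Inr ?h, Inr (nxt G ?h)] @ []) \<in> adj_swap ^^ 2"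
        by (rule adj_swaps_block_n) simp
      thus ?thesis unfolding blk_def 3 t(2) by (intro exI[of _ 2] conjI) simp_all
    qed
  qed
  then obtain l where l: "even l" "(blk G v ?h, blk G v (first' v)) \<in> adj_swap ^^ l" by blast
  have "(blk G v ?h @ blks G vs first, blk G v (first' v) @ blks G vs first') \<in> adj_swap ^^ (l + k)"
    using adj_swaps_trans[OF adj_swaps_append[OF l(2), of "[]" "blks G vs first", simplified]
      adj_swaps_prefix[OF k(2), of "blk G v (first' v)"]] by simp
  thus ?case using l k by (intro exI[of _ "l + k"]) (simp add: blks_def)
qed (auto simp: blks_def intro!: exI[of _ 0])

text \<open>Exchanging two neighbouring blocks of length 4 takes sixteen exchanges, an even
  number.\<close>

lemma blks_reorder:
  "(vs, vs') \<in> adj_swap ^^ n \<Longrightarrow> \<exists>k. even k \<and> (blks G vs first, blks G vs' first) \<in> adj_swap ^^ k"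
proof (induction n arbitrary: vs')
  case (Suc n)
  then obtain ws where ws: "(vs, ws) \<in> adj_swap ^^ n" "(ws, vs') \<in> adj_swap" by auto
  obtain k where k: "even k" "(blks G vs first, blks G ws first) \<in> adj_swap ^^ k" using Suc.IH[OF ws(1)] by blast
  obtain u x y v where uv: "ws = u @ x # y # v" "vs' = u @ y # x # v" using ws(2) unfolding adj_swap_def by blast
  have "(blks G ws first, blks G vs' first) \<in> adj_swap ^^ 16"
  proof -
    have "(blks G u first @ blk G x (first x) @ blk G y (first y) @ blks G v first,
      blks G u first @ blk G y (first y) @ blk G x (first x) @ blks G v first) \<in> adj_swap ^^ 16"
      by (rule adj_swaps_block_n) (simp add: blk_def)
    thus ?thesis unfolding uv blks_def by simp
  qed
  from adj_swaps_trans[OF k(2) this] k(1) show ?case by (intro exI[of _ "k + 16"]) simp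
qed (auto intro!: exI[of _ 0])

text \<open>Any two choices of the order of the vertices and of starting half-edges differ by an
  even number of exchanges, so the classes united in \<open>natural_or\<close> are all
  equal.\<close>

lemma natural_or_eq:
  assumes R: "rib G" and c: "codim G = 0" and vs: "distinct vs" "set vs = verts G" "\<forall>v\<in>verts G. first v \<in> v"
  shows "natural_or G = or_class (blks G vs first)"
proof -
  note c3 = codim_0_card[OF rib_is_graph[OF R] c]
  have eq: "concat (map (\<lambda>v. Inl v # map (\<lambda>i. Inr ((nxt G ^^ i) (f v))) [0..<card v]) ws) = blks G ws f"
    if "set ws = verts G" for ws f
  proof -
    have u: "[0..<3] = [0, Suc 0, Suc (Suc 0)]" by (simp add: upt_rec)
    have "Inl v # map (\<lambda>i. Inr ((nxt G ^^ i) (f v))) [0..<card v] = blk G v (f v)" if "v \<in> set ws" for v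
    proof -
      have "card v = 3" using c3 that \<open>set ws = verts G\<close> by blast
      thus ?thesis by (simp only: u blk_def list.map funpow.simps comp_apply id_apply)
    qed
    thus ?thesis unfolding blks_def by (intro arg_cong[of _ _ concat] map_cong refl)
  qed
  have "or_class (blks G ws f) = or_class (blks G vs first)"
    if ws: "distinct ws" "set ws = verts G" "\<forall>v\<in>verts G. f v \<in> v" for ws f
  proof -
    have "mset vs = mset ws" using vs ws set_eq_iff_mset_eq_distinct[of vs ws] by simp
    from adj_swaps_exist[OF this] obtain n where n: "(vs, ws) \<in> adj_swap ^^ n" ..
    obtain k where k: "even k" "(blks G vs first, blks G ws first) \<in> adj_swap ^^ k" using blks_reorder[OF n, of G first] by metis
    obtain l where l: "even l" "(blks G ws first, blks G ws f) \<in> adj_swap ^^ l"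
      using blks_change_first[OF R, of ws first f] ws vs c3 by auto
    have o: "blks G vs first \<in> orders (basis G)" "blks G ws f \<in> orders (basis G)"
      using blks_ordering[OF R c] vs ws unfolding orderings_eq by auto
    have "blks G ws f \<in> or_class (blks G vs first)"
      using mem_or_class_iff[OF o(1) or_class_self adj_swaps_trans[OF k(2) l(2)]] k(1) l(1) by simp
    thus ?thesis using or_class_eqI[OF o(2,1) or_class_self] by simp
  qed
  note all = this
  show ?thesis unfolding natural_or_def
  proof (intro equalityI Union_least Union_upper CollectI)
    show "\<exists>ws f. or_class (blks G vs first) = or_class (concat (map (\<lambda>v. Inl v # map (\<lambda>i. Inr ((nxt G ^^ i) (f v)))
      [0..<card v]) ws)) \<and> distinct ws \<and> set ws = verts G \<and> (\<forall>v\<in>verts G. f v \<in> v)"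
      by (intro exI[of _ vs] exI[of _ first] conjI vs) (simp only: eq[OF vs(2)])
  next
    fix X assume "X \<in> {or_class (concat (map (\<lambda>v. Inl v # map (\<lambda>i. Inr ((nxt G ^^ i) (f v)))
      [0..<card v]) ws)) | ws f. distinct ws \<and> set ws = verts G \<and> (\<forall>v\<in>verts G. f v \<in> v)}"
    then obtain ws f where X: "X = or_class (concat (map (\<lambda>v. Inl v # map (\<lambda>i. Inr ((nxt G ^^ i) (f v)))
      [0..<card v]) ws))" and ws: "distinct ws" "set ws = verts G" "\<forall>v\<in>verts G. f v \<in> v" by blast
    show "X \<subseteq> or_class (blks G vs first)" unfolding X eq[OF ws(2)] all[OF ws] by (rule subset_refl)
  qed
qed

lemma exists_blks:
  assumes "rib G"
  shows "\<exists>vs first. distinct vs \<and> set vs = verts G \<and> (\<forall>v\<in>verts G. first v \<in> v)"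
proof -
  note g = rib_is_graph[OF assms]
  obtain vs where "set vs = verts G" "distinct vs" using finite_distinct_list[OF finite_verts[OF g]] by blast
  moreover have "\<exists>h. h \<in> v" if "v \<in> verts G" for v using card_vert[OF g that]
    by (metis card.empty ex_in_conv not_numeral_le_zero)
  hence "\<exists>first. \<forall>v\<in>verts G. first v \<in> v" by (intro bchoice) blast
  ultimately show ?thesis by blast
qed

lemma natural_or_orientation:
  assumes R: "rib G" and c: "codim G = 0" shows "natural_or G \<in> orientations G"
proof -
  obtain vs first where "distinct vs" "set vs = verts G" "\<forall>v\<in>verts G. first v \<in> v" using exists_blks[OF R] by blast
  thus ?thesis using natural_or_eq[OF R c, of vs first] blks_ordering[OF R c, of vs first] unfolding orientations_def by simp
qed

lemma map_tj_blks:
  assumes "\<And>v. v \<in> set vs \<Longrightarrow> (the \<circ> m) ` v = w v \<and> the (m (first v)) = first' (w v) \<and>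
      the (m (nxt A (first v))) = nxt B (first' (w v)) \<and>
      the (m (nxt A (nxt A (first v)))) = nxt B (nxt B (first' (w v)))"
  shows "map (tj m) (blks A vs first) = blks B (map w vs) first'"
  using assms by (induction vs) (simp_all add: blks_def blk_def)

lemma natural_or_transport:
  assumes R: "rib A" "rib B" and i: "rg_iso A B m" and c: "codim A = 0"
  shows "transport m (natural_or A) = natural_or B"
proof -
  let ?j = "the \<circ> m"
  note g = rib_is_graph[OF R(1)]
  obtain vs first where vs: "distinct vs" "set vs = verts A" "\<forall>v\<in>verts A. first v \<in> v" using exists_blks[OF R(1)] by blast
  have cB: "codim B = 0" using rg_iso_codim[OF R(1) i] c by simp
  have inj: "inj_on ((`) ?j) (verts A)"
    by (rule inj_on_subset[OF inj_on_image_Pow[OF bij_betw_imp_inj_on[OF rg_iso_bij[OF i]]]])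
      (use vert_subset[OF g] in auto)
  \<comment> \<open>Starting half-edges in \<open>B\<close> are the images of those chosen in
    \<open>A\<close>, so that the natural orderings correspond entry by entry.\<close>
  define first' where "first' w = ?j (first (inv_into (verts A) ((`) ?j) w))" for w
  have f': "first' (?j ` v) = ?j (first v)" if "v \<in> verts A" for v
    unfolding first'_def using inv_into_f_f[OF inj that] by simp
  have "map (tj m) (blks A vs first) = blks B (map ((`) ?j) vs) first'"
  proof (rule map_tj_blks)
    fix v assume "v \<in> set vs"
    hence v: "v \<in> verts A" using vs by simp
    hence h: "first v \<in> halfs A" using vs(3) vert_subset[OF g] by blast
    show "?j ` v = ?j ` v \<and> the (m (first v)) = first' (?j ` v) \<and> the (m (nxt A (first v))) = nxt B (first' (?j ` v)) \<and>
      the (m (nxt A (nxt A (first v)))) = nxt B (nxt B (first' (?j ` v)))"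
      unfolding f'[OF v] using rg_iso_nxt[OF i h] rg_iso_nxt[OF i, of "nxt A (first v)"] nxt_halfs[OF R(1)] h by simp
  qed
  moreover have "distinct (map ((`) ?j) vs)" using vs inj by (simp add: distinct_map)
  moreover have "set (map ((`) ?j) vs) = verts B" using rg_iso_verts[OF i] vs(2) by (simp only: set_map)
  moreover have "\<forall>v\<in>verts B. first' v \<in> v"
  proof
    fix w assume "w \<in> verts B"
    then obtain v where "v \<in> verts A" "w = ?j ` v" using rg_iso_verts[OF i] by (metis imageE)
    thus "first' w \<in> w" using f' vs(3) by simp
  qed
  ultimately show ?thesis
    using natural_or_eq[OF R(1) c vs] natural_or_eq[OF R(2) cB] transport_or_class by metis
qed

section \<open>Expansions\<close>

text \<open>A one-edge expansion of \<open>B\<close> whose new edge has been directed;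
  \<open>f\<close> identifies the collapsed graph with \<open>B\<close>.\<close>

locale expansion = edge_collapse A a b for A :: "'h rgraph" and a b +
  fixes B f assumes RB: "rib B" and iso: "rg_iso (collapse_edge A {a, b}) B f"
begin

abbreviation "j h \<equiv> the (f h)"

lemma j_nxt:
  assumes "h \<in> halfs A" "h \<noteq> a" "h \<noteq> b"
  shows "nxt B (j h) = (if nxt A h = a then j (nxt A b) else if nxt A h = b then j (nxt A a) else j (nxt A h))"
proof -
  have "h \<in> halfs G'" using assms by (simp add: halfs')
  from rg_iso_nxt[OF iso this, symmetric] show ?thesis using assms by (simp only: nxt'[of h] if_False simp_thms if_distrib[of j])
qed

lemma j_inj: "h \<in> halfs G' \<Longrightarrow> k \<in> halfs G' \<Longrightarrow> j h = j k \<longleftrightarrow> h = k"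
  by (rule rg_iso_inj[OF iso])

lemma nxt_a_in: "nxt A a \<in> halfs G'" and nxt_b_in: "nxt A b \<in> halfs G'"
  using nxt_a nxt_b nxt_halfs[OF R] ha hb unfolding halfs' by auto

text \<open>The orientation induced from a trivalent graph, made explicit: the reference ordering
  that lists the half-edges of the 4-valent vertex cyclically, beginning with the one after
  \<open>a\<close>, is negative. Two splittings can then be compared through their reference
  orderings.\<close>

lemma natural_induced:
  assumes c: "codim A = 0" and ws: "distinct ws" "set ws = verts B - {(\<lambda>x. j x) ` vm}"
    "\<forall>v\<in>verts B. first v \<in> v"
  defines "h \<equiv> j (nxt A a)"
  defines "L \<equiv> Inl ((\<lambda>x. j x) ` vm) # map Inr [h, nxt B h, nxt B (nxt B h), nxt B (nxt B (nxt B h))] @ blks B ws first"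
  shows "L \<in> orderings B" "L \<notin> transport f (collapse_or A {a, b} (natural_or A))"
    "nxt B (nxt B h) = j (nxt A b)" "nxt B (nxt B (nxt B (nxt B h))) = h"
    "(\<lambda>x. j x) ` vm = {h, nxt B h, nxt B (nxt B h), nxt B (nxt B (nxt B h))}"
proof -
  let ?j = "the \<circ> f"
  note c3 = codim_0_card[OF g c]
  let ?x1 = "nxt A a" let ?x2 = "nxt A ?x1" let ?y1 = "nxt A b" let ?y2 = "nxt A ?y1"
  note ta = trivalent_vertex[OF R va(1) c3[OF va(1)] va(2)] and tb = trivalent_vertex[OF R vb(1) c3[OF vb(1)] vb(2)]
  have x: "?x1 \<in> halfs A" "?x1 \<noteq> a" "?x1 \<noteq> b" "?x2 \<in> halfs A" "?x2 \<noteq> a" "?x2 \<noteq> b"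
    "?y1 \<in> halfs A" "?y1 \<noteq> a" "?y1 \<noteq> b" "?y2 \<in> halfs A" "?y2 \<noteq> a" "?y2 \<noteq> b"
  proof -
    have iv: "?x1 \<in> va" "?x2 \<in> va" "?y1 \<in> vb" "?y2 \<in> vb"
      using nxt_vert[OF R va(1)] nxt_vert[OF R vb(1)] va(2) vb(2) by simp_all
    show "?x1 \<in> halfs A" "?x2 \<in> halfs A" "?y1 \<in> halfs A" "?y2 \<in> halfs A"
      by (rule subsetD[OF vert_subset[OF g va(1)] iv(1)] subsetD[OF vert_subset[OF g va(1)] iv(2)]
        subsetD[OF vert_subset[OF g vb(1)] iv(3)] subsetD[OF vert_subset[OF g vb(1)] iv(4)])+
    show "?x1 \<noteq> b" "?x2 \<noteq> b" "?y1 \<noteq> a" "?y2 \<noteq> a" using iv notin by metis+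
    show "?x1 \<noteq> a" "?x2 \<noteq> a" "?y1 \<noteq> b" "?y2 \<noteq> b" using ta(3) tb(3) by (simp_all only: distinct.simps list.set insert_iff de_Morgan_disj not_False_eq_True) metis+
  qed
  have n1: "nxt B h = j ?x2" unfolding h_def using j_nxt[OF x(1-3)] x by simp
  have n2: "nxt B (nxt B h) = j ?y1" unfolding n1 using j_nxt[OF x(4-6)] ta(2) by simp
  have n3: "nxt B (nxt B (nxt B h)) = j ?y2" unfolding n2 using j_nxt[OF x(7-9)] x by simp
  have n4: "nxt B (nxt B (nxt B (nxt B h))) = h" unfolding n3 unfolding h_def using j_nxt[OF x(10-12)] tb(2) ab by simp
  show "nxt B (nxt B h) = j (nxt A b)" "nxt B (nxt B (nxt B (nxt B h))) = h" using n2 n4 by auto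
  have "vm = {a, ?x1, ?x2} \<union> {b, ?y1, ?y2} - {a, b}" using ta(1) tb(1) by metis
  also have "\<dots> = {?x1, ?x2, ?y1, ?y2}" using x by auto
  finally have "vm = {?x1, ?x2, ?y1, ?y2}" .
  hence vmB: "(\<lambda>x. j x) ` vm = {j ?x1, j ?x2, j ?y1, j ?y2}" by simp
  thus "(\<lambda>x. j x) ` vm = {h, nxt B h, nxt B (nxt B h), nxt B (nxt B (nxt B h))}"
    unfolding n3 unfolding n2 unfolding n1 unfolding h_def .
  have inj: "inj_on ((`) ?j) (verts G')"
    by (rule inj_on_subset[OF inj_on_image_Pow[OF bij_betw_imp_inj_on[OF rg_iso_bij[OF iso]]]])
      (use vert_subset[OF is_graph'] in auto)
  let ?k = "inv_into (verts G') ((`) ?j)"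
  define vs where "vs = map ?k ws"
  have wsG: "w \<in> (`) ?j ` verts G'" if "w \<in> set ws" for w
    using that ws(2) rg_iso_verts[OF iso] by auto
  have kV: "?k w \<in> verts G'" "?j ` (?k w) = w" if "w \<in> set ws" for w
    using inv_into_into[OF wsG[OF that]] f_inv_into_f[OF wsG[OF that]] by auto
  have kV': "?k w \<in> verts A - {va, vb}" if "w \<in> set ws" for w
  proof -
    have "?k w \<noteq> vm" using kV(2)[OF that] that ws(2) by (auto simp: comp_def)
    thus ?thesis using kV(1)[OF that] verts' by blast
  qed
  have vs: "set vs = verts A - {va, vb}" "distinct vs"
  proof -
    show "set vs = verts A - {va, vb}"
    proof
      show "set vs \<subseteq> verts A - {va, vb}" unfolding vs_def using kV' by auto
      show "verts A - {va, vb} \<subseteq> set vs"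
      proof
        fix v assume v: "v \<in> verts A - {va, vb}"
        hence v': "v \<in> verts G'" "vm \<in> verts G'" "v \<noteq> vm" using verts' vm_disj[of v] vm_ne by auto
        hence "?j ` v \<noteq> ?j ` vm" using inj by (simp only: inj_on_eq_iff not_False_eq_True)
        moreover have "?j ` v \<in> verts B" using rg_iso_vert[OF iso v'(1)] .
        ultimately have "?j ` v \<in> set ws" using ws(2) by (simp add: comp_def)
        moreover have "?k (?j ` v) = v" using inv_into_f_f[OF inj v'(1)] .
        ultimately show "v \<in> set vs" unfolding vs_def by force
      qed
    qed
    have "inj_on ?k (set ws)" by (rule inj_on_inverseI[of _ "(`) ?j"]) (use kV in auto)
    thus "distinct vs" unfolding vs_def using ws(1) by (simp add: distinct_map)
  qed
  have "\<exists>x. x \<in> ?k w \<and> j x = first w" if "w \<in> set ws" for w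
  proof -
    have "first w \<in> ?j ` (?k w)" using kV(2)[OF that] that ws(2,3) by simp
    thus ?thesis by auto
  qed
  then obtain fk where fk: "\<And>w. w \<in> set ws \<Longrightarrow> fk w \<in> ?k w \<and> j (fk w) = first w" by metis
  \<comment> \<open>The blocks of the two end vertices have to begin with the halves of the new
    edge, the others with half-edges lying over the given choice in \<open>B\<close>.\<close>
  define firstA where "firstA v = (if v = va then a else if v = vb then b else fk (?j ` v))" for v
  have fA: "\<forall>v\<in>verts A. firstA v \<in> v"
  proof
    fix v assume v: "v \<in> verts A"
    show "firstA v \<in> v"
    proof (cases "v = va \<or> v = vb")
      case True thus ?thesis unfolding firstA_def using va vb by auto
    next
      case False
      then obtain w where w: "w \<in> set ws" "v = ?k w" using v vs(1) unfolding vs_def by auto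
      thus ?thesis using False fk[OF w(1)] kV(2)[OF w(1)] unfolding firstA_def by simp
    qed
  qed
  have mb: "map (tj f) (blks A vs firstA) = blks B (map ((`) ?j) vs) first"
  proof (rule map_tj_blks)
    fix v assume "v \<in> set vs"
    then obtain w where w: "w \<in> set ws" "v = ?k w" unfolding vs_def by auto
    have v: "v \<in> verts A" "v \<noteq> va" "v \<noteq> vb" using kV'[OF w(1)] w by auto
    have jv: "?j ` v = w" using kV(2)[OF w(1)] w by simp
    have fv: "firstA v = fk w" using v jv unfolding firstA_def by simp
    have in_v: "x \<in> halfs A \<and> x \<noteq> a \<and> x \<noteq> b" if "x \<in> v" for x
      using that vm_disj[OF v] vert_subset[OF g v(1)] va vb by blast
    have st: "nxt B (j x) = j (nxt A x)" if "x \<in> v" for x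
      using j_nxt[of x] in_v[OF that] in_v[OF nxt_vert[OF R v(1) that]] by simp
    have f: "firstA v \<in> v" using fA v by blast
    show "?j ` v = ?j ` v \<and> the (f (firstA v)) = first (?j ` v) \<and> the (f (nxt A (firstA v))) = nxt B (first (?j ` v)) \<and>
      the (f (nxt A (nxt A (firstA v)))) = nxt B (nxt B (first (?j ` v)))"
      unfolding jv using st[OF f] st[OF nxt_vert[OF R v(1) f]] fk[OF w(1)] fv by simp
  qed
  have "map ((`) ?j) vs = ws" unfolding vs_def using kV(2) by (simp add: map_idI)
  hence mb: "map (tj f) (blks A vs firstA) = blks B ws first" using mb by simp
  let ?r = "blks A vs firstA"
  have N: "natural_or A = or_class (blks A (va # vb # vs) firstA)"
    by (rule natural_or_eq[OF R c]) (use vs nl va vb fA in auto)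
  have bl: "blks A (va # vb # vs) firstA =
      [Inl va] @ [Inr a, Inr ?x1, Inr ?x2] @ [Inl vb] @ [Inr b, Inr ?y1, Inr ?y2] @ ?r"
    unfolding blks_def blk_def using nl by (simp add: firstA_def)
  have bo: "blks A (va # vb # vs) firstA \<in> orderings A"
    by (rule blks_ordering[OF R c]) (use vs nl va vb fA in auto)
  have w: "natural_or A \<in> orientations A" by (rule natural_or_orientation[OF R c])
  \<comment> \<open>Moving the second vertex forward passes three half-edges, an odd number; moving
    \<open>b\<close> forward afterwards passes two. One sign remains.\<close>
  let ?s = "[Inl va, Inl vb, Inr a] @ [Inr ?x1, Inr ?x2] @ [Inr b] @ [Inr ?y1, Inr ?y2] @ ?r"
  have so: "?s \<in> orderings A"
    using orderings_block_swap[of "[Inl va]" "[Inr a, Inr ?x1, Inr ?x2]" "[Inl vb]"] bo unfolding bl by simp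
  have "?s \<notin> natural_or A"
    using orient_block_swap[OF w, of "[Inl va]" "[Inr a, Inr ?x1, Inr ?x2]" "[Inl vb]" "[Inr b, Inr ?y1, Inr ?y2] @ ?r"]
      bo or_class_self[of "blks A (va # vb # vs) firstA"] unfolding bl N[symmetric, unfolded bl] by simp
  let ?t = "[Inr ?x1, Inr ?x2, Inr ?y1, Inr ?y2] @ ?r"
  have to: "Inl va # Inl vb # Inr a # Inr b # ?t \<in> orderings A"
    using orderings_block_swap[of "[Inl va, Inl vb, Inr a]" "[Inr ?x1, Inr ?x2]" "[Inr b]" "[Inr ?y1, Inr ?y2] @ ?r"] so by simp
  have "Inl va # Inl vb # Inr a # Inr b # ?t \<notin> natural_or A"
    using orient_block_swap[OF w, of "[Inl va, Inl vb, Inr a]" "[Inr ?x1, Inr ?x2]" "[Inr b]" "[Inr ?y1, Inr ?y2] @ ?r"]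
      so \<open>?s \<notin> natural_or A\<close> by simp
  moreover have uo: "Inl vm # ?t \<in> orderings G'" using to ordering_iff by blast
  ultimately have u: "Inl vm # ?t \<notin> collapse_or A {a, b} (natural_or A)" using collapse_or_mem[OF w uo] by blast
  have L: "L = map (tj f) (Inl vm # ?t)"
    unfolding L_def unfolding n3 unfolding n2 unfolding n1 unfolding h_def using mb by (simp add: comp_def)
  show "L \<in> orderings B" unfolding L by (rule tj_ordering[OF rib' iso uo])
  show "L \<notin> transport f (collapse_or A {a, b} (natural_or A))"
    unfolding L transport_mem[OF rib' iso collapse_or_orientation[OF w] uo] by (rule u)
qed

end

lemma one_edge_expansion:
  assumes "one_edge A e B f"
  obtains a b where "e = {a, b}" "expansion A a b B f" "expansion A b a B f"
proof -
  note D = one_edgeD[OF assms]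
  obtain a b where ab: "e = {a, b}" "edge_collapse A a b" using edge_collapseI[OF D(1,5,6)] by metis
  hence "edge_collapse A b a" unfolding edge_collapse_def by (auto simp: insert_commute)
  hence "expansion A a b B f" "expansion A b a B f"
    using ab D(2,7) unfolding expansion_def expansion_axioms_def by (simp_all add: insert_commute)
  thus thesis using that ab by blast
qed

text \<open>What is missing is connectedness of \<open>A\<close>. Closed sets of half-edges are
  carried over by the isomorphism, so the collapsed graph is connected, and
  \<open>connected'\<close> passes this on to \<open>A\<close>.\<close>

lemma expansion_one_edge: "expansion A a b B f \<Longrightarrow> ribbon_graph B \<Longrightarrow> one_edge A {a, b} B f"
proof -
  assume "expansion A a b B f" and B: "ribbon_graph B"
  then interpret expansion A a b B f by simp
  have c: "connected_graph G' \<longleftrightarrow> connected_graph B"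
  proof -
    have "ribbon_graph H" if "rib H" "rib K" "rg_iso H K m" "ribbon_graph K" for H K :: "'a rgraph" and m
    proof -
      let ?j = "the \<circ> m"
      note gK = rib_is_graph[OF that(2)]
      have "connected_graph H" unfolding connected_graph_iff[OF that(1)]
      proof (intro conjI allI impI)
        have K: "halfs K \<noteq> {}" "\<And>X. X \<subseteq> halfs K \<Longrightarrow> X \<noteq> {} \<Longrightarrow> (\<forall>h\<in>X. nxt K h \<in> X \<and> other_half K h \<in> X) \<Longrightarrow> X = halfs K"
          using that(4) connected_graph_iff[OF that(2)] unfolding ribbon_graph_iff by auto
        show "halfs H \<noteq> {}" using K(1) rg_iso_surj[OF that(3)] by blast
        fix X assume X: "X \<subseteq> halfs H" "X \<noteq> {}" "\<forall>h\<in>X. nxt H h \<in> X \<and> other_half H h \<in> X"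
        have "?j ` X = halfs K"
        proof (rule K(2))
          show "?j ` X \<subseteq> halfs K" using X(1) rg_iso_in[OF that(3)] by auto
          show "\<forall>h\<in>?j ` X. nxt K h \<in> ?j ` X \<and> other_half K h \<in> ?j ` X"
          proof
            fix h assume "h \<in> ?j ` X"
            then obtain x where x: "x \<in> X" "h = ?j x" by blast
            have xH: "x \<in> halfs H" using x X by blast
            have "nxt K h = ?j (nxt H x)" "other_half K h = ?j (other_half H x)"
              using rg_iso_nxt[OF that(3) xH] rg_iso_other_half[OF that(1,3) gK xH] x by simp_all
            thus "nxt K h \<in> ?j ` X \<and> other_half K h \<in> ?j ` X" using X(3) x(1) by blast
          qed
        qed (use X in simp)
        have "h \<in> X" if "h \<in> halfs H" for h
        proof -
          have "?j h \<in> ?j ` X" using \<open>?j ` X = halfs K\<close> rg_iso_in[OF \<open>rg_iso H K m\<close> that] by simp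
          then obtain x where "x \<in> X" "the (m h) = the (m x)" by auto
          thus ?thesis using rg_iso_inj[OF \<open>rg_iso H K m\<close> that, of x] X(1) by auto
        qed
        thus "X = halfs H" using X(1) by blast
      qed
      thus ?thesis using that(1) unfolding ribbon_graph_iff by blast
    qed
    from this[OF rib' RB iso B] show ?thesis using B unfolding ribbon_graph_iff by blast
  qed
  have "ribbon_graph A" using c B ribbon_graph' rib' unfolding ribbon_graph_iff by blast
  thus ?thesis unfolding one_edge_def using B e not_loop_iff[OF g e] nl iso by blast
qed

text \<open>Off the new edges the isomorphism is forced by the maps to \<open>B\<close>. Sending
  \<open>a\<close> to \<open>a'\<close> and \<open>b\<close> to \<open>b'\<close> extends it,
  because the successors of the new half-edges lie over the same half-edges of
  \<open>B\<close>.\<close>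

lemma expansion_unique:
  assumes "expansion A a b B f" "expansion A' a' b' B f'"
    and eq: "f (nxt A a) = f' (nxt A' a')" "f (nxt A b) = f' (nxt A' b')"
  obtains m where "rg_iso A A' m" "f' \<circ>\<^sub>m m = f"
proof -
  interpret p: expansion A a b B f by fact
  interpret q: expansion A' a' b' B f' by fact
  obtain n where n: "rg_iso B q.G' n" "n \<circ>\<^sub>m f' = idm q.G'" "f' \<circ>\<^sub>m n = idm B"
    using rg_iso_inverse[OF q.rib' q.RB q.iso] by blast
  define c where "c = n \<circ>\<^sub>m f"
  have c: "rg_iso p.G' q.G' c" unfolding c_def by (rule rg_iso_comp[OF p.rib' p.iso n(1) p.RB])
  have f'c: "f' \<circ>\<^sub>m c = f"
  proof -
    have "f' \<circ>\<^sub>m c = idm B \<circ>\<^sub>m f" unfolding c_def map_comp_assoc[symmetric] n(3) ..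
    thus ?thesis using rg_iso_ran[OF p.iso] by simp
  qed
  have fc: "f' (the (c h)) = f h" if "h \<in> halfs p.G'" for h
  proof -
    have "c h = Some (the (c h))" by (rule rg_iso_Some[OF c that])
    then obtain y where "c h = Some y" ..
    thus ?thesis using fun_cong[OF f'c, of h] by (simp add: map_comp_def)
  qed
  have cI: "the (c h) = k" if "h \<in> halfs p.G'" "k \<in> halfs q.G'" "f h = f' k" for h k
    using q.j_inj[OF rg_iso_in[OF c that(1)] that(2)] fc[OF that(1)] that(3) by simp
  have ca: "the (c (nxt A a)) = nxt A' a'" "the (c (nxt A b)) = nxt A' b'"
    using cI[OF p.nxt_a_in q.nxt_a_in eq(1)] cI[OF p.nxt_b_in q.nxt_b_in eq(2)] by auto
  \<comment> \<open>\<open>c\<close> is the isomorphism forced on the collapsed graphs; the two new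
    half-edges are added to it.\<close>
  define m where "m = (\<lambda>h. if h = a then Some a' else if h = b then Some b' else c h)"
  have ma: "m a = Some a'" and mb: "m b = Some b'" and mc: "\<And>h. h \<in> halfs p.G' \<Longrightarrow> m h = c h"
    unfolding m_def using p.ab p.halfs' by auto
  have hA: "halfs A = insert a (insert b (halfs p.G'))" "a \<notin> halfs p.G'" "b \<notin> halfs p.G'"
    using p.ha p.hb p.halfs' by auto
  have hA': "halfs A' = insert a' (insert b' (halfs q.G'))" "a' \<notin> halfs q.G'" "b' \<notin> halfs q.G'"
    using q.ha q.hb q.halfs' by auto
  let ?j = "the \<circ> m"
  have im: "?j ` x = (the \<circ> c) ` x" if "x \<subseteq> halfs p.G'" for x
    by (rule image_cong) (use that mc in auto)
  have "rg_iso A A' m"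
  proof (rule rg_isoI_rib[OF p.R q.R])
    show "dom m = halfs A"
      using rg_iso_dom[OF c] hA ma mb mc unfolding m_def by (auto simp: dom_def split: if_splits)
    have bc: "bij_betw (the \<circ> c) (halfs p.G') (halfs q.G')" by (rule rg_iso_bij[OF c])
    have "bij_betw ?j (halfs p.G') (halfs q.G')"
      by (rule bij_betw_cong[THEN iffD1, OF _ bc]) (use mc in auto)
    hence "bij_betw ?j (halfs p.G' \<union> {b}) (halfs q.G' \<union> {b'})"
      using notIn_Un_bij_betw[of b "halfs p.G'" ?j "halfs q.G'"] hA hA' mb by simp
    hence "bij_betw ?j ((halfs p.G' \<union> {b}) \<union> {a}) ((halfs q.G' \<union> {b'}) \<union> {a'})"
      using notIn_Un_bij_betw[of a "halfs p.G' \<union> {b}" ?j "halfs q.G' \<union> {b'}"] hA hA' ma p.ab q.ab by simp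
    thus "bij_betw ?j (halfs A) (halfs A')" unfolding hA(1) hA'(1) by (simp add: insert_commute)
    have EA: "edges A = insert {a, b} (edges p.G')" "edges A' = insert {a', b'} (edges q.G')"
      using p.e q.e p.edges' q.edges' by auto
    have "(`) ?j ` edges p.G' = (`) (the \<circ> c) ` edges p.G'"
      by (rule image_cong) (use im edge_subset[OF p.is_graph'] in auto)
    also have "\<dots> = edges q.G'" by (rule rg_iso_edges[OF c])
    finally show "(`) ?j ` edges A = edges A'" unfolding EA using ma mb by simp
    show "the (m (nxt A h)) = nxt A' (the (m h))" if h: "h \<in> halfs A" for h
    proof -
      consider "h = a" | "h = b" | "h \<in> halfs p.G'" using h hA(1) by blast
      thus ?thesis
      proof cases
        case 1 thus ?thesis using ma mc[OF p.nxt_a_in] ca by simp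
      next
        case 2 thus ?thesis using mb mc[OF p.nxt_b_in] ca by simp
      next
        case 3
        hence hne: "h \<noteq> a" "h \<noteq> b" using hA by auto
        let ?k = "the (c h)"
        have k: "?k \<in> halfs q.G'" by (rule rg_iso_in[OF c 3])
        hence kne: "?k \<noteq> a'" "?k \<noteq> b'" using hA' by auto
        have key: "the (c (nxt p.G' h)) = nxt q.G' ?k" by (rule rg_iso_nxt[OF c 3])
        have np: "nxt p.G' h = (if nxt A h = a then nxt A b else if nxt A h = b then nxt A a else nxt A h)"
          using p.nxt'[of h] hne by simp
        have nq: "nxt q.G' ?k = (if nxt A' ?k = a' then nxt A' b' else if nxt A' ?k = b' then nxt A' a' else nxt A' ?k)"
          using q.nxt'[of ?k] kne by simp
        have ne: "nxt A' ?k \<noteq> nxt A' a'" "nxt A' ?k \<noteq> nxt A' b'" "nxt A' a' \<noteq> nxt A' b'"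
          using nxt_inject[OF q.R] kne q.ab by auto
        have ne': "nxt A h \<noteq> nxt A a" "nxt A h \<noteq> nxt A b" using nxt_inject[OF p.R] hne by auto
        have "nxt A h \<in> halfs A" using nxt_halfs[OF p.R] h by simp
        \<comment> \<open>The predecessors of the new half-edges are recognised by their redirected
          successors, which differ from the ordinary ones since \<open>nxt\<close> is
          injective.\<close>
        then consider "nxt A h = a" | "nxt A h = b" | "nxt A h \<in> halfs p.G'" using hA(1) by blast
        thus ?thesis
        proof cases
          case 1
          hence "nxt A' b' = nxt q.G' ?k" using key np ca by simp
          hence "nxt A' ?k = a'" using nq ne by (auto split: if_splits)
          thus ?thesis using 1 ma mc[OF 3] by simp
        next
          case 2
          hence "nxt A' a' = nxt q.G' ?k" using key np ca p.ab by simp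
          hence "nxt A' ?k = b'" using nq ne by (auto split: if_splits)
          thus ?thesis using 2 mb mc[OF 3] by simp
        next
          case n: 3
          hence "nxt A h \<noteq> a" "nxt A h \<noteq> b" using hA by auto
          hence cn: "the (c (nxt A h)) = nxt q.G' ?k" using key np by simp
          have "the (c (nxt A h)) \<noteq> nxt A' a'" "the (c (nxt A h)) \<noteq> nxt A' b'"
            using ca ne' rg_iso_inj[OF c n p.nxt_a_in] rg_iso_inj[OF c n p.nxt_b_in] by auto
          hence "nxt q.G' ?k = nxt A' ?k" using nq cn by (auto split: if_splits)
          thus ?thesis using cn mc[OF 3] mc[OF n] by simp
        qed
      qed
    qed
  qed
  moreover have "f' \<circ>\<^sub>m m = f"
  proof
    fix h
    have off: "f' a' = None" "f' b' = None" "f a = None" "f b = None"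
      using rg_iso_None[OF q.iso] rg_iso_None[OF p.iso] hA hA' by auto
    show "(f' \<circ>\<^sub>m m) h = f h"
    proof (cases "h = a \<or> h = b")
      case True thus ?thesis using off ma mb by (auto simp: map_comp_def)
    next
      case False
      hence "m h = c h" unfolding m_def by simp
      hence "(f' \<circ>\<^sub>m m) h = (f' \<circ>\<^sub>m c) h" by (simp add: map_comp_def)
      thus ?thesis using f'c by simp
    qed
  qed
  ultimately show thesis using that by blast
qed

text \<open>Away from the new edge \<open>f'\<close> is injective, so both maps agree there. The
  successor of a half of the new edge lies off that edge, and a half-edge is determined by its
  successor. In particular expansions have no nontrivial automorphisms over
  \<open>B\<close>.\<close>

lemma one_edge_rigid:
  assumes o: "one_edge A' e' B f'" and i: "rg_iso A A' m" "rg_iso A A' n" and RA: "rib A"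
    and eq: "f' \<circ>\<^sub>m m = f' \<circ>\<^sub>m n"
  shows "m = n"
proof -
  note D = one_edgeD[OF o]
  obtain a b where e': "e' = {a, b}" "expansion A' a b B f'" using one_edge_expansion[OF o] by metis
  interpret expansion A' a b B f' by fact
  have S: "\<exists>y z. m h = Some y \<and> n h = Some z \<and> y \<in> halfs A' \<and> z \<in> halfs A'" if "h \<in> halfs A" for h
    by (intro exI conjI, rule rg_iso_Some[OF i(1) that], rule rg_iso_Some[OF i(2) that],
      rule rg_iso_in[OF i(1) that], rule rg_iso_in[OF i(2) that])
  have 1: "m h = n h" if h: "h \<in> halfs A" "the (m h) \<notin> e'" for h
  proof -
    obtain y z where yz: "m h = Some y" "n h = Some z" "y \<in> halfs A'" "z \<in> halfs A'" using S[OF h(1)] by blast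
    have "f' y = f' z" using fun_cong[OF eq, of h] yz by (simp add: map_comp_def)
    moreover have y: "y \<in> halfs (collapse_edge A' {a, b})" using yz h(2) e' halfs' by auto
    have "f' y = Some (j y)" by (rule rg_iso_Some[OF iso y])
    hence fz: "f' z = Some (j y)" using calculation by simp
    have z: "z \<in> halfs (collapse_edge A' {a, b})"
    proof (rule ccontr)
      assume "\<not> ?thesis"
      from rg_iso_None[OF iso this] fz show False by simp
    qed
    have "y = z" using j_inj[OF y z] fz by simp
    thus ?thesis using yz by simp
  qed
  show ?thesis
  proof
    fix h
    consider "h \<notin> halfs A" | "h \<in> halfs A" "the (m h) \<notin> e'" | "h \<in> halfs A" "the (m h) \<in> e'" by blast
    thus "m h = n h"
    proof cases
      case 1 thus ?thesis using rg_iso_None[OF i(1)] rg_iso_None[OF i(2)] by simp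
    next
      case 3
      have nh: "nxt A h \<in> halfs A" using 3 nxt_halfs[OF RA] by simp
      have "the (m (nxt A h)) = nxt A' (the (m h))" by (rule rg_iso_nxt[OF i(1) 3(1)])
      hence "the (m (nxt A h)) \<notin> e'" using 3(2) e' nxt_a nxt_b by auto
      from 1[OF nh this] have "nxt A' (the (m h)) = nxt A' (the (n h))"
        using rg_iso_nxt[OF i(1) 3(1)] rg_iso_nxt[OF i(2) 3(1)] by simp
      hence "the (m h) = the (n h)" using nxt_inject[OF D(1)] by blast
      thus ?thesis using S[OF 3(1)] by auto
    qed (use 1 in blast)
  qed
qed

text \<open>A vertex is split by inserting a new half-edge before \<open>x\<close> and one before \<open>y\<close>.\<close>

lemma expansion_exists:
  assumes RB: "ribbon_graph B" and v: "v \<in> verts B" "x \<in> v" "y \<in> v" "x \<noteq> y" "nxt B x \<noteq> y" "nxt B y \<noteq> x"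
    and fresh: "a \<notin> halfs B" "b \<notin> halfs B" "a \<noteq> b"
  shows "\<exists>A. expansion A a b B (idm B) \<and> nxt A a = x \<and> nxt A b = y"
proof -
  have R: "rib B" using RB ribbon_graph_iff by blast
  note g = rib_is_graph[OF R]
  \<comment> \<open>The predecessor of \<open>y\<close> is sent to \<open>a\<close> and
    \<open>a\<close> to \<open>x\<close>, so the arc from \<open>x\<close> to just before
    \<open>y\<close> closes up through \<open>a\<close>; the complementary arc closes up through
    \<open>b\<close>. These are the vertices \<open>P\<close> and \<open>Q\<close>.\<close>
  define \<sigma> where "\<sigma> h = (if h = a then x else if h = b then y else if nxt B h = y then a
     else if nxt B h = x then b else nxt B h)" for h
  define P where "P = orbit \<sigma> a"
  define Q where "Q = orbit \<sigma> b"
  define A where "A = \<lparr>halfs = insert a (insert b (halfs B)), edges = insert {a, b} (edges B),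
    verts = (verts B - {v}) \<union> {P, Q}, nxt = \<sigma>\<rparr>"
  have vh: "v \<subseteq> halfs B" by (rule vert_subset[OF g v(1)])
  have xy: "x \<in> halfs B" "y \<in> halfs B" using v vh by auto
  have nB: "nxt B h \<noteq> a \<and> nxt B h \<noteq> b" if "h \<in> halfs B" for h using nxt_halfs[OF R] that fresh by metis
  have sa: "\<sigma> a = x" and sb: "\<sigma> b = y" using fresh unfolding \<sigma>_def by auto
  have sh: "\<sigma> h = (if nxt B h = y then a else if nxt B h = x then b else nxt B h)" if "h \<noteq> a" "h \<noteq> b" for h
    using that unfolding \<sigma>_def by simp
  have ne: "x \<noteq> a" "x \<noteq> b" "y \<noteq> a" "y \<noteq> b" using xy fresh by auto
  have inj: "inj_on \<sigma> (insert a (insert b (halfs B)))"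
  proof (rule inj_onI)
    fix h k assume hk: "h \<in> insert a (insert b (halfs B))" "k \<in> insert a (insert b (halfs B))" "\<sigma> h = \<sigma> k"
    have val: "\<sigma> h \<noteq> x" "\<sigma> h \<noteq> y" if "h \<in> halfs B" for h
    proof -
      have "h \<noteq> a" "h \<noteq> b" using that fresh by auto
      from sh[OF this] show "\<sigma> h \<noteq> x" "\<sigma> h \<noteq> y" using nB[OF that] ne v(4) by (auto split: if_splits)
    qed
    have rest: "h = k" if hB: "h \<in> halfs B" "k \<in> halfs B"
    proof -
      have ab: "h \<noteq> a" "h \<noteq> b" "k \<noteq> a" "k \<noteq> b" using hB fresh by auto
      have "nxt B h = nxt B k"
        using hk(3) sh[OF ab(1,2)] sh[OF ab(3,4)] nB[OF hB(1)] nB[OF hB(2)] fresh(3) by (auto split: if_splits)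
      thus ?thesis using nxt_inject[OF R] by blast
    qed
    consider "h \<in> halfs B" "k \<in> halfs B" | "h \<in> {a, b}" "k \<in> halfs B" | "h \<in> halfs B" "k \<in> {a, b}"
      | "h \<in> {a, b}" "k \<in> {a, b}" using hk(1,2) by blast
    thus "h = k"
    proof cases
      case 2 thus ?thesis using val[of k] hk(3) sa sb by auto
    next
      case 3 thus ?thesis using val[of h] hk(3) sa sb by auto
    next
      case 4 thus ?thesis using hk(3) sa sb v(4) by auto
    qed (rule rest)
  qed
  have into: "\<sigma> ` (insert a (insert b (halfs B))) \<subseteq> insert a (insert b (halfs B))"
  proof -
    have "\<sigma> h \<in> insert a (insert b (halfs B))" if "h \<in> halfs B" for h
      using that nxt_halfs[OF R, of h] unfolding \<sigma>_def using xy by auto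
    thus ?thesis using sa sb xy by auto
  qed
  have finD: "finite (insert a (insert b (halfs B)))" using finite_halfs[OF g] by simp
  have "\<sigma> permutes (insert a (insert b (halfs B)))"
  proof (rule bij_imp_permutes)
    show "bij_betw \<sigma> (insert a (insert b (halfs B))) (insert a (insert b (halfs B)))"
      using endo_inj_surj[OF finD into inj] inj by (simp add: bij_betw_def)
    show "\<sigma> h = h" if "h \<notin> insert a (insert b (halfs B))" for h
      using that nxt_off[OF R, of h] xy unfolding \<sigma>_def by auto
  qed
  hence perm: "permutation \<sigma>" using finD permutation_permutes by blast
  have cP: "cyclic_on \<sigma> P" "cyclic_on \<sigma> Q" unfolding P_def Q_def
    using cyclic_on_orbit[OF \<open>\<sigma> permutes _\<close> finD] by auto
  have aP: "a \<in> P" and bQ: "b \<in> Q" unfolding P_def Q_def using permutation_self_in_orbit[OF perm] by auto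
  have sP: "\<sigma> z \<in> P" if "z \<in> P" for z using cyclic_on_closed[OF cP(1) that] .
  have sQ: "\<sigma> z \<in> Q" if "z \<in> Q" for z using cyclic_on_closed[OF cP(2) that] .
  have "y \<in> orbit (nxt B) x" using cyclic_vert[OF R v(1)] v(2,3) by (metis cyclic_on_alldef)
  then obtain N where "(nxt B ^^ N) x = y" by (auto simp: orbit_altdef)
  \<comment> \<open>The number of steps from \<open>x\<close> to \<open>y\<close>. The arc it cuts
    out contains \<open>P\<close> apart from \<open>a\<close>, which keeps \<open>b\<close> out of
    \<open>P\<close>.\<close>
  then obtain N where N: "(nxt B ^^ N) x = y" "\<And>i. i < N \<Longrightarrow> (nxt B ^^ i) x \<noteq> y"
    using exists_least_iff[of "\<lambda>N. (nxt B ^^ N) x = y"] by blast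
  let ?A0 = "insert a ((\<lambda>i. (nxt B ^^ i) x) ` {..<N})"
  have N0: "N > 0" using N(1) v(4) by (cases N) auto
  have seg: "(nxt B ^^ i) x \<in> v" for i by (induction i) (use v nxt_vert[OF R v(1)] in auto)
  have "P \<subseteq> ?A0"
  proof
    fix z assume "z \<in> P" thus "z \<in> ?A0" unfolding P_def
    proof induction
      case base show ?case using sa N0 by force
    next
      case (step z)
      show ?case
      proof (cases "z = a")
        case True thus ?thesis using sa N0 by force
      next
        case False
        then obtain i where i: "i < N" "z = (nxt B ^^ i) x" using step by auto
        have "z \<noteq> b" using i seg[of i] vh fresh by auto
        note s = sh[OF False this]
        have nz: "nxt B z = (nxt B ^^ Suc i) x" using i by simp
        show ?thesis
        proof (cases "nxt B z = y")
          case False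
          hence "Suc i \<noteq> N" using nz N(1) by auto
          hence iN: "Suc i < N" using i by simp
          have "nxt B z \<noteq> x"
          proof
            assume "nxt B z = x"
            hence per: "(nxt B ^^ Suc i) x = x" using nz by simp
            have "(nxt B ^^ N) x = (nxt B ^^ (N - Suc i)) ((nxt B ^^ Suc i) x)"
              using iN by (metis add_diff_inverse_nat add.commute comp_apply funpow_add not_less_iff_gr_or_eq)
            hence "(nxt B ^^ (N - Suc i)) x = y" using per N(1) by simp
            thus False using N(2)[of "N - Suc i"] iN by auto
          qed
          hence "\<sigma> z = (nxt B ^^ Suc i) x" using s False nz by simp
          thus ?thesis using iN by blast
        qed (use s in simp)
      qed
    qed
  qed
  hence bP: "b \<notin> P" using seg vh fresh by auto
  have dPQ: "P \<inter> Q = {}"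
  proof -
    have "P = Q" if "z \<in> P" "z \<in> Q" for z
      using that cP by (metis cyclic_on_alldef)
    thus ?thesis using bP bQ by blast
  qed
  have xP: "x \<in> P" and yQ: "y \<in> Q" using sP[OF aP] sQ[OF bQ] sa sb by auto
  have inv: "\<sigma> z \<in> insert a (insert b v)" if "z \<in> insert a (insert b v)" for z
    using that v nxt_vert[OF R v(1), of z] unfolding \<sigma>_def by auto
  have orb: "orbit \<sigma> z \<subseteq> insert a (insert b v)" if "z \<in> insert a (insert b v)" for z
  proof
    fix w assume "w \<in> orbit \<sigma> z" thus "w \<in> insert a (insert b v)" by induction (use that inv in auto)
  qed
  have PQsub: "P \<union> Q \<subseteq> insert a (insert b v)" unfolding P_def Q_def using orb[of a] orb[of b] by auto
  \<comment> \<open>Without the new half-edges the two arcs are closed under the old successor, so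
    together they exhaust \<open>v\<close>.\<close>
  have "(P \<union> Q) - {a, b} = v"
  proof (rule cyclic_on_invariant[OF cyclic_vert[OF R v(1)]])
    show "(P \<union> Q) - {a, b} \<subseteq> v" using PQsub by blast
    show "(P \<union> Q) - {a, b} \<noteq> {}" using xP ne by blast
    fix z assume z: "z \<in> (P \<union> Q) - {a, b}"
    hence zB: "z \<in> halfs B" using PQsub vh by blast
    have s: "\<sigma> z = (if nxt B z = y then a else if nxt B z = x then b else nxt B z)" using sh z by simp
    have "\<sigma> z \<in> P \<union> Q" using z sP sQ by blast
    thus "nxt B z \<in> (P \<union> Q) - {a, b}" using s xP yQ nB[OF zB] ne by (auto split: if_splits)
  qed
  hence PQ: "P \<union> Q = insert a (insert b v)" using aP bQ PQsub by blast
  have fP: "finite P" "finite Q" using PQ finite_vert[OF g v(1)] by (metis finite_Un finite_insert)+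
  \<comment> \<open>Each arc has at least two half-edges because neither of \<open>x\<close> and
    \<open>y\<close> directly follows the other; with the new half-edge the valence is at least
    3.\<close>
  have cardP: "card P \<ge> 3"
  proof -
    have "\<sigma> x = nxt B x" using sh[OF ne(1,2)] v(5) nxt_neq[OF R xy(1)] by simp
    hence "nxt B x \<in> P" using sP[OF xP] by simp
    hence "{a, x, nxt B x} \<subseteq> P" using aP xP by blast
    moreover have "card {a, x, nxt B x} = 3" using ne nB[OF xy(1)] nxt_neq[OF R xy(1)] by auto
    ultimately show ?thesis using card_mono[OF fP(1)] by metis
  qed
  have cardQ: "card Q \<ge> 3"
  proof -
    have "\<sigma> y = nxt B y" using sh[OF ne(3,4)] v(6) nxt_neq[OF R xy(2)] by simp
    hence "nxt B y \<in> Q" using sQ[OF yQ] by simp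
    hence "{b, y, nxt B y} \<subseteq> Q" using bQ yQ by blast
    moreover have "card {b, y, nxt B y} = 3" using ne nB[OF xy(2)] nxt_neq[OF R xy(2)] by auto
    ultimately show ?thesis using card_mono[OF fP(2)] by metis
  qed
  have wd: "w \<inter> insert a (insert b v) = {}" if "w \<in> verts B - {v}" for w
  proof -
    have "w \<inter> v = {}" using that vert_unique[OF g _ v(1), of w] by blast
    thus ?thesis using vert_subset[OF g, of w] that fresh by blast
  qed
  have EB: "\<Union>(edges B) = halfs B" by (rule Union_edges[OF g])
  have gA: "is_graph A" unfolding is_graph_def A_def rgraph.simps
  proof (intro conjI ballI finD)
    show "partition_on (insert a (insert b (halfs B))) (insert {a, b} (edges B))"
    proof (rule partition_onI)
      show "\<Union>(insert {a, b} (edges B)) = insert a (insert b (halfs B))" using EB by auto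
      have "e \<inter> {a, b} = {}" if "e \<in> edges B" for e using edge_subset[OF g that] fresh by blast
      thus "disjnt p q" if "p \<in> insert {a, b} (edges B)" "q \<in> insert {a, b} (edges B)" "p \<noteq> q" for p q
        using that edge_unique[OF g, of p q] unfolding disjnt_def by (metis Int_commute Int_emptyI insertE)
      show "{} \<notin> insert {a, b} (edges B)" using card_edge[OF g, of "{}"] by auto
    qed
    show "card e = 2" if "e \<in> insert {a, b} (edges B)" for e using that card_edge[OF g] fresh(3) by auto
    show "partition_on (insert a (insert b (halfs B))) (verts B - {v} \<union> {P, Q})"
    proof (rule partition_onI)
      have "\<Union>(verts B - {v} \<union> {P, Q}) = \<Union>(verts B - {v}) \<union> (P \<union> Q)" by auto
      also have "\<dots> = insert a (insert b (\<Union>(verts B)))" unfolding PQ using v(1) by auto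
      finally show "\<Union>(verts B - {v} \<union> {P, Q}) = insert a (insert b (halfs B))" unfolding Union_verts[OF g] .
      have D: "w \<inter> P = {} \<and> w \<inter> Q = {}" if "w \<in> verts B - {v}" for w
        using wd[OF that] PQ by blast
      show "disjnt p q" if pq: "p \<in> verts B - {v} \<union> {P, Q}" "q \<in> verts B - {v} \<union> {P, Q}" "p \<noteq> q" for p q
      proof -
        have VV: "p \<inter> q = {}" if "p \<in> verts B" "q \<in> verts B" using vert_unique[OF g that] pq(3) by blast
        have "p \<in> verts B - {v} \<or> p = P \<or> p = Q" "q \<in> verts B - {v} \<or> q = P \<or> q = Q" using pq by auto
        thus ?thesis unfolding disjnt_def using D[of p] D[of q] VV dPQ pq(3) by (metis DiffD1 Int_commute)
      qed
      show "{} \<notin> verts B - {v} \<union> {P, Q}" using card_vert[OF g, of "{}"] aP bQ by auto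
    qed
    show "3 \<le> card w" if "w \<in> verts B - {v} \<union> {P, Q}" for w using that card_vert[OF g] cardP cardQ by auto
  qed
  have RA: "rib A"
  proof (rule ribI[OF gA])
    show "nxt A h = h" if "h \<notin> halfs A" for h
      using that nxt_off[OF R, of h] xy unfolding A_def by (auto simp: \<sigma>_def)
    fix w assume "w \<in> verts A"
    hence "w \<in> verts B - {v} \<or> w = P \<or> w = Q" unfolding A_def by auto
    moreover have "cyclic_on (nxt A) w" if w: "w \<in> verts B - {v}"
    proof -
      have "\<sigma> h = nxt B h" if h: "h \<in> w" for h
      proof -
        have "nxt B h \<in> w" using nxt_vert[OF R _ h] w by blast
        hence "nxt B h \<noteq> x" "nxt B h \<noteq> y" "h \<noteq> a" "h \<noteq> b" using wd[OF w] v h by auto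
        thus ?thesis using sh by simp
      qed
      moreover have "cyclic_on (nxt B) w" using cyclic_vert[OF R] w by blast
      ultimately show ?thesis unfolding A_def using cyclic_cong[of w "nxt B" \<sigma>] by (simp add: A_def)
    qed
    ultimately show "cyclic_on (nxt A) w" using cP unfolding A_def by auto
  qed
  have PA: "P \<in> verts A" "Q \<in> verts A" unfolding A_def by auto
  interpret c: edge_collapse A a b
  proof
    show "{a, b} \<in> edges A" unfolding A_def by simp
    show "vert_of A a \<noteq> vert_of A b"
      using vert_of_eq[OF gA PA(1) aP] vert_of_eq[OF gA PA(2) bQ] bP bQ by auto
  qed (rule RA)
  have "c.G' = B"
  proof (rule rib_eqI[OF c.rib' R])
    show "halfs c.G' = halfs B" unfolding c.halfs' unfolding A_def using fresh by auto
    have "{a, b} \<notin> edges B" using edge_subset[OF g, of "{a, b}"] fresh by blast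
    thus "edges c.G' = edges B" unfolding c.edges' unfolding A_def by simp
    show "nxt c.G' = nxt B"
    proof
      fix h
      have A: "nxt A = \<sigma>" unfolding A_def by simp
      have "h \<notin> halfs B \<Longrightarrow> nxt B h = h" by (rule nxt_off[OF R])
      hence nh: "h \<noteq> a \<Longrightarrow> nxt B h \<noteq> a" "h \<noteq> b \<Longrightarrow> nxt B h \<noteq> b" "nxt B a = a" "nxt B b = b"
        using nB[of h] nxt_off[OF R] fresh by metis+
      show "nxt c.G' h = nxt B h"
        unfolding c.nxt' A using sa sb sh[of h] nh fresh(3) v(4) by auto
    qed
  qed
  hence "expansion A a b B (idm B)"
    unfolding expansion_def expansion_axioms_def using c.edge_collapse_axioms R rg_iso_id[OF R] by simp
  moreover have "nxt A a = x" "nxt A b = y" unfolding A_def using sa sb by auto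
  ultimately show ?thesis by blast
qed

section \<open>Weighted counts over a skeleton\<close>

definition isos :: "'h rgraph \<Rightarrow> 'h rgraph \<Rightarrow> 'h pmap set" where
  "isos G G' = {m. rg_iso G G' m}"

definition wt :: "'h rgraph \<Rightarrow> rat" where
  "wt G = 1 / of_nat (card (Aut G))"

lemma Aut_isos: "Aut G = isos G G" unfolding Aut_def isos_def ..

lemma finite_isos:
  assumes "finite (halfs G)" "finite (halfs G')" shows "finite (isos G G')"
proof (rule finite_subset)
  show "isos G G' \<subseteq> {m. dom m = halfs G \<and> ran m \<subseteq> halfs G'}" unfolding isos_def rg_iso_def by auto
  show "finite {m. dom m = halfs G \<and> ran m \<subseteq> halfs G'}" by (rule finite_set_of_finite_maps[OF assms])
qed

lemma rib_finite_isos: "rib G \<Longrightarrow> rib G' \<Longrightarrow> finite (isos G G')"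
  using finite_isos finite_halfs rib_is_graph by blast

text \<open>Composition with one fixed isomorphism, before or after, identifies the set of
  isomorphisms with either automorphism group.\<close>

lemma card_isos:
  assumes R: "rib A" "rib B" and m: "rg_iso A B m"
  shows "card (isos A B) = card (Aut A)" "card (isos A B) = card (Aut B)" "wt A = wt B"
proof -
  obtain n where n: "rg_iso B A n" "n \<circ>\<^sub>m m = idm A" "m \<circ>\<^sub>m n = idm B" using rg_iso_inverse[OF R m] by blast
  have id: "k \<circ>\<^sub>m idm X = k" if "rg_iso X Y k" for k X Y using rg_iso_dom[OF that] by simp
  have id': "idm Y \<circ>\<^sub>m k = k" if "rg_iso X Y k" for k X Y using rg_iso_ran[OF that] by simp
  have "bij_betw (\<lambda>k. m \<circ>\<^sub>m k) (Aut A) (isos A B)"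
  proof (rule bij_betw_byWitness[where f' = "\<lambda>k. n \<circ>\<^sub>m k"])
    show "\<forall>k\<in>Aut A. n \<circ>\<^sub>m (m \<circ>\<^sub>m k) = k" using n(2) id' by (auto simp: Aut_def map_comp_assoc[symmetric])
    show "\<forall>k\<in>isos A B. m \<circ>\<^sub>m (n \<circ>\<^sub>m k) = k" using n(3) id' by (auto simp: isos_def map_comp_assoc[symmetric])
    show "(\<lambda>k. m \<circ>\<^sub>m k) ` Aut A \<subseteq> isos A B" using rg_iso_comp[OF R(1) _ m R(1)] by (auto simp: Aut_def isos_def)
    show "(\<lambda>k. n \<circ>\<^sub>m k) ` isos A B \<subseteq> Aut A" using rg_iso_comp[OF R(1) _ n(1) R(2)] by (auto simp: Aut_def isos_def)
  qed
  thus 1: "card (isos A B) = card (Aut A)" using bij_betw_same_card by fastforce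
  have "bij_betw (\<lambda>k. k \<circ>\<^sub>m m) (Aut B) (isos A B)"
  proof (rule bij_betw_byWitness[where f' = "\<lambda>k. k \<circ>\<^sub>m n"])
    show "\<forall>k\<in>Aut B. (k \<circ>\<^sub>m m) \<circ>\<^sub>m n = k" using n(3) id by (auto simp: Aut_def map_comp_assoc)
    show "\<forall>k\<in>isos A B. (k \<circ>\<^sub>m n) \<circ>\<^sub>m m = k" using n(2) id by (auto simp: isos_def map_comp_assoc)
    show "(\<lambda>k. k \<circ>\<^sub>m m) ` Aut B \<subseteq> isos A B" using rg_iso_comp[OF R(1) m _ R(2)] by (auto simp: Aut_def isos_def)
    show "(\<lambda>k. k \<circ>\<^sub>m n) ` isos A B \<subseteq> Aut B" using rg_iso_comp[OF R(2) n(1) _ R(1)] by (auto simp: Aut_def isos_def)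
  qed
  thus 2: "card (isos A B) = card (Aut B)" using bij_betw_same_card by fastforce
  show "wt A = wt B" unfolding wt_def using 1 2 by simp
qed

lemma card_Aut_pos: "rib A \<Longrightarrow> card (Aut A) > 0"
  using rib_finite_isos rg_iso_id unfolding Aut_isos isos_def by (auto simp: card_gt_0_iff)

text \<open>The mechanism behind every normalization below: a set parametrized by the isomorphisms
  between two isomorphic graphs has |Aut| elements, so with weights 1/|Aut| it counts as one
  element.\<close>

lemma wt_sum_isos:
  assumes R: "rib P" "rib Q" and m: "rg_iso P Q m" and X: "X = h ` isos P Q" "inj_on h (isos P Q)"
    and ob: "\<And>i. i \<in> isos P Q \<Longrightarrow> ob (h i) = K" and K: "K = P \<or> K = Q"
  shows "finite X" "(\<Sum>x\<in>X. wt (ob x)) = 1"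
proof -
  show "finite X" using X(1) rib_finite_isos[OF R] by simp
  have "(\<Sum>x\<in>X. wt (ob x)) = (\<Sum>i\<in>isos P Q. wt K)"
    unfolding X(1) sum.reindex[OF X(2)] using ob by (intro sum.cong) auto
  also have "\<dots> = of_nat (card (isos P Q)) * wt K" by simp
  also have "\<dots> = 1"
  proof -
    have "card (isos P Q) = card (Aut K)" "rib K" using card_isos[OF R m] K R by auto
    thus ?thesis using card_Aut_pos[of K] unfolding wt_def by simp
  qed
  finally show "(\<Sum>x\<in>X. wt (ob x)) = 1" .
qed

text \<open>The halves of the new edge can be named arbitrarily, but by
  \<open>expansion_unique\<close> the class of an expansion is determined by the two half-edges of
  \<open>G\<close> that follow them. One expansion is chosen for each pair that occurs.\<close>

lemma finite_expansion_reps: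
  assumes G: "ribbon_graph G"
  obtains Z where "finite Z" "\<And>D g. (D, g) \<in> Z \<Longrightarrow> \<exists>e. one_edge D e G g"
    "\<And>A e f. one_edge A e G f \<Longrightarrow> \<exists>D g m. (D, g) \<in> Z \<and> rg_iso A D m \<and> g \<circ>\<^sub>m m = f"
proof -
  define P where "P p z \<longleftrightarrow> (\<exists>a b. expansion (fst z) a b G (snd z) \<and> snd z (nxt (fst z) a) = Some (fst p) \<and>
      snd z (nxt (fst z) b) = Some (snd p))" for p :: "'a \<times> 'a" and z
  define Z where "Z = (\<lambda>p. SOME z. P p z) ` {p \<in> halfs G \<times> halfs G. \<exists>z. P p z}"
  have "rib G" using G ribbon_graph_iff by blast
  hence "finite (halfs G \<times> halfs G)" using finite_halfs[OF rib_is_graph] by blast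
  hence fin: "finite Z" unfolding Z_def by simp
  have edge: "\<exists>e. one_edge D e G g" if "(D, g) \<in> Z" for D g
  proof -
    from that obtain p where p: "(D, g) = (SOME z. P p z)" "p \<in> {p \<in> halfs G \<times> halfs G. \<exists>z. P p z}"
      unfolding Z_def by (rule imageE)
    hence "\<exists>z. P p z" by blast
    hence "P p (D, g)" unfolding p(1) by (rule someI_ex)
    then obtain a b where "expansion D a b G g" unfolding P_def by auto
    from expansion_one_edge[OF this G] show ?thesis by blast
  qed
  have reps: "\<exists>D g m. (D, g) \<in> Z \<and> rg_iso A D m \<and> g \<circ>\<^sub>m m = f" if o: "one_edge A e G f" for A e f
  proof -
    obtain a b where ex: "expansion A a b G f" using one_edge_expansion[OF o] by metis
    then interpret expansion A a b G f .
    let ?p = "(j (nxt A a), j (nxt A b))"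
    have s: "f (nxt A a) = Some (fst ?p)" "f (nxt A b) = Some (snd ?p)"
      using rg_iso_Some[OF iso nxt_a_in] rg_iso_Some[OF iso nxt_b_in] by auto
    have P: "P ?p (A, f)" unfolding P_def using ex s by auto
    obtain D g where D: "(SOME z. P ?p z) = (D, g)" by (cases "SOME z. P ?p z")
    have "P ?p (D, g)" using someI[of "P ?p", OF P] D by simp
    then obtain a' b' where D': "expansion D a' b' G g" "g (nxt D a') = Some (fst ?p)" "g (nxt D b') = Some (snd ?p)"
      unfolding P_def by auto
    obtain m where "rg_iso A D m" "g \<circ>\<^sub>m m = f" using expansion_unique[OF ex D'(1)] s D'(2,3) by metis
    moreover have "?p \<in> halfs G \<times> halfs G" using rg_iso_in[OF iso nxt_a_in] rg_iso_in[OF iso nxt_b_in] by simp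
    hence "(D, g) \<in> Z" unfolding Z_def D[symmetric] using P by blast
    ultimately show ?thesis by blast
  qed
  show thesis by (rule that[OF fin edge reps])
qed

section \<open>Weighted factorizations of morphisms through a skeleton\<close>

locale skeleton =
  fixes S :: "'h::infinite rgraph set"
  assumes S: "is_skeleton S"
begin

lemma S_ribbon: "G \<in> S \<Longrightarrow> ribbon_graph G" and S_rib: "G \<in> S \<Longrightarrow> rib G"
  using S unfolding is_skeleton_def ribbon_graph_iff by auto

lemma rep: 
  assumes "ribbon_graph G" obtains B m where "B \<in> S" "rg_iso G B m"
  using S assms unfolding is_skeleton_def by blast

lemma rep_unique: 
  assumes "ribbon_graph G" "B \<in> S" "rg_iso G B m" "B' \<in> S" "rg_iso G B' m'" shows "B = B'"
  using S assms unfolding is_skeleton_def by blast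

text \<open>The middle graph must be the representative of \<open>G\<close>. Its isomorphism
  \<open>a\<close> to \<open>G\<close> is free, and the first factor is then the inverse of
  \<open>a\<close> after \<open>f\<close>, so the factorizations are parametrized by
  isomorphisms.\<close>

lemma last_face_count:
  assumes f: "fat_mor C G f"
  defines "X \<equiv> {(B, a, m). B \<in> S \<and> fat_mor B G a \<and> codim B = codim G \<and> fat_mor C B m \<and> a \<circ>\<^sub>m m = f}"
  shows "finite X" "(\<Sum>(B, a, m)\<in>X. wt B) = 1"
proof -
  note R = fat_mor_ribbon[OF f]
  obtain B0 m0 where B0: "B0 \<in> S" "rg_iso G B0 m0" using rep R(2) by blast
  obtain i0 where i0: "rg_iso B0 G i0" using rg_iso_inverse[OF R(4) S_rib[OF B0(1)] B0(2)] by blast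
  define ivs where "ivs i = (SOME n. rg_iso G B0 n \<and> n \<circ>\<^sub>m i = idm B0 \<and> i \<circ>\<^sub>m n = idm G)" for i
  have ivs: "rg_iso G B0 (ivs i) \<and> ivs i \<circ>\<^sub>m i = idm B0 \<and> i \<circ>\<^sub>m ivs i = idm G" if i: "rg_iso B0 G i" for i
  proof -
    obtain n where "rg_iso G B0 n" "n \<circ>\<^sub>m i = idm B0" "i \<circ>\<^sub>m n = idm G"
      using rg_iso_inverse[OF S_rib[OF B0(1)] R(4) i] by metis
    hence "\<exists>n. rg_iso G B0 n \<and> n \<circ>\<^sub>m i = idm B0 \<and> i \<circ>\<^sub>m n = idm G" by blast
    from someI_ex[OF this] show ?thesis unfolding ivs_def .
  qed
  let ?h = "\<lambda>i. (B0, i, ivs i \<circ>\<^sub>m f)"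
  have X: "X = ?h ` isos B0 G"
  proof (intro equalityI subsetI)
    fix x assume "x \<in> X"
    then obtain B a m where x: "x = (B, a, m)" "B \<in> S" "fat_mor B G a" "codim B = codim G" "fat_mor C B m" "a \<circ>\<^sub>m m = f"
      unfolding X_def by auto
    have a: "rg_iso B G a" using fat_mor_iso[OF x(3,4)] .
    then obtain n where "rg_iso G B n" using rg_iso_inverse[OF S_rib[OF x(2)] R(4)] by blast
    hence "B = B0" using rep_unique[OF R(2) x(2) _ B0] by blast
    note i = ivs[OF a[unfolded this]]
    have "ivs a \<circ>\<^sub>m f = (ivs a \<circ>\<^sub>m a) \<circ>\<^sub>m m" unfolding x(6)[symmetric] map_comp_assoc ..
    also have "\<dots> = m" using i fat_mor_domran(2)[OF x(5)] \<open>B = B0\<close> by simp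
    finally show "x \<in> ?h ` isos B0 G" using x(1) a \<open>B = B0\<close> unfolding isos_def by auto
  next
    fix x assume "x \<in> ?h ` isos B0 G"
    then obtain i where i: "rg_iso B0 G i" "x = (B0, i, ivs i \<circ>\<^sub>m f)" unfolding isos_def by auto
    note v = ivs[OF i(1)]
    have "fat_mor C B0 (ivs i \<circ>\<^sub>m f)"
      using fat_mor_comp[OF f rg_iso_fat_mor[OF R(2) S_ribbon[OF B0(1)]]] v by blast
    moreover have "i \<circ>\<^sub>m (ivs i \<circ>\<^sub>m f) = f"
      using v fat_mor_domran(2)[OF f] by (simp add: map_comp_assoc[symmetric])
    ultimately show "x \<in> X" unfolding X_def i(2)
      using B0(1) rg_iso_fat_mor[OF S_ribbon[OF B0(1)] R(2) i(1)] rg_iso_codim[OF S_rib[OF B0(1)] i(1)] by simp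
  qed
  have "inj_on ?h (isos B0 G)" by (auto simp: inj_on_def)
  from wt_sum_isos[OF S_rib[OF B0(1)] R(4) i0 X this, of fst B0]
  show "finite X" "(\<Sum>(B, a, m)\<in>X. wt B) = 1" by (auto simp: case_prod_beta)
qed

text \<open>The middle graph is the representative of the graph left by collapsing \<open>e\<close>.
  Here the first factor is free, being given by an isomorphism, and determines the second since
  morphisms can be cancelled on the right.\<close>

lemma factor_count:
  assumes R: "ribbon_graph A" "ribbon_graph C" and c: "collapsible A [e, e2]"
    and h: "rg_iso (collapse_edge (collapse_edge A e) e2) C h"
  defines "X \<equiv> {(B, f, m). B \<in> S \<and> fat_mor B C f \<and> one_edge A e B m \<and> f \<circ>\<^sub>m m = h}"
  shows "finite X" "(\<Sum>(B, f, m)\<in>X. wt B) = 1"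
proof -
  have RA: "rib A" "rib C" using R ribbon_graph_iff by auto
  let ?A = "collapse_edge A e"
  have A: "ribbon_graph ?A" "rib ?A" using foldl_collapse[OF RA(1), of "[e]"] c R by auto
  have fh: "fat_mor ?A C h" unfolding fat_mor_iff using A R c h by (auto intro!: exI[of _ "[e2]"])
  obtain B0 i0 where B0: "B0 \<in> S" "rg_iso ?A B0 i0" using rep A(1) by blast
  note RB = S_ribbon[OF B0(1)] S_rib[OF B0(1)]
  have ex: "\<exists>f. fat_mor B0 C f \<and> f \<circ>\<^sub>m i = h" if i: "rg_iso ?A B0 i" for i
  proof -
    obtain n where n: "rg_iso B0 ?A n" "n \<circ>\<^sub>m i = idm ?A" using rg_iso_inverse[OF A(2) RB(2) i] by blast
    have "fat_mor B0 C (h \<circ>\<^sub>m n)" using fat_mor_comp[OF rg_iso_fat_mor[OF RB(1) A(1) n(1)] fh] .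
    moreover have "(h \<circ>\<^sub>m n) \<circ>\<^sub>m i = h" using n(2) fat_mor_domran(1)[OF fh] by (simp add: map_comp_assoc)
    ultimately show ?thesis by blast
  qed
  define F where "F i = (SOME f. fat_mor B0 C f \<and> f \<circ>\<^sub>m i = h)" for i
  have F: "fat_mor B0 C (F i) \<and> F i \<circ>\<^sub>m i = h" if "rg_iso ?A B0 i" for i
    unfolding F_def using ex[OF that] by (rule someI_ex)
  let ?h = "\<lambda>i. (B0, F i, i)"
  have X: "X = ?h ` isos ?A B0"
  proof (intro equalityI subsetI)
    fix x assume "x \<in> X"
    then obtain B f m where x: "x = (B, f, m)" "B \<in> S" "fat_mor B C f" "one_edge A e B m" "f \<circ>\<^sub>m m = h"
      unfolding X_def by auto
    note m = one_edgeD(7)[OF x(4)]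
    have "B = B0" using rep_unique[OF A(1) x(2) m B0] .
    note FF = F[OF m[unfolded this]]
    have "f = F m"
    proof (rule map_comp_cancel)
      show "dom f \<subseteq> ran m" "dom (F m) \<subseteq> ran m"
        using fat_mor_domran(1)[OF x(3)] fat_mor_domran(1)[OF conjunct1[OF FF]] rg_iso_ran[OF m] \<open>B = B0\<close> by auto
      show "f \<circ>\<^sub>m m = F m \<circ>\<^sub>m m" using x(5) FF by simp
    qed
    thus "x \<in> ?h ` isos ?A B0" using x(1) m \<open>B = B0\<close> unfolding isos_def by auto
  next
    fix x assume "x \<in> ?h ` isos ?A B0"
    then obtain i where i: "rg_iso ?A B0 i" "x = (B0, F i, i)" unfolding isos_def by auto
    have "one_edge A e B0 i" unfolding one_edge_def using R RB c i by auto
    thus "x \<in> X" unfolding X_def i(2) using F[OF i(1)] B0(1) by simp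
  qed
  have "inj_on ?h (isos ?A B0)" by (auto simp: inj_on_def)
  from wt_sum_isos[OF A(2) RB(2) B0(2) X this, of fst B0]
  show "finite X" "(\<Sum>(B, f, m)\<in>X. wt B) = 1" by (auto simp: case_prod_beta)
qed

definition pm :: "bool \<Rightarrow> rat" where "pm b = (if b then 1 else - 1)"

lemma pm_not: "pm (\<not> b) = - pm b" by (simp add: pm_def)

lemma pm_orient:
  assumes "\<omega> \<in> orientations G" "\<omega>' \<in> orientations G" "ribbon_graph G"
  shows "pm (rev_or G \<omega>' = \<omega>) = - pm (\<omega>' = \<omega>)"
proof -
  note c = ribbon_card_basis[OF assms(3)]
  have "rev_or G \<omega>' = \<omega> \<longleftrightarrow> \<not> \<omega>' = \<omega>"
    using orient_or_rev[OF assms(2,1) c] orient_rev(3)[OF assms(2) c] by metis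
  thus ?thesis by (simp add: pm_not)
qed

text \<open>A collapse of two edges factors through the collapse of either one first. Each kind has
  total weight 1 and a constant sign, and the two signs are opposite.\<close>

lemma factor_cancel:
  assumes h: "fat_mor A C h" and cd: "codim C = Suc (Suc (codim A))"
    and w: "\<omega>\<^sub>0 \<in> orientations A" "\<omega> \<in> orientations C"
  defines "X \<equiv> {(B, f, m). B \<in> S \<and> codim B = Suc (codim A) \<and> fat_mor B C f \<and> fat_mor A B m \<and> f \<circ>\<^sub>m m = h}"
  shows "(\<Sum>(B, f, m)\<in>X. wt B * pm (induced_or B f (induced_or A m \<omega>\<^sub>0) = \<omega>)) = 0"
proof -
  note R = fat_mor_ribbon[OF h]
  obtain e1 e2 where e: "collapsible A [e1, e2]" "rg_iso (collapse_edge (collapse_edge A e1) e2) C h"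
    "e1 \<noteq> e2" "collapsed A h = {e1, e2}" using fat_mor_two_edges[OF h cd] by metis
  note e' = collapse_commute[OF R(3) e(1)]
  define Y where "Y e = {(B, f, m). B \<in> S \<and> fat_mor B C f \<and> one_edge A e B m \<and> f \<circ>\<^sub>m m = h}" for e
  let ?sg = "\<lambda>(B, f, m). pm (induced_or B f (induced_or A m \<omega>\<^sub>0) = \<omega>)"
  have Yc: "finite (Y e1)" "(\<Sum>(B, f, m)\<in>Y e1. wt B) = 1" "finite (Y e2)" "(\<Sum>(B, f, m)\<in>Y e2. wt B) = 1"
    unfolding Y_def using factor_count[OF R(1,2) e(1,2)] factor_count[OF R(1,2) e'(1) e(2)[unfolded e'(2)]] by auto
  have two: "\<exists>eB. one_edge A e B m \<and> one_edge B eB C f" if "(B, f, m) \<in> Y e" for B f m e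
  proof -
    have y: "fat_mor B C f" "one_edge A e B m" using that unfolding Y_def by auto
    have "codim C = Suc (codim B)" using cd one_edgeD(10)[OF y(2)] by simp
    thus ?thesis using fat_mor_one_edge[OF y(1)] y(2) by metis
  qed
  have XY: "X = Y e1 \<union> Y e2" "Y e1 \<inter> Y e2 = {}"
  proof -
    show "X = Y e1 \<union> Y e2"
    proof (intro equalityI subsetI)
      fix x assume "x \<in> X"
      then obtain B f m where x: "x = (B, f, m)" "B \<in> S" "codim B = Suc (codim A)" "fat_mor B C f" "fat_mor A B m"
        "f \<circ>\<^sub>m m = h" unfolding X_def by auto
      obtain e where m: "one_edge A e B m" using fat_mor_one_edge[OF x(5,3)] by metis
      hence "(B, f, m) \<in> Y e" unfolding Y_def using x by auto
      then obtain eB where "one_edge B eB C f" using two by blast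
      then obtain e3 where "collapsed A (f \<circ>\<^sub>m m) = {e, e3}" using two_steps[OF m _ w(1)] by metis
      hence "e = e1 \<or> e = e2" using x(6) e(4) by auto
      thus "x \<in> Y e1 \<union> Y e2" using \<open>(B, f, m) \<in> Y e\<close> x(1) by auto
    next
      fix x assume "x \<in> Y e1 \<union> Y e2"
      then obtain B f m e where x: "x = (B, f, m)" "B \<in> S" "fat_mor B C f" "one_edge A e B m" "f \<circ>\<^sub>m m = h"
        unfolding Y_def by blast
      thus "x \<in> X" unfolding X_def using one_edgeD(8,10)[OF x(4)] by simp
    qed
    show "Y e1 \<inter> Y e2 = {}"
    proof (rule Int_emptyI)
      fix x assume x: "x \<in> Y e1" "x \<in> Y e2"
      obtain B f m where "x = (B, f, m)" by (cases x)
      hence "one_edge A e1 B m" "one_edge A e2 B m" using x unfolding Y_def by simp_all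
      hence "{e1} = {e2}" using one_edgeD(9) by metis
      thus False using e(3) by simp
    qed
  qed
  \<comment> \<open>Once \<open>e\<close> is collapsed first, the other edge is known, and the final
    orientation depends only on the edges and on \<open>h\<close>.\<close>
  have same: "induced_or B f (induced_or A m \<omega>\<^sub>0) = induced_or B' f' (induced_or A m' \<omega>\<^sub>0)"
    if y: "(B, f, m) \<in> Y e" "(B', f', m') \<in> Y e" for B f m B' f' m' e
  proof -
    obtain eB where t: "one_edge A e B m" "one_edge B eB C f" using two[OF y(1)] by blast
    obtain eB' where t': "one_edge A e B' m'" "one_edge B' eB' C f'" using two[OF y(2)] by blast
    have hh: "f \<circ>\<^sub>m m = h" "f' \<circ>\<^sub>m m' = h" using y unfolding Y_def by auto
    obtain d where d: "collapsible A [e, d]" "e \<noteq> d" "collapsed A (f \<circ>\<^sub>m m) = {e, d}"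
      "induced_or B f (induced_or A m \<omega>\<^sub>0) = transport (f \<circ>\<^sub>m m) (collapse_or (collapse_edge A e) d (collapse_or A e \<omega>\<^sub>0))"
      using two_steps[OF t w(1)] by metis
    obtain d' where d': "collapsible A [e, d']" "e \<noteq> d'" "collapsed A (f' \<circ>\<^sub>m m') = {e, d'}"
      "induced_or B' f' (induced_or A m' \<omega>\<^sub>0) = transport (f' \<circ>\<^sub>m m') (collapse_or (collapse_edge A e) d' (collapse_or A e \<omega>\<^sub>0))"
      using two_steps[OF t' w(1)] by metis
    have "d = d'" using d(2,3) d'(2,3) hh by (metis doubleton_eq_iff)
    thus ?thesis using d d' hh by simp
  qed
  have sum: "(\<Sum>x\<in>Y e. wt (fst x) * ?sg x) = ?sg y" if y: "y \<in> Y e" and s1: "(\<Sum>(B, f, m)\<in>Y e. wt B) = 1" for y e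
  proof -
    have "(\<Sum>x\<in>Y e. wt (fst x) * ?sg x) = (\<Sum>x\<in>Y e. wt (fst x) * ?sg y)"
    proof (rule sum.cong[OF refl])
      fix x assume x: "x \<in> Y e"
      obtain B f m B' f' m' where xy: "x = (B, f, m)" "y = (B', f', m')" by (cases x; cases y) auto
      show "wt (fst x) * ?sg x = wt (fst x) * ?sg y" using same[of B f m e B' f' m'] x y unfolding xy by simp
    qed
    also have "\<dots> = (\<Sum>x\<in>Y e. wt (fst x)) * ?sg y" by (simp add: sum_distrib_right)
    also have "(\<Sum>x\<in>Y e. wt (fst x)) = 1" using s1 by (simp add: case_prod_beta)
    finally show ?thesis by simp
  qed
  have "Y e1 \<noteq> {}" "Y e2 \<noteq> {}" using Yc by auto
  then obtain y1 y2 where y: "y1 \<in> Y e1" "y2 \<in> Y e2" by blast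
  obtain B f m B' f' m' where yy: "y1 = (B, f, m)" "y2 = (B', f', m')" by (cases y1; cases y2) auto
  obtain eB where t: "one_edge A e1 B m" "one_edge B eB C f" using two y yy by blast
  obtain eB' where t': "one_edge A e2 B' m'" "one_edge B' eB' C f'" using two y yy by blast
  have eq: "f \<circ>\<^sub>m m = f' \<circ>\<^sub>m m'" using y yy unfolding Y_def by auto
  have "induced_or B' f' (induced_or A m' \<omega>\<^sub>0) = rev_or C (induced_or B f (induced_or A m \<omega>\<^sub>0))"
    by (rule two_steps_anticommute[OF t t' eq e(3) w(1)])
  moreover have "induced_or B f (induced_or A m \<omega>\<^sub>0) \<in> orientations C"
    using induced_or_facts(1)[OF step_mor_one_edge[OF t(2)] induced_or_facts(1)[OF step_mor_one_edge[OF t(1)] w(1)]] .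
  ultimately have "?sg y2 = - ?sg y1" using pm_orient[OF w(2) _ R(2)] yy by simp
  moreover have "(\<Sum>x\<in>X. wt (fst x) * ?sg x) = ?sg y1 + ?sg y2"
    unfolding XY(1) sum.union_disjoint[OF Yc(1,3) XY(2)] using sum[OF y(1) Yc(2)] sum[OF y(2) Yc(4)] by simp
  ultimately show ?thesis by (simp add: case_prod_beta)
qed

definition over_exp :: "'h rgraph \<Rightarrow> 'h rgraph \<Rightarrow> 'h pmap \<Rightarrow> ('h rgraph \<times> 'h pmap) set" where
  "over_exp B D g = {(A, f). A \<in> S \<and> (\<exists>i. rg_iso A D i \<and> f = g \<circ>\<^sub>m i)}"

text \<open>Rigidity of expansions makes the parametrization by isomorphisms injective, so an
  expansion class also has total weight 1.\<close>

lemma over_exp_count: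
  assumes o: "one_edge D e B g"
  shows "finite (over_exp B D g)" "(\<Sum>(A, f)\<in>over_exp B D g. wt A) = 1"
proof -
  note R = one_edgeD[OF o]
  obtain A0 m0 where A0: "A0 \<in> S" "rg_iso D A0 m0" using rep R(3) by blast
  obtain i0 where i0: "rg_iso A0 D i0" using rg_iso_inverse[OF R(1) S_rib[OF A0(1)] A0(2)] by blast
  have X: "over_exp B D g = (\<lambda>i. (A0, g \<circ>\<^sub>m i)) ` isos A0 D"
  proof -
    have A: "A = A0" if A: "A \<in> S" "rg_iso A D i" for A i
    proof -
      obtain n where "rg_iso D A n" using rg_iso_inverse[OF S_rib[OF A(1)] R(1) A(2)] by blast
      thus ?thesis using rep_unique[OF R(3) A(1) _ A0] by blast
    qed
    show ?thesis
    proof (intro equalityI subsetI)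
      fix x assume "x \<in> over_exp B D g"
      then obtain A i where x: "x = (A, g \<circ>\<^sub>m i)" "A \<in> S" "rg_iso A D i" unfolding over_exp_def by auto
      thus "x \<in> (\<lambda>i. (A0, g \<circ>\<^sub>m i)) ` isos A0 D" using A[OF x(2,3)] unfolding isos_def by auto
    qed (use A0(1) in \<open>auto simp: over_exp_def isos_def\<close>)
  qed
  have "inj_on (\<lambda>i. (A0, g \<circ>\<^sub>m i)) (isos A0 D)"
    using one_edge_rigid[OF o _ _ S_rib[OF A0(1)]] unfolding inj_on_def isos_def by auto
  from wt_sum_isos[OF S_rib[OF A0(1)] R(1) i0 X this, of fst A0]
  show "finite (over_exp B D g)" "(\<Sum>(A, f)\<in>over_exp B D g. wt A) = 1" by (auto simp: case_prod_beta)
qed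

definition objs :: "nat \<Rightarrow> 'h rgraph \<Rightarrow> ('h rgraph \<times> 'h pmap) set" where
  "objs k G = {(B, a). B \<in> S \<and> codim B = k \<and> fat_mor B G a}"

lemma objs_same_codim:
  assumes G: "ribbon_graph G" and B0: "B0 \<in> S" "rg_iso G B0 m0"
  shows "objs (codim G) G = (\<lambda>i. (B0, i)) ` isos B0 G"
proof (intro equalityI subsetI)
  have R: "rib G" using G ribbon_graph_iff by blast
  fix x assume "x \<in> objs (codim G) G"
  then obtain B a where x: "x = (B, a)" "B \<in> S" "codim B = codim G" "fat_mor B G a" unfolding objs_def by auto
  have a: "rg_iso B G a" using fat_mor_iso[OF x(4,3)] .
  then obtain n where "rg_iso G B n" using rg_iso_inverse[OF S_rib[OF x(2)] R] by blast
  hence "B = B0" using rep_unique[OF G x(2) _ B0] by blast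
  thus "x \<in> (\<lambda>i. (B0, i)) ` isos B0 G" using x(1) a unfolding isos_def by auto
next
  fix x assume "x \<in> (\<lambda>i. (B0, i)) ` isos B0 G"
  then obtain i where i: "x = (B0, i)" "rg_iso B0 G i" unfolding isos_def by auto
  show "x \<in> objs (codim G) G" unfolding objs_def i(1)
    using B0(1) rg_iso_fat_mor[OF S_ribbon[OF B0(1)] G i(2)] rg_iso_codim[OF S_rib[OF B0(1)] i(2)] by simp
qed

text \<open>In this range the morphism is an isomorphism or collapses one edge, or does not exist.
  The latter kind falls into finitely many expansion classes.\<close>

lemma finite_objs:
  assumes "codim G \<le> Suc k" shows "finite (objs k G)"
proof (cases "ribbon_graph G")
  case False
  hence "objs k G = {}" unfolding objs_def fat_mor_def by auto
  thus ?thesis by simp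
next
  case G: True
  have RG: "rib G" using G ribbon_graph_iff by blast
  consider "codim G < k" | "codim G = k" | "codim G = Suc k" using assms by linarith
  thus ?thesis
  proof cases
    case 1
    hence "objs k G = {}" unfolding objs_def using fat_mor_domran(3) by fastforce
    thus ?thesis by simp
  next
    case 2
    obtain B0 m0 where B0: "B0 \<in> S" "rg_iso G B0 m0" using rep G by blast
    show ?thesis using objs_same_codim[OF G B0] rib_finite_isos[OF S_rib[OF B0(1)] RG] 2 by simp
  next
    case 3
    obtain Z where Z: "finite Z" "\<And>D g. (D, g) \<in> Z \<Longrightarrow> \<exists>e. one_edge D e G g"
      "\<And>A e f. one_edge A e G f \<Longrightarrow> \<exists>D g m. (D, g) \<in> Z \<and> rg_iso A D m \<and> g \<circ>\<^sub>m m = f"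
      using finite_expansion_reps[OF G] by metis
    have "objs k G \<subseteq> (\<Union>z\<in>Z. over_exp G (fst z) (snd z))"
    proof
      fix x assume "x \<in> objs k G"
      then obtain A f where x: "x = (A, f)" "A \<in> S" "codim A = k" "fat_mor A G f" unfolding objs_def by auto
      obtain e where "one_edge A e G f" using fat_mor_one_edge[OF x(4)] x(3) 3 by metis
      then obtain D g m where "(D, g) \<in> Z" "rg_iso A D m" "g \<circ>\<^sub>m m = f" using Z(3) by blast
      thus "x \<in> (\<Union>z\<in>Z. over_exp G (fst z) (snd z))" unfolding over_exp_def x(1) using x(2) by force
    qed
    moreover have "finite (over_exp G (fst z) (snd z))" if "z \<in> Z" for z
      using Z(2)[of "fst z" "snd z"] that over_exp_count(1) by auto
    ultimately show ?thesis using Z(1) finite_subset by blast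
  qed
qed

lemma induced_or_over_exp:
  assumes o: "one_edge D e B g" and c: "codim D = 0" and x: "(A, f) \<in> over_exp B D g"
  shows "induced_or A f (natural_or A) = induced_or D g (natural_or D)" "fat_mor A B f" "codim A = 0"
proof -
  note R = one_edgeD[OF o]
  obtain i where i: "A \<in> S" "rg_iso A D i" "f = g \<circ>\<^sub>m i" using x unfolding over_exp_def by auto
  note RA = S_ribbon[OF i(1)] S_rib[OF i(1)]
  show cA: "codim A = 0" using rg_iso_codim[OF RA(2) i(2)] c by simp
  have "natural_or A \<in> orientations A" by (rule natural_or_orientation[OF RA(2) cA])
  thus "induced_or A f (natural_or A) = induced_or D g (natural_or D)"
    using one_edge_comp_iso(2)[OF o i(2) RA(1)] natural_or_transport[OF RA(2) R(1) i(2) cA] i(3) by simp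
  show "fat_mor A B f" using fat_mor_comp[OF rg_iso_fat_mor[OF RA(1) R(3) i(2)] R(8)] i(3) by simp
qed

end

section \<open>Splitting vertices of valence at least 4\<close>

lemma exists_big_vertex:
  assumes "codim G \<noteq> 0" obtains v h where "v \<in> verts G" "card v \<ge> 4" "h \<in> v"
proof -
  have "\<exists>v\<in>verts G. card v \<ge> 4"
  proof (rule ccontr)
    assume "\<not> ?thesis"
    hence "card v - 3 = 0" if "v \<in> verts G" for v using that by force
    hence "codim G = 0" unfolding codim_def by simp
    thus False using assms by simp
  qed
  then obtain v where v: "v \<in> verts G" "card v \<ge> 4" by blast
  hence "v \<noteq> {}" by auto
  thus thesis using that v by blast
qed

lemma exists_new_pair:
  fixes A :: "'a::infinite set"
  assumes "finite A" obtains a b where "a \<noteq> b" "a \<notin> A" "b \<notin> A"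
proof -
  obtain a where a: "a \<notin> A" using ex_new_if_finite[OF infinite_UNIV assms] by blast
  have "finite (insert a A)" using assms by simp
  from ex_new_if_finite[OF infinite_UNIV this] show thesis using that a by blast
qed

text \<open>The vertex is cut before \<open>h\<close> and before the half-edge two places later. One
  arc has two half-edges, and the other has at least two by the bound on the valence.\<close>

lemma split_big_vertex:
  assumes B: "ribbon_graph B" and v: "v \<in> verts B" "card v \<ge> 4" and h: "h \<in> v"
    and ab: "a \<noteq> b" "a \<notin> halfs B" "b \<notin> halfs B"
  shows "\<exists>A. expansion A a b B (idm B) \<and> nxt A a = h \<and> nxt A b = nxt B (nxt B h)"
proof -
  have R: "rib B" using B ribbon_graph_iff by blast
  let ?n = "nxt B"
  have hB: "h \<in> halfs B" using h v vert_subset[OF rib_is_graph[OF R]] by blast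
  have nv: "?n z \<in> v" if "z \<in> v" for z using nxt_vert[OF R v(1) that] .
  have nB: "?n z \<in> halfs B" if "z \<in> halfs B" for z using that nxt_halfs[OF R] by simp
  have n3: "?n (?n (?n h)) \<noteq> h"
  proof
    assume *: "?n (?n (?n h)) = h"
    have "{h, ?n h, ?n (?n h)} = v"
      by (rule cyclic_on_invariant[OF cyclic_vert[OF R v(1)]]) (use * h nv in auto)
    moreover have "card {h, ?n h, ?n (?n h)} \<le> 3" by (simp add: card_insert_if)
    ultimately show False using v(2) by simp
  qed
  show ?thesis using nxt_nxt_neq[OF R hB] nxt_neq[OF R nB[OF hB]] n3 ab h nv
    by (intro expansion_exists[OF B v(1)]) (simp_all add: eq_commute[of h] eq_commute[of "?n h"])
qed

lemma codim_1_unique: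
  assumes "is_graph B" "codim B = 1" "v \<in> verts B" "card v \<ge> 4" "w \<in> verts B" "card w \<ge> 4"
  shows "v = w"
proof (rule ccontr)
  assume "v \<noteq> w"
  have "(\<Sum>u\<in>{v, w}. card u - 3) \<le> codim B" unfolding codim_def
    by (rule sum_mono2) (use finite_verts[OF assms(1)] assms in auto)
  thus False using \<open>v \<noteq> w\<close> assms by simp
qed

lemma card_vm_image:
  assumes "expansion A a b B f"
  shows "(\<lambda>x. the (f x)) ` (vert_of A a \<union> vert_of A b - {a, b}) \<in> verts B"
    "card ((\<lambda>x. the (f x)) ` (vert_of A a \<union> vert_of A b - {a, b})) \<ge> 4"
proof -
  interpret expansion A a b B f by fact
  have vm: "vm \<in> verts G'" using verts' by blast
  have eq: "(\<lambda>x. j x) ` vm = (the \<circ> f) ` vm" by auto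
  show "(\<lambda>x. j x) ` vm \<in> verts B" unfolding eq by (rule rg_iso_vert[OF iso vm])
  have "inj_on (the \<circ> f) vm"
    by (rule inj_on_subset[OF bij_betw_imp_inj_on[OF rg_iso_bij[OF iso]] vert_subset[OF is_graph' vm]])
  from card_image[OF this] show "card ((\<lambda>x. j x) ` vm) \<ge> 4" unfolding eq using card_vm(2) by simp
qed

context skeleton
begin

text \<open>The only vertex that is not trivalent has valence 4 and splits in two ways. Their
  reference orderings in \<open>natural_induced\<close> begin one half-edge apart, and rotating four
  half-edges is odd, so the induced orientations are opposite while both classes have weight
  1.\<close>

lemma trivalent_cancel:
  assumes B: "ribbon_graph B" and c: "codim B = 1" and w: "\<omega> \<in> orientations B"
  shows "(\<Sum>(A, f)\<in>objs 0 B. wt A * pm (induced_or A f (natural_or A) = \<omega>)) = 0"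
proof -
  have R: "rib B" using B ribbon_graph_iff by blast
  note g = rib_is_graph[OF R]
  let ?n = "nxt B"
  obtain v h where v: "v \<in> verts B" "card v \<ge> 4" and h: "h \<in> v" using exists_big_vertex[of B] c by auto
  have hB: "h \<in> halfs B" using h v vert_subset[OF g] by blast
  have nv: "?n z \<in> v" if "z \<in> v" for z using nxt_vert[OF R v(1) that] .
  have nB: "?n z \<in> halfs B" if "z \<in> halfs B" for z using that nxt_halfs[OF R] by simp
  obtain a b where ab: "a \<noteq> b" "a \<notin> halfs B" "b \<notin> halfs B" using exists_new_pair[OF finite_halfs[OF g]] by blast
  \<comment> \<open>Both splittings of the vertex: the cuts are before the first and third
    half-edge, or before the second and fourth.\<close>
  obtain D1 where D1: "expansion D1 a b B (idm B)" "nxt D1 a = h" "nxt D1 b = ?n (?n h)"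
    using split_big_vertex[OF B v h ab] by blast
  obtain D2 where D2: "expansion D2 a b B (idm B)" "nxt D2 a = ?n h" "nxt D2 b = ?n (?n (?n h))"
    using split_big_vertex[OF B v nv[OF h] ab] by blast
  note o1 = expansion_one_edge[OF D1(1) B] and o2 = expansion_one_edge[OF D2(1) B]
  have c12: "codim D1 = 0" "codim D2 = 0" using one_edgeD(10)[OF o1] one_edgeD(10)[OF o2] c by auto
  obtain vs first where vs: "distinct vs" "set vs = verts B" "\<forall>v\<in>verts B. first v \<in> v" using exists_blks[OF R] by blast
  define ws where "ws = filter (\<lambda>w. w \<noteq> v) vs"
  have ws: "distinct ws" "set ws = verts B - {v}" unfolding ws_def using vs by auto
  define L where "L x = Inl v # map Inr [x, ?n x, ?n (?n x), ?n (?n (?n x))] @ blks B ws first" for x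
  have N: "L (the (f (nxt A a'))) \<in> orderings B" "L (the (f (nxt A a'))) \<notin> induced_or A f (natural_or A)"
    "?n (?n (the (f (nxt A a')))) = the (f (nxt A b'))" "?n (?n (?n (?n (the (f (nxt A a')))))) = the (f (nxt A a'))"
    "the (f (nxt A a')) \<in> v" 
    "v = {the (f (nxt A a')), ?n (the (f (nxt A a'))), ?n (?n (the (f (nxt A a')))), ?n (?n (?n (the (f (nxt A a')))))}"
    if ex: "expansion A a' b' B f" and cA: "codim A = 0" for A a' b' f
  proof -
    have vm: "(\<lambda>x. the (f x)) ` (vert_of A a' \<union> vert_of A b' - {a', b'}) = v"
      using codim_1_unique[OF g c card_vm_image[OF ex] v] .
    note ni = expansion.natural_induced[OF ex cA ws(1) _ vs(3), unfolded vm, OF ws(2)]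
    show "L (the (f (nxt A a'))) \<in> orderings B" unfolding L_def by (rule ni(1))
    show "L (the (f (nxt A a'))) \<notin> induced_or A f (natural_or A)"
      unfolding L_def induced_or_one_edge[OF expansion_one_edge[OF ex B]] by (rule ni(2))
    show "?n (?n (the (f (nxt A a')))) = the (f (nxt A b'))" "?n (?n (?n (?n (the (f (nxt A a')))))) = the (f (nxt A a'))"
      "v = {the (f (nxt A a')), ?n (the (f (nxt A a'))), ?n (?n (the (f (nxt A a')))), ?n (?n (?n (the (f (nxt A a')))))}"
      by (rule ni(3), rule ni(4), rule ni(5))
    thus "the (f (nxt A a')) \<in> v" by blast
  qed
  have idm: "idm B x = Some x" if "x \<in> halfs B" for x using that by simp
  have e1: "the (idm B (nxt D1 a)) = h" "the (idm B (nxt D2 a)) = ?n h"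
    unfolding D1(2) D2(2) using idm[OF hB] idm[OF nB[OF hB]] by auto
  note N1 = N[OF D1(1) c12(1), unfolded e1] and N2 = N[OF D2(1) c12(2), unfolded e1]
  let ?w1 = "induced_or D1 (idm B) (natural_or D1)" and ?w2 = "induced_or D2 (idm B) (natural_or D2)"
  have w1: "?w1 \<in> orientations B"
    by (rule induced_or_facts(1)[OF step_mor_one_edge[OF o1] natural_or_orientation[OF one_edgeD(1)[OF o1] c12(1)]])
  have w2: "?w2 \<in> orientations B"
    by (rule induced_or_facts(1)[OF step_mor_one_edge[OF o2] natural_or_orientation[OF one_edgeD(1)[OF o2] c12(2)]])
  \<comment> \<open>One half-edge passes three others, an odd exchange that relates the two
    reference orderings.\<close>
  have Lr: "L h = [Inl v] @ [Inr h] @ [Inr (?n h), Inr (?n (?n h)), Inr (?n (?n (?n h)))] @ blks B ws first"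
    "L (?n h) = [Inl v] @ [Inr (?n h), Inr (?n (?n h)), Inr (?n (?n (?n h)))] @ [Inr h] @ blks B ws first"
    unfolding L_def using N1(4) by simp_all
  have "L (?n h) \<in> ?w1 \<longleftrightarrow> L h \<notin> ?w1"
    using orient_block_swap[OF w1, of "[Inl v]" "[Inr h]" "[Inr (?n h), Inr (?n (?n h)), Inr (?n (?n (?n h)))]"
      "blks B ws first"] N1(1) unfolding Lr by simp
  hence "L (?n h) \<in> ?w1" using N1(2) by blast
  hence ne: "?w2 \<noteq> ?w1" using N2(2) by blast
  hence rv: "?w2 = rev_or B ?w1" using orient_or_rev[OF w1 w2 ribbon_card_basis[OF B]] by blast
  have U: "objs 0 B = over_exp B D1 (idm B) \<union> over_exp B D2 (idm B)"
  proof (intro equalityI subsetI)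
    fix x assume "x \<in> objs 0 B"
    then obtain A f where x: "x = (A, f)" "A \<in> S" "codim A = 0" "fat_mor A B f" unfolding objs_def by auto
    have "codim B = Suc (codim A)" using c x(3) by simp
    then obtain e where "one_edge A e B f" using fat_mor_one_edge[OF x(4)] by metis
    then obtain a' b' where ex: "expansion A a' b' B f" "expansion A b' a' B f" using one_edge_expansion by metis
    let ?k = "the (f (nxt A a'))"
    note M = N[OF ex(1) x(3)]
    have ff: "f (nxt A a') = Some ?k" "f (nxt A b') = Some (?n (?n ?k))"
      using rg_iso_Some[OF expansion.iso[OF ex(1)] expansion.nxt_a_in[OF ex(1)]]
        rg_iso_Some[OF expansion.iso[OF ex(1)] expansion.nxt_b_in[OF ex(1)]] M(3) by simp_all
    have i1: "idm B (nxt D1 a) = Some h" "idm B (nxt D1 b) = Some (?n (?n h))"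
      "idm B (nxt D2 a) = Some (?n h)" "idm B (nxt D2 b) = Some (?n (?n (?n h)))"
      unfolding D1(2,3) D2(2,3) using hB nB by simp_all
    \<comment> \<open>A directed expansion has four possible starting places. Opposite places differ
      by the direction of the new edge only, which leaves two classes.\<close>
    have "?k \<in> {h, ?n h, ?n (?n h), ?n (?n (?n h))}" using M(5) N1(6) by metis
    then consider "?k = h" | "?k = ?n h" | "?k = ?n (?n h)" | "?k = ?n (?n (?n h))" by blast
    hence "(\<exists>m. rg_iso A D1 m \<and> idm B \<circ>\<^sub>m m = f) \<or> (\<exists>m. rg_iso A D2 m \<and> idm B \<circ>\<^sub>m m = f)"
    proof cases
      case 1 thus ?thesis using expansion_unique[OF ex(1) D1(1)] ff i1 by metis
    next
      case 2 thus ?thesis using expansion_unique[OF ex(1) D2(1)] ff i1 by metis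
    next
      case 3 thus ?thesis using expansion_unique[OF ex(2) D1(1)] ff i1 N1(4) by metis
    next
      case 4 thus ?thesis using expansion_unique[OF ex(2) D2(1)] ff i1 N1(4) by metis
    qed
    thus "x \<in> over_exp B D1 (idm B) \<union> over_exp B D2 (idm B)" unfolding over_exp_def x(1) using x(2) by blast
  next
    fix x assume "x \<in> over_exp B D1 (idm B) \<union> over_exp B D2 (idm B)"
    moreover obtain A f where x: "x = (A, f)" by (cases x)
    ultimately have "(A, f) \<in> over_exp B D1 (idm B) \<or> (A, f) \<in> over_exp B D2 (idm B)" by blast
    hence "A \<in> S \<and> fat_mor A B f \<and> codim A = 0"
      using induced_or_over_exp(2,3)[OF o1 c12(1), of A f] induced_or_over_exp(2,3)[OF o2 c12(2), of A f]
      unfolding over_exp_def by blast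
    thus "x \<in> objs 0 B" unfolding objs_def x by simp
  qed
  have I: "over_exp B D1 (idm B) \<inter> over_exp B D2 (idm B) = {}"
  proof (rule Int_emptyI)
    fix x assume x: "x \<in> over_exp B D1 (idm B)" "x \<in> over_exp B D2 (idm B)"
    obtain A f where xx: "x = (A, f)" by (cases x)
    show False using induced_or_over_exp(1)[OF o1 c12(1)] induced_or_over_exp(1)[OF o2 c12(2)] x ne unfolding xx by metis
  qed
  have s: "(\<Sum>(A, f)\<in>over_exp B D (idm B). wt A * pm (induced_or A f (natural_or A) = \<omega>)) =
      pm (induced_or D (idm B) (natural_or D) = \<omega>)" if o: "one_edge D {a, b} B (idm B)" and cD: "codim D = 0" for D
  proof -
    have "(\<Sum>(A, f)\<in>over_exp B D (idm B). wt A * pm (induced_or A f (natural_or A) = \<omega>)) =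
        (\<Sum>(A, f)\<in>over_exp B D (idm B). wt A * pm (induced_or D (idm B) (natural_or D) = \<omega>))"
      by (rule sum.cong) (use induced_or_over_exp(1)[OF o cD] in auto)
    also have "\<dots> = (\<Sum>(A, f)\<in>over_exp B D (idm B). wt A) * pm (induced_or D (idm B) (natural_or D) = \<omega>)"
      by (simp add: sum_distrib_right case_prod_beta)
    finally show ?thesis using over_exp_count(2)[OF o] by simp
  qed
  show ?thesis
    unfolding U sum.union_disjoint[OF over_exp_count(1)[OF o1] over_exp_count(1)[OF o2] I] s[OF o1 c12(1)] s[OF o2 c12(2)]
    using pm_orient[OF w w1 B] unfolding rv by simp
qed

end

section \<open>Sequences of graphs and their boundaries\<close>

lemma last_nth: "length xs = Suc n \<Longrightarrow> last xs = xs ! n"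
  by (cases xs rule: rev_cases) auto

definition seq_or :: "'h simplex \<times> 'h pmap \<Rightarrow> 'h ordering set" where
  "seq_or = (\<lambda>((xs, ms), a). foldl (\<lambda>\<omega>' (G, m). induced_or G m \<omega>') (natural_or (xs ! 0)) (zip xs (ms @ [a])))"

definition seq_wt :: "'h simplex \<times> 'h pmap \<Rightarrow> rat" where
  "seq_wt = (\<lambda>((xs, ms), a). \<Prod>G\<leftarrow>xs. wt G)"

text \<open>The composite of the arrows in \<open>ms\<close> in turn, followed by
  \<open>a\<close>.\<close>

definition tail_comp :: "'h pmap list \<Rightarrow> 'h pmap \<Rightarrow> 'h pmap" where
  "tail_comp ms a = foldr (\<lambda>m f. f \<circ>\<^sub>m m) ms a"

text \<open>The tautological lift to the slice category: every graph of the sequence carries its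
  composite morphism to the final target.\<close>

definition lift_seq :: "'h simplex \<times> 'h pmap \<Rightarrow> 'h over_simplex" where
  "lift_seq = (\<lambda>((xs, ms), a). (map (\<lambda>i. (xs ! i, tail_comp (drop i ms) a)) [0..<length xs], ms))"

definition over_act :: "'h pmap \<Rightarrow> 'h over_simplex \<Rightarrow> 'h over_simplex" where
  "over_act f = (\<lambda>(os, ms). (map (\<lambda>(D, a). (D, f \<circ>\<^sub>m a)) os, ms))"

definition cone :: "'h rgraph \<Rightarrow> 'h pmap \<Rightarrow> 'h simplex \<times> 'h pmap \<Rightarrow> 'h simplex \<times> 'h pmap" where
  "cone B a = (\<lambda>((xs, ms), m). ((xs @ [B], ms @ [m]), a))"

text \<open>The cone with apex \<open>(B, a)\<close> on a simplex over \<open>B\<close>: the arrow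
  to the apex is the structure map of the last object. The empty simplex, which arises as the face
  of a 0-simplex, has no such arrow.\<close>

definition over_cone :: "'h rgraph \<Rightarrow> 'h pmap \<Rightarrow> 'h over_simplex \<Rightarrow> 'h over_simplex" where
  "over_cone B a = (\<lambda>(os, ms). (map (\<lambda>(D, f). (D, a \<circ>\<^sub>m f)) os @ [(B, a)],
     if os = [] then [] else ms @ [snd (last os)]))"

lemma tail_comp_snoc: "tail_comp (ms @ [m]) a = a \<circ>\<^sub>m tail_comp ms m"
  unfolding tail_comp_def by (induction ms) (simp_all add: map_comp_assoc)

lemma tail_comp_act: "tail_comp ms (f \<circ>\<^sub>m a) = f \<circ>\<^sub>m tail_comp ms a"
  unfolding tail_comp_def by (induction ms) (simp_all add: map_comp_assoc)

lemma lift_seq_act: "over_act f (lift_seq ((xs, ms), a)) = lift_seq ((xs, ms), f \<circ>\<^sub>m a)"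
  unfolding over_act_def lift_seq_def by (simp add: tail_comp_act)

lemma lift_seq_cone:
  assumes "length xs = Suc (length ms)"
  shows "lift_seq (cone B a ((xs, ms), m)) = over_cone B a (lift_seq ((xs, ms), m))"
proof -
  have "(xs @ [B]) ! i = xs ! i \<and> drop i (ms @ [m]) = drop i ms @ [m]" if "i < length xs" for i
    using that assms by (simp add: nth_append)
  hence "map (\<lambda>i. ((xs @ [B]) ! i, tail_comp (drop i (ms @ [m])) a)) [0..<length xs] =
     map ((\<lambda>(D, f). (D, a \<circ>\<^sub>m f)) \<circ> (\<lambda>i. (xs ! i, tail_comp (drop i ms) m))) [0..<length xs]"
    by (intro map_cong) (auto simp: tail_comp_snoc)
  moreover have "drop (length xs) (ms @ [m]) = []" using assms by simp
  moreover have "last (map (\<lambda>i. (xs ! i, tail_comp (drop i ms) m)) [0..<length xs]) = (last xs, m)"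
    using assms by (simp add: last_map tail_comp_def last_nth[OF assms])
  ultimately show ?thesis using assms
    by (simp add: lift_seq_def cone_def over_cone_def nth_append tail_comp_def)
qed

lemma lift_seq_length: "length (fst (lift_seq ((xs, ms), a))) = length xs" "snd (lift_seq ((xs, ms), a)) = ms"
  unfolding lift_seq_def by auto

lemma lift_seq_last:
  "length xs = Suc (length ms) \<Longrightarrow> last (fst (lift_seq ((xs, ms), a))) = (last xs, a)"
  unfolding lift_seq_def by (simp add: last_map tail_comp_def last_nth)

text \<open>Deleting the apex leaves the base, pushed forward along \<open>a\<close>.\<close>

lemma face_last_over_cone:
  assumes "length os = Suc (length ms)"
  shows "face (Suc (length ms)) (over_cone B a (os, ms)) = over_act a (os, ms)"
proof -
  have "os \<noteq> []" using assms by auto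
  thus ?thesis using assms unfolding face_def over_cone_def over_act_def by (simp add: Let_def)
qed

text \<open>The other faces are cones on faces of the base. If the last object of the base is
  deleted, its structure map is composed with the last arrow, and this gives the structure map of
  the object before it.\<close>

lemma face_over_cone:
  assumes len: "length os = Suc (length ms)" and i: "i \<le> length ms"
    and last: "ms \<noteq> [] \<Longrightarrow> snd (os ! (length ms - 1)) = snd (last os) \<circ>\<^sub>m last ms"
  shows "face i (over_cone B a (os, ms)) = over_cone B a (face i (os, ms))"
proof -
  let ?g = "\<lambda>(D, f). (D, a \<circ>\<^sub>m f)"
  let ?l = "snd (last os)"
  have ne: "os \<noteq> []" using len by auto
  have X: "take i (map ?g os @ [(B, a)]) @ drop (Suc i) (map ?g os @ [(B, a)]) =
      map ?g (take i os @ drop (Suc i) os) @ [(B, a)]"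
    using len i by (simp add: take_map drop_map)
  have F: "face i (us, ns) = (take i us @ drop (Suc i) us, if i = 0 then tl ns else if i = length ns then butlast ns
      else take (i - 1) ns @ [ns ! i \<circ>\<^sub>m ns ! (i - 1)] @ drop (Suc i) ns)" for us and ns :: "'a pmap list"
    unfolding face_def by (simp add: Let_def)
  have oc: "over_cone B a (os, ms) = (map ?g os @ [(B, a)], ms @ [?l])" using ne by (simp add: over_cone_def)
  consider "ms = []" | "ms \<noteq> []" "i = 0" | "ms \<noteq> []" "0 < i" "i < length ms" | "ms \<noteq> []" "i = length ms" using i by linarith
  thus ?thesis
  proof cases
    case 1
    hence "i = 0" using i by simp
    then obtain o1 where "os = [o1]" using len 1 by (metis length_0_conv length_Suc_conv list.size(3))
    thus ?thesis using 1 \<open>i = 0\<close> unfolding face_def over_cone_def by (simp add: Let_def)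
  next
    case 2
    then obtain o1 o2 os' where "os = o1 # o2 # os'" using len by (metis Suc_length_conv length_0_conv neq_Nil_conv)
    thus ?thesis using 2 X unfolding face_def over_cone_def by (simp add: Let_def)
  next
    case 3
    have "take i os @ drop (Suc i) os \<noteq> []" "last (take i os @ drop (Suc i) os) = last os"
      using 3 len by auto
    moreover have "take (i - 1) (ms @ [?l]) @ [(ms @ [?l]) ! i \<circ>\<^sub>m (ms @ [?l]) ! (i - 1)] @ drop (Suc i) (ms @ [?l])
      = (take (i - 1) ms @ [ms ! i \<circ>\<^sub>m ms ! (i - 1)] @ drop (Suc i) ms) @ [?l]"
    proof -
      have "i - 1 < length ms" using 3 by simp
      thus ?thesis using 3 by (simp add: nth_append)
    qed
    ultimately show ?thesis using 3 X ne unfolding face_def over_cone_def by (simp add: Let_def)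
  next
    case 4
    hence e: "take i os @ drop (Suc i) os = butlast os" using len by (simp add: butlast_conv_take)
    have i0: "i \<noteq> 0" using 4 by simp
    have "butlast os \<noteq> []" using 4 len by (cases os) (auto simp: length_Suc_conv)
    moreover have "last (butlast os) = os ! (length ms - 1)"
      using 4 len calculation by (simp add: last_conv_nth nth_butlast)
    moreover have "take (i - 1) (ms @ [?l]) @ [(ms @ [?l]) ! i \<circ>\<^sub>m (ms @ [?l]) ! (i - 1)] @ drop (Suc i) (ms @ [?l])
      = butlast ms @ [?l \<circ>\<^sub>m last ms]"
      using 4 by (simp add: nth_append butlast_conv_take last_conv_nth)
    moreover have "i \<noteq> length (ms @ [?l])" using 4 by simp
    ultimately have "face i (over_cone B a (os, ms)) = (map ?g (butlast os) @ [(B, a)], butlast ms @ [?l \<circ>\<^sub>m last ms])"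
      unfolding oc F X e using i0 by (simp only: if_False)
    moreover have "face i (os, ms) = (butlast os, butlast ms)" unfolding F e using 4 i0 by simp
    ultimately show ?thesis using \<open>butlast os \<noteq> []\<close> \<open>last (butlast os) = _\<close> last[OF 4(1)]
      by (simp add: over_cone_def)
  qed
qed

lemma face_cone:
  assumes len: "length xs = Suc (length ms)"
  shows "i \<le> length ms \<Longrightarrow> face i (lift_seq (cone B a ((xs, ms), m))) = over_cone B a (face i (lift_seq ((xs, ms), m)))"
    "face (Suc (length ms)) (lift_seq (cone B a ((xs, ms), m))) = lift_seq ((xs, ms), a \<circ>\<^sub>m m)"
proof -
  obtain os where os: "lift_seq ((xs, ms), m) = (os, ms)" "length os = Suc (length ms)"
    using lift_seq_length[of xs ms m] len by (metis prod.collapse)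
  have l: "last os = (last xs, m)" using lift_seq_last[OF len, of m] os by simp
  show "face (Suc (length ms)) (lift_seq (cone B a ((xs, ms), m))) = lift_seq ((xs, ms), a \<circ>\<^sub>m m)"
    unfolding lift_seq_cone[OF len] os(1) face_last_over_cone[OF os(2)] by (simp add: os(1)[symmetric] lift_seq_act)
  assume i: "i \<le> length ms"
  have "snd (os ! (length ms - 1)) = snd (last os) \<circ>\<^sub>m last ms" if ms: "ms \<noteq> []"
  proof -
    have "os = map (\<lambda>i. (xs ! i, tail_comp (drop i ms) m)) [0..<length xs]" using os(1) unfolding lift_seq_def by simp
    hence "snd (os ! (length ms - 1)) = tail_comp (drop (length ms - 1) ms) m" using len ms
      nth_upt[of 0 "length ms - 1" "Suc (length ms)"] by (simp del: upt_Suc)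
    also have "drop (length ms - 1) ms = [last ms]"
      using ms by (metis append_butlast_last_id append_eq_conv_conj length_butlast)
    finally show ?thesis using l by (simp add: tail_comp_def)
  qed
  from face_over_cone[OF os(2) i this] show "face i (lift_seq (cone B a ((xs, ms), m))) = over_cone B a (face i (lift_seq ((xs, ms), m)))"
    unfolding lift_seq_cone[OF len] os(1) .
qed

text \<open>A cone appends one graph, so the fold of induced orientations is extended by a single
  step.\<close>

lemma seq_or_cone:
  "length xs = Suc (length ms) \<Longrightarrow> seq_or (cone B a ((xs, ms), m)) = induced_or B a (seq_or ((xs, ms), m))"
proof -
  assume len: "length xs = Suc (length ms)"
  have "zip (xs @ [B]) ((ms @ [m]) @ [a]) = zip xs (ms @ [m]) @ [(B, a)]"
    using zip_append[of xs "ms @ [m]" "[B]" "[a]"] len by simp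
  moreover have "(xs @ [B]) ! 0 = xs ! 0" using len by (simp add: nth_append)
  ultimately show ?thesis unfolding seq_or_def cone_def by (simp only: prod.case foldl_append foldl.simps)
qed

lemma seq_wt_cone: "seq_wt (cone B a t) = wt B * seq_wt t"
  unfolding seq_wt_def cone_def by (cases t) (auto simp: mult.commute)

section \<open>Signed sums over sequences of graphs\<close>

context skeleton
begin

text \<open>Unlike in \<open>D_seqs\<close> the last arrow may be any morphism. The induction needs
  targets of codimension \<open>Suc n\<close> as well, over which the sequences lie after their last
  graph has been deleted.\<close>

definition seqs :: "nat \<Rightarrow> 'h rgraph \<Rightarrow> ('h simplex \<times> 'h pmap) set" where
  "seqs n G = {((xs, ms), a). (xs, ms) \<in> nerve S fat_mor n \<and> (\<forall>i\<le>n. codim (xs ! i) = i) \<and>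
     fat_mor (xs ! n) G a}"

lemma seqs_length: "((xs, ms), a) \<in> seqs n G \<Longrightarrow> length xs = Suc n \<and> length ms = n \<and> last xs = xs ! n"
  unfolding seqs_def nerve_def by (auto simp: last_nth)

lemma seqs_0: "seqs 0 G = (\<lambda>(A, a). (([A], []), a)) ` objs 0 G"
proof (intro equalityI subsetI)
  fix t assume "t \<in> seqs 0 G"
  then obtain xs ms a where t: "t = ((xs, ms), a)" "length xs = Suc 0" "ms = []" "set xs \<subseteq> S" "codim (xs ! 0) = 0"
    "fat_mor (xs ! 0) G a" unfolding seqs_def nerve_def by auto
  then obtain A where "xs = [A]" by (auto simp: length_Suc_conv)
  thus "t \<in> (\<lambda>(A, a). (([A], []), a)) ` objs 0 G" using t unfolding objs_def by force
qed (auto simp: objs_def seqs_def nerve_def)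

lemma seqs_Suc: "seqs (Suc n) G = (\<lambda>((B, a), t). cone B a t) ` (SIGMA p:objs (Suc n) G. seqs n (fst p))"
proof (intro equalityI subsetI)
  fix t assume "t \<in> seqs (Suc n) G"
  then obtain xs ms a where t: "t = ((xs, ms), a)" "length xs = Suc (Suc n)" "length ms = Suc n" "set xs \<subseteq> S"
    "\<forall>i<Suc n. fat_mor (xs ! i) (xs ! Suc i) (ms ! i)" "\<forall>i\<le>Suc n. codim (xs ! i) = i" "fat_mor (xs ! Suc n) G a"
    unfolding seqs_def nerve_def by auto
  obtain ys B where xs: "xs = ys @ [B]" using t(2) by (cases xs rule: rev_cases) auto
  obtain ns m where ms: "ms = ns @ [m]" using t(3) by (cases ms rule: rev_cases) auto
  have len: "length ys = Suc n" "length ns = n" using t(2,3) xs ms by auto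
  have B: "(B, a) \<in> objs (Suc n) G" unfolding objs_def
    using t(4) t(6)[rule_format, of "Suc n"] t(7) len unfolding xs by (simp add: nth_append)
  have "((ys, ns), m) \<in> seqs n B"
  proof -
    have "fat_mor (ys ! i) (ys ! Suc i) (ns ! i)" if "i < n" for i
      using t(5)[rule_format, of i] that len unfolding xs ms by (simp add: nth_append)
    moreover have "codim (ys ! i) = i" if "i \<le> n" for i
      using t(6)[rule_format, of i] that len unfolding xs by (simp add: nth_append)
    moreover have "fat_mor (ys ! n) B m"
      using t(5)[rule_format, of n] len unfolding xs ms by (simp add: nth_append)
    ultimately show ?thesis using t(4) len unfolding seqs_def nerve_def xs by auto
  qed
  moreover have "t = cone B a ((ys, ns), m)" unfolding t(1) xs ms cone_def by simp
  ultimately show "t \<in> (\<lambda>((B, a), t). cone B a t) ` (SIGMA p:objs (Suc n) G. seqs n (fst p))"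
    using B by force
next
  fix t assume "t \<in> (\<lambda>((B, a), t). cone B a t) ` (SIGMA p:objs (Suc n) G. seqs n (fst p))"
  then obtain B a ys ns m where t: "t = ((ys @ [B], ns @ [m]), a)" "(B, a) \<in> objs (Suc n) G" "((ys, ns), m) \<in> seqs n B"
    unfolding cone_def by force
  have y: "length ys = Suc n" "length ns = n" "set ys \<subseteq> S" "\<forall>i<n. fat_mor (ys ! i) (ys ! Suc i) (ns ! i)"
    "\<forall>i\<le>n. codim (ys ! i) = i" "fat_mor (ys ! n) B m" using t(3) unfolding seqs_def nerve_def by auto
  have B: "B \<in> S" "codim B = Suc n" "fat_mor B G a" using t(2) unfolding objs_def by auto
  have "fat_mor ((ys @ [B]) ! i) ((ys @ [B]) ! Suc i) ((ns @ [m]) ! i)" if "i < Suc n" for i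
    using that y by (cases "i = n") (auto simp: nth_append)
  moreover have "codim ((ys @ [B]) ! i) = i" if "i \<le> Suc n" for i
    using that y B by (cases "i = Suc n") (auto simp: nth_append)
  ultimately show "t \<in> seqs (Suc n) G" unfolding t(1) seqs_def nerve_def using y B by (simp add: nth_append)
qed

lemma seqs_SucE:
  assumes "t \<in> seqs (Suc n) G"
  obtains B a s where "t = cone B a s" "(B, a) \<in> objs (Suc n) G" "s \<in> seqs n B"
  using assms unfolding seqs_Suc by auto

lemma inj_cone: "inj_on (\<lambda>((B, a), t). cone B a t) X"
  by (rule inj_onI) (auto simp: cone_def split: prod.splits)

lemma finite_seqs: "codim G \<le> Suc n \<Longrightarrow> finite (seqs n G)"
proof (induction n arbitrary: G)
  case 0
  thus ?case unfolding seqs_0 using finite_objs by simp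
next
  case (Suc n)
  have "finite (seqs n (fst p))" if "p \<in> objs (Suc n) G" for p
    using that Suc.IH[of "fst p"] unfolding objs_def by auto
  thus ?case unfolding seqs_Suc using finite_objs[OF Suc.prems] by (intro finite_imageI finite_SigmaI)
qed

lemma sum_seqs_0: "(\<Sum>t\<in>seqs 0 G. F t) = (\<Sum>(A, a)\<in>objs 0 G. F (([A], []), a))"
  unfolding seqs_0 by (subst sum.reindex) (auto simp: inj_on_def case_prod_beta)

lemma sum_seqs_Suc:
  assumes "codim G \<le> Suc (Suc n)"
  shows "(\<Sum>t\<in>seqs (Suc n) G. F t) = (\<Sum>(B, a)\<in>objs (Suc n) G. \<Sum>t\<in>seqs n B. F (cone B a t))"
proof -
  have f: "finite (seqs n (fst p))" if "p \<in> objs (Suc n) G" for p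
    using that finite_seqs[of "fst p" n] unfolding objs_def by auto
  have "(\<Sum>t\<in>seqs (Suc n) G. F t) = (\<Sum>(p, t)\<in>(SIGMA p:objs (Suc n) G. seqs n (fst p)). F (cone (fst p) (snd p) t))"
    unfolding seqs_Suc sum.reindex[OF inj_cone] by (intro sum.cong) (auto simp: case_prod_beta)
  also have "\<dots> = (\<Sum>p\<in>objs (Suc n) G. \<Sum>t\<in>seqs n (fst p). F (cone (fst p) (snd p) t))"
    using sum.Sigma[OF finite_objs[OF assms], of "\<lambda>p. seqs n (fst p)" "\<lambda>p t. F (cone (fst p) (snd p) t)"] f by simp
  finally show ?thesis by (simp add: case_prod_beta)
qed

lemma seq_or_orientation:
  "t \<in> seqs n G \<Longrightarrow> codim G \<le> Suc n \<Longrightarrow> seq_or t \<in> orientations G"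
proof (induction n arbitrary: G t)
  case 0
  then obtain A a where t: "t = (([A], []), a)" "A \<in> S" "codim A = 0" "fat_mor A G a"
    unfolding seqs_0 objs_def by auto
  have "step_mor A G a" unfolding step_mor_def using t 0 by simp
  thus ?case unfolding t(1) seq_or_def
    using induced_or_facts(1) natural_or_orientation[OF S_rib[OF t(2)] t(3)] by simp
next
  case (Suc n)
  then obtain B a s where t: "t = cone B a s" "B \<in> S" "codim B = Suc n" "fat_mor B G a" "s \<in> seqs n B"
    unfolding seqs_Suc objs_def by auto
  obtain xs ms m where s: "s = ((xs, ms), m)" by (metis prod.collapse)
  have len: "length xs = Suc (length ms)" using seqs_length t(5) s by simp
  have "step_mor B G a" unfolding step_mor_def using t Suc.prems by simp
  moreover have "seq_or s \<in> orientations B" using Suc.IH[OF t(5)] t(3) by simp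
  ultimately show ?case using induced_or_facts(1) seq_or_cone[OF len] t(1) s by simp
qed

text \<open>
  The orientation of the last graph of a sequence, before it is transported along the final
  morphism.
\<close>

definition last_or :: "'h simplex \<Rightarrow> 'h ordering set" where
  "last_or s = seq_or (s, idm (last (fst s)))"

text \<open>The last step of the fold is the only one that involves the final arrow. So the
  orientation before it is common to all final arrows and is read off with the identity.\<close>

lemma seq_or_last:
  assumes "t \<in> seqs n G" "t = ((xs, ms), a)"
  shows "last_or (xs, ms) \<in> orientations (last xs)" "seq_or t = induced_or (last xs) a (last_or (xs, ms))"
proof -
  let ?A = "last xs"
  have A: "?A = xs ! n" "ribbon_graph ?A" "rib ?A" "codim ?A = n"
  proof -
    show 1: "?A = xs ! n" using seqs_length assms by blast
    have "fat_mor (xs ! n) G a" using assms unfolding seqs_def by simp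
    thus "ribbon_graph ?A" "rib ?A" using fat_mor_ribbon 1 by simp_all
    show "codim ?A = n" using assms 1 unfolding seqs_def by simp
  qed
  have s: "((xs, ms), idm ?A) \<in> seqs n ?A"
    using assms A rg_iso_fat_mor[OF A(2,2) rg_iso_id[OF A(3)]] unfolding seqs_def by simp
  show l: "last_or (xs, ms) \<in> orientations ?A" unfolding last_or_def
    using seq_or_orientation[OF s] A by simp
  have len: "length xs = Suc (length ms)" using seqs_length assms by blast
  obtain ys where ys: "xs = ys @ [?A]" "length ys = length ms" using len by (cases xs rule: rev_cases) auto
  define \<omega> where "\<omega> = foldl (\<lambda>\<omega>' (G, m). induced_or G m \<omega>') (natural_or (xs ! 0)) (zip ys ms)"
  have z: "zip xs (ms @ [b]) = zip ys ms @ [(?A, b)]" for b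
  proof -
    have "zip (ys @ [?A]) (ms @ [b]) = zip ys ms @ [(?A, b)]"
      using zip_append[of ys ms "[?A]" "[b]"] ys(2) by simp
    thus ?thesis using ys(1) by simp
  qed
  have so: "seq_or ((xs, ms), b) = induced_or ?A b \<omega>" for b unfolding seq_or_def \<omega>_def by (simp add: z)
  have w: "\<omega> \<in> orientations ?A"
  proof (cases n)
    case 0
    then obtain B where "xs = [B]" using seqs_length[of xs ms a 0 G] assms by (auto simp: length_Suc_conv)
    hence "\<omega> = natural_or ?A" unfolding \<omega>_def using ys by simp
    thus ?thesis using natural_or_orientation[OF A(3)] A(4) 0 by simp
  next
    case (Suc k)
    have "((xs, ms), a) \<in> seqs (Suc k) G" using assms Suc by simp
    then obtain B b s where t: "((xs, ms), a) = cone B b s" "(B, b) \<in> objs (Suc k) G" "s \<in> seqs k B"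
      by (rule seqs_SucE)
    hence cB: "codim B = Suc k" unfolding objs_def by simp
    obtain ys' ns m where s': "s = ((ys', ns), m)" by (metis prod.collapse)
    have e: "xs = ys' @ [B]" "ms = ns @ [m]" using t(1) unfolding s' cone_def by auto
    have "ys' = ys" "?A = B" using e ys(1) by auto
    have len': "length ys' = Suc (length ns)" using seqs_length t(3) s' by simp
    have "\<omega> = seq_or s" unfolding \<omega>_def s' seq_or_def e(2) \<open>ys' = ys\<close>[symmetric] using len'
      by (cases ys') (simp_all add: e(1))
    thus ?thesis using seq_or_orientation[OF t(3)] cB \<open>?A = B\<close> by simp
  qed
  have "last_or (xs, ms) = \<omega>" unfolding last_or_def
    using so[of "idm ?A"] induced_or_iso[OF A(3) rg_iso_id[OF A(3)]] transport_idm[OF rib_is_graph[OF A(3)] w] by simp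
  thus "seq_or t = induced_or ?A a (last_or (xs, ms))" using so[of a] assms(2) by simp
qed

definition sgn_wt :: "'h ordering set \<Rightarrow> 'h simplex \<times> 'h pmap \<Rightarrow> rat" where
  "sgn_wt \<omega> t = seq_wt t * pm (seq_or t = \<omega>)"

text \<open>The functional \<open>v\<close> is arbitrary, so this is a boundary in the weakest form
  that the cancellations need. For \<open>n = 0\<close> its only face is the empty simplex, as in
  the augmented complex.\<close>

definition bdsum :: "nat \<Rightarrow> ('h over_simplex \<Rightarrow> rat) \<Rightarrow> 'h over_simplex \<Rightarrow> rat" where
  "bdsum n v s = (\<Sum>i\<le>n. (- 1) ^ i * v (face i s))"

lemma sgn_wt_cone:
  assumes t: "t \<in> seqs n B" and f: "step_mor B G f" and c: "codim B \<le> Suc n" and w: "\<omega> \<in> orientations G"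
  shows "sgn_wt \<omega> (cone B f t) = wt B * sgn_wt (inducing_or B f \<omega>) t"
proof -
  obtain xs ms m where t': "t = ((xs, ms), m)" by (metis prod.collapse)
  have len: "length xs = Suc (length ms)" using seqs_length t t' by simp
  have o: "seq_or t \<in> orientations B" using seq_or_orientation[OF t c] .
  have "seq_or (cone B f t) = \<omega> \<longleftrightarrow> seq_or t = inducing_or B f \<omega>"
    using seq_or_cone[OF len] t' inducing_or[OF f w] inducing_or_eq[OF f o] by metis
  thus ?thesis unfolding sgn_wt_def seq_wt_cone by simp
qed

text \<open>The boundary of a cone: the cone on the boundary of the base, and the base itself as
  last face.\<close>

lemma bdsum_cone:
  assumes "((xs, ms), m) \<in> seqs n B"
  shows "bdsum (Suc n) v (lift_seq (cone B a ((xs, ms), m))) =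
    bdsum n (v \<circ> over_cone B a) (lift_seq ((xs, ms), m)) + (- 1) ^ Suc n * v (lift_seq ((xs, ms), a \<circ>\<^sub>m m))"
proof -
  have len: "length xs = Suc (length ms)" "length ms = n" using seqs_length assms by blast+
  have "bdsum (Suc n) v (lift_seq (cone B a ((xs, ms), m))) =
      (\<Sum>i\<le>n. (- 1) ^ i * v (face i (lift_seq (cone B a ((xs, ms), m))))) +
      (- 1) ^ Suc n * v (face (Suc n) (lift_seq (cone B a ((xs, ms), m))))"
    unfolding bdsum_def by simp
  also have "(\<Sum>i\<le>n. (- 1) ^ i * v (face i (lift_seq (cone B a ((xs, ms), m))))) =
      bdsum n (v \<circ> over_cone B a) (lift_seq ((xs, ms), m))"
    unfolding bdsum_def using face_cone(1)[OF len(1)] len(2) by (intro sum.cong) auto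
  also have "face (Suc n) (lift_seq (cone B a ((xs, ms), m))) = lift_seq ((xs, ms), a \<circ>\<^sub>m m)"
    using face_cone(2)[OF len(1)] len(2) by simp
  finally show ?thesis .
qed

lemma seqs_act:
  assumes "((xs, ms), m) \<in> seqs n B" "fat_mor B G a" shows "((xs, ms), a \<circ>\<^sub>m m) \<in> seqs n G"
  using assms fat_mor_comp unfolding seqs_def by auto

text \<open>The outer sum on the right is over the sequences obtained by forgetting the last graph \<open>B\<close>.\<close>

lemma sum_pairs_group:
  fixes F :: "'h rgraph \<Rightarrow> 'h pmap \<Rightarrow> 'h simplex \<times> 'h pmap \<Rightarrow> rat"
  assumes cG: "codim G \<le> Suc k" "k \<le> Suc n"
  shows "(\<Sum>(B, a)\<in>objs k G. \<Sum>t\<in>seqs n B. F B a t) =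
    (\<Sum>((xs, ms), h)\<in>(\<lambda>((B, a), ((xs, ms), m)). ((xs, ms), a \<circ>\<^sub>m m)) ` (SIGMA p:objs k G. seqs n (fst p)).
       \<Sum>(B, a, m)\<in>{(B, a, m). B \<in> S \<and> codim B = k \<and> fat_mor B G a \<and> fat_mor (last xs) B m \<and> a \<circ>\<^sub>m m = h}.
         F B a ((xs, ms), m))"
proof -
  let ?P = "SIGMA p:objs k G. seqs n (fst p)"
  let ?g = "\<lambda>((B, a), ((xs, ms), m)). ((xs, ms), a \<circ>\<^sub>m m) :: 'h simplex \<times> 'h pmap"
  have f: "finite (seqs n (fst p))" if "p \<in> objs k G" for p
    using that finite_seqs[of "fst p" n] cG unfolding objs_def by auto
  have fP: "finite ?P" using finite_objs[OF cG(1)] f by (intro finite_SigmaI)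
  have "(\<Sum>(B, a)\<in>objs k G. \<Sum>t\<in>seqs n B. F B a t) = (\<Sum>(p, t)\<in>?P. F (fst p) (snd p) t)"
    using sum.Sigma[OF finite_objs[OF cG(1)], of "\<lambda>p. seqs n (fst p)" "\<lambda>p t. F (fst p) (snd p) t"] f
    by (simp add: case_prod_beta)
  also have "\<dots> = (\<Sum>y\<in>?g ` ?P. \<Sum>x\<in>{x \<in> ?P. ?g x = y}. (\<lambda>(p, t). F (fst p) (snd p) t) x)"
    by (rule sum.image_gen[OF fP])
  also have "\<dots> = (\<Sum>((xs, ms), h)\<in>?g ` ?P. \<Sum>(B, a, m)\<in>{(B, a, m). B \<in> S \<and> codim B = k \<and> fat_mor B G a \<and>
      fat_mor (last xs) B m \<and> a \<circ>\<^sub>m m = h}. F B a ((xs, ms), m))"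
  proof (rule sum.cong[OF refl])
    fix y assume y: "y \<in> ?g ` ?P"
    then obtain B0 a0 xs ms m0 where y0: "(B0, a0) \<in> objs k G" "((xs, ms), m0) \<in> seqs n B0" "y = ((xs, ms), a0 \<circ>\<^sub>m m0)"
      by force
    have lx: "last xs = xs ! n" using seqs_length[OF y0(2)] by blast
    let ?X = "{(B, a, m). B \<in> S \<and> codim B = k \<and> fat_mor B G a \<and> fat_mor (last xs) B m \<and> a \<circ>\<^sub>m m = a0 \<circ>\<^sub>m m0}"
    let ?e = "\<lambda>(B, a, m). ((B, a), ((xs, ms), m))"
    have eq: "{x \<in> ?P. ?g x = y} = ?e ` ?X"
    proof (intro equalityI subsetI)
      fix x assume x: "x \<in> {x \<in> ?P. ?g x = y}"
      obtain B a xs' ms' m where xx: "x = ((B, a), ((xs', ms'), m))" by (metis prod.collapse)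
      have "xs' = xs" "ms' = ms" "a \<circ>\<^sub>m m = a0 \<circ>\<^sub>m m0" "(B, a) \<in> objs k G" "((xs, ms), m) \<in> seqs n B"
        using x y0(3) unfolding xx by auto
      hence "(B, a, m) \<in> ?X" unfolding objs_def seqs_def lx by auto
      thus "x \<in> ?e ` ?X" unfolding xx \<open>xs' = xs\<close> \<open>ms' = ms\<close> by force
    next
      fix x assume "x \<in> ?e ` ?X"
      then obtain B a m where x: "x = ((B, a), ((xs, ms), m))" "B \<in> S" "codim B = k" "fat_mor B G a"
        "fat_mor (xs ! n) B m" "a \<circ>\<^sub>m m = a0 \<circ>\<^sub>m m0" unfolding lx by auto
      have "((xs, ms), m) \<in> seqs n B" using y0(2) x(5) unfolding seqs_def by simp
      moreover have "(B, a) \<in> objs k G" using x unfolding objs_def by simp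
      ultimately show "x \<in> {x \<in> ?P. ?g x = y}" unfolding x(1) y0(3) using x(6) by simp
    qed
    have inj: "inj_on ?e ?X" by (auto simp: inj_on_def)
    show "(\<Sum>x\<in>{x \<in> ?P. ?g x = y}. (\<lambda>(p, t). F (fst p) (snd p) t) x) =
        (\<lambda>((xs, ms), h). \<Sum>(B, a, m)\<in>{(B, a, m). B \<in> S \<and> codim B = k \<and> fat_mor B G a \<and>
          fat_mor (last xs) B m \<and> a \<circ>\<^sub>m m = h}. F B a ((xs, ms), m)) y"
      unfolding eq sum.reindex[OF inj] unfolding y0(3) by (simp add: case_prod_beta comp_def)
  qed
  finally show ?thesis .
qed

text \<open>The faces other than the last are cones on faces of the shorter sequences. Their sum
  vanishes by \<open>van\<close> for the functional composed with the cone, which is why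
  \<open>van\<close> is required of all functionals. Only the last faces are left.\<close>

lemma bdsum_seqs_Suc:
  assumes c: "codim G \<le> Suc (Suc n)" and w: "\<omega> \<in> orientations G"
    and van: "\<And>A f v. (A, f) \<in> objs (Suc n) G \<Longrightarrow>
      (\<Sum>t\<in>seqs n A. sgn_wt (inducing_or A f \<omega>) t * bdsum n v (lift_seq t)) = 0"
  shows "(\<Sum>t\<in>seqs (Suc n) G. sgn_wt \<omega> t * bdsum (Suc n) v (lift_seq t)) =
    (- 1) ^ Suc n * (\<Sum>(A, f)\<in>objs (Suc n) G. \<Sum>t\<in>seqs n A.
      sgn_wt \<omega> (cone A f t) * v (lift_seq (fst t, f \<circ>\<^sub>m snd t)))"
proof -
  let ?F = "\<lambda>A f t. sgn_wt \<omega> (cone A f t) * v (lift_seq (fst t, f \<circ>\<^sub>m snd t))"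
  have alg: "W * (X + e * V) = wA * (sg * X) + e * (W * V)" if "W = wA * sg" for W X e V wA sg :: rat
    unfolding that by (simp add: algebra_simps)
  have "(\<Sum>t\<in>seqs (Suc n) G. sgn_wt \<omega> t * bdsum (Suc n) v (lift_seq t)) =
      (\<Sum>(A, f)\<in>objs (Suc n) G. \<Sum>t\<in>seqs n A. sgn_wt \<omega> (cone A f t) * bdsum (Suc n) v (lift_seq (cone A f t)))"
    by (rule sum_seqs_Suc[OF c])
  also have "\<dots> = (\<Sum>(A, f)\<in>objs (Suc n) G. (- 1) ^ Suc n * (\<Sum>t\<in>seqs n A. ?F A f t))"
  proof (rule sum.cong[OF refl], clarify)
    fix A f assume Af: "(A, f) \<in> objs (Suc n) G"
    hence A: "codim A = Suc n" "step_mor A G f" using c unfolding objs_def step_mor_def by auto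
    have "(\<Sum>t\<in>seqs n A. sgn_wt \<omega> (cone A f t) * bdsum (Suc n) v (lift_seq (cone A f t))) =
        (\<Sum>t\<in>seqs n A. wt A * (sgn_wt (inducing_or A f \<omega>) t * bdsum n (v \<circ> over_cone A f) (lift_seq t)) +
          (- 1) ^ Suc n * ?F A f t)"
    proof (rule sum.cong[OF refl])
      fix t assume t: "t \<in> seqs n A"
      obtain xs ms m where t': "t = ((xs, ms), m)" by (metis prod.collapse)
      have s: "sgn_wt \<omega> (cone A f t) = wt A * sgn_wt (inducing_or A f \<omega>) t"
        by (rule sgn_wt_cone[OF t A(2) _ w]) (use A in simp)
      show "sgn_wt \<omega> (cone A f t) * bdsum (Suc n) v (lift_seq (cone A f t)) =
        wt A * (sgn_wt (inducing_or A f \<omega>) t * bdsum n (v \<circ> over_cone A f) (lift_seq t)) + (- 1) ^ Suc n * ?F A f t"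
        unfolding t' bdsum_cone[OF t[unfolded t']] fst_conv snd_conv by (rule alg[OF s[unfolded t']])
    qed
    also have "\<dots> = wt A * (\<Sum>t\<in>seqs n A. sgn_wt (inducing_or A f \<omega>) t * bdsum n (v \<circ> over_cone A f) (lift_seq t)) +
        (- 1) ^ Suc n * (\<Sum>t\<in>seqs n A. ?F A f t)"
      by (simp only: sum.distrib sum_distrib_left)
    finally show "(\<Sum>t\<in>seqs n A. sgn_wt \<omega> (cone A f t) * bdsum (Suc n) v (lift_seq (cone A f t))) =
        (- 1) ^ Suc n * (\<Sum>t\<in>seqs n A. ?F A f t)"
      using van[OF Af] by simp
  qed
  also have "\<dots> = (- 1) ^ Suc n * (\<Sum>(A, f)\<in>objs (Suc n) G. \<Sum>t\<in>seqs n A. ?F A f t)"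
    by (simp add: sum_distrib_left case_prod_beta)
  finally show ?thesis .
qed

text \<open>The target lies one codimension above the last graph. Inner faces vanish by induction;
  deleting the last graph leaves a morphism collapsing two edges, whose factorizations cancel by
  \<open>factor_cancel\<close>. The induction starts with \<open>trivalent_cancel\<close>.\<close>

lemma faces_cancel:
  "ribbon_graph B \<Longrightarrow> codim B = Suc n \<Longrightarrow> \<omega> \<in> orientations B \<Longrightarrow>
    (\<Sum>t\<in>seqs n B. sgn_wt \<omega> t * bdsum n v (lift_seq t)) = 0"
proof (induction n arbitrary: B \<omega> v)
  case 0
  \<comment> \<open>The face of a 0-simplex is the empty simplex, so \<open>v\<close> enters through
    a constant factor.\<close>
  have "(\<Sum>t\<in>seqs 0 B. sgn_wt \<omega> t * bdsum 0 v (lift_seq t)) =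
      (\<Sum>(A, f)\<in>objs 0 B. wt A * pm (induced_or A f (natural_or A) = \<omega>) * v ([], []))"
    unfolding sum_seqs_0 sgn_wt_def seq_wt_def seq_or_def bdsum_def lift_seq_def face_def by simp
  also have "\<dots> = (\<Sum>(A, f)\<in>objs 0 B. wt A * pm (induced_or A f (natural_or A) = \<omega>)) * v ([], [])"
    by (simp add: sum_distrib_right case_prod_beta)
  also have "\<dots> = 0" using trivalent_cancel[OF 0(1) _ 0(3)] 0(2) by simp
  finally show ?case .
next
  case (Suc n)
  let ?F = "\<lambda>A f t. sgn_wt \<omega> (cone A f t) * v (lift_seq (fst t, f \<circ>\<^sub>m snd t))"
  have "(\<Sum>t\<in>seqs (Suc n) B. sgn_wt \<omega> t * bdsum (Suc n) v (lift_seq t)) =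
    (- 1) ^ Suc n * (\<Sum>(A, f)\<in>objs (Suc n) B. \<Sum>t\<in>seqs n A. ?F A f t)"
  proof (rule bdsum_seqs_Suc[OF _ Suc.prems(3)])
    fix A f v assume "(A, f) \<in> objs (Suc n) B"
    hence A: "A \<in> S" "codim A = Suc n" "step_mor A B f" using Suc.prems unfolding objs_def step_mor_def by auto
    show "(\<Sum>t\<in>seqs n A. sgn_wt (inducing_or A f \<omega>) t * bdsum n v (lift_seq t)) = 0"
      by (rule Suc.IH[OF S_ribbon[OF A(1)] A(2) inducing_or(1)[OF A(3) Suc.prems(3)]])
  qed (use Suc.prems in simp)
  \<comment> \<open>The last faces are collected by what they retain: the shortened sequence and its
    composite to \<open>B\<close>. Within such a group only the deleted graph varies.\<close>
  also have "(\<Sum>(A, f)\<in>objs (Suc n) B. \<Sum>t\<in>seqs n A. ?F A f t) = 0"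
  proof (subst sum_pairs_group)
    show "codim B \<le> Suc (Suc n)" "Suc n \<le> Suc n" using Suc.prems by auto
    show "(\<Sum>((xs, ms), h)\<in>(\<lambda>((B, a), ((xs, ms), m)). ((xs, ms), a \<circ>\<^sub>m m)) ` (SIGMA p:objs (Suc n) B. seqs n (fst p)).
       \<Sum>(A, f, m)\<in>{(A, f, m). A \<in> S \<and> codim A = Suc n \<and> fat_mor A B f \<and> fat_mor (last xs) A m \<and> f \<circ>\<^sub>m m = h}.
         ?F A f ((xs, ms), m)) = 0"
    proof (rule sum.neutral, rule ballI)
      fix y assume "y \<in> (\<lambda>((B, a), ((xs, ms), m)). ((xs, ms), a \<circ>\<^sub>m m)) ` (SIGMA p:objs (Suc n) B. seqs n (fst p))"
      then obtain A0 f0 xs ms m0 where y0: "(A0, f0) \<in> objs (Suc n) B" "((xs, ms), m0) \<in> seqs n A0"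
        "y = ((xs, ms), f0 \<circ>\<^sub>m m0)" by force
      let ?h = "f0 \<circ>\<^sub>m m0" and ?C = "last xs"
      have C: "((xs, ms), ?h) \<in> seqs n B" using seqs_act[OF y0(2)] y0(1) unfolding objs_def by auto
      have Cn: "?C = xs ! n" "length xs = Suc (length ms)" using seqs_length[OF C] by auto
      have cC: "codim ?C = n" "fat_mor ?C B ?h" using C Cn unfolding seqs_def by auto
      have lo: "last_or (xs, ms) \<in> orientations ?C" using seq_or_last(1)[OF C] by simp
      let ?X = "{(A, f, m). A \<in> S \<and> codim A = Suc n \<and> fat_mor A B f \<and> fat_mor ?C A m \<and> f \<circ>\<^sub>m m = ?h}"
      have "(\<Sum>(A, f, m)\<in>?X. ?F A f ((xs, ms), m)) =
          (\<Sum>(A, f, m)\<in>?X. wt A * pm (induced_or A f (induced_or ?C m (last_or (xs, ms))) = \<omega>) *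
             (seq_wt ((xs, ms), ?h) * v (lift_seq ((xs, ms), ?h))))"
      proof (rule sum.cong[OF refl], clarify)
        fix A f m assume *: "A \<in> S" "codim A = Suc n" "fat_mor A B f" "fat_mor ?C A m" "f \<circ>\<^sub>m m = ?h"
        have m: "((xs, ms), m) \<in> seqs n A" using C *(4) Cn unfolding seqs_def by auto
        have "seq_or (cone A f ((xs, ms), m)) = induced_or A f (induced_or ?C m (last_or (xs, ms)))"
          using seq_or_cone[OF Cn(2)] seq_or_last(2)[OF m refl] by simp
        thus "?F A f ((xs, ms), m) = wt A * pm (induced_or A f (induced_or ?C m (last_or (xs, ms))) = \<omega>) *
             (seq_wt ((xs, ms), ?h) * v (lift_seq ((xs, ms), ?h)))"
          unfolding sgn_wt_def seq_wt_cone using *(5) by (simp add: seq_wt_def)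
      qed
      also have "\<dots> = (\<Sum>(A, f, m)\<in>?X. wt A * pm (induced_or A f (induced_or ?C m (last_or (xs, ms))) = \<omega>)) *
             (seq_wt ((xs, ms), ?h) * v (lift_seq ((xs, ms), ?h)))"
        by (simp add: sum_distrib_right case_prod_beta)
      also have "\<dots> = 0"
        using factor_cancel[OF cC(2) _ lo Suc.prems(3)] cC(1) Suc.prems(2) by simp
      finally show "(\<lambda>((xs, ms), h). \<Sum>(A, f, m)\<in>{(A, f, m). A \<in> S \<and> codim A = Suc n \<and> fat_mor A B f \<and>
         fat_mor (last xs) A m \<and> f \<circ>\<^sub>m m = h}. ?F A f ((xs, ms), m)) y = 0" unfolding y0(3) by simp
    qed
  qed
  finally show ?case by simp
qed

text \<open>Now the last graph is isomorphic to the target. Deleting it gives every sequence over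
  \<open>G\<close> that is shorter by one, each with total weight 1 by
  \<open>last_face_count\<close> and with an unchanged orientation.\<close>

lemma boundary_sum:
  assumes G: "ribbon_graph G" and c: "codim G = Suc n" and w: "\<omega> \<in> orientations G"
  shows "(\<Sum>t\<in>seqs (Suc n) G. sgn_wt \<omega> t * bdsum (Suc n) v (lift_seq t)) =
    (- 1) ^ Suc n * (\<Sum>t\<in>seqs n G. sgn_wt \<omega> t * v (lift_seq t))"
proof -
  let ?F = "\<lambda>A f t. sgn_wt \<omega> (cone A f t) * v (lift_seq (fst t, f \<circ>\<^sub>m snd t))"
  have "(\<Sum>t\<in>seqs (Suc n) G. sgn_wt \<omega> t * bdsum (Suc n) v (lift_seq t)) =
    (- 1) ^ Suc n * (\<Sum>(A, f)\<in>objs (Suc n) G. \<Sum>t\<in>seqs n A. ?F A f t)"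
  proof (rule bdsum_seqs_Suc[OF _ w])
    fix A f v assume "(A, f) \<in> objs (Suc n) G"
    hence A: "A \<in> S" "codim A = Suc n" "step_mor A G f" using c unfolding objs_def step_mor_def by auto
    show "(\<Sum>t\<in>seqs n A. sgn_wt (inducing_or A f \<omega>) t * bdsum n v (lift_seq t)) = 0"
      by (rule faces_cancel[OF S_ribbon[OF A(1)] A(2) inducing_or(1)[OF A(3) w]])
  qed (use c in simp)
  also have "(\<Sum>(A, f)\<in>objs (Suc n) G. \<Sum>t\<in>seqs n A. ?F A f t) = (\<Sum>t\<in>seqs n G. sgn_wt \<omega> t * v (lift_seq t))"
  proof (subst sum_pairs_group)
    show "codim G \<le> Suc (Suc n)" "Suc n \<le> Suc n" using c by auto
    let ?Y = "(\<lambda>((B, a), ((xs, ms), m)). ((xs, ms), a \<circ>\<^sub>m m)) ` (SIGMA p:objs (Suc n) G. seqs n (fst p))"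
    have in_seqs: "y \<in> seqs n G" if "y \<in> ?Y" for y
    proof -
      obtain B a xs ms m where *: "(B, a) \<in> objs (Suc n) G" "((xs, ms), m) \<in> seqs n B" "y = ((xs, ms), a \<circ>\<^sub>m m)"
        using \<open>y \<in> ?Y\<close> by force
      thus ?thesis using seqs_act[OF *(2)] unfolding objs_def by auto
    qed
    have X: "{(B, a, m). B \<in> S \<and> fat_mor B G a \<and> codim B = codim G \<and> fat_mor C B m \<and> a \<circ>\<^sub>m m = h} =
        {(B, a, m). B \<in> S \<and> codim B = Suc n \<and> fat_mor B G a \<and> fat_mor C B m \<and> a \<circ>\<^sub>m m = h}" for C h
      using c by auto
    \<comment> \<open>Total weight 1 shows in particular that a factorization exists.\<close>
    have onto: "y \<in> ?Y" if y: "y \<in> seqs n G" for y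
    proof -
      obtain xs ms h where y': "y = ((xs, ms), h)" by (metis prod.collapse)
      have Cn: "last xs = xs ! n" using seqs_length y y' by blast
      have "fat_mor (last xs) G h" using y unfolding y' seqs_def Cn by simp
      from last_face_count(2)[OF this] have "{(B, a, m). B \<in> S \<and> fat_mor B G a \<and> codim B = codim G \<and>
          fat_mor (last xs) B m \<and> a \<circ>\<^sub>m m = h} \<noteq> {}" by (auto simp del: Collect_empty_eq)
      then obtain B a m where B: "B \<in> S" "codim B = Suc n" "fat_mor B G a" "fat_mor (last xs) B m" "a \<circ>\<^sub>m m = h"
        unfolding X by auto
      have "((xs, ms), m) \<in> seqs n B" using y B(4) unfolding y' seqs_def Cn by simp
      moreover have "(B, a) \<in> objs (Suc n) G" using B unfolding objs_def by simp
      ultimately show ?thesis unfolding y' B(5)[symmetric] by force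
    qed
    have Y: "?Y = seqs n G" using in_seqs onto by blast
    show "(\<Sum>((xs, ms), h)\<in>?Y. \<Sum>(A, f, m)\<in>{(A, f, m). A \<in> S \<and> codim A = Suc n \<and> fat_mor A G f \<and>
        fat_mor (last xs) A m \<and> f \<circ>\<^sub>m m = h}. ?F A f ((xs, ms), m)) = (\<Sum>t\<in>seqs n G. sgn_wt \<omega> t * v (lift_seq t))"
      unfolding Y
    proof (rule sum.cong[OF refl])
      fix y assume y: "y \<in> seqs n G"
      obtain xs ms h where y': "y = ((xs, ms), h)" by (metis prod.collapse)
      let ?C = "last xs"
      have Cn: "?C = xs ! n" "length xs = Suc (length ms)" using seqs_length y y' by blast+
      have cC: "codim ?C = n" "fat_mor ?C G h" using y Cn unfolding y' seqs_def by auto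
      have lo: "last_or (xs, ms) \<in> orientations ?C" using seq_or_last(1)[OF y y'] by simp
      let ?X = "{(A, f, m). A \<in> S \<and> codim A = Suc n \<and> fat_mor A G f \<and> fat_mor ?C A m \<and> f \<circ>\<^sub>m m = h}"
      have "(\<Sum>(A, f, m)\<in>?X. ?F A f ((xs, ms), m)) = (\<Sum>(A, f, m)\<in>?X. wt A * (sgn_wt \<omega> y * v (lift_seq y)))"
      proof (rule sum.cong[OF refl])
        fix x assume "x \<in> ?X"
        then obtain A f m where x: "x = (A, f, m)"
          and *: "A \<in> S" "codim A = Suc n" "fat_mor A G f" "fat_mor ?C A m" "f \<circ>\<^sub>m m = h" by blast
        have m: "((xs, ms), m) \<in> seqs n A" using y *(4) Cn unfolding y' seqs_def by auto
        have iso: "rg_iso A G f" using fat_mor_iso[OF *(3)] *(2) c by simp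
        have sm: "step_mor ?C A m" unfolding step_mor_def using * cC by simp
        have "seq_or (cone A f ((xs, ms), m)) = transport f (induced_or ?C m (last_or (xs, ms)))"
          using seq_or_cone[OF Cn(2)] seq_or_last(2)[OF m refl] induced_or_iso[OF S_rib[OF *(1)] iso] by simp
        also have "\<dots> = induced_or ?C h (last_or (xs, ms))"
          using induced_or_iso_comp[OF sm iso G lo] *(5) by simp
        also have "\<dots> = seq_or y" using seq_or_last(2)[OF y y'] by simp
        finally have "?F A f ((xs, ms), m) = wt A * (sgn_wt \<omega> y * v (lift_seq y))"
          unfolding sgn_wt_def seq_wt_cone using *(5) y' by (simp add: seq_wt_def)
        thus "(\<lambda>(A, f, m). ?F A f ((xs, ms), m)) x = (\<lambda>(A, f, m). wt A * (sgn_wt \<omega> y * v (lift_seq y))) x"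
          unfolding x by simp
      qed
      also have "\<dots> = (\<Sum>(A, f, m)\<in>?X. wt A) * (sgn_wt \<omega> y * v (lift_seq y))"
        by (simp add: sum_distrib_right case_prod_beta)
      also have "(\<Sum>(A, f, m)\<in>?X. wt A) = 1" using last_face_count(2)[OF cC(2)] unfolding X .
      finally show "(\<lambda>((xs, ms), h). \<Sum>(A, f, m)\<in>{(A, f, m). A \<in> S \<and> codim A = Suc n \<and> fat_mor A G f \<and>
        fat_mor (last xs) A m \<and> f \<circ>\<^sub>m m = h}. ?F A f ((xs, ms), m)) y = sgn_wt \<omega> y * v (lift_seq y)"
        unfolding y' by simp
    qed
  qed
  finally show ?thesis .
qed

end

section \<open>Presented abelian groups\<close>

lemma add_group_simps [simp]:
  "carrier (add_group A) = A" "x \<otimes>\<^bsub>add_group A\<^esub> y = x + y" "\<one>\<^bsub>add_group A\<^esub> = 0"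
  by (simp_all add: add_group_def)

lemma comm_group_add_group:
  assumes "0 \<in> A" "\<And>x y. x \<in> A \<Longrightarrow> y \<in> A \<Longrightarrow> x + y \<in> A" "\<And>x. x \<in> A \<Longrightarrow> - x \<in> A"
  shows "comm_group (add_group A)"
proof (rule comm_groupI)
  fix x assume "x \<in> carrier (add_group A)"
  thus "\<exists>y\<in>carrier (add_group A). y \<otimes>\<^bsub>add_group A\<^esub> x = \<one>\<^bsub>add_group A\<^esub>"
    using assms(3) by (intro bexI[of _ "- x"]) auto
qed (use assms in \<open>auto simp: algebra_simps\<close>)

lemma inv_add_group:
  assumes "comm_group (add_group A)" "x \<in> A" "- x \<in> A" shows "inv\<^bsub>add_group A\<^esub> x = - x"
proof -
  interpret comm_group "add_group A" by fact
  show ?thesis by (rule inv_equality) (use assms in auto)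
qed

abbreviation ints :: "int monoid" where "ints \<equiv> add_group UNIV"

lemma comm_group_ints: "comm_group ints" by (rule comm_group_add_group) auto

lemma inv_ints: "inv\<^bsub>ints\<^esub> x = - x" by (rule inv_add_group[OF comm_group_ints]) auto

text \<open>The common frame of graph cohomology and of the forest carrier: generators modulo an
  equivalence, with an involution that acts as the sign. An element may be equivalent to its own
  reverse; its class is then annihilated by 2.\<close>

locale signed_set =
  fixes X :: "'a set" and E :: "'a \<Rightarrow> 'a \<Rightarrow> bool" and \<rho> :: "'a \<Rightarrow> 'a"
  assumes E_in: "E x y \<Longrightarrow> x \<in> X \<and> y \<in> X"
    and E_refl: "x \<in> X \<Longrightarrow> E x x" and E_sym: "E x y \<Longrightarrow> E y x" and E_trans: "E x y \<Longrightarrow> E y z \<Longrightarrow> E x z"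
    and \<rho>_in: "x \<in> X \<Longrightarrow> \<rho> x \<in> X" and \<rho>_\<rho>: "x \<in> X \<Longrightarrow> \<rho> (\<rho> x) = x" and E_\<rho>: "E x y \<Longrightarrow> E (\<rho> x) (\<rho> y)"
begin

definition rels :: "('a \<Rightarrow>\<^sub>0 int) set" where
  "rels = {frag_of x - frag_of y | x y. E x y} \<union> {frag_of (\<rho> x) + frag_of x | x. x \<in> X}"

abbreviation "FG \<equiv> free_Abelian_group X"
abbreviation "N \<equiv> generate FG rels"
abbreviation "P \<equiv> pres_group X rels"
abbreviation "gen \<equiv> pres_gen X rels"

lemma rels_subset: "rels \<subseteq> carrier FG"
proof
  fix r assume "r \<in> rels"
  then consider x y where "r = frag_of x - frag_of y" "E x y" | x where "r = frag_of (\<rho> x) + frag_of x" "x \<in> X"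
    unfolding rels_def by blast
  thus "r \<in> carrier FG"
  proof cases
    case 1 thus ?thesis using E_in[OF 1(2)] keys_diff[of "frag_of x" "frag_of y"] by auto
  next
    case 2 thus ?thesis using \<rho>_in[OF 2(2)] keys_add[of "frag_of (\<rho> x)" "frag_of x"] by auto
  qed
qed

lemma subgroup_N: "subgroup N FG"
  by (rule group.generate_is_subgroup[OF group_free_Abelian_group rels_subset])

lemma normal_N: "N \<lhd> FG"
  by (rule comm_group.subgroup_imp_normal[OF abelian_free_Abelian_group subgroup_N])

lemma comm_group_P: "comm_group P"
  unfolding pres_group_def by (rule comm_group.abelian_FactGroup[OF abelian_free_Abelian_group subgroup_N])

lemma proj_hom: "(\<lambda>c. N #>\<^bsub>FG\<^esub> c) \<in> hom FG P"
  unfolding pres_group_def by (rule normal.r_coset_hom_Mod[OF normal_N])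

lemma gen_in: "x \<in> X \<Longrightarrow> gen x \<in> carrier P"
  unfolding pres_gen_def using hom_in_carrier[OF proj_hom] by simp

lemma carrier_P: "Y \<in> carrier P \<Longrightarrow> \<exists>c\<in>carrier FG. Y = N #>\<^bsub>FG\<^esub> c"
  unfolding pres_group_def by (auto simp: carrier_FactGroup)

lemma hom_eqI:
  assumes B: "group B" and h: "h \<in> hom P B" "h' \<in> hom P B" and eq: "\<And>x. x \<in> X \<Longrightarrow> h (gen x) = h' (gen x)"
    and Y: "Y \<in> carrier P"
  shows "h Y = h' Y"
proof -
  let ?p = "\<lambda>c. N #>\<^bsub>FG\<^esub> c"
  have hp: "h \<circ> ?p \<in> hom FG B" "h' \<circ> ?p \<in> hom FG B" using Group.hom_compose[OF proj_hom] h by blast+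
  interpret a: group_hom FG B "h \<circ> ?p" using hp(1) B by (auto simp: group_hom_def group_hom_axioms_def)
  interpret b: group_hom FG B "h' \<circ> ?p" using hp(2) B by (auto simp: group_hom_def group_hom_axioms_def)
  have "(h \<circ> ?p) c = (h' \<circ> ?p) c" if "Poly_Mapping.keys c \<subseteq> X" for c
  proof (rule free_Abelian_group_induct[OF that])
    show "(h \<circ> ?p) 0 = (h' \<circ> ?p) 0" using a.hom_one b.hom_one by simp
  next
    fix x y assume 2: "Poly_Mapping.keys x \<subseteq> X" "Poly_Mapping.keys y \<subseteq> X"
      "(h \<circ> ?p) x = (h' \<circ> ?p) x" "(h \<circ> ?p) y = (h' \<circ> ?p) y"
    have "x - y = x \<otimes>\<^bsub>FG\<^esub> inv\<^bsub>FG\<^esub> y" using 2 by simp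
    moreover have "Poly_Mapping.keys (inv\<^bsub>FG\<^esub> y) \<subseteq> X" using 2 by (simp add: keys_minus)
    ultimately show "(h \<circ> ?p) (x - y) = (h' \<circ> ?p) (x - y)" using a.hom_mult[of x "inv\<^bsub>FG\<^esub> y"] b.hom_mult[of x "inv\<^bsub>FG\<^esub> y"] a.hom_inv[of y] b.hom_inv[of y] 2
      by (simp del: mult_free_Abelian_group inv_free_Abelian_group add: keys_minus)
  next
    fix x assume "x \<in> X"
    thus "(h \<circ> ?p) (frag_of x) = (h' \<circ> ?p) (frag_of x)" using eq unfolding pres_gen_def by simp
  qed
  thus ?thesis using carrier_P[OF Y] by auto
qed

text \<open>The universal property of the presentation. The kernel of the map from the free group
  contains the relators, and generators determine a homomorphism; hence the description in
  \<open>the_hom\<close> denotes.\<close>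

lemma the_hom_P:
  assumes B: "comm_group B" and val: "\<And>x. x \<in> X \<Longrightarrow> val x \<in> carrier B"
    and vE: "\<And>x y. E x y \<Longrightarrow> val x = val y" and v\<rho>: "\<And>x. x \<in> X \<Longrightarrow> val (\<rho> x) \<otimes>\<^bsub>B\<^esub> val x = \<one>\<^bsub>B\<^esub>"
  shows "the_hom P B X gen val \<in> hom P B" "\<And>Y. Y \<notin> carrier P \<Longrightarrow> the_hom P B X gen val Y = \<one>\<^bsub>B\<^esub>"
    "\<And>x. x \<in> X \<Longrightarrow> the_hom P B X gen val (gen x) = val x"
proof -
  interpret B: comm_group B by fact
  obtain e where e: "e \<in> hom FG B" "\<And>x. x \<in> X \<Longrightarrow> e (frag_of x) = val x"
    using B.free_Abelian_group_universal[of val X] val by blast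
  interpret e: group_hom FG B e using e(1) by (auto simp: group_hom_def group_hom_axioms_def)
  have "rels \<subseteq> kernel FG B e"
  proof
    fix r assume r: "r \<in> rels"
    hence rc: "r \<in> carrier FG" using rels_subset by blast
    from r consider x y where "r = frag_of x - frag_of y" "E x y" | x where "r = frag_of (\<rho> x) + frag_of x" "x \<in> X"
      unfolding rels_def by blast
    hence "e r = \<one>\<^bsub>B\<^esub>"
    proof cases
      case 1
      note xy = E_in[OF 1(2)]
      have "r = frag_of x \<otimes>\<^bsub>FG\<^esub> inv\<^bsub>FG\<^esub> (frag_of y)" using xy 1 by simp
      moreover have "frag_of x \<in> carrier FG" "frag_of y \<in> carrier FG" using xy by simp_all
      ultimately have "e r = e (frag_of x) \<otimes>\<^bsub>B\<^esub> inv\<^bsub>B\<^esub> e (frag_of y)" 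
        using e.hom_mult[of "frag_of x" "inv\<^bsub>FG\<^esub> (frag_of y)"] e.hom_inv[of "frag_of y"]
          group.inv_closed[OF group_free_Abelian_group[of X], of "frag_of y"] by metis
      thus ?thesis using e(2) xy vE[OF 1(2)] val by simp
    next
      case 2
      have "e r = e (frag_of (\<rho> x)) \<otimes>\<^bsub>B\<^esub> e (frag_of x)"
        using e.hom_mult[of "frag_of (\<rho> x)" "frag_of x"] 2 \<rho>_in by simp
      thus ?thesis using e(2) 2 \<rho>_in v\<rho> by simp
    qed
    thus "r \<in> kernel FG B e" using rc by (simp add: kernel_def)
  qed
  hence NK: "N \<subseteq> kernel FG B e"
    using group.generate_subgroup_incl[OF group_free_Abelian_group] e.subgroup_kernel by blast
  obtain g where g: "g \<in> hom P B" "\<And>c. c \<in> carrier FG \<Longrightarrow> g (N #>\<^bsub>FG\<^esub> c) = e c"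
  proof (rule FactGroup_universal[OF e(1) normal_N])
    fix x y assume xy: "x \<in> carrier FG" "y \<in> carrier FG" "N #>\<^bsub>FG\<^esub> x = N #>\<^bsub>FG\<^esub> y"
    have "x \<in> N #>\<^bsub>FG\<^esub> y" using group.rcos_self[OF group_free_Abelian_group xy(1) subgroup_N] xy(3) by simp
    then obtain n where n: "n \<in> N" "x = n \<otimes>\<^bsub>FG\<^esub> y" unfolding r_coset_def by blast
    have "e n = \<one>\<^bsub>B\<^esub>" "n \<in> carrier FG" using n NK by (auto simp: kernel_def)
    thus "e x = e y" using n(2) e.hom_mult[of n y] xy(2) by simp
  qed (auto simp: pres_group_def intro: that)
  define h where "h Y = (if Y \<in> carrier P then g Y else \<one>\<^bsub>B\<^esub>)" for Y
  interpret Pg: comm_group P by (rule comm_group_P)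
  have h: "h \<in> hom P B" using g(1) unfolding h_def hom_def by auto
  have hg: "h (gen x) = val x" if "x \<in> X" for x
    using g(2)[of "frag_of x"] e(2) gen_in that unfolding h_def pres_gen_def by simp
  have "\<exists>!h. h \<in> hom P B \<and> (\<forall>Y. Y \<notin> carrier P \<longrightarrow> h Y = \<one>\<^bsub>B\<^esub>) \<and> (\<forall>x\<in>X. h (gen x) = val x)"
  proof (rule ex1I[of _ h])
    show "h \<in> hom P B \<and> (\<forall>Y. Y \<notin> carrier P \<longrightarrow> h Y = \<one>\<^bsub>B\<^esub>) \<and> (\<forall>x\<in>X. h (gen x) = val x)"
      using h hg by (auto simp: h_def)
    fix h' assume h': "h' \<in> hom P B \<and> (\<forall>Y. Y \<notin> carrier P \<longrightarrow> h' Y = \<one>\<^bsub>B\<^esub>) \<and> (\<forall>x\<in>X. h' (gen x) = val x)"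
    show "h' = h"
    proof
      fix Y show "h' Y = h Y"
        by (cases "Y \<in> carrier P") (use h' h hg hom_eqI[OF B.is_group, of h' h Y] in \<open>auto simp: h_def\<close>)
    qed
  qed
  from theI'[OF this, folded the_hom_def]
  show "the_hom P B X gen val \<in> hom P B" "\<And>Y. Y \<notin> carrier P \<Longrightarrow> the_hom P B X gen val Y = \<one>\<^bsub>B\<^esub>"
    "\<And>x. x \<in> X \<Longrightarrow> the_hom P B X gen val (gen x) = val x"
    by blast+
qed

lemma gen_eq:
  assumes "E x y" shows "gen x = gen y"
proof -
  note xy = E_in[OF assms]
  have "frag_of x - frag_of y \<in> N"
    by (rule generate.incl) (use assms in \<open>auto simp: rels_def\<close>)
  hence "frag_of x \<in> N #>\<^bsub>FG\<^esub> frag_of y" unfolding r_coset_def by force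
  thus ?thesis unfolding pres_gen_def
    using group.repr_independence[OF group_free_Abelian_group _ _ subgroup_N, of "frag_of x" "frag_of y"] xy by simp
qed

lemma gen_\<rho>:
  assumes "x \<in> X" shows "gen (\<rho> x) \<otimes>\<^bsub>P\<^esub> gen x = \<one>\<^bsub>P\<^esub>" "gen (\<rho> x) = inv\<^bsub>P\<^esub> gen x"
proof -
  interpret P: comm_group P by (rule comm_group_P)
  have r: "frag_of (\<rho> x) + frag_of x \<in> N" by (rule generate.incl) (use assms in \<open>auto simp: rels_def\<close>)
  have "gen (\<rho> x) \<otimes>\<^bsub>P\<^esub> gen x = N #>\<^bsub>FG\<^esub> (frag_of (\<rho> x) \<otimes>\<^bsub>FG\<^esub> frag_of x)"
    unfolding pres_gen_def by (rule hom_mult[OF proj_hom, symmetric]) (use assms \<rho>_in in auto)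
  also have "\<dots> = N" using r group.coset_join2[OF group_free_Abelian_group _ subgroup_N] subgroup.mem_carrier[OF subgroup_N] by auto
  finally show 1: "gen (\<rho> x) \<otimes>\<^bsub>P\<^esub> gen x = \<one>\<^bsub>P\<^esub>" by (simp add: pres_group_def FactGroup_def)
  show "gen (\<rho> x) = inv\<^bsub>P\<^esub> gen x" using P.inv_equality[OF 1] gen_in assms \<rho>_in by simp
qed

lemma E_\<rho>_iff: "x \<in> X \<Longrightarrow> y \<in> X \<Longrightarrow> E (\<rho> x) y \<longleftrightarrow> E x (\<rho> y)"
  using E_\<rho>[of "\<rho> x" y] E_\<rho>[of x "\<rho> y"] \<rho>_\<rho> by auto

text \<open>The coordinate functional at \<open>x\<close>. If \<open>x\<close> is equivalent to its
  reverse, the two indicators coincide and the functional is zero.\<close>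

definition dual :: "'a \<Rightarrow> ('a \<Rightarrow>\<^sub>0 int) set \<Rightarrow> int" where
  "dual x = the_hom P ints X gen (\<lambda>y. of_bool (E y x) - of_bool (E y (\<rho> x)))"

lemma dual:
  assumes x: "x \<in> X"
  shows "dual x \<in> hom P ints" "Y \<notin> carrier P \<Longrightarrow> dual x Y = 0"
    "y \<in> X \<Longrightarrow> dual x (gen y) = of_bool (E y x) - of_bool (E y (\<rho> x))"
proof -
  have 1: "(of_bool (E y x) - of_bool (E y (\<rho> x)) :: int) = of_bool (E z x) - of_bool (E z (\<rho> x))" if "E y z" for y z
  proof -
    have "E y w \<longleftrightarrow> E z w" for w using E_trans[OF that] E_trans[OF E_sym[OF that]] by blast
    thus ?thesis by simp
  qed
  have 2: "(of_bool (E (\<rho> y) x) - of_bool (E (\<rho> y) (\<rho> x))) + (of_bool (E y x) - of_bool (E y (\<rho> x))) = (0 :: int)"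
    if "y \<in> X" for y
    using E_\<rho>_iff[OF that x] E_\<rho>_iff[OF that \<rho>_in[OF x]] \<rho>_\<rho>[OF x] by simp
  note t = the_hom_P[OF comm_group_ints, of "\<lambda>y. of_bool (E y x) - of_bool (E y (\<rho> x))", folded dual_def]
  show "dual x \<in> hom P ints" by (rule t(1)) (use 1 2 in auto)
  show "Y \<notin> carrier P \<Longrightarrow> dual x Y = 0" using t(2) 1 2 by simp
  show "y \<in> X \<Longrightarrow> dual x (gen y) = of_bool (E y x) - of_bool (E y (\<rho> x))" by (rule t(3)) (use 1 2 in auto)
qed

lemma dual_eq_E: "E x y \<Longrightarrow> dual x = dual y"
proof -
  assume e: "E x y"
  have "E z x \<longleftrightarrow> E z y" "E z (\<rho> x) \<longleftrightarrow> E z (\<rho> y)" for z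
    using E_trans[OF _ e] E_trans[OF _ E_sym[OF e]] E_trans[OF _ E_\<rho>[OF e]] E_trans[OF _ E_sym[OF E_\<rho>[OF e]]] by blast+
  thus ?thesis unfolding dual_def by simp
qed

lemma dual_\<rho>:
  assumes x: "x \<in> X" shows "dual (\<rho> x) Y = - dual x Y"
proof (cases "Y \<in> carrier P")
  case True
  interpret P: comm_group P by (rule comm_group_P)
  have "(\<lambda>Y. - dual x Y) \<in> hom P ints" using dual(1)[OF x] unfolding hom_def by auto
  moreover have "group ints" using comm_group_ints comm_group.axioms by blast
  ultimately show ?thesis
    using hom_eqI[of ints "dual (\<rho> x)" "\<lambda>Y. - dual x Y" Y] dual(1)[OF \<rho>_in[OF x]] dual(3)[OF x] dual(3)[OF \<rho>_in[OF x]]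
      \<rho>_\<rho>[OF x] True by simp
next
  case False
  thus ?thesis using dual(2)[OF x] dual(2)[OF \<rho>_in[OF x]] by simp
qed

end

section \<open>Oriented graphs and forest generators as signed sets\<close>

lemma oiso_id: "rib (fst x) \<Longrightarrow> snd x \<in> orientations (fst x) \<Longrightarrow> oiso x x (idm (fst x))"
  unfolding oiso_def using rg_iso_id transport_idm rib_is_graph by blast

lemma ographsD:
  assumes "x \<in> ographs n"
  shows "ribbon_graph (fst x)" "rib (fst x)" "codim (fst x) = n" "snd x \<in> orientations (fst x)"
  using assms unfolding ographs_def ribbon_graph_iff by auto

lemma oiso_comp:
  assumes "x \<in> ographs n" "y \<in> ographs k" "oiso x y m" "oiso y z l" shows "oiso x z (l \<circ>\<^sub>m m)"
  using assms ographsD(2)[OF assms(1)] ographsD(2)[OF assms(2)] ographsD(4)[OF assms(1)] rg_iso_comp transport_comp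
  unfolding oiso_def by metis

lemma oiso_inverse:
  assumes x: "x \<in> ographs n" and y: "y \<in> ographs k" and m: "oiso x y m"
  obtains l where "oiso y x l" "l \<circ>\<^sub>m m = idm (fst x)" "m \<circ>\<^sub>m l = idm (fst y)"
proof -
  note X = ographsD[OF x] and Y = ographsD[OF y]
  have i: "rg_iso (fst x) (fst y) m" and t: "transport m (snd x) = snd y" using m unfolding oiso_def by auto
  obtain l where l: "rg_iso (fst y) (fst x) l" "l \<circ>\<^sub>m m = idm (fst x)" "m \<circ>\<^sub>m l = idm (fst y)"
    using rg_iso_inverse[OF X(2) Y(2) i] by blast
  have "transport l (snd y) = transport (l \<circ>\<^sub>m m) (snd x)"
    unfolding t[symmetric] using transport_comp[OF X(2) i l(1) X(4)] by simp
  hence "transport l (snd y) = snd x" unfolding l(2) using transport_idm[OF rib_is_graph[OF X(2)] X(4)] by simp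
  thus thesis using that l unfolding oiso_def by blast
qed

lemma rev_graph:
  assumes "x \<in> ographs n"
  shows "rev_graph x \<in> ographs n" "rev_graph (rev_graph x) = x" "fst (rev_graph x) = fst x"
  using ographsD[OF assms] orient_rev[of "snd x" "fst x"] ribbon_card_basis[of "fst x"] assms
  unfolding rev_graph_def ographs_def by (auto simp: prod_eq_iff)

lemma oiso_rev_graph:
  assumes "x \<in> ographs n" "oiso x y m" shows "oiso (rev_graph x) (rev_graph y) m"
  using ographsD[OF assms(1)] assms(2) transport_rev[of "fst x" "fst y" m "snd x"] ribbon_card_basis[of "fst x"]
  unfolding oiso_def rev_graph_def by simp

definition oeq :: "nat \<Rightarrow> 'h ograph \<Rightarrow> 'h ograph \<Rightarrow> bool" where
  "oeq n x y \<longleftrightarrow> x \<in> ographs n \<and> y \<in> ographs n \<and> (\<exists>m. oiso x y m)"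

interpretation coh: signed_set "ographs n" "oeq n" rev_graph for n :: nat
proof
  fix x y z :: "'h ograph"
  show "x \<in> ographs n \<Longrightarrow> oeq n x x" using oiso_id[of x] ographsD[of x n] unfolding oeq_def by blast
  show "oeq n x y \<Longrightarrow> oeq n y x" unfolding oeq_def using oiso_inverse by metis
  show "oeq n x y \<Longrightarrow> oeq n y z \<Longrightarrow> oeq n x z" unfolding oeq_def using oiso_comp by blast
  show "oeq n x y \<Longrightarrow> oeq n (rev_graph x) (rev_graph y)" unfolding oeq_def using oiso_rev_graph rev_graph(1) by blast
qed (use rev_graph oeq_def in blast)+

lemma coh_rels_eq: "coh_rels n = coh.rels n"
  unfolding coh_rels_def coh.rels_def oeq_def ..

definition feq :: "nat \<Rightarrow> 'h rgraph \<Rightarrow> 'h fgen \<Rightarrow> 'h fgen \<Rightarrow> bool" where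
  "feq k G0 p q \<longleftrightarrow> p \<in> F_gens k G0 \<and> q \<in> F_gens k G0 \<and> (\<exists>m. oiso (fst p) (fst q) m \<and> snd q \<circ>\<^sub>m m = snd p)"

definition frev :: "'h fgen \<Rightarrow> 'h fgen" where "frev p = (rev_graph (fst p), snd p)"

lemma F_gensD: "p \<in> F_gens k G0 \<Longrightarrow> fst p \<in> ographs k \<and> fat_mor (fst (fst p)) G0 (snd p)"
  unfolding F_gens_def by auto

lemma F_gensI: "x \<in> ographs k \<Longrightarrow> fat_mor (fst x) G0 f \<Longrightarrow> (x, f) \<in> F_gens k G0"
  unfolding F_gens_def by auto

interpretation fc: signed_set "F_gens k G0" "feq k G0" frev for k :: nat and G0 :: "'h rgraph"
proof
  fix p q r :: "'h fgen"
  show "p \<in> F_gens k G0 \<Longrightarrow> feq k G0 p p"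
  proof -
    assume p: "p \<in> F_gens k G0"
    note D = F_gensD[OF p]
    have "oiso (fst p) (fst p) (idm (fst (fst p)))" using oiso_id[of "fst p"] ographsD[of "fst p" k] D by blast
    moreover have "snd p \<circ>\<^sub>m idm (fst (fst p)) = snd p" by (rule map_comp_idm, rule fat_mor_domran(1)[OF conjunct2[OF D]])
    ultimately show ?thesis unfolding feq_def using p by blast
  qed
  show "feq k G0 p q \<Longrightarrow> feq k G0 q p"
  proof -
    assume a: "feq k G0 p q"
    then obtain m where m: "oiso (fst p) (fst q) m" "snd q \<circ>\<^sub>m m = snd p" unfolding feq_def by blast
    have D: "fst p \<in> ographs k" "fst q \<in> ographs k" "fat_mor (fst (fst q)) G0 (snd q)"
      using a F_gensD unfolding feq_def by blast+
    obtain l where l: "oiso (fst q) (fst p) l" "m \<circ>\<^sub>m l = idm (fst (fst q))" using oiso_inverse[OF D(1,2) m(1)] by metis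
    have "snd p \<circ>\<^sub>m l = snd q" unfolding m(2)[symmetric] map_comp_assoc l(2) using fat_mor_domran(1)[OF D(3)] by simp
    thus ?thesis using a l(1) unfolding feq_def by blast
  qed
  show "feq k G0 p q \<Longrightarrow> feq k G0 q r \<Longrightarrow> feq k G0 p r"
  proof -
    assume a: "feq k G0 p q" "feq k G0 q r"
    then obtain m l where "oiso (fst p) (fst q) m" "snd q \<circ>\<^sub>m m = snd p" "oiso (fst q) (fst r) l" "snd r \<circ>\<^sub>m l = snd q"
      unfolding feq_def by blast
    moreover have "fst p \<in> ographs k" "fst q \<in> ographs k" using a F_gensD unfolding feq_def by blast+
    ultimately have "oiso (fst p) (fst r) (l \<circ>\<^sub>m m)" "snd r \<circ>\<^sub>m (l \<circ>\<^sub>m m) = snd p"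
      using oiso_comp by (blast, simp add: map_comp_assoc[symmetric])
    thus ?thesis using a unfolding feq_def by blast
  qed
  show "p \<in> F_gens k G0 \<Longrightarrow> frev p \<in> F_gens k G0"
    using rev_graph[of "fst p" k] F_gensD[of p k G0] unfolding frev_def by (auto intro: F_gensI)
  thus "feq k G0 p q \<Longrightarrow> feq k G0 (frev p) (frev q)"
    unfolding feq_def using oiso_rev_graph[of "fst p" k "fst q"] F_gensD[of p k G0]
      rev_graph[of "fst q" k] F_gensD[of q k G0] by (auto simp: frev_def intro: F_gensI)
  show "p \<in> F_gens k G0 \<Longrightarrow> frev (frev p) = p"
    using rev_graph(2)[of "fst p" k] F_gensD[of p k G0] unfolding frev_def by simp
qed (auto simp: feq_def)

lemma F_rels_eq: "F_rels k G0 = fc.rels k G0"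
proof -
  have "{frag_of (x, f) - frag_of (y, g) | x f y g. (x, f) \<in> F_gens k G0 \<and> (y, g) \<in> F_gens k G0 \<and>
        (\<exists>m. oiso x y m \<and> g \<circ>\<^sub>m m = f)} = {frag_of p - frag_of q | p q. feq k G0 p q}"
    unfolding feq_def by auto
  moreover have "{frag_of (rev_graph x, f) + frag_of (x, f) | x f. (x, f) \<in> F_gens k G0} =
      {frag_of (frev p) + frag_of p | p. p \<in> F_gens k G0}"
    unfolding frev_def by force
  ultimately show ?thesis unfolding F_rels_def fc.rels_def by simp
qed

lemma F_group_eq: "F_group k G0 = pres_group (F_gens k G0) (fc.rels k G0)"
  and F_cls_eq: "F_cls k G0 = pres_gen (F_gens k G0) (fc.rels k G0)"
  unfolding F_group_def F_cls_def F_rels_eq by simp_all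

lemma Gcoh_eq: "Gcoh n = pres_group (ographs n) (coh.rels n)"
  and Gcls_eq: "Gcls n = pres_gen (ographs n) (coh.rels n)"
  unfolding Gcoh_def Gcls_def coh_rels_eq by simp_all

lemmas F_the_hom = fc.the_hom_P[folded F_group_eq F_cls_eq]
lemmas F_hom_eqI = fc.hom_eqI[folded F_group_eq F_cls_eq]
lemmas F_comm_group = fc.comm_group_P[folded F_group_eq]
lemmas F_cls_in = fc.gen_in[folded F_group_eq F_cls_eq]
lemmas F_cls_E = fc.gen_eq[folded F_group_eq F_cls_eq]
lemmas F_cls_rev = fc.gen_\<rho>[folded F_group_eq F_cls_eq]
lemmas F_dual = fc.dual[folded F_group_eq F_cls_eq]

subsection \<open>The duals and their span\<close>

lemma Gdual_eq: "x \<in> ographs n \<Longrightarrow> Gdual n x = coh.dual n x"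
proof -
  assume x: "x \<in> ographs n"
  have v: "(of_bool (\<exists>m. oiso y x m) - of_bool (\<exists>m. oiso y (rev_graph x) m) :: int) =
      of_bool (oeq n y x) - of_bool (oeq n y (rev_graph x))" if "y \<in> ographs n" for y
    using that x rev_graph(1)[OF x] unfolding oeq_def by simp
  show ?thesis unfolding Gdual_def coh.dual_def the_hom_def Gcoh_eq Gcls_eq
    by (rule arg_cong[of _ _ The], rule ext) (use v in auto)
qed

definition Ghoms :: "nat \<Rightarrow> ('h, 'r::comm_ring_1) gcochain set" where
  "Ghoms n = {c. c \<in> hom (Gcoh n) (add_group UNIV) \<and> (\<forall>X. X \<notin> carrier (Gcoh n) \<longrightarrow> c X = 0) \<and>
     finite {X \<in> Gcls n ` ographs n. c X \<noteq> 0}}"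

lemma Ghom_eq: "Ghom n = add_group (Ghoms n)" unfolding Ghom_def Ghoms_def ..

lemma Ghoms_zero: "0 \<in> Ghoms n" unfolding Ghoms_def hom_def by auto

lemma Ghoms_uminus: "c \<in> Ghoms n \<Longrightarrow> - c \<in> Ghoms n" unfolding Ghoms_def hom_def by auto

lemma Ghoms_add:
  assumes "c \<in> Ghoms n" "d \<in> Ghoms n" shows "c + d \<in> Ghoms n"
proof -
  have "finite {X \<in> Gcls n ` ographs n. (c + d) X \<noteq> 0}"
    by (rule finite_subset[of _ "{X \<in> Gcls n ` ographs n. c X \<noteq> 0} \<union> {X \<in> Gcls n ` ographs n. d X \<noteq> 0}"])
      (use assms in \<open>auto simp: Ghoms_def\<close>)
  thus ?thesis using assms unfolding Ghoms_def hom_def by (auto simp: algebra_simps)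
qed

lemma Ghom_comm_group: "comm_group (Ghom n)"
  unfolding Ghom_eq by (rule comm_group_add_group) (use Ghoms_zero Ghoms_add Ghoms_uminus in auto)

lemma angle_gen:
  assumes "x \<in> ographs n" "y \<in> ographs n"
  shows "angle n x (Gcls n y) = int (card (Aut (fst x))) * (of_bool (oeq n y x) - of_bool (oeq n y (rev_graph x)))"
  unfolding angle_def Gdual_eq[OF assms(1)] Gcls_eq using coh.dual(3)[OF assms] by simp

text \<open>Among the classes of generators, the support contains at most those of \<open>x\<close>
  and of its reverse.\<close>

lemma angle_Ghoms:
  assumes x: "x \<in> ographs n" shows "angle n x \<in> Ghoms n"
proof -
  have "angle n x \<in> hom (Gcoh n) ints"
    using coh.dual(1)[OF x] unfolding angle_def Gdual_eq[OF x] Gcoh_eq hom_def by (auto simp: algebra_simps)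
  moreover have "angle n x X = 0" if "X \<notin> carrier (Gcoh n)" for X
    using coh.dual(2)[OF x] that unfolding angle_def Gdual_eq[OF x] Gcoh_eq by simp
  moreover have "{X \<in> Gcls n ` ographs n. angle n x X \<noteq> 0} \<subseteq> {Gcls n x, Gcls n (rev_graph x)}"
  proof
    fix X assume "X \<in> {X \<in> Gcls n ` ographs n. angle n x X \<noteq> 0}"
    then obtain y where y: "y \<in> ographs n" "X = Gcls n y" "angle n x X \<noteq> 0" by blast
    hence "oeq n y x \<or> oeq n y (rev_graph x)" using angle_gen[OF x y(1)] by (auto split: if_splits)
    thus "X \<in> {Gcls n x, Gcls n (rev_graph x)}" using coh.gen_eq y(2) unfolding Gcls_eq by blast
  qed
  hence "finite {X \<in> Gcls n ` ographs n. angle n x X \<noteq> 0}" using finite_subset by blast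
  ultimately show ?thesis unfolding Ghoms_def by blast
qed

lemma angle_oeq:
  assumes "oeq n x y" shows "angle n x = angle n y"
proof -
  have xy: "x \<in> ographs n" "y \<in> ographs n" using assms unfolding oeq_def by auto
  obtain m where m: "rg_iso (fst x) (fst y) m" using assms unfolding oeq_def oiso_def by blast
  have "card (Aut (fst x)) = card (Aut (fst y))" using card_isos(1,2)[OF ographsD(2)[OF xy(1)] ographsD(2)[OF xy(2)] m] by simp
  thus ?thesis unfolding angle_def Gdual_eq[OF xy(1)] Gdual_eq[OF xy(2)] using coh.dual_eq_E[OF assms] by simp
qed

lemma angle_rev: 
  assumes x: "x \<in> ographs n" shows "angle n (rev_graph x) = - angle n x"
  unfolding angle_def Gdual_eq[OF x] Gdual_eq[OF rev_graph(1)[OF x]] using coh.dual_\<rho>[OF x] rev_graph(3)[OF x]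
  by (auto simp: fun_eq_iff)

lemma GZ_comm_group: "comm_group (GZ_group n)"
proof -
  interpret comm_group "Ghom n :: ('h, int) gcochain monoid" by (rule Ghom_comm_group)
  show ?thesis unfolding GZ_group_def by (rule abelian_subgroup_generated) unfold_locales
qed

lemma angle_GZ: "x \<in> ographs n \<Longrightarrow> angle n x \<in> carrier (GZ_group n)"
  unfolding GZ_group_def carrier_subgroup_generated
  by (intro generate.incl IntI imageI) (simp_all add: Ghom_eq angle_Ghoms)

lemma GZ_simps: "f \<otimes>\<^bsub>GZ_group n\<^esub> g = f + g" "\<one>\<^bsub>GZ_group n\<^esub> = 0"
  unfolding GZ_group_def by (simp_all add: subgroup_generated_def Ghom_eq)

section \<open>The forest carrier\<close>

lemma expansions_iff: "(D, g) \<in> expansions G \<longleftrightarrow> (\<exists>e. one_edge D e G g)"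
proof
  assume "(D, g) \<in> expansions G"
  hence f: "fat_mor D G g" "card (collapsed D g) = 1" unfolding expansions_def by auto
  hence "codim G = Suc (codim D)" using fat_mor_domran(3,4)[OF f(1)] by simp
  thus "\<exists>e. one_edge D e G g" using fat_mor_one_edge[OF f(1)] by metis
next
  assume "\<exists>e. one_edge D e G g"
  then obtain e where e: "one_edge D e G g" by blast
  show "(D, g) \<in> expansions G" unfolding expansions_def using one_edgeD(8,9)[OF e] by simp
qed

lemma expansionsD:
  assumes "(D, g) \<in> expansions G"
  shows "step_mor D G g" "ribbon_graph D" "rib D" "ribbon_graph G" "rib G" "fat_mor D G g" "codim G = Suc (codim D)"
proof -
  obtain e where e: "one_edge D e G g" using assms expansions_iff by blast
  note one_edgeD[OF e] step_mor_one_edge[OF e]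
  thus "step_mor D G g" "ribbon_graph D" "rib D" "ribbon_graph G" "rib G" "fat_mor D G g" "codim G = Suc (codim D)"
    by simp_all
qed

lemma expansions_iso_comp:
  assumes "(D, g) \<in> expansions G" "rg_iso G G' m" "ribbon_graph G'" shows "(D, m \<circ>\<^sub>m g) \<in> expansions G'"
  using assms one_edge_iso_comp unfolding expansions_iff by blast

lemma exp_equiv_iso_comp:
  assumes "((D1, g1), (D2, g2)) \<in> exp_equiv G" "rg_iso G G' m" "ribbon_graph G'"
  shows "((D1, m \<circ>\<^sub>m g1), (D2, m \<circ>\<^sub>m g2)) \<in> exp_equiv G'"
  using assms expansions_iso_comp unfolding exp_equiv_def by (auto simp: map_comp_assoc)

lemma equiv_exp_equiv: "equiv (expansions G) (exp_equiv G)"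
proof (rule equivI)
  show "exp_equiv G \<subseteq> expansions G \<times> expansions G" unfolding exp_equiv_def by auto
  show "refl_on (expansions G) (exp_equiv G)"
  proof (rule refl_onI)
    fix z assume "z \<in> expansions G"
    moreover obtain D g where z: "z = (D, g)" by (cases z)
    ultimately have "(D, g) \<in> expansions G" by simp
    note D = expansionsD[OF this]
    have "rg_iso D D (idm D)" "g \<circ>\<^sub>m idm D = g"
      by (rule rg_iso_id[OF D(3)], rule map_comp_idm[OF fat_mor_domran(1)[OF D(6)]])
    thus "(z, z) \<in> exp_equiv G" using \<open>z \<in> expansions G\<close> z unfolding exp_equiv_def by blast
  qed
  show "sym (exp_equiv G)"
  proof (rule symI)
    fix z z' assume "(z, z') \<in> exp_equiv G"
    then obtain D g D' g' m where z: "z = (D, g)" "z' = (D', g')" "(D, g) \<in> expansions G" "(D', g') \<in> expansions G"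
      "rg_iso D D' m" "g' \<circ>\<^sub>m m = g" unfolding exp_equiv_def by auto
    obtain n where n: "rg_iso D' D n" "m \<circ>\<^sub>m n = idm D'"
      using rg_iso_inverse[OF expansionsD(3)[OF z(3)] expansionsD(3)[OF z(4)] z(5)] by blast
    have "g \<circ>\<^sub>m n = g'" unfolding z(6)[symmetric] map_comp_assoc n(2)
      by (rule map_comp_idm, rule fat_mor_domran(1)[OF expansionsD(6)[OF z(4)]])
    thus "(z', z) \<in> exp_equiv G" unfolding exp_equiv_def using z n(1) by blast
  qed
  show "trans (exp_equiv G)"
  proof (rule transI)
    fix x y z assume "(x, y) \<in> exp_equiv G" "(y, z) \<in> exp_equiv G"
    then obtain D g D' g' D'' g'' m m' where *: "x = (D, g)" "y = (D', g')" "z = (D'', g'')"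
      "(D, g) \<in> expansions G" "(D', g') \<in> expansions G" "(D'', g'') \<in> expansions G"
      "rg_iso D D' m" "g' \<circ>\<^sub>m m = g" "rg_iso D' D'' m'" "g'' \<circ>\<^sub>m m' = g'" unfolding exp_equiv_def by auto
    have "rg_iso D D'' (m' \<circ>\<^sub>m m)"
      by (rule rg_iso_comp[OF expansionsD(3)[OF *(4)] *(7,9) expansionsD(3)[OF *(5)]])
    moreover have "g'' \<circ>\<^sub>m (m' \<circ>\<^sub>m m) = g" using *(8,10) by (simp add: map_comp_assoc[symmetric])
    ultimately show "(x, z) \<in> exp_equiv G" unfolding exp_equiv_def using * by blast
  qed
qed

text \<open>Finiteness matters for the meaning of the boundary: \<open>finprod\<close> over an
  infinite index set is the neutral element by convention.\<close>

lemma finite_expansion_classes: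
  assumes G: "ribbon_graph G" shows "finite (expansions G // exp_equiv G)"
proof -
  obtain Z where Z: "finite Z" "\<And>D g. (D, g) \<in> Z \<Longrightarrow> \<exists>e. one_edge D e G g"
    "\<And>A e f. one_edge A e G f \<Longrightarrow> \<exists>D g m. (D, g) \<in> Z \<and> rg_iso A D m \<and> g \<circ>\<^sub>m m = f"
    using finite_expansion_reps[OF G] by metis
  have "expansions G // exp_equiv G \<subseteq> (\<lambda>z. exp_equiv G `` {z}) ` Z"
  proof
    fix K assume "K \<in> expansions G // exp_equiv G"
    then obtain A f where K: "(A, f) \<in> expansions G" "K = exp_equiv G `` {(A, f)}" by (metis quotientE surj_pair)
    then obtain D g m where D: "(D, g) \<in> Z" "rg_iso A D m" "g \<circ>\<^sub>m m = f" using Z(3) expansions_iff by metis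
    have "(D, g) \<in> expansions G" using Z(2)[OF D(1)] expansions_iff by blast
    hence "((A, f), (D, g)) \<in> exp_equiv G" unfolding exp_equiv_def using K(1) D by blast
    hence "K = exp_equiv G `` {(D, g)}" unfolding K(2) by (rule equiv_class_eq[OF equiv_exp_equiv])
    thus "K \<in> (\<lambda>z. exp_equiv G `` {z}) ` Z" using D(1) by blast
  qed
  thus ?thesis using Z(1) finite_subset by blast
qed

section \<open>The boundary of the forest complex\<close>

definition cls_term :: "nat \<Rightarrow> 'h rgraph \<Rightarrow> 'h ordering set \<Rightarrow> 'h pmap \<Rightarrow> ('h rgraph \<times> 'h pmap) set \<Rightarrow> ('h fgen \<Rightarrow>\<^sub>0 int) set" where
  "cls_term k G0 \<omega> f K = (let (D, g) = (SOME z. z \<in> K) in F_cls k G0 ((D, inducing_or D g \<omega>), f \<circ>\<^sub>m g))"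

definition bd_val :: "nat \<Rightarrow> 'h rgraph \<Rightarrow> 'h fgen \<Rightarrow> ('h fgen \<Rightarrow>\<^sub>0 int) set" where
  "bd_val k G0 = (\<lambda>((G, \<omega>), f). finprod (F_group k G0) (cls_term k G0 \<omega> f) (expansions G // exp_equiv G))"

lemma F_bd_eq: "F_bd k G0 = the_hom (F_group (Suc k) G0) (F_group k G0) (F_gens (Suc k) G0) (F_cls (Suc k) G0) (bd_val k G0)"
  unfolding F_bd_def bd_val_def cls_term_def ..

lemma expansion_gen:
  assumes "((G, \<omega>), f) \<in> F_gens (Suc k) G0" "(D, g) \<in> expansions G"
  shows "((D, inducing_or D g \<omega>), f \<circ>\<^sub>m g) \<in> F_gens k G0"
proof -
  note D = expansionsD[OF assms(2)]
  have x: "(G, \<omega>) \<in> ographs (Suc k)" "fat_mor G G0 f" using F_gensD[OF assms(1)] by auto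
  have w: "\<omega> \<in> orientations G" "codim G = Suc k" using ographsD[OF x(1)] by auto
  have "(D, inducing_or D g \<omega>) \<in> ographs k"
    using inducing_or(1)[OF D(1) w(1)] D w unfolding ographs_def by simp
  thus ?thesis using fat_mor_comp[OF D(6) x(2)] by (auto intro: F_gensI)
qed

lemma expansion_gen_feq:
  assumes p: "((G, \<omega>), f) \<in> F_gens (Suc k) G0" and e: "((D, g), (D', g')) \<in> exp_equiv G"
  shows "feq k G0 ((D, inducing_or D g \<omega>), f \<circ>\<^sub>m g) ((D', inducing_or D' g' \<omega>), f \<circ>\<^sub>m g')"
proof -
  obtain m where m: "(D, g) \<in> expansions G" "(D', g') \<in> expansions G" "rg_iso D D' m" "g' \<circ>\<^sub>m m = g"
    using e unfolding exp_equiv_def by blast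
  note D = expansionsD[OF m(1)] and D' = expansionsD[OF m(2)]
  have w: "\<omega> \<in> orientations G" using F_gensD[OF p] ographsD by auto
  note i = inducing_or[OF D(1) w]
  have "induced_or D' g' (transport m (inducing_or D g \<omega>)) = \<omega>"
    using induced_or_comp_iso[OF D'(1) m(3) D(2) i(1)] m(4) i(2) by simp
  hence "transport m (inducing_or D g \<omega>) = inducing_or D' g' \<omega>"
    using inducing_or_eq[OF D'(1) transport_orientation[OF D(3) m(3) i(1)]] by simp
  hence "oiso (D, inducing_or D g \<omega>) (D', inducing_or D' g' \<omega>) m" unfolding oiso_def using m(3) by simp
  moreover have "(f \<circ>\<^sub>m g') \<circ>\<^sub>m m = f \<circ>\<^sub>m g" using m(4) by (simp add: map_comp_assoc)
  ultimately show ?thesis unfolding feq_def using expansion_gen[OF p m(1)] expansion_gen[OF p m(2)] by auto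
qed

text \<open>Equivalent expansions with the inducing orientations are isomorphic over
  \<open>G0\<close>, so the choice of a representative in \<open>cls_term\<close> is
  immaterial.\<close>

lemma cls_term_eq:
  assumes p: "((G, \<omega>), f) \<in> F_gens (Suc k) G0" and K: "K \<in> expansions G // exp_equiv G" "(D, g) \<in> K"
  shows "cls_term k G0 \<omega> f K = F_cls k G0 ((D, inducing_or D g \<omega>), f \<circ>\<^sub>m g)" "(D, g) \<in> expansions G"
proof -
  obtain D' g' where s: "(SOME z. z \<in> K) = (D', g')" by (cases "SOME z. z \<in> K")
  have "(D', g') \<in> K" using someI[of "\<lambda>z. z \<in> K", OF K(2)] s by simp
  hence e: "((D', g'), (D, g)) \<in> exp_equiv G"
    using in_quotient_imp_in_rel[OF equiv_exp_equiv K(1)] K(2) by blast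
  thus "(D, g) \<in> expansions G" unfolding exp_equiv_def by blast
  show "cls_term k G0 \<omega> f K = F_cls k G0 ((D, inducing_or D g \<omega>), f \<circ>\<^sub>m g)"
    unfolding cls_term_def s using F_cls_E[OF expansion_gen_feq[OF p e]] by simp
qed

lemma cls_term_in:
  assumes p: "((G, \<omega>), f) \<in> F_gens (Suc k) G0" and K: "K \<in> expansions G // exp_equiv G"
  shows "cls_term k G0 \<omega> f K \<in> carrier (F_group k G0)"
proof -
  obtain D g where z: "(D, g) \<in> K" using in_quotient_imp_non_empty[OF equiv_exp_equiv K] by fast
  show ?thesis unfolding cls_term_eq(1)[OF p K z] by (rule F_cls_in[OF expansion_gen[OF p cls_term_eq(2)[OF p K z]]])
qed

text \<open>Composition with the isomorphism \<open>m\<close> carries the expansion classes of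
  \<open>G\<close> bijectively to those of \<open>G'\<close>, with matching terms; the product is
  reindexed along it.\<close>

lemma bd_val_feq:
  assumes e: "feq (Suc k) G0 p q" shows "bd_val k G0 p = bd_val k G0 q"
proof -
  interpret C: comm_group "F_group k G0" by (rule F_comm_group)
  obtain G \<omega> f G' \<omega>' f' where pq: "p = ((G, \<omega>), f)" "q = ((G', \<omega>'), f')" by (metis prod.collapse)
  have P: "((G, \<omega>), f) \<in> F_gens (Suc k) G0" and Q: "((G', \<omega>'), f') \<in> F_gens (Suc k) G0"
    using e pq unfolding feq_def by auto
  obtain m where m: "rg_iso G G' m" "transport m \<omega> = \<omega>'" "f' \<circ>\<^sub>m m = f"
    using e pq unfolding feq_def oiso_def by auto
  have x: "(G, \<omega>) \<in> ographs (Suc k)" "(G', \<omega>') \<in> ographs (Suc k)" using F_gensD[OF P] F_gensD[OF Q] by auto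
  have R: "ribbon_graph G" "rib G" "ribbon_graph G'" "rib G'" "\<omega> \<in> orientations G"
    using ographsD[OF x(1)] ographsD[OF x(2)] by auto
  obtain n where n: "rg_iso G' G n" "n \<circ>\<^sub>m m = idm G" "m \<circ>\<^sub>m n = idm G'" using rg_iso_inverse[OF R(2,4) m(1)] by blast
  define \<Theta> where "\<Theta> l = (\<lambda>(D :: 'a rgraph, g :: 'a pmap). (D, l \<circ>\<^sub>m g))" for l :: "'a pmap"
  have cl: "\<Theta> l ` (exp_equiv H `` {(D, g)}) = exp_equiv H' `` {(D, l \<circ>\<^sub>m g)}"
    if l: "rg_iso H H' l" "rg_iso H' H l'" "l' \<circ>\<^sub>m l = idm H" "l \<circ>\<^sub>m l' = idm H'" and H: "ribbon_graph H" "ribbon_graph H'"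
      and Dg: "(D, g) \<in> expansions H" for H H' l l' D g
  proof (intro equalityI subsetI)
    fix z assume "z \<in> \<Theta> l ` (exp_equiv H `` {(D, g)})"
    then obtain D' g' where "((D, g), (D', g')) \<in> exp_equiv H" "z = (D', l \<circ>\<^sub>m g')" unfolding \<Theta>_def by auto
    thus "z \<in> exp_equiv H' `` {(D, l \<circ>\<^sub>m g)}" using exp_equiv_iso_comp[OF _ l(1) H(2)] by blast
  next
    fix z assume z: "z \<in> exp_equiv H' `` {(D, l \<circ>\<^sub>m g)}"
    then obtain D' g' where z': "z = (D', g')" "((D, l \<circ>\<^sub>m g), (D', g')) \<in> exp_equiv H'" by (cases z) auto
    hence g': "(D', g') \<in> expansions H'" unfolding exp_equiv_def by blast
    have "((D, l' \<circ>\<^sub>m (l \<circ>\<^sub>m g)), (D', l' \<circ>\<^sub>m g')) \<in> exp_equiv H" by (rule exp_equiv_iso_comp[OF z'(2) l(2) H(1)])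
    moreover have "l' \<circ>\<^sub>m (l \<circ>\<^sub>m g) = g" "l \<circ>\<^sub>m (l' \<circ>\<^sub>m g') = g'"
      using fat_mor_domran(2)[OF expansionsD(6)[OF Dg]] fat_mor_domran(2)[OF expansionsD(6)[OF g']] l(3,4)
      by (simp_all add: map_comp_assoc[symmetric])
    ultimately show "z \<in> \<Theta> l ` (exp_equiv H `` {(D, g)})" unfolding \<Theta>_def z'(1) by force
  qed
  let ?Q = "expansions G // exp_equiv G" and ?Q' = "expansions G' // exp_equiv G'"
  have im: "\<Theta> l ` K \<in> expansions H' // exp_equiv H'"
    if l: "rg_iso H H' l" "rg_iso H' H l'" "l' \<circ>\<^sub>m l = idm H" "l \<circ>\<^sub>m l' = idm H'" and H: "ribbon_graph H" "ribbon_graph H'"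
      and K: "K \<in> expansions H // exp_equiv H" for H H' l l' K
  proof -
    obtain D g where z: "(D, g) \<in> expansions H" "K = exp_equiv H `` {(D, g)}" using K by (metis quotientE surj_pair)
    show ?thesis unfolding z(2) cl[OF l H z(1)] using expansions_iso_comp[OF z(1) l(1) H(2)] by (rule quotientI)
  qed
  have retract: "\<Theta> l' ` \<Theta> l ` K = K" 
    if l: "l' \<circ>\<^sub>m l = idm H" and K: "K \<in> expansions H // exp_equiv H" for H l l' K
  proof -
    have "\<Theta> l' (\<Theta> l z) = z" if z: "z \<in> K" for z
    proof -
      obtain D g where Dg: "z = (D, g)" by (cases z)
      have "z \<in> expansions H" using in_quotient_imp_subset[OF equiv_exp_equiv K] z by blast
      hence "ran g = halfs H" using fat_mor_domran(2)[OF expansionsD(6)] Dg by blast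
      thus ?thesis unfolding \<Theta>_def Dg using l by (simp add: map_comp_assoc[symmetric])
    qed
    thus ?thesis unfolding image_image by simp
  qed
  have inj: "inj_on ((`) (\<Theta> m)) ?Q" by (rule inj_on_inverseI[of _ "(`) (\<Theta> n)"]) (rule retract[OF n(2)])
  have onto: "(`) (\<Theta> m) ` ?Q = ?Q'"
  proof (intro equalityI subsetI)
    fix K assume "K \<in> (`) (\<Theta> m) ` ?Q" thus "K \<in> ?Q'" using im[OF m(1) n R(1,3)] by blast
  next
    fix K assume K: "K \<in> ?Q'"
    have "\<Theta> n ` K \<in> ?Q" by (rule im[OF n(1) m(1) n(3,2) R(3,1) K])
    moreover have "K = \<Theta> m ` \<Theta> n ` K" using retract[OF n(3) K] by simp
    ultimately show "K \<in> (`) (\<Theta> m) ` ?Q" by blast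
  qed
  have val: "cls_term k G0 \<omega>' f' (\<Theta> m ` K) = cls_term k G0 \<omega> f K" if K: "K \<in> ?Q" for K
  proof -
    obtain D g where z: "(D, g) \<in> K" using in_quotient_imp_non_empty[OF equiv_exp_equiv K] by fast
    note c = cls_term_eq[OF P K z]
    note D = expansionsD[OF c(2)]
    have K': "\<Theta> m ` K \<in> ?Q'" using onto K by blast
    have z': "(D, m \<circ>\<^sub>m g) \<in> \<Theta> m ` K" unfolding \<Theta>_def using z by force
    note c' = cls_term_eq[OF Q K' z']
    note i = inducing_or[OF D(1) R(5)]
    have "induced_or D (m \<circ>\<^sub>m g) (inducing_or D g \<omega>) = \<omega>'"
      using induced_or_iso_comp[OF D(1) m(1) R(3) i(1)] i(2) m(2) by simp
    hence "inducing_or D (m \<circ>\<^sub>m g) \<omega>' = inducing_or D g \<omega>"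
      using inducing_or_eq[OF expansionsD(1)[OF c'(2)] i(1)] by simp
    thus ?thesis unfolding c(1) c'(1) using m(3) by (simp add: map_comp_assoc[symmetric])
  qed
  have "finprod (F_group k G0) (cls_term k G0 \<omega>' f') ?Q' = finprod (F_group k G0) (\<lambda>K. cls_term k G0 \<omega>' f' (\<Theta> m ` K)) ?Q"
    unfolding onto[symmetric] by (rule C.finprod_reindex) (use cls_term_in[OF Q] onto inj in auto)
  also have "\<dots> = finprod (F_group k G0) (cls_term k G0 \<omega> f) ?Q"
    by (rule C.finprod_cong') (use val cls_term_in[OF P] in auto)
  finally show ?thesis unfolding pq bd_val_def by simp
qed

lemma bd_val_in: "p \<in> F_gens (Suc k) G0 \<Longrightarrow> bd_val k G0 p \<in> carrier (F_group k G0)"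
proof -
  interpret C: comm_group "F_group k G0" by (rule F_comm_group)
  assume p: "p \<in> F_gens (Suc k) G0"
  obtain G \<omega> f where pq: "p = ((G, \<omega>), f)" by (metis prod.collapse)
  show ?thesis unfolding pq bd_val_def using cls_term_in[OF p[unfolded pq]] by (auto intro: C.finprod_closed)
qed

text \<open>Reversing the orientation below reverses every inducing orientation, so the two products
  cancel class by class.\<close>

lemma bd_val_frev:
  assumes p: "p \<in> F_gens (Suc k) G0"
  shows "bd_val k G0 (frev p) \<otimes>\<^bsub>F_group k G0\<^esub> bd_val k G0 p = \<one>\<^bsub>F_group k G0\<^esub>"
proof -
  interpret C: comm_group "F_group k G0" by (rule F_comm_group)
  obtain G \<omega> f where pq: "p = ((G, \<omega>), f)" by (metis prod.collapse)
  note P = p[unfolded pq]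
  have r: "frev p = ((G, rev_or G \<omega>), f)" unfolding pq frev_def rev_graph_def by simp
  have P': "((G, rev_or G \<omega>), f) \<in> F_gens (Suc k) G0" using fc.\<rho>_in[OF p] r by simp
  have w: "\<omega> \<in> orientations G" using F_gensD[OF P] ographsD by auto
  let ?Q = "expansions G // exp_equiv G"
  have one: "cls_term k G0 (rev_or G \<omega>) f K \<otimes>\<^bsub>F_group k G0\<^esub> cls_term k G0 \<omega> f K = \<one>\<^bsub>F_group k G0\<^esub>" if K: "K \<in> ?Q" for K
  proof -
    obtain D g where z: "(D, g) \<in> K" using in_quotient_imp_non_empty[OF equiv_exp_equiv K] by fast
    note c = cls_term_eq[OF P K z] and c' = cls_term_eq[OF P' K z]
    have "((D, inducing_or D g (rev_or G \<omega>)), f \<circ>\<^sub>m g) = frev ((D, inducing_or D g \<omega>), f \<circ>\<^sub>m g)"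
      unfolding frev_def rev_graph_def using inducing_or_rev[OF expansionsD(1)[OF c(2)] w] by simp
    thus ?thesis unfolding c(1) c'(1) using F_cls_rev(1)[OF expansion_gen[OF P c(2)]] by simp
  qed
  have "bd_val k G0 (frev p) \<otimes>\<^bsub>F_group k G0\<^esub> bd_val k G0 p = finprod (F_group k G0)
      (\<lambda>K. cls_term k G0 (rev_or G \<omega>) f K \<otimes>\<^bsub>F_group k G0\<^esub> cls_term k G0 \<omega> f K) ?Q"
    unfolding r unfolding pq bd_val_def prod.case
    by (rule C.finprod_multf[symmetric]) (use cls_term_in[OF P] cls_term_in[OF P'] in auto)
  also have "\<dots> = \<one>\<^bsub>F_group k G0\<^esub>" by (rule C.finprod_one_eqI) (rule one)
  finally show ?thesis .
qed

lemma F_bd: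
  shows "F_bd k G0 \<in> hom (F_group (Suc k) G0) (F_group k G0)"
    "p \<in> F_gens (Suc k) G0 \<Longrightarrow> F_bd k G0 (F_cls (Suc k) G0 p) = bd_val k G0 p"
proof -
  note t = F_the_hom[where val = "bd_val k G0", OF F_comm_group bd_val_in bd_val_feq bd_val_frev]
  show "F_bd k G0 \<in> hom (F_group (Suc k) G0) (F_group k G0)" unfolding F_bd_eq by (rule t(1))
  show "p \<in> F_gens (Suc k) G0 \<Longrightarrow> F_bd k G0 (F_cls (Suc k) G0 p) = bd_val k G0 p"
    unfolding F_bd_eq by (rule t(3))
qed

section \<open>Functoriality, projection and augmentation of the forest carrier\<close>

lemma F_map:
  assumes h: "fat_mor G0 G1 h"
  shows "F_map k G0 G1 h \<in> hom (F_group k G0) (F_group k G1)"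
    "(x, f) \<in> F_gens k G0 \<Longrightarrow> F_map k G0 G1 h (F_cls k G0 (x, f)) = F_cls k G1 (x, h \<circ>\<^sub>m f)"
proof -
  let ?v = "\<lambda>(x, f). F_cls k G1 (x, h \<circ>\<^sub>m f)"
  have g: "(x, h \<circ>\<^sub>m f) \<in> F_gens k G1" if "(x, f) \<in> F_gens k G0" for x f
    using F_gensD[OF that] fat_mor_comp[OF _ h] by (auto intro: F_gensI)
  have 1: "?v p \<in> carrier (F_group k G1)" if "p \<in> F_gens k G0" for p
    using F_cls_in[OF g[of "fst p" "snd p"]] that by (simp add: case_prod_beta)
  have 2: "?v p = ?v q" if e: "feq k G0 p q" for p q
  proof -
    obtain x f y f' where pq: "p = (x, f)" "q = (y, f')" by (metis prod.collapse)
    have m: "p \<in> F_gens k G0" "q \<in> F_gens k G0" "\<exists>m. oiso x y m \<and> f' \<circ>\<^sub>m m = f" using e pq unfolding feq_def by auto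
    then obtain m where "oiso x y m" "f' \<circ>\<^sub>m m = f" by blast
    hence "oiso x y m \<and> (h \<circ>\<^sub>m f') \<circ>\<^sub>m m = h \<circ>\<^sub>m f" by (simp add: map_comp_assoc)
    hence "feq k G1 (x, h \<circ>\<^sub>m f) (y, h \<circ>\<^sub>m f')" unfolding feq_def using g m pq by auto
    thus ?thesis using F_cls_E pq by simp
  qed
  have 3: "?v (frev p) \<otimes>\<^bsub>F_group k G1\<^esub> ?v p = \<one>\<^bsub>F_group k G1\<^esub>" if "p \<in> F_gens k G0" for p
    using F_cls_rev(1)[of "(fst p, h \<circ>\<^sub>m snd p)" k G1] g[of "fst p" "snd p"] that unfolding frev_def by (simp add: case_prod_beta)
  note t = F_the_hom[where val = ?v, OF F_comm_group 1 2 3]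
  show "F_map k G0 G1 h \<in> hom (F_group k G0) (F_group k G1)" unfolding F_map_def by (rule t(1))
  show "(x, f) \<in> F_gens k G0 \<Longrightarrow> F_map k G0 G1 h (F_cls k G0 (x, f)) = F_cls k G1 (x, h \<circ>\<^sub>m f)"
    unfolding F_map_def using t(3)[where x = "(x, f)"] by simp
qed

lemma F_proj:
  shows "F_proj k G0 \<in> hom (F_group k G0) (GZ_group k)"
    "(x, f) \<in> F_gens k G0 \<Longrightarrow> F_proj k G0 (F_cls k G0 (x, f)) = angle k x"
proof -
  let ?v = "\<lambda>(x, f). angle k x :: ('a, int) gcochain"
  have 1: "?v p \<in> carrier (GZ_group k)" if "p \<in> F_gens k G0" for p :: "'a fgen"
    using F_gensD[OF that] angle_GZ[of "fst p" k] by (simp add: case_prod_beta)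
  have 2: "?v p = ?v q" if e: "feq k G0 p q" for p q :: "'a fgen"
  proof -
    have "oeq k (fst p) (fst q)" using e F_gensD unfolding feq_def oeq_def by blast
    thus ?thesis using angle_oeq[of k "fst p" "fst q"] by (simp add: case_prod_beta)
  qed
  have 3: "?v (frev p) \<otimes>\<^bsub>GZ_group k\<^esub> ?v p = \<one>\<^bsub>GZ_group k\<^esub>" if "p \<in> F_gens k G0" for p :: "'a fgen"
    using F_gensD[OF that] angle_rev[of "fst p" k] unfolding frev_def GZ_simps by (simp add: case_prod_beta)
  note t = F_the_hom[where val = ?v, OF GZ_comm_group 1 2 3]
  show "F_proj k G0 \<in> hom (F_group k G0) (GZ_group k)" unfolding F_proj_def by (rule t(1))
  show "(x, f) \<in> F_gens k G0 \<Longrightarrow> F_proj k G0 (F_cls k G0 (x, f)) = angle k x"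
    unfolding F_proj_def using t(3)[where x = "(x, f)"] by simp
qed

lemma o_sign_oiso:
  assumes "x \<in> ographs 0" "y \<in> ographs 0" "oiso x y m" shows "o_sign x = o_sign y"
proof -
  note X = ographsD[OF assms(1)] and Y = ographsD[OF assms(2)]
  have i: "rg_iso (fst x) (fst y) m" "transport m (snd x) = snd y" using assms(3) unfolding oiso_def by auto
  have s: "step_mor (fst x) (fst y) m" by (rule step_mor_iso[OF X(1) Y(1) i(1)])
  note n = natural_or_orientation[OF X(2,3)]
  have "transport m (natural_or (fst x)) = natural_or (fst y)" by (rule natural_or_transport[OF X(2) Y(2) i(1) X(3)])
  hence "snd x = natural_or (fst x) \<longleftrightarrow> snd y = natural_or (fst y)"
    using induced_or_inject[OF s X(4) n] induced_or_iso[OF X(2) i(1)] i(2) by simp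
  thus ?thesis unfolding o_sign_def by simp
qed

lemma o_sign_rev:
  assumes "x \<in> ographs 0" shows "o_sign (rev_graph x) = - o_sign x"
proof -
  note X = ographsD[OF assms(1)]
  note n = natural_or_orientation[OF X(2,3)]
  have "rev_or (fst x) (snd x) = natural_or (fst x) \<longleftrightarrow> snd x \<noteq> natural_or (fst x)"
    using orient_or_rev[OF X(4) n ribbon_card_basis[OF X(1)]] orient_rev(3)[OF X(4) ribbon_card_basis[OF X(1)]] by metis
  thus ?thesis unfolding o_sign_def rev_graph_def by simp
qed

lemma F_aug:
  shows "aug (F_complex G0) \<in> hom (F_group 0 G0) ints"
    "(x, f) \<in> F_gens 0 G0 \<Longrightarrow> aug (F_complex G0) (F_cls 0 G0 (x, f)) = o_sign x"
proof -
  let ?v = "\<lambda>(x, f). o_sign x"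
  have 1: "?v p \<in> carrier ints" for p :: "'a fgen" by simp
  have 2: "?v p = ?v q" if e: "feq 0 G0 p q" for p q :: "'a fgen"
  proof -
    obtain m where "oiso (fst p) (fst q) m" "fst p \<in> ographs 0" "fst q \<in> ographs 0"
      using e F_gensD unfolding feq_def by blast
    thus ?thesis using o_sign_oiso[of "fst p" "fst q" m] by (simp add: case_prod_beta)
  qed
  have 3: "?v (frev p) \<otimes>\<^bsub>ints\<^esub> ?v p = \<one>\<^bsub>ints\<^esub>" if "p \<in> F_gens 0 G0" for p :: "'a fgen"
    using F_gensD[OF that] o_sign_rev[of "fst p"] unfolding frev_def by (simp add: case_prod_beta)
  note t = F_the_hom[where val = ?v, OF comm_group_ints 1 2 3]
  show "aug (F_complex G0) \<in> hom (F_group 0 G0) ints" unfolding F_complex_def by simp (rule t(1))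
  show "(x, f) \<in> F_gens 0 G0 \<Longrightarrow> aug (F_complex G0) (F_cls 0 G0 (x, f)) = o_sign x"
    unfolding F_complex_def using t(3)[where x = "(x, f)"] by simp
qed

subsection \<open>Coefficients\<close>

definition top_gen :: "'h ograph \<Rightarrow> 'h fgen" where "top_gen x = (x, idm (fst x))"

abbreviation F_coeff :: "nat \<Rightarrow> 'h rgraph \<Rightarrow> 'h fgen \<Rightarrow> ('h fgen \<Rightarrow>\<^sub>0 int) set \<Rightarrow> int" where
  "F_coeff k G0 \<equiv> fc.dual k G0"

lemma top_gen_in: "x \<in> ographs n \<Longrightarrow> top_gen x \<in> F_gens n (fst x)"
  unfolding top_gen_def
  by (rule F_gensI) (auto intro: rg_iso_fat_mor rg_iso_id dest: ographsD)

text \<open>\<open>F\<^sub>n(\<Gamma>)\<close> is cyclic if \<open>\<Gamma>\<close> has codimension \<open>n\<close>.\<close>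

lemma F_top_hom_eqI:
  assumes x: "x \<in> ographs n" and B: "group B" and h: "h \<in> hom (F_group n (fst x)) B" "h' \<in> hom (F_group n (fst x)) B"
    and eq: "h (F_cls n (fst x) (top_gen x)) = h' (F_cls n (fst x) (top_gen x))"
    and Y: "Y \<in> carrier (F_group n (fst x))"
  shows "h Y = h' Y"
proof (rule F_hom_eqI[OF B h _ Y])
  note X = ographsD[OF x]
  let ?F = "F_group n (fst x)"
  interpret C: comm_group ?F by (rule F_comm_group)
  interpret a: group_hom ?F B h using h B by (auto simp: group_hom_def group_hom_axioms_def)
  interpret b: group_hom ?F B h' using h B by (auto simp: group_hom_def group_hom_axioms_def)
  fix p assume p: "p \<in> F_gens n (fst x)"
  note P = F_gensD[OF p]
  have py: "fst p \<in> ographs n" using P by blast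
  note Y = ographsD[OF py]
  have i: "rg_iso (fst (fst p)) (fst x) (snd p)" using fat_mor_iso[of "fst (fst p)" "fst x" "snd p"] P Y X by simp
  have t: "top_gen x \<in> F_gens n (fst x)" by (rule top_gen_in[OF x])
  have comp: "idm (fst x) \<circ>\<^sub>m snd p = snd p" using rg_iso_ran[OF i] by simp
  \<comment> \<open>Equal codimension makes every generator an isomorphism onto the graph, so up to
    isomorphism over it only the orientation is left to choose.\<close>
  have "transport (snd p) (snd (fst p)) = snd x \<or> transport (snd p) (snd (fst p)) = rev_or (fst x) (snd x)"
    by (rule orient_or_rev[OF X(4) transport_orientation[OF Y(2) i Y(4)] ribbon_card_basis[OF X(1)]])
  hence "feq n (fst x) p (top_gen x) \<or> feq n (fst x) p (frev (top_gen x))"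
    unfolding feq_def oiso_def using p t fc.\<rho>_in[OF t] i comp
    by (auto simp: top_gen_def frev_def rev_graph_def)
  hence "F_cls n (fst x) p = F_cls n (fst x) (top_gen x) \<or> F_cls n (fst x) p = inv\<^bsub>?F\<^esub> F_cls n (fst x) (top_gen x)"
    using F_cls_E F_cls_rev(2)[OF t] by metis
  thus "h (F_cls n (fst x) p) = h' (F_cls n (fst x) p)"
    using eq a.hom_inv[OF F_cls_in[OF t]] b.hom_inv[OF F_cls_in[OF t]] by metis
qed

text \<open>Without nontrivial automorphisms over \<open>G0\<close> no automorphism can reverse the
  orientation, so the generator is not identified with its negative and the coordinate functional
  takes the value 1.\<close>

lemma F_coeff_self:
  assumes p: "p \<in> F_gens k G0" and rigid: "\<And>m. rg_iso (fst (fst p)) (fst (fst p)) m \<Longrightarrow> snd p \<circ>\<^sub>m m = snd p \<Longrightarrow> m = idm (fst (fst p))"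
  shows "F_coeff k G0 p (F_cls k G0 p) = 1" "\<not> feq k G0 p (frev p)"
proof -
  have px: "fst p \<in> ographs k" using F_gensD[OF p] by blast
  note X = ographsD[OF px]
  show n: "\<not> feq k G0 p (frev p)"
  proof
    assume "feq k G0 p (frev p)"
    then obtain m where m: "rg_iso (fst (fst p)) (fst (fst p)) m" "transport m (snd (fst p)) = rev_or (fst (fst p)) (snd (fst p))"
      "snd p \<circ>\<^sub>m m = snd p" unfolding feq_def oiso_def frev_def rev_graph_def by auto
    have "transport m (snd (fst p)) = snd (fst p)"
      using rigid[OF m(1,3)] transport_idm[OF rib_is_graph[OF X(2)] X(4)] by simp
    thus False using m(2) orient_rev(3)[OF X(4) ribbon_card_basis[OF X(1)]] by simp
  qed
  show "F_coeff k G0 p (F_cls k G0 p) = 1" using F_dual(3)[OF p p] n fc.E_refl[OF p] by simp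
qed

lemma top_gen_coeff:
  assumes x: "x \<in> ographs n" shows "F_coeff n (fst x) (top_gen x) (F_cls n (fst x) (top_gen x)) = 1"
proof (rule F_coeff_self(1)[OF top_gen_in[OF x]])
  fix m assume m: "rg_iso (fst (fst (top_gen x))) (fst (fst (top_gen x))) m" "snd (top_gen x) \<circ>\<^sub>m m = snd (top_gen x)"
  thus "m = idm (fst (fst (top_gen x)))" using rg_iso_ran[OF m(1)] unfolding top_gen_def by simp
qed

lemma one_edge_self_rigid:
  assumes "one_edge D e G g" "rg_iso D D m" "g \<circ>\<^sub>m m = g" shows "m = idm D"
proof (rule one_edge_rigid[OF assms(1,2) rg_iso_id[OF one_edgeD(1)[OF assms(1)]] one_edgeD(1)[OF assms(1)]])
  show "g \<circ>\<^sub>m m = g \<circ>\<^sub>m idm D"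
    using assms(3) map_comp_idm[OF fat_mor_domran(1)[OF one_edgeD(8)[OF assms(1)]]] by simp
qed

lemma finprod_ints_hom:
  assumes C: "comm_group C" and h: "h \<in> hom C ints" and A: "finite A" "\<And>x. x \<in> A \<Longrightarrow> f x \<in> carrier C"
  shows "h (finprod C f A) = (\<Sum>x\<in>A. h (f x))"
proof -
  interpret C: comm_group C by fact
  interpret h: group_hom C ints h using h comm_group_ints comm_group.axioms(2) by (auto simp: group_hom_def group_hom_axioms_def)
  show ?thesis using A
  proof (induction A)
    case empty thus ?case using h.hom_one by simp
  next
    case (insert x A)
    have "finprod C f (insert x A) = f x \<otimes>\<^bsub>C\<^esub> finprod C f A"
      by (rule C.finprod_insert) (use insert in auto)
    moreover have "finprod C f A \<in> carrier C" by (rule C.finprod_closed) (use insert in auto)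
    ultimately show ?case using insert h.hom_mult[of "f x" "finprod C f A"] by simp
  qed
qed

text \<open>Each expansion class contributes one generator to the boundary, and different classes
  give generators that are inequivalent even up to orientation. Rigidity makes the remaining
  coefficient 1 rather than 0.\<close>

lemma F_coeff_bd:
  assumes x: "(G, \<omega>) \<in> ographs (Suc n)" and D: "(D, g) \<in> expansions G"
  defines "y \<equiv> (D, inducing_or D g \<omega>)"
  shows "y \<in> ographs n" "(y, g) \<in> F_gens n G" "F_coeff n G (y, g) (F_cls n G (y, g)) = 1"
    "F_coeff n G (y, g) (F_bd n G (F_cls (Suc n) G (top_gen (G, \<omega>)))) = 1"
proof -
  have t: "((G, \<omega>), idm G) \<in> F_gens (Suc n) G" using top_gen_in[OF x] unfolding top_gen_def by simp
  have R: "ribbon_graph G" "rib G" using ographsD[OF x] by auto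
  have id: "idm G \<circ>\<^sub>m g' = g'" if "(D', g') \<in> expansions G" for D' g'
    using fat_mor_domran(2)[OF expansionsD(6)[OF that]] by simp
  show p: "(y, g) \<in> F_gens n G" using expansion_gen[OF t D] id[OF D] unfolding y_def by simp
  thus "y \<in> ographs n" using F_gensD by fastforce
  obtain e where e: "one_edge D e G g" using D expansions_iff by blast
  note self = F_coeff_self[OF p, unfolded y_def fst_conv snd_conv, OF one_edge_self_rigid[OF e], folded y_def]
  show one: "F_coeff n G (y, g) (F_cls n G (y, g)) = 1" by (rule self(1))
  let ?Q = "expansions G // exp_equiv G"
  let ?K0 = "exp_equiv G `` {(D, g)}"
  have K0: "?K0 \<in> ?Q" "(D, g) \<in> ?K0" using D equiv_class_self[OF equiv_exp_equiv D] by (auto intro: quotientI)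
  have "F_bd n G (F_cls (Suc n) G (top_gen (G, \<omega>))) = finprod (F_group n G) (cls_term n G \<omega> (idm G)) ?Q"
    using F_bd(2)[OF t] unfolding top_gen_def bd_val_def by simp
  hence "F_coeff n G (y, g) (F_bd n G (F_cls (Suc n) G (top_gen (G, \<omega>)))) =
      (\<Sum>K\<in>?Q. F_coeff n G (y, g) (cls_term n G \<omega> (idm G) K))"
    using finprod_ints_hom[OF F_comm_group F_dual(1)[OF p] finite_expansion_classes[OF R(1)]] cls_term_in[OF t] by simp
  also have "\<dots> = (\<Sum>K\<in>?Q. if K = ?K0 then 1 else 0)"
  proof (rule sum.cong[OF refl])
    fix K assume K: "K \<in> ?Q"
    show "F_coeff n G (y, g) (cls_term n G \<omega> (idm G) K) = (if K = ?K0 then 1 else 0)"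
    proof (cases "K = ?K0")
      case True
      have "cls_term n G \<omega> (idm G) K = F_cls n G (y, g)"
        using cls_term_eq(1)[OF t K, of D g] K0(2) id[OF D] unfolding True y_def by simp
      thus ?thesis using one True by simp
    next
      case False
      obtain D' g' where z: "(D', g') \<in> K" using in_quotient_imp_non_empty[OF equiv_exp_equiv K] by fast
      note c = cls_term_eq[OF t K z]
      let ?q = "((D', inducing_or D' g' \<omega>), g')"
      have q: "?q \<in> F_gens n G" using expansion_gen[OF t c(2)] id[OF c(2)] by simp
      have "\<not> (\<exists>m. rg_iso D' D m \<and> g \<circ>\<^sub>m m = g')"
      proof
        assume "\<exists>m. rg_iso D' D m \<and> g \<circ>\<^sub>m m = g'"
        hence "((D', g'), (D, g)) \<in> exp_equiv G" unfolding exp_equiv_def using c(2) D by blast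
        hence "(D, g) \<in> K" using in_quotient_imp_closed[OF equiv_exp_equiv K z] by blast
        hence "K = ?K0" using K K0 by (metis equiv_exp_equiv quotient_eqI in_quotient_imp_in_rel Image_singleton_iff equiv_class_self[OF equiv_exp_equiv D] quotient_disj disjoint_iff)
        thus False using False by blast
      qed
      \<comment> \<open>Reversal does not change the graph or its morphism to \<open>G\<close>, so
        both alternatives would give an isomorphism over \<open>G\<close>.\<close>
      hence "\<not> feq n G ?q (y, g)" "\<not> feq n G ?q (frev (y, g))"
        unfolding feq_def oiso_def frev_def rev_graph_def y_def by auto
      hence "F_coeff n G (y, g) (F_cls n G ?q) = 0" using F_dual(3)[OF p q] by simp
      thus ?thesis using c(1) id[OF c(2)] False by simp
    qed
  qed
  also have "\<dots> = 1" using finite_expansion_classes[OF R(1)] K0(1) by simp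
  finally show "F_coeff n G (y, g) (F_bd n G (F_cls (Suc n) G (top_gen (G, \<omega>)))) = 1" .
qed

text \<open>Positive codimension provides a vertex of valence at least 4, and the infinite type of
  half-edges provides two fresh ones for splitting it.\<close>

lemma expansions_nonempty:
  fixes G :: "'h::infinite rgraph"
  assumes B: "ribbon_graph G" and c: "codim G = Suc n"
  shows "\<exists>z. z \<in> expansions G"
proof -
  have "is_graph G" using B ribbon_graph_iff rib_is_graph by blast
  obtain v h where v: "v \<in> verts G" "card v \<ge> 4" "h \<in> v" using exists_big_vertex[of G] c by auto
  obtain a b where "a \<noteq> b" "a \<notin> halfs G" "b \<notin> halfs G"
    using exists_new_pair[OF finite_halfs[OF \<open>is_graph G\<close>]] by blast
  from split_big_vertex[OF B v this] show ?thesis using expansion_one_edge[OF _ B] expansions_iff by blast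
qed

section \<open>The carried chain map on the lifted sequences\<close>

lemma face_nerve:
  assumes tr: "\<And>x y z f g. Arr x y f \<Longrightarrow> Arr y z g \<Longrightarrow> Arr x z (g \<circ>\<^sub>m f)"
    and s: "s \<in> nerve Ob Arr (Suc n)" and i: "i \<le> Suc n"
  shows "face i s \<in> nerve Ob Arr n"
proof -
  obtain xs ms where s': "s = (xs, ms)" by (cases s)
  have len: "length xs = Suc (Suc n)" "length ms = Suc n" and X: "set xs \<subseteq> Ob"
    and A: "\<And>j. j < Suc n \<Longrightarrow> Arr (xs ! j) (xs ! Suc j) (ms ! j)" using s unfolding s' nerve_def by auto
  let ?ys = "take i xs @ drop (Suc i) xs"
  let ?ns = "if i = 0 then tl ms else if i = length ms then butlast ms
      else take (i - 1) ms @ [ms ! i \<circ>\<^sub>m ms ! (i - 1)] @ drop (Suc i) ms"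
  have ys: "?ys ! j = (if j < i then xs ! j else xs ! Suc j)" if "j < Suc n" for j
    using that len i by (auto simp: nth_append min_def)
  have ns: "?ns ! j = (if Suc j < i then ms ! j else if Suc j = i then ms ! i \<circ>\<^sub>m ms ! j else ms ! Suc j)"
    if "j < n" "i \<noteq> Suc n" for j
    using that len i by (auto simp: nth_append min_def nth_tl)
  have ns': "?ns ! j = ms ! j" if "j < n" "i = Suc n" for j
    using that len by (simp add: nth_butlast)
  have l: "length ?ys = Suc n" "length ?ns = n" using len i by (auto simp: min_def)
  have "Arr (?ys ! j) (?ys ! Suc j) (?ns ! j)" if j: "j < n" for j
  proof (cases "i = Suc n")
    case True thus ?thesis using ns'[OF j] ys[of j] ys[of "Suc j"] A[of j] j by simp
  next
    case False
    have jj: "j < Suc n" "Suc j < Suc n" using j by auto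
    consider "Suc j < i" | "Suc j = i" | "i \<le> j" by linarith
    thus ?thesis
    proof cases
      case 1 thus ?thesis unfolding ns[OF j False] ys[OF jj(1)] ys[OF jj(2)] using A[of j] j by simp
    next
      case 2 
      have "Arr (xs ! j) (xs ! Suc (Suc j)) (ms ! Suc j \<circ>\<^sub>m ms ! j)" using tr[OF A[of j] A[of "Suc j"]] j by simp
      thus ?thesis unfolding ns[OF j False] ys[OF jj(1)] ys[OF jj(2)] using 2 by auto
    next
      case 3 thus ?thesis unfolding ns[OF j False] ys[OF jj(1)] ys[OF jj(2)] using A[of "Suc j"] j by simp
    qed
  qed
  moreover have "set ?ys \<subseteq> Ob" using X set_take_subset[of i xs] set_drop_subset[of "Suc i" xs] by auto
  moreover have "face i s = (?ys, ?ns)" unfolding s' face_def by (simp add: Let_def)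
  ultimately show ?thesis using l unfolding nerve_def by simp
qed

lemma over_arr_comp: "over_arr x y f \<Longrightarrow> over_arr y z g \<Longrightarrow> over_arr x z (g \<circ>\<^sub>m f)"
  unfolding over_arr_def using fat_mor_comp by (auto simp: map_comp_assoc[symmetric])

lemma over_map_of: "over_map f (frag_of \<tau>) = frag_of (over_act f \<tau>)"
  unfolding over_map_def over_act_def by (simp add: case_prod_beta)

lemma over_forget_lift:
  "length xs = Suc (length ms) \<Longrightarrow> over_forget (frag_of (lift_seq ((xs, ms), a))) = frag_of (xs, ms)"
  unfolding over_forget_def lift_seq_def using map_nth[of xs] by (simp add: comp_def del: upt_Suc)

section \<open>Lifted sequences as simplices of the slice category\<close>

context skeleton
begin

lemma lift_seq_nerve:
  assumes t: "t \<in> seqs n G" shows "lift_seq t \<in> nerve (over_obj G) over_arr n"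
proof -
  obtain xs ms a where t': "t = ((xs, ms), a)" by (metis prod.collapse)
  have len: "length xs = Suc n" "length ms = n" and f: "fat_mor (xs ! n) G a"
    and A: "\<And>j. j < n \<Longrightarrow> fat_mor (xs ! j) (xs ! Suc j) (ms ! j)" using t unfolding t' seqs_def nerve_def by auto
  have d: "tail_comp (drop j ms) a = tail_comp (drop (Suc j) ms) a \<circ>\<^sub>m ms ! j" if "j < n" for j
    using that len by (simp add: Cons_nth_drop_Suc[symmetric] tail_comp_def)
  have F: "fat_mor (xs ! j) G (tail_comp (drop j ms) a)" if "j \<le> n" for j
    using that
  proof (induction rule: inc_induct)
    case base thus ?case using f len by (simp add: tail_comp_def)
  next
    case (step j) thus ?case using d fat_mor_comp[OF A] by simp
  qed
  have nth: "map (\<lambda>i. (xs ! i, tail_comp (drop i ms) a)) [0..<length xs] ! j = (xs ! j, tail_comp (drop j ms) a)"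
    if "j \<le> n" for j using that len nth_map[of j "[0..<length xs]"] by (simp del: upt_Suc)
  show ?thesis unfolding t' lift_seq_def nerve_def over_arr_def over_obj_def
    using len A d F nth by (auto simp del: upt_Suc)
qed

lemma hom_frag_boundary:
  assumes h: "h \<in> hom (free_Abelian_group X) ints" and X: "\<And>i. i \<le> n \<Longrightarrow> face i s \<in> X"
  shows "of_int (h (\<Sum>i\<le>n. frag_cmul ((-1) ^ i) (frag_of (face i s)))) = bdsum n (\<lambda>\<tau>. of_int (h (frag_of \<tau>))) s"
proof -
  interpret h: group_hom "free_Abelian_group X" ints h
    using h comm_group_ints comm_group.axioms(2) by (auto simp: group_hom_def group_hom_axioms_def)
  have one: "h (frag_cmul ((-1) ^ i) (frag_of x)) = (-1) ^ i * h (frag_of x)" if x: "x \<in> X" for i x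
  proof (cases "even i")
    case True thus ?thesis by simp
  next
    case False
    have "h (- frag_of x) = - h (frag_of x)" using h.hom_inv[of "frag_of x"] x inv_ints by simp
    thus ?thesis using False by simp
  qed
  have in_X: "Poly_Mapping.keys (\<Sum>i\<in>A. frag_cmul ((-1) ^ i) (frag_of (face i s))) \<subseteq> X" if "A \<subseteq> {..n}" for A
    using that X by (intro order_trans[OF keys_sum]) (auto split: if_splits dest: subsetD)
  have "h (\<Sum>i\<in>A. frag_cmul ((-1) ^ i) (frag_of (face i s))) = (\<Sum>i\<in>A. (-1) ^ i * h (frag_of (face i s)))"
    if "finite A" "A \<subseteq> {..n}" for A using that
  proof (induction A)
    case empty thus ?case using h.hom_one by simp
  next
    case (insert i A)
    thus ?case using h.hom_mult[of "frag_cmul ((-1) ^ i) (frag_of (face i s))" "\<Sum>i\<in>A. frag_cmul ((-1) ^ i) (frag_of (face i s))"]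
      in_X[of "{i}"] in_X[of A] one[of "face i s" i] X[of i] by simp
  qed
  thus ?thesis unfolding bdsum_def by simp
qed

end

section \<open>Coefficients of the carrier map on lifted sequences\<close>

locale carried = skeleton S for S :: "'h::infinite rgraph set" +
  fixes \<Phi> :: "'h rgraph \<Rightarrow> nat \<Rightarrow> ('h over_simplex \<Rightarrow>\<^sub>0 int) \<Rightarrow> ('h fgen \<Rightarrow>\<^sub>0 int) set"
  assumes chain: "ribbon_graph G \<Longrightarrow> aug_chain_map (C_over G) (F_complex G) (\<Phi> G)"
    and natural: "fat_mor G G' h \<Longrightarrow> c \<in> carrier (grp (C_over G) n) \<Longrightarrow>
      F_map n G G' h (\<Phi> G n c) = \<Phi> G' n (over_map h c)"
begin

text \<open>The integer by which the generator of the cyclic group F_n(\<Gamma>) is multiplied in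
  the image of the lifted sequence.\<close>

definition \<kappa> :: "nat \<Rightarrow> 'h ograph \<Rightarrow> 'h simplex \<times> 'h pmap \<Rightarrow> int" where
  "\<kappa> n x t = F_coeff n (fst x) (top_gen x) (\<Phi> (fst x) n (frag_of (lift_seq t)))"

lemma \<Phi>_hom: "ribbon_graph G \<Longrightarrow> \<Phi> G n \<in> hom (free_Abelian_group (nerve (over_obj G) over_arr n)) (F_group n G)"
  using chain[of G] unfolding aug_chain_map_def C_over_def nerve_complex_def F_complex_def by simp

lemma frag_in: "t \<in> seqs n G \<Longrightarrow> frag_of (lift_seq t) \<in> carrier (grp (C_over G) n)"
  using lift_seq_nerve[of t n G] unfolding C_over_def nerve_complex_def by simp

lemma \<Phi>_in: "ribbon_graph G \<Longrightarrow> t \<in> seqs n G \<Longrightarrow> \<Phi> G n (frag_of (lift_seq t)) \<in> carrier (F_group n G)"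
  using hom_in_carrier[OF \<Phi>_hom[of G n]] lift_seq_nerve[of t n G] by simp

lemma \<Phi>_act:
  assumes "((xs, ms), a) \<in> seqs n D" "fat_mor D G f"
  shows "\<Phi> G n (frag_of (lift_seq ((xs, ms), f \<circ>\<^sub>m a))) = F_map n D G f (\<Phi> D n (frag_of (lift_seq ((xs, ms), a))))"
  using natural[OF assms(2) frag_in[OF assms(1)]] unfolding over_map_of lift_seq_act by simp

lemma group_ints: "group ints" using comm_group_ints comm_group.axioms(2) by blast

text \<open>On the cyclic group F_0(\<Gamma>) of a trivalent graph the augmentation is the
  coefficient times \<open>o_sign x\<close>, and an augmented chain map sends a 0-simplex to
  something of augmentation 1.\<close>

lemma \<kappa>_0:
  assumes x: "x \<in> ographs 0" and t: "t \<in> seqs 0 (fst x)" shows "o_sign x * \<kappa> 0 x t = 1"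
proof -
  note X = ographsD[OF x]
  let ?G = "fst x" and ?Y = "\<Phi> (fst x) 0 (frag_of (lift_seq t))"
  note tg = top_gen_in[OF x]
  have "aug (F_complex ?G) ?Y = o_sign x * F_coeff 0 ?G (top_gen x) ?Y"
  proof (rule F_top_hom_eqI[OF x group_ints F_aug(1) _ _ \<Phi>_in[OF X(1) t]])
    show "(\<lambda>Y. o_sign x * F_coeff 0 ?G (top_gen x) Y) \<in> hom (F_group 0 ?G) ints"
      using F_dual(1)[OF tg] unfolding hom_def by (auto simp: algebra_simps)
    show "aug (F_complex ?G) (F_cls 0 ?G (top_gen x)) = o_sign x * F_coeff 0 ?G (top_gen x) (F_cls 0 ?G (top_gen x))"
      using F_aug(2)[of x "idm ?G" ?G] tg top_gen_coeff[OF x] unfolding top_gen_def by simp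
  qed
  moreover have "aug (F_complex ?G) ?Y = 1"
  proof -
    have "aug (F_complex ?G) ?Y = aug (C_over ?G) (frag_of (lift_seq t))"
      using chain[OF X(1)] frag_in[OF t] unfolding aug_chain_map_def by blast
    thus ?thesis unfolding C_over_def nerve_complex_def by simp
  qed
  ultimately show ?thesis unfolding \<kappa>_def by simp
qed

text \<open>The orientation sign of a sequence of length 0 is \<open>o_sign x\<close>, which cancels
  against \<open>\<kappa>\<close>; the weights of the isomorphisms from the representative add up to
  1.\<close>

lemma lift_sum_0:
  assumes x: "x \<in> ographs 0" shows "(\<Sum>t\<in>seqs 0 (fst x). sgn_wt (snd x) t * of_int (\<kappa> 0 x t)) = 1"
proof -
  note X = ographsD[OF x]
  let ?G = "fst x"
  obtain B0 m0 where B0: "B0 \<in> S" "rg_iso ?G B0 m0" using rep X(1) by blast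
  obtain i0 where i0: "rg_iso B0 ?G i0" using rg_iso_inverse[OF X(2) S_rib[OF B0(1)] B0(2)] by blast
  have iso: "rg_iso A ?G a" if "(A, a) \<in> objs 0 ?G" for A a
    using that fat_mor_iso[of A ?G a] X(3) unfolding objs_def by simp
  note obj = objs_same_codim[OF X(1) B0, unfolded X(3)]
  have "sgn_wt (snd x) (([A], []), a) * of_int (\<kappa> 0 x (([A], []), a)) = wt A" if Aa: "(A, a) \<in> objs 0 ?G" for A a
  proof -
    have A: "A \<in> S" "codim A = 0" using Aa unfolding objs_def by auto
    have "seq_or (([A], []), a) = natural_or ?G"
      using natural_or_transport[OF S_rib[OF A(1)] X(2) iso[OF Aa] A(2)] induced_or_iso[OF S_rib[OF A(1)] iso[OF Aa]]
      unfolding seq_or_def by simp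
    moreover have "pm (natural_or ?G = snd x) = of_int (o_sign x)" unfolding o_sign_def pm_def by auto
    moreover have "(([A], []), a) \<in> seqs 0 ?G" using Aa unfolding seqs_0 by force
    hence "(of_int (o_sign x) * of_int (\<kappa> 0 x (([A], []), a)) :: rat) = 1"
      using \<kappa>_0[OF x] by (metis of_int_1 of_int_mult)
    ultimately show ?thesis unfolding sgn_wt_def seq_wt_def by simp
  qed
  hence "(\<Sum>t\<in>seqs 0 ?G. sgn_wt (snd x) t * of_int (\<kappa> 0 x t)) = (\<Sum>z\<in>objs 0 ?G. wt (fst z))"
    unfolding sum_seqs_0 by (intro sum.cong) auto
  also have "\<dots> = 1"
    by (rule wt_sum_isos(2)[OF S_rib[OF B0(1)] X(2) i0 obj]) (auto simp: inj_on_def)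
  finally show ?thesis .
qed

lemma lift_sum:
  "x \<in> ographs n \<Longrightarrow> (\<Sum>t\<in>seqs n (fst x). sgn_wt (snd x) t * of_int (\<kappa> n x t)) = (- 1) ^ (Suc n choose 2)"
proof (induction n arbitrary: x)
  case 0 thus ?case using lift_sum_0 by (simp add: numeral_2_eq_2)
next
  case (Suc n)
  note x = Suc.prems
  note X = ographsD[OF x]
  define G where "G = fst x"
  define \<omega> where "\<omega> = snd x"
  have xx: "x = (G, \<omega>)" unfolding G_def \<omega>_def by simp
  note X = X[folded G_def \<omega>_def]
  \<comment> \<open>Any one-edge expansion serves. Its graph has codimension \<open>n\<close>, so
    the induction hypothesis applies to it with the inducing orientation.\<close>
  obtain D g where D: "(D, g) \<in> expansions G" using expansions_nonempty[OF X(1,3)] by auto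
  note E = expansionsD[OF D]
  define y where "y = (D, inducing_or D g \<omega>)"
  have fy: "fst y = D" "snd y = inducing_or D g \<omega>" unfolding y_def by auto
  note c = F_coeff_bd[OF x[unfolded xx] D, folded y_def]
  note Y = ographsD[OF c(1), unfolded fy]
  let ?k = "F_coeff n G (y, g)"
  define v :: "'h over_simplex \<Rightarrow> rat" where "v \<tau> = of_int (?k (\<Phi> G n (frag_of \<tau>)))" for \<tau>
  have kh: "?k \<in> hom (F_group n G) ints" by (rule F_dual(1)[OF c(2)])
  \<comment> \<open>Both sides are homomorphisms with value 1 at the generator of a cyclic group:
    this reads the top coefficient off the boundary.\<close>
  have top: "F_coeff (Suc n) G (top_gen x) Z = ?k (F_bd n G Z)" if "Z \<in> carrier (F_group (Suc n) G)" for Z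
  proof -
    have "F_coeff (Suc n) G (top_gen x) Z = (?k \<circ> F_bd n G) Z"
    proof (rule F_top_hom_eqI[OF x group_ints, folded G_def])
      show "F_coeff (Suc n) G (top_gen x) \<in> hom (F_group (Suc n) G) ints"
        by (rule F_dual(1)[OF top_gen_in[OF x, folded G_def]])
      show "?k \<circ> F_bd n G \<in> hom (F_group (Suc n) G) ints" by (rule Group.hom_compose[OF F_bd(1) kh])
      show "F_coeff (Suc n) G (top_gen x) (F_cls (Suc n) G (top_gen x)) = (?k \<circ> F_bd n G) (F_cls (Suc n) G (top_gen x))"
        using top_gen_coeff[OF x, folded G_def] c(4)[folded xx] by simp
    qed (rule that)
    thus ?thesis by simp
  qed
  have step: "of_int (\<kappa> (Suc n) x t) = bdsum (Suc n) v (lift_seq t)" if t: "t \<in> seqs (Suc n) G" for t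
  proof -
    have "\<kappa> (Suc n) x t = ?k (F_bd n G (\<Phi> G (Suc n) (frag_of (lift_seq t))))"
      unfolding \<kappa>_def using top[OF \<Phi>_in[OF X(1) t]] G_def by simp
    also have "F_bd n G (\<Phi> G (Suc n) (frag_of (lift_seq t))) = \<Phi> G n (bd (C_over G) n (frag_of (lift_seq t)))"
      using chain[OF X(1)] frag_in[OF t] unfolding aug_chain_map_def by (simp add: F_complex_def)
    also have "bd (C_over G) n (frag_of (lift_seq t)) = (\<Sum>i\<le>Suc n. frag_cmul ((-1) ^ i) (frag_of (face i (lift_seq t))))"
      unfolding C_over_def nerve_complex_def by simp
    finally have k: "\<kappa> (Suc n) x t = (?k \<circ> \<Phi> G n) (\<Sum>i\<le>Suc n. frag_cmul ((-1) ^ i) (frag_of (face i (lift_seq t))))" by simp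
    have "of_int (\<kappa> (Suc n) x t) = bdsum (Suc n) (\<lambda>\<tau>. of_int ((?k \<circ> \<Phi> G n) (frag_of \<tau>))) (lift_seq t)"
      unfolding k by (rule hom_frag_boundary[OF Group.hom_compose[OF \<Phi>_hom[OF X(1)] kh]])
        (rule face_nerve[OF over_arr_comp lift_seq_nerve[OF t]])
    thus ?thesis unfolding v_def comp_def .
  qed
  let ?h = "\<lambda>((xs, ms), b). ((xs, ms), g \<circ>\<^sub>m b) :: 'h simplex \<times> 'h pmap"
  obtain e where e: "one_edge D e G g" using D expansions_iff by blast
  \<comment> \<open>For a sequence over \<open>D\<close>, composed with \<open>g\<close>: naturality
    and F_n(D) being cyclic show that the coefficient at the expansion equals the top coefficient
    over \<open>D\<close>, and the signs match by the choice of the inducing orientation.\<close>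
  have good: "sgn_wt \<omega> (?h t) * v (lift_seq (?h t)) = sgn_wt (snd y) t * of_int (\<kappa> n y t)" if t: "t \<in> seqs n D" for t
  proof -
    obtain xs ms b where t': "t = ((xs, ms), b)" by (metis prod.collapse)
    note t1 = t[unfolded t']
    note t2 = seqs_act[OF t1 E(6)]
    have C: "last xs = xs ! n" "fat_mor (last xs) D b" "codim (last xs) = n"
      using seqs_length[OF t1] t1 unfolding seqs_def by auto
    note R = fat_mor_ribbon[OF C(2)]
    have b: "rg_iso (last xs) D b" using fat_mor_iso[OF C(2)] C(3) Y(3) by simp
    have lo: "last_or (xs, ms) \<in> orientations (last xs)" using seq_or_last(1)[OF t1 refl] .
    have so: "seq_or ((xs, ms), b) \<in> orientations D" using seq_or_orientation[OF t1] Y(3) by simp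
    have "seq_or ((xs, ms), g \<circ>\<^sub>m b) = induced_or D g (seq_or ((xs, ms), b))"
      using seq_or_last(2)[OF t1 refl] seq_or_last(2)[OF t2 refl] induced_or_comp_iso[OF E(1) b R(1) lo]
        induced_or_iso[OF R(3) b] by simp
    hence "seq_or ((xs, ms), g \<circ>\<^sub>m b) = \<omega> \<longleftrightarrow> seq_or ((xs, ms), b) = snd y"
      using inducing_or_eq[OF E(1) so] inducing_or(2)[OF E(1) X(4)] unfolding fy by metis
    hence s: "sgn_wt \<omega> ((xs, ms), g \<circ>\<^sub>m b) = sgn_wt (snd y) ((xs, ms), b)" unfolding sgn_wt_def seq_wt_def by simp
    have "(?k \<circ> F_map n D G g) (\<Phi> D n (frag_of (lift_seq ((xs, ms), b)))) =
        F_coeff n D (top_gen y) (\<Phi> D n (frag_of (lift_seq ((xs, ms), b))))"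
    proof (rule F_top_hom_eqI[OF c(1) group_ints, unfolded fy])
      show "?k \<circ> F_map n D G g \<in> hom (F_group n D) ints" by (rule Group.hom_compose[OF F_map(1)[OF E(6)] kh])
      show "F_coeff n D (top_gen y) \<in> hom (F_group n D) ints" using F_dual(1)[OF top_gen_in[OF c(1)]] fy by simp
      show "\<Phi> D n (frag_of (lift_seq ((xs, ms), b))) \<in> carrier (F_group n D)" by (rule \<Phi>_in[OF Y(1) t1])
      have "F_map n D G g (F_cls n D (top_gen y)) = F_cls n G (y, g)"
        using F_map(2)[OF E(6), of y "idm D" n] top_gen_in[OF c(1)] map_comp_idm[OF fat_mor_domran(1)[OF E(6)]]
        unfolding top_gen_def fy by simp
      thus "(?k \<circ> F_map n D G g) (F_cls n D (top_gen y)) = F_coeff n D (top_gen y) (F_cls n D (top_gen y))"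
        using c(3) top_gen_coeff[OF c(1)] fy by simp
    qed
    thus ?thesis unfolding t' using s unfolding v_def \<kappa>_def fy by (simp add: \<Phi>_act[OF t1 E(6)])
  qed
  \<comment> \<open>By naturality the image is a multiple of the class of the morphism
    \<open>f\<close> from the last graph. Not being isomorphic over \<open>G\<close> to the
    expansion, this class has coefficient zero there.\<close>
  have bad: "v (lift_seq t) = 0" if t: "t \<in> seqs n G" and no: "t \<notin> ?h ` seqs n D" for t
  proof -
    obtain xs ms f where t': "t = ((xs, ms), f)" by (metis prod.collapse)
    note t1 = t[unfolded t']
    let ?C = "last xs"
    have C: "?C = xs ! n" "fat_mor ?C G f" "codim ?C = n" using seqs_length[OF t1] t1 unfolding seqs_def by auto
    note R = fat_mor_ribbon[OF C(2)]
    define z where "z = (?C, last_or (xs, ms))"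
    have fz: "fst z = ?C" unfolding z_def by simp
    have z: "z \<in> ographs n" using seq_or_last(1)[OF t1 refl] C(3) R(1) unfolding z_def ographs_def by simp
    have t0: "((xs, ms), idm ?C) \<in> seqs n ?C"
      using t1 C(1) rg_iso_fat_mor[OF R(1,1) rg_iso_id[OF R(3)]] unfolding seqs_def by simp
    have fi: "f \<circ>\<^sub>m idm ?C = f" by (rule map_comp_idm[OF fat_mor_domran(1)[OF C(2)]])
    have zf: "(z, f) \<in> F_gens n G" using z C(2) fz by (simp add: F_gensI)
    have not: "\<not> (\<exists>m. rg_iso ?C D m \<and> g \<circ>\<^sub>m m = f)"
    proof
      assume "\<exists>m. rg_iso ?C D m \<and> g \<circ>\<^sub>m m = f"
      then obtain m where m: "rg_iso ?C D m" "g \<circ>\<^sub>m m = f" by blast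
      have "((xs, ms), m) \<in> seqs n D"
        using t1 C(1) rg_iso_fat_mor[OF R(1) E(2) m(1)] unfolding seqs_def by simp
      thus False using no m(2) t' by force
    qed
    have "(?k \<circ> F_map n ?C G f) (\<Phi> ?C n (frag_of (lift_seq ((xs, ms), idm ?C)))) = (\<lambda>_. 0) (\<Phi> ?C n (frag_of (lift_seq ((xs, ms), idm ?C))))"
    proof (rule F_top_hom_eqI[OF z group_ints, unfolded fz])
      show "?k \<circ> F_map n ?C G f \<in> hom (F_group n ?C) ints" by (rule Group.hom_compose[OF F_map(1)[OF C(2)] kh])
      show "(\<lambda>_. 0) \<in> hom (F_group n ?C) ints" unfolding hom_def by simp
      show "\<Phi> ?C n (frag_of (lift_seq ((xs, ms), idm ?C))) \<in> carrier (F_group n ?C)" by (rule \<Phi>_in[OF R(1) t0])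
      have "F_map n ?C G f (F_cls n ?C (top_gen z)) = F_cls n G (z, f)"
        using F_map(2)[OF C(2), of z "idm ?C" n] top_gen_in[OF z] fi unfolding top_gen_def fz by simp
      moreover have "\<not> feq n G (z, f) (y, g)" "\<not> feq n G (z, f) (frev (y, g))"
        using not unfolding feq_def oiso_def frev_def rev_graph_def by (auto simp: fz fy)
      ultimately show "(?k \<circ> F_map n ?C G f) (F_cls n ?C (top_gen z)) = 0"
        using F_dual(3)[OF c(2) zf] by simp
    qed
    thus ?thesis unfolding t' v_def using \<Phi>_act[OF t0 C(2)] fi by simp
  qed
  have sub: "?h ` seqs n D \<subseteq> seqs n G" using seqs_act[OF _ E(6)] by auto
  \<comment> \<open>Two isomorphisms to \<open>D\<close> with the same composite to \<open>G\<close>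
    agree, by rigidity.\<close>
  have inj: "inj_on ?h (seqs n D)"
  proof (rule inj_onI)
    fix t t' assume t: "t \<in> seqs n D" "t' \<in> seqs n D" "?h t = ?h t'"
    obtain xs ms b b' where tt: "t = ((xs, ms), b)" "t' = ((xs, ms), b')" "g \<circ>\<^sub>m b = g \<circ>\<^sub>m b'"
      using t(3) by (cases t; cases t') auto
    have C: "fat_mor (xs ! n) D b" "fat_mor (xs ! n) D b'" "codim (xs ! n) = n"
      using t(1,2) unfolding tt seqs_def by auto
    have "rg_iso (xs ! n) D b" "rg_iso (xs ! n) D b'" using fat_mor_iso[OF C(1)] fat_mor_iso[OF C(2)] C(3) Y(3) by simp_all
    from one_edge_rigid[OF e this fat_mor_ribbon(3)[OF C(1)] tt(3)] show "t = t'" unfolding tt by simp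
  qed
  have fin: "finite (seqs n G)" using finite_seqs X(3) by simp
  have "(\<Sum>t\<in>seqs (Suc n) G. sgn_wt \<omega> t * of_int (\<kappa> (Suc n) x t)) =
      (\<Sum>t\<in>seqs (Suc n) G. sgn_wt \<omega> t * bdsum (Suc n) v (lift_seq t))"
    by (rule sum.cong[OF refl]) (simp add: step)
  also have "\<dots> = (- 1) ^ Suc n * (\<Sum>t\<in>seqs n G. sgn_wt \<omega> t * v (lift_seq t))"
    by (rule boundary_sum[OF X(1,3,4)])
  also have "(\<Sum>t\<in>seqs n G. sgn_wt \<omega> t * v (lift_seq t)) = (\<Sum>t\<in>?h ` seqs n D. sgn_wt \<omega> t * v (lift_seq t))"
    by (rule sum.mono_neutral_right[OF fin sub]) (use bad in auto)
  also have "\<dots> = (\<Sum>t\<in>seqs n D. sgn_wt \<omega> (?h t) * v (lift_seq (?h t)))"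
    by (simp add: sum.reindex[OF inj])
  also have "\<dots> = (\<Sum>t\<in>seqs n D. sgn_wt (snd y) t * of_int (\<kappa> n y t))"
    by (rule sum.cong[OF refl good])
  also have "\<dots> = (- 1) ^ (Suc n choose 2)" using Suc.IH[OF c(1)] fy by simp
  \<comment> \<open>Pascal's rule: (n + 2 choose 2) = (n + 1) + (n + 1 choose 2).\<close>
  also have "(- 1) ^ Suc n * (- 1) ^ (Suc n choose 2) = ((- 1) ^ (Suc (Suc n) choose 2) :: rat)"
    by (simp add: numeral_2_eq_2 power_add)
  finally show ?case unfolding G_def \<omega>_def .
qed

end

section \<open>The rational cochains as a span of the generators\<close>

text \<open>Additive maps of the rationals are linear: multiplying by the denominator reduces this
  to integers.\<close>

lemma rat_additive:
  fixes \<alpha> :: "rat \<Rightarrow> rat"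
  assumes add: "\<And>p q. \<alpha> (p + q) = \<alpha> p + \<alpha> q" shows "\<alpha> q = q * \<alpha> 1"
proof -
  have z: "\<alpha> 0 = 0" using add[of 0 0] by simp
  have neg: "\<alpha> (- p) = - \<alpha> p" for p using add[of p "- p"] z by simp
  have nt: "\<alpha> (of_nat k * p) = of_nat k * \<alpha> p" for k p
    by (induction k) (simp_all add: z add algebra_simps)
  have it: "\<alpha> (of_int k * p) = of_int k * \<alpha> p" for k p
    by (cases k rule: int_cases2) (simp_all add: nt neg)
  obtain a b where ab: "q = Fract a b" "b > 0" by (cases q) auto
  hence "of_int b * q = of_int a * 1" by (simp add: Fract_of_int_quotient)
  hence "of_int b * \<alpha> q = of_int a * \<alpha> 1" using it by metis
  hence "of_int b * \<alpha> q = of_int b * (q * \<alpha> 1)" using ab by (simp add: Fract_of_int_quotient)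
  thus ?thesis using ab(2) by simp
qed

abbreviation angleQ :: "nat \<Rightarrow> 'h ograph \<Rightarrow> ('h, rat) gcochain" where
  "angleQ n x \<equiv> (\<lambda>X. of_int (angle n x X))"

lemma scaled_angle_Ghoms:
  assumes "x \<in> ographs n" shows "(\<lambda>X. q * angleQ n x X) \<in> Ghoms n"
proof -
  note a = angle_Ghoms[OF assms]
  have "finite {X \<in> Gcls n ` ographs n. q * angleQ n x X \<noteq> 0}"
    by (rule finite_subset[of _ "{X \<in> Gcls n ` ographs n. angle n x X \<noteq> 0}"]) (use a in \<open>auto simp: Ghoms_def\<close>)
  thus ?thesis using a unfolding Ghoms_def hom_def by (auto simp: algebra_simps)
qed

lemma group_rats: "group (add_group (UNIV :: rat set))"
  using comm_group_add_group[of "UNIV :: rat set"] comm_group.axioms(2) by auto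

lemma Ghoms_gen:
  fixes c :: "('h, rat) gcochain"
  assumes c: "c \<in> Ghoms n"
  shows "oeq n x y \<Longrightarrow> c (Gcls n x) = c (Gcls n y)" "x \<in> ographs n \<Longrightarrow> c (Gcls n (rev_graph x)) = - c (Gcls n x)"
    "(\<And>x. x \<in> ographs n \<Longrightarrow> c (Gcls n x) = 0) \<Longrightarrow> c = 0"
proof -
  have h: "c \<in> hom (Gcoh n) (add_group UNIV)" using c unfolding Ghoms_def by simp
  interpret P: comm_group "Gcoh n" unfolding Gcoh_eq by (rule coh.comm_group_P)
  interpret h: group_hom "Gcoh n" "add_group (UNIV :: rat set)" c
    using h group_rats by (auto simp: group_hom_def group_hom_axioms_def)
  show "oeq n x y \<Longrightarrow> c (Gcls n x) = c (Gcls n y)" unfolding Gcls_eq using coh.gen_eq by metis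
  show "c (Gcls n (rev_graph x)) = - c (Gcls n x)" if x: "x \<in> ographs n"
  proof -
    have "c (Gcls n (rev_graph x) \<otimes>\<^bsub>Gcoh n\<^esub> Gcls n x) = c (Gcls n (rev_graph x)) + c (Gcls n x)"
      using h.hom_mult[of "Gcls n (rev_graph x)" "Gcls n x"] coh.gen_in[OF x] coh.gen_in[OF rev_graph(1)[OF x]]
      unfolding Gcls_eq Gcoh_eq by simp
    hence "0 = c (Gcls n (rev_graph x)) + c (Gcls n x)"
      using h.hom_one coh.gen_\<rho>(1)[OF x] unfolding Gcls_eq Gcoh_eq by simp
    thus ?thesis by simp
  qed
  assume z: "\<And>x. x \<in> ographs n \<Longrightarrow> c (Gcls n x) = 0"
  show "c = 0"
  proof
    fix Y
    have "(\<lambda>_. 0) \<in> hom (Gcoh n) (add_group (UNIV :: rat set))" unfolding hom_def by simp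
    thus "c Y = 0 Y"
      using coh.hom_eqI[OF group_rats, folded Gcoh_eq Gcls_eq, OF h, of "\<lambda>_. 0" Y] z c unfolding Ghoms_def
      by (cases "Y \<in> carrier (Gcoh n)") auto
  qed
qed

text \<open>Finite support allows induction: subtracting the multiple of \<open>angleQ n x\<close>
  that agrees with the cochain at \<open>x\<close> removes that class and its reverse from the
  support and changes nothing elsewhere.\<close>

lemma Ghoms_induct [consumes 1, case_names zero scale add]:
  fixes c :: "('h, rat) gcochain"
  assumes "c \<in> Ghoms n" and zero: "Q 0" and scale: "\<And>x q. x \<in> ographs n \<Longrightarrow> Q (\<lambda>X. q * angleQ n x X)"
    and add: "\<And>c d. c \<in> Ghoms n \<Longrightarrow> d \<in> Ghoms n \<Longrightarrow> Q c \<Longrightarrow> Q d \<Longrightarrow> Q (c + d)"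
  shows "Q c"
  using assms(1)
proof (induction "card {X \<in> Gcls n ` ographs n. c X \<noteq> 0}" arbitrary: c rule: less_induct)
  case less
  note c = less.prems
  let ?N = "\<lambda>c. {X \<in> Gcls n ` ographs n. c X \<noteq> 0}"
  show ?case
  proof (cases "?N c = {}")
    case True
    hence "c = 0" by (intro Ghoms_gen(3)[OF c]) auto
    thus ?thesis using zero by simp
  next
    case False
    then obtain x where x: "x \<in> ographs n" "c (Gcls n x) \<noteq> 0" by auto
    \<comment> \<open>A cochain with rational values vanishes on a class that is its own
      negative.\<close>
    have nr: "\<not> oeq n x (rev_graph x)"
    proof
      assume "oeq n x (rev_graph x)"
      hence "c (Gcls n x) = - c (Gcls n x)" using Ghoms_gen(1,2)[OF c] x(1) by metis
      thus False using x(2) by simp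
    qed
    have a: "angle n x (Gcls n x) = int (card (Aut (fst x)))"
      using angle_gen[OF x(1,1)] nr coh.E_refl[OF x(1)] by simp
    have a0: "angleQ n x (Gcls n x) \<noteq> 0" unfolding a using card_Aut_pos[OF ographsD(2)[OF x(1)]] by simp
    \<comment> \<open>Rational coefficients are needed here, because \<open>angle\<close> carries
      the factor |Aut|.\<close>
    define q where "q = c (Gcls n x) / angleQ n x (Gcls n x)"
    let ?d = "\<lambda>X. q * angleQ n x X"
    have d: "?d \<in> Ghoms n" by (rule scaled_angle_Ghoms[OF x(1)])
    have c': "c + - ?d \<in> Ghoms n" by (rule Ghoms_add[OF c Ghoms_uminus[OF d]])
    have z: "(c + - ?d) (Gcls n x) = 0" unfolding q_def using a0 by simp
    have "?N (c + - ?d) \<subseteq> ?N c - {Gcls n x}"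
    proof
      fix X assume X: "X \<in> ?N (c + - ?d)"
      then obtain y where y: "y \<in> ographs n" "X = Gcls n y" by auto
      have "\<not> oeq n y x" using X z y Ghoms_gen(1)[OF c', of y x] by auto
      moreover have "\<not> oeq n y (rev_graph x)"
        using X z y Ghoms_gen(1)[OF c', of y "rev_graph x"] Ghoms_gen(2)[OF c' x(1)] by auto
      ultimately have "angle n x X = 0" unfolding y(2) using angle_gen[OF x(1) y(1)] by simp
      hence "c X \<noteq> 0" using X by simp
      moreover have "X \<noteq> Gcls n x" using X z by auto
      ultimately show "X \<in> ?N c - {Gcls n x}" using X by simp
    qed
    moreover have "finite (?N c)" using c unfolding Ghoms_def by simp
    ultimately have "card (?N (c + - ?d)) < card (?N c)" using x by (intro psubset_card_mono) auto
    hence "Q (c + - ?d)" using less.hyps c' by blast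
    hence "Q ((c + - ?d) + ?d)" using add[OF c' d] scale[OF x(1)] by blast
    moreover have "(c + - ?d) + ?d = c" by (simp add: fun_eq_iff)
    ultimately show ?thesis by simp
  qed
qed

text \<open>Additivity implies linearity on each line through some \<open>angleQ n x\<close>, and
  these lines span. This gives both the uniqueness of \<open>psi\<close> and the reduction of the
  final identity to generators.\<close>

lemma Ghoms_additive_eq_0:
  fixes \<delta> :: "('h, rat) gcochain \<Rightarrow> rat"
  assumes c: "c \<in> Ghoms n" and add: "\<And>c d. c \<in> Ghoms n \<Longrightarrow> d \<in> Ghoms n \<Longrightarrow> \<delta> (c + d) = \<delta> c + \<delta> d"
    and ang: "\<And>x. x \<in> ographs n \<Longrightarrow> \<delta> (angleQ n x) = 0"
  shows "\<delta> c = 0"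
  using c
proof (induction rule: Ghoms_induct)
  case zero
  show ?case using add[OF Ghoms_zero Ghoms_zero, unfolded add_0_left] by linarith
next
  case (scale x q)
  have "\<delta> (\<lambda>X. (p + r) * angleQ n x X) = \<delta> (\<lambda>X. p * angleQ n x X) + \<delta> (\<lambda>X. r * angleQ n x X)" for p r
  proof -
    have e: "(\<lambda>X. (p + r) * angleQ n x X) = (\<lambda>X. p * angleQ n x X) + (\<lambda>X. r * angleQ n x X)"
      by (simp add: fun_eq_iff algebra_simps)
    show ?thesis unfolding e by (rule add; rule scaled_angle_Ghoms[OF scale])
  qed
  from rat_additive[of "\<lambda>q. \<delta> (\<lambda>X. q * angleQ n x X)", OF this, of q] show ?case using ang[OF scale] by simp
next
  case (add c d) show ?case unfolding assms(2)[OF add(1,2)] add(3,4) by simp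
qed

section \<open>The map psi\<close>

context skeleton
begin

lemma seq_sign_wt:
  fixes t :: "'h simplex \<times> 'h pmap"
  shows "of_int (seq_sign \<omega> t) / (\<Prod>G\<leftarrow>fst (fst t). of_nat (card (Aut G))) = seq_wt t * pm (seq_or t = \<omega>)"
proof -
  have "(\<Prod>G\<leftarrow>xs. wt G) = 1 / (\<Prod>G\<leftarrow>xs. of_nat (card (Aut G)))" for xs :: "'h rgraph list"
    unfolding wt_def by (induction xs) auto
  thus ?thesis unfolding seq_sign_def seq_wt_def seq_or_def pm_def by (simp add: case_prod_beta)
qed

text \<open>A formula for the coefficients of \<open>psi\<close>, up to the global sign, that is
  visibly linear in the cochain: the cochain is evaluated at the last graph of the simplex with the
  orientation induced along it. It supplies the existence of the homomorphism described by
  \<open>psi\<close>.\<close>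

definition psi_val :: "nat \<Rightarrow> ('h, rat) gcochain \<Rightarrow> 'h simplex \<Rightarrow> rat" where
  "psi_val n c s = c (Gcls n (last (fst s), last_or s)) * (\<Prod>G\<leftarrow>fst s. wt G)"

definition top_simplices :: "nat \<Rightarrow> 'h simplex set" where
  "top_simplices n = {(xs, ms) \<in> nerve S fat_mor n. \<forall>i\<le>n. codim (xs ! i) = i}"

lemma top_simplex:
  assumes "s \<in> top_simplices n"
  shows "length (fst s) = Suc n" "last (fst s) \<in> S" "codim (last (fst s)) = n" "(s, a) \<in> seqs n G \<longleftrightarrow> fat_mor (last (fst s)) G a"
proof -
  obtain xs ms where s: "s = (xs, ms)" "(xs, ms) \<in> nerve S fat_mor n" "\<forall>i\<le>n. codim (xs ! i) = i"
    using assms unfolding top_simplices_def by auto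
  have l: "length xs = Suc n" "set xs \<subseteq> S" using s(2) unfolding nerve_def by auto
  note la = last_nth[OF l(1)]
  have "xs ! n \<in> set xs" using l(1) by simp
  thus "length (fst s) = Suc n" "last (fst s) \<in> S" "codim (last (fst s)) = n" "(s, a) \<in> seqs n G \<longleftrightarrow> fat_mor (last (fst s)) G a"
    using l s la unfolding seqs_def by auto
qed

lemma D_seqs_eq:
  assumes G: "ribbon_graph G" "codim G = n" shows "D_seqs S n G = seqs n G"
proof -
  have "rg_iso (xs ! n) G a \<longleftrightarrow> fat_mor (xs ! n) G a" if "(xs, ms) \<in> nerve S fat_mor n" "codim (xs ! n) = n" for xs ms a
  proof -
    have "xs ! n \<in> S" using that(1) unfolding nerve_def by auto
    thus ?thesis using fat_mor_iso[of "xs ! n" G a] rg_iso_fat_mor[OF S_ribbon G(1)] G(2) that(2) by auto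
  qed
  thus ?thesis unfolding D_seqs_def seqs_def by auto
qed

lemma Dbar_eq:
  assumes "x \<in> ographs n"
  shows "Dbar S n x = (\<Sum>t\<in>seqs n (fst x). Poly_Mapping.single (fst t) (sgn_wt (snd x) t))"
  unfolding Dbar_def D_seqs_eq[OF ographsD(1,3)[OF assms]] seq_sign_wt sgn_wt_def ..

text \<open>Without an orientation-reversing automorphism all isomorphisms have the same sign, and
  their number |Aut| is the factor in \<open>angle\<close>. With one, composition with it pairs off
  opposite signs, and the dual is zero.\<close>

lemma sum_iso_signs:
  assumes x: "x \<in> ographs n" and y: "y \<in> ographs n"
  shows "(\<Sum>a\<in>isos (fst y) (fst x). pm (transport a (snd y) = snd x)) = angleQ n x (Gcls n y)"
proof -
  note X = ographsD[OF x] and Y = ographsD[OF y]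
  let ?I = "isos (fst y) (fst x)" and ?p = "\<lambda>a. pm (transport a (snd y) = snd x)"
  note cb = ribbon_card_basis[OF X(1)]
  have o: "transport a (snd y) = rev_or (fst x) (snd x) \<longleftrightarrow> transport a (snd y) \<noteq> snd x" if "a \<in> ?I" for a
    using orient_or_rev[OF X(4) transport_orientation[OF Y(2) _ Y(4)] cb] orient_rev(3)[OF X(4) cb] that
    unfolding isos_def by auto
  have plus: "oeq n y x \<longleftrightarrow> (\<exists>a\<in>?I. transport a (snd y) = snd x)"
    using x y unfolding oeq_def oiso_def isos_def by auto
  have minus: "oeq n y (rev_graph x) \<longleftrightarrow> (\<exists>a\<in>?I. transport a (snd y) \<noteq> snd x)"
    using o rev_graph(1)[OF x] y unfolding oeq_def oiso_def rev_graph_def isos_def by auto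
  have cI: "card ?I = card (Aut (fst x))" if "a \<in> ?I" for a
    using that card_isos(2)[OF Y(2) X(2)] unfolding isos_def by auto
  consider "\<not> oeq n y x" "\<not> oeq n y (rev_graph x)" | "oeq n y x" "\<not> oeq n y (rev_graph x)"
    | "\<not> oeq n y x" "oeq n y (rev_graph x)" | "oeq n y x" "oeq n y (rev_graph x)" by blast
  hence "(\<Sum>a\<in>?I. ?p a) = of_nat (card (Aut (fst x))) * (of_bool (oeq n y x) - of_bool (oeq n y (rev_graph x)))"
  proof cases
    case 1
    hence "?I = {}" using plus minus by blast
    thus ?thesis using 1 by simp
  next
    case 2
    hence "(\<Sum>a\<in>?I. ?p a) = (\<Sum>a\<in>?I. 1)" using minus by (intro sum.cong) (auto simp: pm_def)
    thus ?thesis using 2 plus cI by auto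
  next
    case 3
    hence "(\<Sum>a\<in>?I. ?p a) = (\<Sum>a\<in>?I. - 1)" using plus by (intro sum.cong) (auto simp: pm_def)
    thus ?thesis using 3 minus cI by auto
  next
    case 4
    obtain a where a: "rg_iso (fst y) (fst x) a" "transport a (snd y) = snd x" using 4(1) unfolding oeq_def oiso_def by blast
    \<comment> \<open>Isomorphisms of both signs yield an automorphism \<open>k\<close> that
      reverses the orientation.\<close>
    have "oeq n x (rev_graph x)" using coh.E_trans[OF coh.E_sym[OF 4(1)] 4(2)] .
    then obtain k where k: "rg_iso (fst x) (fst x) k" "transport k (snd x) = rev_or (fst x) (snd x)"
      unfolding oeq_def oiso_def rev_graph_def by auto
    obtain k' where k': "rg_iso (fst x) (fst x) k'" "k' \<circ>\<^sub>m k = idm (fst x)" "k \<circ>\<^sub>m k' = idm (fst x)"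
      using rg_iso_inverse[OF X(2,2) k(1)] by blast
    have id: "idm (fst x) \<circ>\<^sub>m a = a" if "a \<in> ?I" for a using that rg_iso_ran[of "fst y" "fst x" a] unfolding isos_def by simp
    have bij: "bij_betw (\<lambda>a. k \<circ>\<^sub>m a) ?I ?I"
    proof (rule bij_betw_byWitness[where f' = "\<lambda>a. k' \<circ>\<^sub>m a"])
      show "\<forall>a\<in>?I. k' \<circ>\<^sub>m (k \<circ>\<^sub>m a) = a" "\<forall>a\<in>?I. k \<circ>\<^sub>m (k' \<circ>\<^sub>m a) = a"
        using id k'(2,3) by (auto simp: map_comp_assoc[symmetric])
      show "(\<lambda>a. k \<circ>\<^sub>m a) ` ?I \<subseteq> ?I" "(\<lambda>a. k' \<circ>\<^sub>m a) ` ?I \<subseteq> ?I"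
        using rg_iso_comp[OF Y(2) _ k(1) X(2)] rg_iso_comp[OF Y(2) _ k'(1) X(2)] unfolding isos_def by auto
    qed
    have "?p (k \<circ>\<^sub>m a) = - ?p a" if a: "a \<in> ?I" for a
    proof -
      have i: "rg_iso (fst y) (fst x) a" using a unfolding isos_def by simp
      note s = step_mor_iso[OF X(1,1) k(1)]
      have kx: "induced_or (fst x) k \<omega> = transport k \<omega>" for \<omega> by (rule induced_or_iso[OF X(2) k(1)])
      have r: "transport k (rev_or (fst x) (snd x)) = snd x"
        using induced_or_facts(2)[OF s X(4)] orient_rev(2)[OF X(4) cb] k(2) unfolding kx by simp
      have "transport (k \<circ>\<^sub>m a) (snd y) = transport k (transport a (snd y))"
        using transport_comp[OF Y(2) i k(1) Y(4)] by simp
      hence "transport (k \<circ>\<^sub>m a) (snd y) = snd x \<longleftrightarrow> transport a (snd y) \<noteq> snd x"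
        using o[OF a] r k(2) orient_rev(3)[OF X(4) cb] by metis
      thus ?thesis by (simp add: pm_def)
    qed
    hence "(\<Sum>a\<in>?I. ?p (k \<circ>\<^sub>m a)) = - (\<Sum>a\<in>?I. ?p a)" by (simp add: sum_negf)
    hence "(\<Sum>a\<in>?I. ?p a) = - (\<Sum>a\<in>?I. ?p a)" using sum.reindex_bij_betw[OF bij, of ?p] by simp
    thus ?thesis using 4 by simp
  qed
  thus ?thesis unfolding angle_gen[OF x y] by simp
qed

text \<open>Over a fixed simplex the sequences differ only in the last isomorphism. Its sign
  compares the transported orientation with that of \<open>x\<close>, so
  \<open>sum_iso_signs\<close> evaluates the sum.\<close>

lemma lookup_Dbar:
  assumes x: "x \<in> ographs n"
  shows "Poly_Mapping.lookup (Dbar S n x) s = (if s \<in> top_simplices n then psi_val n (angleQ n x) s else 0)"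
proof -
  note X = ographsD[OF x]
  have fin: "finite (seqs n (fst x))" using finite_seqs X(3) by simp
  have l: "Poly_Mapping.lookup (Dbar S n x) s = (\<Sum>t\<in>{t \<in> seqs n (fst x). fst t = s}. sgn_wt (snd x) t)"
    unfolding Dbar_eq[OF x] lookup_sum lookup_single when_def using fin by (simp add: sum.inter_filter)
  show ?thesis
  proof (cases "s \<in> top_simplices n")
    case False
    hence none: "{t \<in> seqs n (fst x). fst t = s} = {}" unfolding seqs_def top_simplices_def by auto
    show ?thesis unfolding l none using False by simp
  next
    case True
    note ts = top_simplex[OF True]
    let ?B = "last (fst s)"
    note B = S_ribbon[OF ts(2)] S_rib[OF ts(2)]
    have iso: "fat_mor ?B (fst x) a \<longleftrightarrow> rg_iso ?B (fst x) a" for a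
      using fat_mor_iso[of ?B "fst x" a] rg_iso_fat_mor[OF B(1) X(1)] ts(3) X(3) by auto
    have set: "{t \<in> seqs n (fst x). fst t = s} = (\<lambda>a. (s, a)) ` isos ?B (fst x)"
      using ts(4) iso unfolding isos_def by auto
    have id: "((fst s, snd s), idm ?B) \<in> seqs n ?B"
      using ts(4)[of "idm ?B" ?B] rg_iso_fat_mor[OF B(1,1) rg_iso_id[OF B(2)]] by simp
    have lo: "last_or s \<in> orientations ?B" using seq_or_last(1)[OF id refl] by simp
    have sw: "sgn_wt (snd x) (s, a) = (\<Prod>G\<leftarrow>fst s. wt G) * pm (transport a (last_or s) = snd x)" if a: "a \<in> isos ?B (fst x)" for a
    proof -
      have i: "rg_iso ?B (fst x) a" using a unfolding isos_def by simp
      have "((fst s, snd s), a) \<in> seqs n (fst x)" using ts(4) iso i by simp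
      from seq_or_last(2)[OF this refl] have "seq_or (s, a) = transport a (last_or s)"
        using induced_or_iso[OF B(2) i] by simp
      thus ?thesis unfolding sgn_wt_def seq_wt_def by (simp add: case_prod_beta)
    qed
    have y: "(?B, last_or s) \<in> ographs n" unfolding ographs_def using B ts(3) lo by simp
    have "Poly_Mapping.lookup (Dbar S n x) s = (\<Sum>a\<in>isos ?B (fst x). sgn_wt (snd x) (s, a))"
      unfolding l set by (subst sum.reindex) (auto simp: inj_on_def)
    also have "\<dots> = (\<Sum>a\<in>isos ?B (fst x). (\<Prod>G\<leftarrow>fst s. wt G) * pm (transport a (last_or s) = snd x))"
      by (rule sum.cong[OF refl sw])
    also have "\<dots> = (\<Prod>G\<leftarrow>fst s. wt G) * angleQ n x (Gcls n (?B, last_or s))"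
      unfolding sum_distrib_left[symmetric] using sum_iso_signs[OF x y] by simp
    finally show ?thesis using True unfolding psi_val_def by (simp add: mult.commute)
  qed
qed

text \<open>The value 0 off the cochains agrees with the normalization in \<open>the_hom\<close>.
  That the function has finite support is shown in \<open>lookup_Psi\<close>.\<close>

definition Psi :: "nat \<Rightarrow> ('h, rat) gcochain \<Rightarrow> 'h simplex \<Rightarrow>\<^sub>0 rat" where
  "Psi n c = (if c \<in> Ghoms n then Abs_poly_mapping
     (\<lambda>s. if s \<in> top_simplices n then (-1) ^ (Suc n choose 2) * psi_val n c s else 0) else 0)"

lemma lookup_Psi:
  assumes c: "c \<in> Ghoms n"
  shows "Poly_Mapping.lookup (Psi n c) s = (if s \<in> top_simplices n then (-1) ^ (Suc n choose 2) * psi_val n c s else 0)"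
proof -
  \<comment> \<open>For multiples of a single \<open>angleQ n x\<close> the nonzero coefficients are
    those of a finitely supported chain; sums are handled by the induction over the span.\<close>
  have "finite {s \<in> top_simplices n. psi_val n c s \<noteq> 0}" using c
  proof (induction rule: Ghoms_induct)
    case zero show ?case unfolding psi_val_def by simp
  next
    case (scale x q)
    have "finite {s \<in> top_simplices n. psi_val n (angleQ n x) s \<noteq> 0}"
      by (rule finite_subset[OF _ finite_keys[of "Dbar S n x"]]) (auto simp: in_keys_iff lookup_Dbar[OF scale])
    thus ?case by (rule finite_subset[rotated]) (auto simp: psi_val_def)
  next
    case (add c d)
    show ?case by (rule finite_subset[OF _ finite_UnI[OF add(3,4)]]) (auto simp: psi_val_def algebra_simps)
  qed
  hence "finite {s. (if s \<in> top_simplices n then (-1) ^ (Suc n choose 2) * psi_val n c s else 0) \<noteq> 0}"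
    by (rule finite_subset[rotated]) auto
  thus ?thesis unfolding Psi_def using c by (simp add: Abs_poly_mapping_inverse)
qed

lemma Psi_hom: "Psi n \<in> hom (Ghom n) (CQ_Fin S n)"
proof -
  have "Poly_Mapping.keys (Psi n c) \<subseteq> nerve S fat_mor n" if "c \<in> Ghoms n" for c
    using lookup_Psi[OF that] unfolding top_simplices_def by (auto simp: in_keys_iff split: if_splits)
  moreover have "Psi n (c + d) = Psi n c + Psi n d" if "c \<in> Ghoms n" "d \<in> Ghoms n" for c d
    by (rule poly_mapping_eqI)
      (auto simp: lookup_add lookup_Psi[OF that(1)] lookup_Psi[OF that(2)] lookup_Psi[OF Ghoms_add[OF that]] psi_val_def algebra_simps)
  ultimately show ?thesis unfolding CQ_Fin_def Ghom_eq hom_def by auto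
qed

lemma angleQ_Ghoms: "x \<in> ographs n \<Longrightarrow> angleQ n x \<in> Ghoms n"
  using scaled_angle_Ghoms[of x n 1] by simp

lemma Psi_angle:
  assumes x: "x \<in> ographs n"
  shows "Psi n (angleQ n x) = Poly_Mapping.map ((*) ((-1) ^ (Suc n choose 2))) (Dbar S n x)"
proof (rule poly_mapping_eqI)
  fix s
  show "Poly_Mapping.lookup (Psi n (angleQ n x)) s =
      Poly_Mapping.lookup (Poly_Mapping.map ((*) ((-1) ^ (Suc n choose 2))) (Dbar S n x)) s"
    unfolding lookup_Psi[OF angleQ_Ghoms[OF x]] Poly_Mapping.map.rep_eq lookup_Dbar[OF x] by (simp add: when_def)
qed

text \<open>Existence is \<open>Psi_hom\<close> with \<open>Psi_angle\<close>. For uniqueness each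
  coefficient of the difference is an additive functional that vanishes on the generators.\<close>

lemma psi_eq: "psi S n = Psi n"
proof -
  let ?R = "\<lambda>h. h \<in> hom (Ghom n) (CQ_Fin S n) \<and> (\<forall>c. c \<notin> carrier (Ghom n) \<longrightarrow> h c = \<one>\<^bsub>CQ_Fin S n\<^esub>) \<and>
    (\<forall>x\<in>ographs n. h (angleQ n x) = Poly_Mapping.map ((*) ((-1) ^ (Suc n choose 2))) (Dbar S n x))"
  have "?R (Psi n)" using Psi_hom Psi_angle by (auto simp: Psi_def Ghom_eq CQ_Fin_def)
  moreover have "h = Psi n" if h: "?R h" for h
  proof
    fix c
    show "h c = Psi n c"
    proof (cases "c \<in> Ghoms n")
      case True
      show ?thesis
      proof (rule poly_mapping_eqI)
        fix s
        have "Poly_Mapping.lookup (h c) s - Poly_Mapping.lookup (Psi n c) s = 0"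
        proof (rule Ghoms_additive_eq_0[OF True])
          fix c d :: "('h, rat) gcochain" assume cd: "c \<in> Ghoms n" "d \<in> Ghoms n"
          have "h (c + d) = h c + h d" "Psi n (c + d) = Psi n c + Psi n d"
            using hom_mult[of h "Ghom n" "CQ_Fin S n" c d] hom_mult[OF Psi_hom, of c n d] h cd unfolding Ghom_eq CQ_Fin_def by auto
          thus "Poly_Mapping.lookup (h (c + d)) s - Poly_Mapping.lookup (Psi n (c + d)) s =
            Poly_Mapping.lookup (h c) s - Poly_Mapping.lookup (Psi n c) s + (Poly_Mapping.lookup (h d) s - Poly_Mapping.lookup (Psi n d) s)"
            by (simp add: lookup_add)
        qed (use h Psi_angle in auto)
        thus "Poly_Mapping.lookup (h c) s = Poly_Mapping.lookup (Psi n c) s" by simp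
      qed
    next
      case False thus ?thesis using h unfolding Ghom_eq Psi_def CQ_Fin_def by simp
    qed
  qed
  ultimately show ?thesis unfolding psi_def the_hom_def by (rule the_equality)
qed

end

section \<open>The rational extension of the carried map\<close>

lemma tensor_Q_superset:
  assumes "finite A" "Poly_Mapping.keys c \<subseteq> A"
  shows "tensor_Q \<phi> n c X = (\<Sum>s\<in>A. Poly_Mapping.lookup c s * of_int (\<phi> n (frag_of s) X))"
  unfolding tensor_Q_def by (rule sum.mono_neutral_left[OF assms]) (auto simp: in_keys_iff)

lemma tensor_Q_add: "tensor_Q \<phi> n (c + d) X = tensor_Q \<phi> n c X + tensor_Q \<phi> n d X"
proof -
  let ?A = "Poly_Mapping.keys c \<union> Poly_Mapping.keys d"
  have "finite ?A" "Poly_Mapping.keys (c + d) \<subseteq> ?A" using keys_add[of c d] by auto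
  thus ?thesis using tensor_Q_superset[of ?A c] tensor_Q_superset[of ?A d] tensor_Q_superset[of ?A "c + d"]
    by (simp add: lookup_add sum.distrib algebra_simps)
qed

lemma tensor_Q_sum: "finite A \<Longrightarrow> tensor_Q \<phi> n (\<Sum>t\<in>A. Poly_Mapping.single (s t) (w t)) X = (\<Sum>t\<in>A. w t * of_int (\<phi> n (frag_of (s t)) X))"
proof (induction rule: finite_induct)
  case empty show ?case by (simp add: tensor_Q_def)
next
  case (insert t A)
  have "tensor_Q \<phi> n (Poly_Mapping.single (s t) (w t)) X = w t * of_int (\<phi> n (frag_of (s t)) X)"
    using tensor_Q_superset[of "{s t}" "Poly_Mapping.single (s t) (w t)"] by simp
  thus ?case using insert by (simp add: tensor_Q_add)
qed

lemma tensor_Q_map: "tensor_Q \<phi> n (Poly_Mapping.map ((*) q) c) X = q * tensor_Q \<phi> n c X"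
proof -
  have "Poly_Mapping.lookup (Poly_Mapping.map ((*) q) c) s = q * Poly_Mapping.lookup c s" for s
    by (simp add: Poly_Mapping.map.rep_eq when_def)
  moreover have "Poly_Mapping.keys (Poly_Mapping.map ((*) q) c) \<subseteq> Poly_Mapping.keys c"
    using calculation by (auto simp: in_keys_iff)
  ultimately show ?thesis
    using tensor_Q_superset[of "Poly_Mapping.keys c" "Poly_Mapping.map ((*) q) c"] tensor_Q_superset[of "Poly_Mapping.keys c" c]
    by (simp add: sum_distrib_left mult.assoc)
qed

context carried
begin

text \<open>Each simplex of the chain is sent to \<open>\<kappa>\<close> times the generator, so the
  weighted sum is the one in \<open>lift_sum\<close>; its sign is the same as the one built into
  \<open>psi\<close>, and the two cancel.\<close>

lemma tensor_Q_psi: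
  assumes proj: "\<And>G c. ribbon_graph G \<Longrightarrow> c \<in> carrier (grp (C_over G) n) \<Longrightarrow> F_proj n G (\<Phi> G n c) = \<phi> n (over_forget c)"
    and x: "x \<in> ographs n"
  shows "tensor_Q \<phi> n (psi S n (angleQ n x)) X = angleQ n x X"
proof -
  note D = ographsD[OF x]
  let ?e = "(- 1) ^ (Suc n choose 2) :: rat" and ?G = "fst x"
  \<comment> \<open>The projection sends the generator of the cyclic group F_n(\<Gamma>) to
    \<open>angle n x\<close>, hence its value at a lifted sequence is the coefficient times
    that.\<close>
  have v: "\<phi> n (frag_of (fst t)) X = \<kappa> n x t * angle n x X" if t: "t \<in> seqs n ?G" for t
  proof -
    obtain xs ms a where t': "t = ((xs, ms), a)" by (metis prod.collapse)
    have "over_forget (frag_of (lift_seq t)) = frag_of (fst t)"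
      unfolding t' using over_forget_lift[of xs ms a] seqs_length[OF t[unfolded t']] by simp
    hence "\<phi> n (frag_of (fst t)) X = F_proj n ?G (\<Phi> ?G n (frag_of (lift_seq t))) X"
      using proj[OF D(1) frag_in[OF t]] by simp
    also have "\<dots> = F_coeff n ?G (top_gen x) (\<Phi> ?G n (frag_of (lift_seq t))) * angle n x X"
    proof (rule F_top_hom_eqI[OF x group_ints])
      show "(\<lambda>Y. F_proj n ?G Y X) \<in> hom (F_group n ?G) ints"
        using F_proj(1)[of n ?G] unfolding hom_def by (auto simp: GZ_simps)
      show "(\<lambda>Y. F_coeff n ?G (top_gen x) Y * angle n x X) \<in> hom (F_group n ?G) ints"
        using F_dual(1)[OF top_gen_in[OF x]] unfolding hom_def by (auto simp: algebra_simps)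
      show "F_proj n ?G (F_cls n ?G (top_gen x)) X = F_coeff n ?G (top_gen x) (F_cls n ?G (top_gen x)) * angle n x X"
        using F_proj(2)[of x "idm ?G" n ?G] top_gen_in[OF x] top_gen_coeff[OF x] unfolding top_gen_def by simp
    qed (rule \<Phi>_in[OF D(1) t])
    finally show ?thesis unfolding \<kappa>_def .
  qed
  have "tensor_Q \<phi> n (psi S n (angleQ n x)) X = ?e * (\<Sum>t\<in>seqs n ?G. sgn_wt (snd x) t * of_int (\<phi> n (frag_of (fst t)) X))"
    unfolding psi_eq Psi_angle[OF x] tensor_Q_map Dbar_eq[OF x]
    using tensor_Q_sum[OF finite_seqs[of ?G n], of \<phi> n fst "sgn_wt (snd x)" X] D(3) by simp
  also have "\<dots> = ?e * ((\<Sum>t\<in>seqs n ?G. sgn_wt (snd x) t * of_int (\<kappa> n x t)) * angleQ n x X)"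
    unfolding sum_distrib_right by (rule arg_cong[where f = "(*) ?e"], rule sum.cong[OF refl]) (simp add: v)
  also have "\<dots> = angleQ n x X" unfolding lift_sum[OF x] by (simp flip: mult.assoc power_mult_distrib)
  finally show ?thesis .
qed

end

theorem theorem1p28:
  fixes S :: "'h::infinite rgraph set"
    and \<phi> :: "nat \<Rightarrow> ('h simplex \<Rightarrow>\<^sub>0 int) \<Rightarrow> ('h, int) gcochain"
  assumes "is_skeleton S"
    and "aug_chain_map C_Fat GZ \<phi>"
    and "carried_by_F \<phi>"
  shows "\<forall>n. \<forall>x\<in>carrier (Ghom n). tensor_Q \<phi> n (psi S n x) = x"
proof (intro allI ballI)
  fix n and c :: "('h, rat) gcochain" assume c: "c \<in> carrier (Ghom n)"
  obtain \<Phi> where \<Phi>: "carried S \<Phi>"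
    "\<And>n G c. ribbon_graph G \<Longrightarrow> c \<in> carrier (grp (C_over G) n) \<Longrightarrow> F_proj n G (\<Phi> G n c) = \<phi> n (over_forget c)"
    using assms(1,3) unfolding carried_by_F_def carried_def skeleton_def carried_axioms_def by blast
  interpret carried S \<Phi> by fact
  show "tensor_Q \<phi> n (psi S n c) = c"
  proof
    fix X
    \<comment> \<open>At each fixed argument \<open>X\<close> the defect is an additive function of
      the cochain, so it is enough that it vanishes on the generators.\<close>
    have "tensor_Q \<phi> n (psi S n c) X - c X = 0"
    proof (rule Ghoms_additive_eq_0[of c n])
      show "c \<in> Ghoms n" using c by (simp add: Ghom_eq)
      fix c d :: "('h, rat) gcochain" assume "c \<in> Ghoms n" "d \<in> Ghoms n"
      hence "Psi n (c + d) = Psi n c + Psi n d" using hom_mult[OF Psi_hom, of c n d] by (simp add: Ghom_eq CQ_Fin_def)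
      thus "tensor_Q \<phi> n (psi S n (c + d)) X - (c + d) X = tensor_Q \<phi> n (psi S n c) X - c X + (tensor_Q \<phi> n (psi S n d) X - d X)"
        unfolding psi_eq by (simp add: tensor_Q_add)
    next
      fix x :: "'h ograph" assume "x \<in> ographs n"
      from tensor_Q_psi[of n \<phi>, OF \<Phi>(2) this] show "tensor_Q \<phi> n (psi S n (angleQ n x)) X - angleQ n x X = 0" by simp
    qed
    thus "tensor_Q \<phi> n (psi S n c) X = c X" by simp
  qed
qed

end
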